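(* Let $\Omega$ be $(\mathbb{D}^m)_{nc}$ or $(\mathbb{B}^m)_{nc}$. (i) $H^2(\Omega)$ is an inner product space with inner product $\langle f,g\rangle=\lim_{r\to1^-}\widetilde{\varphi_{f,g}}(r)$, which equals $\sum_{w\in\mathcal{F}_m}\overline{g_w}f_w$ if $f,g\in H^2((\mathbb{D}^m)_{nc})$ and $\sum_{w\in\mathcal{F}_m}\frac{1}{m^{|w|}}\overline{g_w}f_w$ if $f,g\in H^2((\mathbb{B}^m)_{nc})$. (ii) The functions $X\mapsto X^w$, $w\in\mathcal{F}_m$, form a complete orthonormal system in $H^2((\mathbb{D}^m)_{nc})$, and for every $f\in H^2((\mathbb{D}^m)_{nc})$ we have $f_w=\langle f,X^w\rangle$ and $f=\sum_{w\in\mathcal{F}_m}f_wX^w$ in $H^2((\mathbb{D}^m)_{nc})$. (iii) The functions $X\mapsto m^{|w|/2}X^w$, $w\in\mathcal{F}_m$, form a complete orthonormal system in $H^2((\mathbb{B}^m)_{nc})$, and for every $f\in H^2((\mathbb{B}^m)_{nc})$ we have $f_w=\langle f,m^{|w|}X^w\rangle$ and $f=\sum_{w\in\mathcal{F}_m}f_wX^w$ in $H^2((\mathbb{B}^m)_{nc})$.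
   Context: $\mathcal{F}_m$ is the free monoid on $\{1,\dots,m\}$, $|w|$ the length of $w$; $X^w=X_{w_1}\cdots X_{w_t}$, $X^\emptyset=I_N$; $\operatorname{Tr}$ is the non-normalized trace. $(\mathbb{D}^m)_{nc}=\coprod_N\{X\in(\mathbb{C}^{N\times N})^m:\|X_j\|<1\ \forall j\}$, $(\mathbb{B}^m)_{nc}=\coprod_N\{X:\sum_iX_i^\ast X_i<I_N\}$. Noncommutative functions on $\Omega$ map level $N$ to $\mathbb{C}^{N\times N}$ and respect direct sums and similarities; $\mathcal{A}_\Omega$ consists of those locally bounded on slices separately in every matrix dimension; each $f\in\mathcal{A}_\Omega$ has Taylor--Taylor coefficients $f_w\in\mathbb{C}$ at $0$ with $f(X)=\sum_l\sum_{|w|=l}f_wX^w$ on $\Omega$. $(\partial(\mathbb{D}^m)_{nc})_N=\mathcal{U}(N)^m$ with $\omega_N=\mu_N$ the product of normalized Haar measures; $(\partial(\mathbb{B}^m)_{nc})_N=\{X:\sum_iX_i^\ast X_i=I_N\}$ with $\omega_N=\nu_N$ the unique probability measure invariant under the left action of $\mathcal{U}(mN)$ on columns $[X_1;\dots;X_m]\in\mathbb{C}^{mN\times N}$. $H^2(\Omega)=\{f\in\mathcal{A}_\Omega:\sup_N\sup_{0<r<1}\int_{(\partial\Omega)_N}\frac1N\operatorname{Tr}(f(rX)^\ast f(rX))\,d\omega_N<\infty\}$. For $f,g\in H^2(\Omega)$, $\widetilde{\varphi_{f,g}}$ is the continuous function on $[0,1]$ given by $\widetilde{\varphi_{f,g}}(r)=\sum_{l\ge0}r^{2l}\sum_{|w|=l}\overline{g_w}f_w$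 for the polydisc and $\sum_{l\ge0}r^{2l}m^{-l}\sum_{|w|=l}\overline{g_w}f_w$ for the ball; for small $r$ it equals $\lim_{N\to\infty}\int_{(\partial\Omega)_N}\frac1N\operatorname{Tr}(g(rX)^\ast f(rX))\,d\omega_N$. *)

theory Defs
  imports "HOL-Analysis.Analysis" "HOL-Probability.Probability"
begin

text \<open>An N x N complex matrix is encoded as a function nat => nat => complex which
  vanishes outside the index range {..<N} x {..<N}.  An m-tuple (X_1,...,X_m) of such
  matrices is encoded as a function nat => cmat with index j < m (0-based; X_j for j >= m
  is the zero matrix).  Function spaces carry the product topology (HOL-Analysis),
  hence a Borel sigma algebra.\<close>

type_synonym cmat = "nat \<Rightarrow> nat \<Rightarrow> complex"
type_synonym ctup = "nat \<Rightarrow> cmat"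

definition is_mat :: "nat \<Rightarrow> cmat \<Rightarrow> bool" where
  "is_mat N A \<longleftrightarrow> (\<forall>i k. (N \<le> i \<or> N \<le> k) \<longrightarrow> A i k = 0)"

definition is_tup :: "nat \<Rightarrow> nat \<Rightarrow> ctup \<Rightarrow> bool" where
  "is_tup m N X \<longleftrightarrow> (\<forall>j<m. is_mat N (X j)) \<and> (\<forall>j. m \<le> j \<longrightarrow> X j = (\<lambda>i k. 0))"

definition mid :: "nat \<Rightarrow> cmat" where
  "mid N = (\<lambda>i k. if i = k \<and> i < N then 1 else 0)"

definition mzero :: cmat where
  "mzero = (\<lambda>i k. 0)"

definition mmul :: "nat \<Rightarrow> cmat \<Rightarrow> cmat \<Rightarrow> cmat" where
  "mmul N A B = (\<lambda>i k. \<Sum>l<N. A i l * B l k)"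

definition madd :: "cmat \<Rightarrow> cmat \<Rightarrow> cmat" where
  "madd A B = (\<lambda>i k. A i k + B i k)"

definition msub :: "cmat \<Rightarrow> cmat \<Rightarrow> cmat" where
  "msub A B = (\<lambda>i k. A i k - B i k)"

definition mscale :: "complex \<Rightarrow> cmat \<Rightarrow> cmat" where
  "mscale c A = (\<lambda>i k. c * A i k)"

definition madj :: "cmat \<Rightarrow> cmat" where
  "madj A = (\<lambda>i k. cnj (A k i))"

definition mtrace :: "nat \<Rightarrow> cmat \<Rightarrow> complex" where
  "mtrace N A = (\<Sum>i<N. A i i)"

definition mnorm :: "nat \<Rightarrow> cmat \<Rightarrow> real" where
  "mnorm N A = Sup {sqrt (\<Sum>i<N. (cmod (\<Sum>k<N. A i k * v k))\<^sup>2) | v.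
                     (\<Sum>k<N. (cmod (v k))\<^sup>2) \<le> 1}"

definition posdef :: "nat \<Rightarrow> cmat \<Rightarrow> bool" where
  "posdef N A \<longleftrightarrow> madj A = A \<and>
     (\<forall>v. (\<exists>k<N. v k \<noteq> 0) \<longrightarrow> 0 < Re (\<Sum>i<N. \<Sum>k<N. cnj (v i) * A i k * v k))"

definition unitary :: "nat \<Rightarrow> cmat \<Rightarrow> bool" where
  "unitary N U \<longleftrightarrow> is_mat N U \<and> mmul N (madj U) U = mid N"

definition invertible_mat :: "nat \<Rightarrow> cmat \<Rightarrow> cmat \<Rightarrow> bool" where
  "invertible_mat N S T \<longleftrightarrow> is_mat N S \<and> is_mat N T \<and> mmul N S T = mid N \<and> mmul N T S = mid N"

definition mdsum :: "nat \<Rightarrow> cmat \<Rightarrow> cmat \<Rightarrow> cmat" where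
  "mdsum N A B = (\<lambda>i k. if i < N \<and> k < N then A i k
                        else if N \<le> i \<and> N \<le> k then B (i - N) (k - N) else 0)"

definition tdsum :: "nat \<Rightarrow> ctup \<Rightarrow> ctup \<Rightarrow> ctup" where
  "tdsum N X Y = (\<lambda>j. mdsum N (X j) (Y j))"

definition tadd :: "ctup \<Rightarrow> ctup \<Rightarrow> ctup" where
  "tadd X Y = (\<lambda>j. madd (X j) (Y j))"

definition tscale :: "complex \<Rightarrow> ctup \<Rightarrow> ctup" where
  "tscale c X = (\<lambda>j. mscale c (X j))"

definition polydisc :: "nat \<Rightarrow> nat \<Rightarrow> ctup set" where
  "polydisc m N = {X. is_tup m N X \<and> (\<forall>j<m. mnorm N (X j) < 1)}"

definition ncball :: "nat \<Rightarrow> nat \<Rightarrow> ctup set" where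
  "ncball m N = {X. is_tup m N X \<and>
      posdef N (msub (mid N) (\<lambda>i k. \<Sum>j<m. mmul N (madj (X j)) (X j) i k))}"

definition torus :: "nat \<Rightarrow> nat \<Rightarrow> ctup set" where
  "torus m N = {X. is_tup m N X \<and> (\<forall>j<m. unitary N (X j))}"

definition sphere_nc :: "nat \<Rightarrow> nat \<Rightarrow> ctup set" where
  "sphere_nc m N = {X. is_tup m N X \<and> (\<lambda>i k. \<Sum>j<m. mmul N (madj (X j)) (X j) i k) = mid N}"

definition act_torus :: "nat \<Rightarrow> nat \<Rightarrow> ctup \<Rightarrow> ctup \<Rightarrow> ctup" where
  "act_torus m N U X = (\<lambda>j. if j < m then mmul N (U j) (X j) else mzero)"

text \<open>left action of an mN x mN matrix U on the column [X_1; ...; X_m] in C^(mN x N)\<close>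
definition act_col :: "nat \<Rightarrow> nat \<Rightarrow> cmat \<Rightarrow> ctup \<Rightarrow> ctup" where
  "act_col m N U X = (\<lambda>j i k. if j < m \<and> i < N \<and> k < N
       then (\<Sum>l<m*N. U (j*N + i) l * X (l div N) (l mod N) k) else 0)"

text \<open>mu_N: product of the normalized Haar measures on U(N)^m, characterized as the unique
  Borel probability measure on U(N)^m invariant under left multiplication by U(N)^m.\<close>
definition haar_torus :: "nat \<Rightarrow> nat \<Rightarrow> ctup measure" where
  "haar_torus m N = (THE M. sets M = sets borel \<and> prob_space M \<and>
      (AE X in M. X \<in> torus m N) \<and>
      (\<forall>U. (\<forall>j<m. unitary N (U j)) \<longrightarrow> distr M borel (act_torus m N U) = M))"

definition haar_sphere :: "nat \<Rightarrow> nat \<Rightarrow> ctup measure" where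
  "haar_sphere m N = (THE M. sets M = sets borel \<and> prob_space M \<and>
      (AE X in M. X \<in> sphere_nc m N) \<and>
      (\<forall>U. unitary (m*N) U \<longrightarrow> distr M borel (act_col m N U) = M))"

text \<open>A function on Omega maps level N to N x N matrices: f N X for X in Omega N.\<close>
type_synonym ncfun = "nat \<Rightarrow> ctup \<Rightarrow> cmat"

definition nc_function :: "nat \<Rightarrow> (nat \<Rightarrow> ctup set) \<Rightarrow> ncfun \<Rightarrow> bool" where
  "nc_function m \<Omega> f \<longleftrightarrow>
     (\<forall>N>0. \<forall>X\<in>\<Omega> N. is_mat N (f N X)) \<and>
     (\<forall>N>0. \<forall>M>0. \<forall>X\<in>\<Omega> N. \<forall>Y\<in>\<Omega> M. tdsum N X Y \<in> \<Omega> (N + M) \<longrightarrow>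
         f (N + M) (tdsum N X Y) = mdsum N (f N X) (f M Y)) \<and>
     (\<forall>N>0. \<forall>X\<in>\<Omega> N. \<forall>S T. invertible_mat N S T \<longrightarrow>
         (\<lambda>j. if j < m then mmul N (mmul N S (X j)) T else mzero) \<in> \<Omega> N \<longrightarrow>
         f N (\<lambda>j. if j < m then mmul N (mmul N S (X j)) T else mzero) = mmul N (mmul N S (f N X)) T)"

definition loc_bdd_slices :: "nat \<Rightarrow> (nat \<Rightarrow> ctup set) \<Rightarrow> ncfun \<Rightarrow> bool" where
  "loc_bdd_slices m \<Omega> f \<longleftrightarrow>
     (\<forall>N>0. \<forall>X\<in>\<Omega> N. \<forall>Z. is_tup m N Z \<longrightarrow>
        (\<exists>\<epsilon>>0. \<exists>B. \<forall>t::complex. cmod t < \<epsilon> \<longrightarrow> tadd X (tscale t Z) \<in> \<Omega> N \<longrightarrow>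
            (\<forall>i k. cmod (f N (tadd X (tscale t Z)) i k) \<le> B)))"

definition A_class :: "nat \<Rightarrow> (nat \<Rightarrow> ctup set) \<Rightarrow> ncfun set" where
  "A_class m \<Omega> = {f. nc_function m \<Omega> f \<and> loc_bdd_slices m \<Omega> f}"

definition words :: "nat \<Rightarrow> nat \<Rightarrow> nat list set" where
  "words m l = {w. length w = l \<and> set w \<subseteq> {..<m}}"

definition all_words :: "nat \<Rightarrow> nat list set" where
  "all_words m = {w. set w \<subseteq> {..<m}}"

definition wpow :: "nat \<Rightarrow> ctup \<Rightarrow> nat list \<Rightarrow> cmat" where
  "wpow N X w = foldr (\<lambda>j A. mmul N (X j) A) w (mid N)"

text \<open>Taylor--Taylor coefficients at 0: the (unique) coefficients f_w with
  f(X) = sum_l sum_{|w|=l} f_w X^w on Omega.\<close>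
definition tt_coeff :: "nat \<Rightarrow> (nat \<Rightarrow> ctup set) \<Rightarrow> ncfun \<Rightarrow> nat list \<Rightarrow> complex" where
  "tt_coeff m \<Omega> f = (THE c. (\<forall>w. w \<notin> all_words m \<longrightarrow> c w = 0) \<and>
      (\<forall>N>0. \<forall>X\<in>\<Omega> N. \<forall>i k.
         (\<lambda>l. \<Sum>w\<in>words m l. c w * wpow N X w i k) sums (f N X i k)))"

definition ntr :: "nat \<Rightarrow> cmat \<Rightarrow> complex" where
  "ntr N A = mtrace N A / of_nat N"

definition H2 :: "nat \<Rightarrow> (nat \<Rightarrow> ctup set) \<Rightarrow> (nat \<Rightarrow> ctup measure) \<Rightarrow> ncfun set" where
  "H2 m \<Omega> \<omega> = {f \<in> A_class m \<Omega>.
     (SUP N\<in>{0<..}. SUP r\<in>{0<..<(1::real)}.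
        \<integral>\<^sup>+ X. ennreal (Re (ntr N (mmul N (madj (f N (tscale (of_real r) X)))
                                            (f N (tscale (of_real r) X))))) \<partial>(\<omega> N)) < \<infinity>}"

definition H2_polydisc :: "nat \<Rightarrow> ncfun set" where
  "H2_polydisc m = H2 m (polydisc m) (haar_torus m)"

definition H2_ball :: "nat \<Rightarrow> ncfun set" where
  "H2_ball m = H2 m (ncball m) (haar_sphere m)"

definition phi_polydisc :: "nat \<Rightarrow> ncfun \<Rightarrow> ncfun \<Rightarrow> real \<Rightarrow> complex" where
  "phi_polydisc m f g r = (\<Sum>l. complex_of_real (r ^ (2*l)) *
      (\<Sum>w\<in>words m l. cnj (tt_coeff m (polydisc m) g w) * tt_coeff m (polydisc m) f w))"

definition phi_ball :: "nat \<Rightarrow> ncfun \<Rightarrow> ncfun \<Rightarrow> real \<Rightarrow> complex" where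
  "phi_ball m f g r = (\<Sum>l. complex_of_real (r ^ (2*l) / real m ^ l) *
      (\<Sum>w\<in>words m l. cnj (tt_coeff m (ncball m) g w) * tt_coeff m (ncball m) f w))"

definition ip_polydisc :: "nat \<Rightarrow> ncfun \<Rightarrow> ncfun \<Rightarrow> complex" where
  "ip_polydisc m f g = Lim (at_left 1) (phi_polydisc m f g)"

definition ip_ball :: "nat \<Rightarrow> ncfun \<Rightarrow> ncfun \<Rightarrow> complex" where
  "ip_ball m f g = Lim (at_left 1) (phi_ball m f g)"

text \<open>Elements of H are identified when they agree on Omega; vector operations are pointwise.\<close>
definition eq_on :: "(nat \<Rightarrow> ctup set) \<Rightarrow> ncfun \<Rightarrow> ncfun \<Rightarrow> bool" where
  "eq_on \<Omega> f g \<longleftrightarrow> (\<forall>N>0. \<forall>X\<in>\<Omega> N. f N X = g N X)"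

definition fadd :: "ncfun \<Rightarrow> ncfun \<Rightarrow> ncfun" where
  "fadd f g = (\<lambda>N X. madd (f N X) (g N X))"

definition fscale :: "complex \<Rightarrow> ncfun \<Rightarrow> ncfun" where
  "fscale c f = (\<lambda>N X. mscale c (f N X))"

definition fzero :: ncfun where
  "fzero = (\<lambda>N X. mzero)"

definition fsub :: "ncfun \<Rightarrow> ncfun \<Rightarrow> ncfun" where
  "fsub f g = (\<lambda>N X. msub (f N X) (g N X))"

definition inner_product_space ::
    "(nat \<Rightarrow> ctup set) \<Rightarrow> ncfun set \<Rightarrow> (ncfun \<Rightarrow> ncfun \<Rightarrow> complex) \<Rightarrow> bool" where
  "inner_product_space \<Omega> H ip \<longleftrightarrow>
     fzero \<in> H \<and> (\<forall>f\<in>H. \<forall>g\<in>H. fadd f g \<in> H) \<and> (\<forall>c. \<forall>f\<in>H. fscale c f \<in> H) \<and>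
     (\<forall>f\<in>H. \<forall>f'\<in>H. \<forall>g\<in>H. ip (fadd f f') g = ip f g + ip f' g) \<and>
     (\<forall>c. \<forall>f\<in>H. \<forall>g\<in>H. ip (fscale c f) g = c * ip f g) \<and>
     (\<forall>f\<in>H. \<forall>g\<in>H. ip g f = cnj (ip f g)) \<and>
     (\<forall>f\<in>H. Im (ip f f) = 0 \<and> 0 \<le> Re (ip f f)) \<and>
     (\<forall>f\<in>H. ip f f = 0 \<longrightarrow> eq_on \<Omega> f fzero)"

definition ipnorm :: "(ncfun \<Rightarrow> ncfun \<Rightarrow> complex) \<Rightarrow> ncfun \<Rightarrow> real" where
  "ipnorm ip f = sqrt (Re (ip f f))"

definition complete_orthonormal_system ::
    "(nat \<Rightarrow> ctup set) \<Rightarrow> ncfun set \<Rightarrow> (ncfun \<Rightarrow> ncfun \<Rightarrow> complex) \<Rightarrow>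
     'w set \<Rightarrow> ('w \<Rightarrow> ncfun) \<Rightarrow> bool" where
  "complete_orthonormal_system \<Omega> H ip W e \<longleftrightarrow>
     (\<forall>w\<in>W. e w \<in> H) \<and>
     (\<forall>v\<in>W. \<forall>w\<in>W. ip (e v) (e w) = (if v = w then 1 else 0)) \<and>
     (\<forall>f\<in>H. (\<forall>w\<in>W. ip f (e w) = 0) \<longrightarrow> eq_on \<Omega> f fzero)"

definition wsum :: "'w set \<Rightarrow> ('w \<Rightarrow> complex) \<Rightarrow> ('w \<Rightarrow> ncfun) \<Rightarrow> ncfun" where
  "wsum S cfs bas = (\<lambda>N X i k. \<Sum>w\<in>S. cfs w * bas w N X i k)"

definition ortho_expansion ::
    "(ncfun \<Rightarrow> ncfun \<Rightarrow> complex) \<Rightarrow> 'w set \<Rightarrow> ('w \<Rightarrow> complex) \<Rightarrow> ('w \<Rightarrow> ncfun) \<Rightarrow> ncfun \<Rightarrow> bool" where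
  "ortho_expansion ip W cfs bas f \<longleftrightarrow>
     (\<forall>e::real. 0 < e \<longrightarrow> (\<exists>G0. finite G0 \<and> G0 \<subseteq> W \<and>
        (\<forall>S. (finite S \<and> G0 \<subseteq> S \<and> S \<subseteq> W) \<longrightarrow>
           ipnorm ip (fsub f (wsum S cfs bas)) < e)))"

end

theory Submission
  imports Defs "HOL-Complex_Analysis.Complex_Analysis" "HOL-Real_Asymp.Real_Asymp"
begin

text \<open>Both domains are instances of one construction: the labelling $cl$ splits the variables into
  classes of equal size $d$, and the column formed by the $X_j$ of one class has to be a strict
  contraction. Singleton classes ($d = 1$) give the polydisc, a single class ($d = m$) gives the ball.
  The boundary is an orbit of a block diagonal unitary group, whose Haar measure is the law of the
  Gram--Schmidt orthonormalisation of a random matrix.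

  Invariance of the boundary measure under the one-parameter groups generated by rank one matrices
  yields loop equations for the trace moments. To leading order in $1/N$ they show that the words
  $X^w$ become orthogonal with squared norm $d^{-|w|}$. Averaging a function over the rotations
  $X \mapsto zX$ bounds its mean square at radius $r$ from below by the finite sums of $r^{2l}$ times
  those of its homogeneous parts; letting $N \to \infty$ and $r \to 1$ gives
  $\sum_w d^{-|w|} |f_w|^2 < \infty$ on $H^2$. Hence $H^2$ sits inside a weighted $\ell^2$ space in
  which the monomials form the standard orthogonal basis.\<close>

section \<open>Taylor--Taylor series\<close>

text \<open>The coefficients and both boundary measures are definite descriptions, so nothing can be
  computed before existence and uniqueness are proved. For the coefficients the analytic input is
  local boundedness on slices. It becomes differentiability through block upper triangular tuples,
  where the corner of f is a difference quotient. The algebra rests on one principle: X S = S Y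
  implies f(X) S = S f(Y). Applied to truncated creation operators on words, it shows that the
  coefficients do not depend on N and X. Because the tuples involved are indexed by pairs, disjoint
  sums or words, f is first extended to arbitrary finite index sets. A loop equation for one trace
  produces products of two traces, so it does not close. The moments are therefore products with
  arbitrary further trace factors, and the induction runs on the word in the first factor only.
  Since f is not known to be measurable, integrals over the boundary are taken of its series. Only
  finitely many degrees are integrated at a time; both limits then act on finite sums, and the
  resulting bound is uniform in the number of degrees.\<close>

locale nc_dom =
  fixes m :: nat and cl :: "nat \<Rightarrow> nat"
  assumes m_pos: "1 \<le> m"
begin

definition cls :: "nat \<Rightarrow> nat set" where
  "cls j0 = {j. j < m \<and> cl j = cl j0}"

text \<open>The index set is arbitrary so that tuples over pairs, disjoint sums and words are
  covered. The uniform gap below 1 makes the condition open and stable under small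
  dilations.\<close>

definition sdom :: "'i set \<Rightarrow> (nat \<Rightarrow> 'i \<Rightarrow> 'i \<Rightarrow> complex) \<Rightarrow> bool" where
  "sdom I X \<longleftrightarrow> (\<exists>q<1. \<forall>j0<m. \<forall>v. (\<Sum>j\<in>cls j0. \<Sum>i\<in>I. (cmod (\<Sum>k\<in>I. X j i k * v k))\<^sup>2)
       \<le> q * (\<Sum>k\<in>I. (cmod (v k))\<^sup>2))"

definition Dom :: "nat \<Rightarrow> ctup set" where
  "Dom N = {X. is_tup m N X \<and> sdom {..<N} X}"

lemma finite_cls [simp]: "finite (cls j)"
  by (simp add: cls_def)

lemma cls_less: "j \<in> cls j0 \<Longrightarrow> j < m"
  by (simp add: cls_def)

lemma sdom_cong:
  assumes "\<And>j i k. j < m \<Longrightarrow> i \<in> I \<Longrightarrow> k \<in> I \<Longrightarrow> X j i k = Y j i k"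
  shows "sdom I X \<longleftrightarrow> sdom I Y"
proof -
  have "(\<Sum>j\<in>cls j0. \<Sum>i\<in>I. (cmod (\<Sum>k\<in>I. X j i k * v k))\<^sup>2)
     = (\<Sum>j\<in>cls j0. \<Sum>i\<in>I. (cmod (\<Sum>k\<in>I. Y j i k * v k))\<^sup>2)" for j0 v
    by (intro sum.cong refl arg_cong[where f = "\<lambda>x. (cmod x)\<^sup>2"])
       (use assms cls_less in auto)
  then show ?thesis unfolding sdom_def by simp
qed

lemma sdom_zero: "sdom I (\<lambda>j i k. 0)"
  unfolding sdom_def by (intro exI[of _ 0]) simp

lemma sdom_reindex:
  assumes b: "bij_betw h J I"
  shows "sdom J (\<lambda>j a b. X j (h a) (h b)) \<longleftrightarrow> sdom I X"
proof -
  have 1: "(\<Sum>j\<in>cls j0. \<Sum>i\<in>J. (cmod (\<Sum>k\<in>J. X j (h i) (h k) * v (h k)))\<^sup>2)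
      = (\<Sum>j\<in>cls j0. \<Sum>i\<in>I. (cmod (\<Sum>k\<in>I. X j i k * v k))\<^sup>2)" for j0 v
    by (intro sum.cong refl)
       (simp add: sum.reindex_bij_betw[OF b, of "\<lambda>k. X _ _ k * v k"] sum.reindex_bij_betw[OF b, of "\<lambda>i. (cmod (\<Sum>k\<in>I. X _ i k * v k))\<^sup>2"])
  have 2: "(\<Sum>k\<in>J. (cmod (v (h k)))\<^sup>2) = (\<Sum>k\<in>I. (cmod (v k))\<^sup>2)" for v :: "_ \<Rightarrow> complex"
    by (rule sum.reindex_bij_betw[OF b, of "\<lambda>k. (cmod (v k))\<^sup>2"])
  have inv: "h (inv_into J h i) = i" if "i \<in> I" for i
    using b that by (simp add: bij_betw_inv_into_right)
  have inv2: "inv_into J h (h k) = k" if "k \<in> J" for k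
    using b that by (simp add: bij_betw_inv_into_left)
  show ?thesis
  proof
    assume "sdom J (\<lambda>j a b. X j (h a) (h b))"
    then obtain q where q: "q < 1" "\<And>j0 v. j0 < m \<Longrightarrow> (\<Sum>j\<in>cls j0. \<Sum>i\<in>J. (cmod (\<Sum>k\<in>J. X j (h i) (h k) * v k))\<^sup>2) \<le> q * (\<Sum>k\<in>J. (cmod (v k))\<^sup>2)"
      unfolding sdom_def by blast
    show "sdom I X" unfolding sdom_def
    proof (intro exI[of _ q] conjI allI impI)
      fix j0 v assume "j0 < m"
      from q(2)[OF this, of "\<lambda>k. v (h k)"]
      show "(\<Sum>j\<in>cls j0. \<Sum>i\<in>I. (cmod (\<Sum>k\<in>I. X j i k * v k))\<^sup>2) \<le> q * (\<Sum>k\<in>I. (cmod (v k))\<^sup>2)"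
        by (simp only: 1 2)
    qed (use q in auto)
  next
    assume "sdom I X"
    then obtain q where q: "q < 1" "\<And>j0 v. j0 < m \<Longrightarrow> (\<Sum>j\<in>cls j0. \<Sum>i\<in>I. (cmod (\<Sum>k\<in>I. X j i k * v k))\<^sup>2) \<le> q * (\<Sum>k\<in>I. (cmod (v k))\<^sup>2)"
      unfolding sdom_def by blast
    show "sdom J (\<lambda>j a b. X j (h a) (h b))" unfolding sdom_def
    proof (intro exI[of _ q] conjI allI impI)
      fix j0 and v :: "_ \<Rightarrow> complex" assume j0: "j0 < m"
      let ?u = "\<lambda>i. v (inv_into J h i)"
      have e: "(\<Sum>k\<in>J. X j (h i) (h k) * v k) = (\<Sum>k\<in>J. X j (h i) (h k) * ?u (h k))" for i j
        by (intro sum.cong refl) (simp add: inv2)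
      have e2: "(\<Sum>k\<in>J. (cmod (v k))\<^sup>2) = (\<Sum>k\<in>J. (cmod (?u (h k)))\<^sup>2)"
        by (intro sum.cong refl) (simp add: inv2)
      show "(\<Sum>j\<in>cls j0. \<Sum>i\<in>J. (cmod (\<Sum>k\<in>J. X j (h i) (h k) * v k))\<^sup>2) \<le> q * (\<Sum>k\<in>J. (cmod (v k))\<^sup>2)"
        proof -
        note q(2)[OF j0, of ?u]
        also have "(\<Sum>k\<in>I. (cmod (?u k))\<^sup>2) = (\<Sum>k\<in>J. (cmod (?u (h k)))\<^sup>2)"
          by (rule 2[symmetric])
        also have "(\<Sum>j\<in>cls j0. \<Sum>i\<in>I. (cmod (\<Sum>k\<in>I. X j i k * ?u k))\<^sup>2)
           = (\<Sum>j\<in>cls j0. \<Sum>i\<in>J. (cmod (\<Sum>k\<in>J. X j (h i) (h k) * ?u (h k)))\<^sup>2)"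
          by (rule 1[symmetric])
        finally show ?thesis unfolding e e2 .
      qed
    qed (use q in auto)
  qed
qed

text \<open>The gap q leaves room for every factor of modulus below 1/sqrt(q). A radius above 1 is
  what later puts z = 1 inside the disc of convergence of z -> f(zX).\<close>

lemma sdom_scale:
  assumes "sdom I X" shows "\<exists>R>1. \<forall>z. cmod z < R \<longrightarrow> sdom I (\<lambda>j i k. z * X j i k)"
proof -
  obtain q0 where q0: "q0 < 1" "\<And>j0 v. j0 < m \<Longrightarrow> (\<Sum>j\<in>cls j0. \<Sum>i\<in>I. (cmod (\<Sum>k\<in>I. X j i k * v k))\<^sup>2) \<le> q0 * (\<Sum>k\<in>I. (cmod (v k))\<^sup>2)"
    using assms unfolding sdom_def by blast
  \<comment> \<open>The maximum with 1/2 keeps q positive, so that 1/sqrt(q) is a genuine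
    radius.\<close>
  define q where "q = max q0 (1/2)"
  have q: "q < 1" "q > 0" using q0 by (auto simp: q_def)
  have qb: "(\<Sum>j\<in>cls j0. \<Sum>i\<in>I. (cmod (\<Sum>k\<in>I. X j i k * v k))\<^sup>2) \<le> q * (\<Sum>k\<in>I. (cmod (v k))\<^sup>2)" if "j0 < m" for j0 v
    by (rule order_trans[OF q0(2)[OF that]]) (intro mult_right_mono, auto simp: q_def intro: sum_nonneg)
  define R where "R = 1 / sqrt q"
  have "R > 1" using q by (simp add: R_def)
  moreover have "sdom I (\<lambda>j i k. z * X j i k)" if z: "cmod z < R" for z
  proof -
    have "(cmod z)\<^sup>2 < R\<^sup>2" using z by (intro power_strict_mono) auto
    then have *: "(cmod z)\<^sup>2 * q < 1" using q by (simp add: R_def power_divide field_simps)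
    show ?thesis unfolding sdom_def
    proof (intro exI[of _ "(cmod z)\<^sup>2 * q"] conjI allI impI *)
      fix j0 v assume j0: "j0 < m"
      have "(\<Sum>j\<in>cls j0. \<Sum>i\<in>I. (cmod (\<Sum>k\<in>I. z * X j i k * v k))\<^sup>2)
         = (cmod z)\<^sup>2 * (\<Sum>j\<in>cls j0. \<Sum>i\<in>I. (cmod (\<Sum>k\<in>I. X j i k * v k))\<^sup>2)"
        by (simp add: sum_distrib_left[symmetric] mult.assoc norm_mult power_mult_distrib)
      also have "\<dots> \<le> (cmod z)\<^sup>2 * (q * (\<Sum>k\<in>I. (cmod (v k))\<^sup>2))"
        using qb[OF j0] by (intro mult_left_mono) auto
      finally show "(\<Sum>j\<in>cls j0. \<Sum>i\<in>I. (cmod (\<Sum>k\<in>I. z * X j i k * v k))\<^sup>2) \<le> (cmod z)\<^sup>2 * q * (\<Sum>k\<in>I. (cmod (v k))\<^sup>2)"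
        by (simp add: mult.assoc)
    qed
  qed
  ultimately show ?thesis by blast
qed

text \<open>Young's inequality with a free weight: the plain factor 2 would use up the gap below 1,
  whereas 1 + \<eta> can be taken close to 1.\<close>

lemma cmod_add_sq_le:
  assumes "0 < \<eta>"
  shows "(cmod (a + b))\<^sup>2 \<le> (1 + \<eta>) * (cmod a)\<^sup>2 + (1 + 1/\<eta>) * (cmod b)\<^sup>2"
proof -
  have "(cmod (a + b))\<^sup>2 \<le> (cmod a + cmod b)\<^sup>2"
    by (intro power_mono norm_triangle_ineq) auto
  also have "\<dots> = (cmod a)\<^sup>2 + (cmod b)\<^sup>2 + 2 * cmod a * cmod b"
    by (simp add: power2_sum)
  also have "2 * cmod a * cmod b \<le> \<eta> * (cmod a)\<^sup>2 + (cmod b)\<^sup>2 / \<eta>"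
  proof -
    have "0 \<le> (\<eta> * cmod a - cmod b)\<^sup>2 / \<eta>" using assms by simp
    also have "\<dots> = \<eta> * (cmod a)\<^sup>2 + (cmod b)\<^sup>2 / \<eta> - 2 * cmod a * cmod b"
      using assms by (simp add: power2_eq_square field_simps)
    finally show ?thesis by simp
  qed
  finally show ?thesis by (simp add: algebra_simps)
qed

lemma cmod_sum_sq_le:
  assumes "finite I" "\<And>k. k \<in> I \<Longrightarrow> cmod (a k) \<le> \<delta>"
  shows "(cmod (\<Sum>k\<in>I. a k * v k))\<^sup>2 \<le> \<delta>\<^sup>2 * real (card I) * (\<Sum>k\<in>I. (cmod (v k))\<^sup>2)"
proof -
  have "cmod (\<Sum>k\<in>I. a k * v k) \<le> (\<Sum>k\<in>I. cmod (a k) * cmod (v k))"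
    by (rule order_trans[OF norm_sum]) (simp add: norm_mult)
  then have "(cmod (\<Sum>k\<in>I. a k * v k))\<^sup>2 \<le> (\<Sum>k\<in>I. cmod (a k) * cmod (v k))\<^sup>2"
    by (intro power_mono) auto
  also have "\<dots> \<le> (\<Sum>k\<in>I. (cmod (a k))\<^sup>2) * (\<Sum>k\<in>I. (cmod (v k))\<^sup>2)"
    by (rule Cauchy_Schwarz_ineq_sum)
  also have "(\<Sum>k\<in>I. (cmod (a k))\<^sup>2) \<le> (\<Sum>k\<in>I. \<delta>\<^sup>2)"
    using assms by (intro sum_mono power_mono) auto
  finally show ?thesis using assms(1)
    by (simp add: mult.commute mult_right_mono sum_nonneg)
qed

lemma sdom_open:
  assumes "finite I" "sdom I X"
  shows "\<exists>\<delta>>0. \<forall>Z. (\<forall>j<m. \<forall>i\<in>I. \<forall>k\<in>I. cmod (Z j i k) \<le> \<delta>) \<longrightarrow> sdom I (\<lambda>j i k. X j i k + Z j i k)"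
proof -
  obtain q0 where q0: "q0 < 1" "\<And>j0 v. j0 < m \<Longrightarrow> (\<Sum>j\<in>cls j0. \<Sum>i\<in>I. (cmod (\<Sum>k\<in>I. X j i k * v k))\<^sup>2) \<le> q0 * (\<Sum>k\<in>I. (cmod (v k))\<^sup>2)"
    using assms unfolding sdom_def by blast
  define q where "q = max q0 (1/2)"
  have q: "q < 1" "q > 0" using q0 by (auto simp: q_def)
  have qb: "(\<Sum>j\<in>cls j0. \<Sum>i\<in>I. (cmod (\<Sum>k\<in>I. X j i k * v k))\<^sup>2) \<le> q * (\<Sum>k\<in>I. (cmod (v k))\<^sup>2)" if "j0 < m" for j0 v
    by (rule order_trans[OF q0(2)[OF that]]) (intro mult_right_mono, auto simp: q_def intro: sum_nonneg)
  \<comment> \<open>With this weight (1 + \<eta>) q is the midpoint of q and 1.\<close>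
  define \<eta> where "\<eta> = (1 - q) / (2 * q)"
  have \<eta>: "\<eta> > 0" using q by (simp add: \<eta>_def)
  have \<eta>q: "(1 + \<eta>) * q = (1 + q) / 2" using q by (simp add: \<eta>_def field_simps)
  define c where "c = (1 + 1/\<eta>) * (real m * real (card I) * real (card I)) + 1"
  have c: "c > 0" using \<eta> by (simp add: c_def add_nonneg_pos)
  \<comment> \<open>Chosen so that the perturbation costs (1 - q)/4, half of the gap still left
    above the midpoint.\<close>
  define \<delta> where "\<delta> = sqrt ((1 - q) / (4 * c))"
  have \<delta>: "\<delta> > 0" "\<delta>\<^sup>2 * c = (1 - q) / 4" using q c by (auto simp: \<delta>_def)
  show ?thesis
  proof (intro exI[of _ \<delta>] conjI allI impI \<delta>(1))
    fix Z assume Z: "\<forall>j<m. \<forall>i\<in>I. \<forall>k\<in>I. cmod (Z j i k) \<le> \<delta>"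
    show "sdom I (\<lambda>j i k. X j i k + Z j i k)" unfolding sdom_def
    proof (intro exI[of _ "(1 + q) / 2 + (1 - q) / 4"] conjI allI impI)
      show "(1 + q) / 2 + (1 - q) / 4 < 1" using q(1) by argo
      fix j0 v assume j0: "j0 < m"
      define V where "V = (\<Sum>k\<in>I. (cmod (v k))\<^sup>2)"
      have V: "V \<ge> 0" by (simp add: V_def sum_nonneg)
      have "(\<Sum>j\<in>cls j0. \<Sum>i\<in>I. (cmod (\<Sum>k\<in>I. (X j i k + Z j i k) * v k))\<^sup>2)
         \<le> (\<Sum>j\<in>cls j0. \<Sum>i\<in>I. (1 + \<eta>) * (cmod (\<Sum>k\<in>I. X j i k * v k))\<^sup>2 + (1 + 1/\<eta>) * (\<delta>\<^sup>2 * real (card I) * V))"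
      proof (intro sum_mono)
        fix j i assume ji: "j \<in> cls j0" "i \<in> I"
        have "(cmod (\<Sum>k\<in>I. (X j i k + Z j i k) * v k))\<^sup>2
          \<le> (1 + \<eta>) * (cmod (\<Sum>k\<in>I. X j i k * v k))\<^sup>2 + (1 + 1/\<eta>) * (cmod (\<Sum>k\<in>I. Z j i k * v k))\<^sup>2"
          unfolding ring_distribs sum.distrib using cmod_add_sq_le[OF \<eta>] by (simp add: ring_distribs)
        also have "(cmod (\<Sum>k\<in>I. Z j i k * v k))\<^sup>2 \<le> \<delta>\<^sup>2 * real (card I) * V"
          unfolding V_def using Z ji cls_less by (intro cmod_sum_sq_le assms) blast
        finally show "(cmod (\<Sum>k\<in>I. (X j i k + Z j i k) * v k))\<^sup>2
          \<le> (1 + \<eta>) * (cmod (\<Sum>k\<in>I. X j i k * v k))\<^sup>2 + (1 + 1/\<eta>) * (\<delta>\<^sup>2 * real (card I) * V)"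
          using \<eta> by (simp add: mult_left_mono)
      qed
      also have "\<dots> = (1 + \<eta>) * (\<Sum>j\<in>cls j0. \<Sum>i\<in>I. (cmod (\<Sum>k\<in>I. X j i k * v k))\<^sup>2)
          + (real (card (cls j0)) * real (card I)) * ((1 + 1/\<eta>) * (\<delta>\<^sup>2 * real (card I) * V))"
        by (simp add: sum.distrib sum_distrib_left)
      also have "\<dots> \<le> (1 + \<eta>) * (q * V) + (real m * real (card I)) * ((1 + 1/\<eta>) * (\<delta>\<^sup>2 * real (card I) * V))"
      proof (intro add_mono mult_left_mono mult_right_mono)
        show "(\<Sum>j\<in>cls j0. \<Sum>i\<in>I. (cmod (\<Sum>k\<in>I. X j i k * v k))\<^sup>2) \<le> q * V"
          using qb[OF j0] by (simp add: V_def)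
        have "cls j0 \<subseteq> {..<m}" by (auto simp: cls_def)
        from card_mono[OF _ this] show "real (card (cls j0)) \<le> real m" by simp
      qed (use \<eta> V in auto)
      also have "\<dots> \<le> (1 + \<eta>) * (q * V) + \<delta>\<^sup>2 * c * V"
        using V \<eta> by (simp add: c_def algebra_simps)
      also have "\<dots> = ((1 + q) / 2 + (1 - q) / 4) * V"
        unfolding \<delta>(2) mult.assoc[symmetric] \<eta>q by (simp add: algebra_simps)
      finally show "(\<Sum>j\<in>cls j0. \<Sum>i\<in>I. (cmod (\<Sum>k\<in>I. (X j i k + Z j i k) * v k))\<^sup>2) \<le> ((1 + q) / 2 + (1 - q) / 4) * (\<Sum>k\<in>I. (cmod (v k))\<^sup>2)"
        by (simp add: V_def)
    qed
  qed
qed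

end

section \<open>Matrix algebra and direct sums in the domain\<close>

lemma mmul_assoc: "mmul N (mmul N A B) C = mmul N A (mmul N B C)"
proof (intro ext)
  fix i k
  have "(\<Sum>l<N. (\<Sum>a<N. A i a * B a l) * C l k) = (\<Sum>l<N. \<Sum>a<N. A i a * B a l * C l k)"
    by (simp add: sum_distrib_right)
  also have "\<dots> = (\<Sum>a<N. \<Sum>l<N. A i a * B a l * C l k)" by (rule sum.swap)
  finally show "mmul N (mmul N A B) C i k = mmul N A (mmul N B C) i k"
    by (simp add: mmul_def sum_distrib_left mult.assoc)
qed

lemma mmul_mid_right: "is_mat N A \<Longrightarrow> mmul N A (mid N) = A"
proof (intro ext)
  fix i k assume A: "is_mat N A"
  have "mmul N A (mid N) i k = (\<Sum>l<N. if l = k then A i k else 0)"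
    unfolding mmul_def mid_def by (intro sum.cong) auto
  then show "mmul N A (mid N) i k = A i k"
    using A by (auto simp: is_mat_def)
qed

lemma mmul_mid_left: "is_mat N A \<Longrightarrow> mmul N (mid N) A = A"
proof (intro ext)
  fix i k assume A: "is_mat N A"
  have "mmul N (mid N) A i k = (\<Sum>l<N. if l = i then A i k else 0)"
    unfolding mmul_def mid_def by (intro sum.cong) auto
  then show "mmul N (mid N) A i k = A i k"
    using A by (auto simp: is_mat_def)
qed

lemma is_mat_mmul: "is_mat N A \<Longrightarrow> is_mat N B \<Longrightarrow> is_mat N (mmul N A B)"
  by (auto simp: is_mat_def mmul_def)

lemma is_mat_mid [simp]: "is_mat N (mid N)"
  by (auto simp: is_mat_def mid_def)

lemma sum_lessThan_split: "(\<Sum>l<N+M. g l) = (\<Sum>l<N. g l) + (\<Sum>l<M. g (N + l))" for g :: "nat \<Rightarrow> 'a::comm_monoid_add"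
proof -
  have "{..<N+M} = {..<N} \<union> {N..<N+M}" by auto
  moreover have "sum g ({..<N} \<union> {N..<N+M}) = (\<Sum>l<N. g l) + (\<Sum>l\<in>{N..<N+M}. g l)"
    by (rule sum.union_disjoint) auto
  ultimately have "(\<Sum>l<N+M. g l) = (\<Sum>l<N. g l) + (\<Sum>l\<in>{N..<N+M}. g l)" by simp
  also have "(\<Sum>l\<in>{N..<N+M}. g l) = (\<Sum>l<M. g (N + l))"
    using sum.shift_bounds_nat_ivl[of g 0 N M] by (simp add: add.commute atLeast0LessThan)
  finally show ?thesis .
qed

text \<open>Block upper triangular tuple with diagonal X, Y and corner Z. A disjoint sum as index
  set avoids offset arithmetic.\<close>

definition blk :: "(nat \<Rightarrow> 'a \<Rightarrow> 'a \<Rightarrow> complex) \<Rightarrow> (nat \<Rightarrow> 'a \<Rightarrow> 'b \<Rightarrow> complex) \<Rightarrow> (nat \<Rightarrow> 'b \<Rightarrow> 'b \<Rightarrow> complex)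
    \<Rightarrow> nat \<Rightarrow> 'a + 'b \<Rightarrow> 'a + 'b \<Rightarrow> complex" where
  "blk X Z Y j p q = (case p of Inl i \<Rightarrow> (case q of Inl k \<Rightarrow> X j i k | Inr k \<Rightarrow> Z j i k)
     | Inr i \<Rightarrow> (case q of Inl k \<Rightarrow> 0 | Inr k \<Rightarrow> Y j i k))"

lemma blk_simps [simp]:
  "blk X Z Y j (Inl i) (Inl k) = X j i k" "blk X Z Y j (Inl i) (Inr k') = Z j i k'"
  "blk X Z Y j (Inr i') (Inl k) = 0" "blk X Z Y j (Inr i') (Inr k') = Y j i' k'"
  by (auto simp: blk_def)

context nc_dom
begin

lemma sdom_blk:
  assumes "finite I" "finite J" "sdom I X" "sdom J Y"
  shows "sdom (I <+> J) (blk X (\<lambda>_ _ _. 0) Y)"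
proof -
  obtain q where q: "q < 1" "\<And>j0 v. j0 < m \<Longrightarrow> (\<Sum>j\<in>cls j0. \<Sum>i\<in>I. (cmod (\<Sum>k\<in>I. X j i k * v k))\<^sup>2) \<le> q * (\<Sum>k\<in>I. (cmod (v k))\<^sup>2)"
    using assms unfolding sdom_def by blast
  obtain p where p: "p < 1" "\<And>j0 v. j0 < m \<Longrightarrow> (\<Sum>j\<in>cls j0. \<Sum>i\<in>J. (cmod (\<Sum>k\<in>J. Y j i k * v k))\<^sup>2) \<le> p * (\<Sum>k\<in>J. (cmod (v k))\<^sup>2)"
    using assms unfolding sdom_def by blast
  show ?thesis unfolding sdom_def
  proof (intro exI[of _ "max q p"] conjI allI impI)
    fix j0 v assume j0: "j0 < m"
    have "(\<Sum>j\<in>cls j0. \<Sum>i\<in>I <+> J. (cmod (\<Sum>k\<in>I <+> J. blk X (\<lambda>_ _ _. 0) Y j i k * v k))\<^sup>2)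
      = (\<Sum>j\<in>cls j0. \<Sum>i\<in>I. (cmod (\<Sum>k\<in>I. X j i k * v (Inl k)))\<^sup>2) + (\<Sum>j\<in>cls j0. \<Sum>i\<in>J. (cmod (\<Sum>k\<in>J. Y j i k * v (Inr k)))\<^sup>2)"
      by (simp add: sum.Plus assms sum.distrib)
    also have "\<dots> \<le> q * (\<Sum>k\<in>I. (cmod (v (Inl k)))\<^sup>2) + p * (\<Sum>k\<in>J. (cmod (v (Inr k)))\<^sup>2)"
      by (intro add_mono q(2) p(2) j0)
    also have "\<dots> \<le> max q p * (\<Sum>k\<in>I. (cmod (v (Inl k)))\<^sup>2) + max q p * (\<Sum>k\<in>J. (cmod (v (Inr k)))\<^sup>2)"
      by (intro add_mono mult_right_mono sum_nonneg) auto
    finally show "(\<Sum>j\<in>cls j0. \<Sum>i\<in>I <+> J. (cmod (\<Sum>k\<in>I <+> J. blk X (\<lambda>_ _ _. 0) Y j i k * v k))\<^sup>2)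
      \<le> max q p * (\<Sum>k\<in>I <+> J. (cmod (v k))\<^sup>2)"
      by (simp add: sum.Plus assms ring_distribs)
  qed (use q p in auto)
qed

lemma tdsum_Dom:
  assumes "X \<in> Dom N" "Y \<in> Dom M"
  shows "tdsum N X Y \<in> Dom (N + M)"
proof -
  define h :: "nat \<Rightarrow> nat + nat" where "h a = (if a < N then Inl a else Inr (a - N))" for a
  have b: "bij_betw h {..<N+M} ({..<N} <+> {..<M})"
    by (rule bij_betw_byWitness[where f' = "case_sum (\<lambda>i. i) (\<lambda>i. N + i)"]) (auto simp: h_def)
  have s: "sdom ({..<N} <+> {..<M}) (blk X (\<lambda>_ _ _. 0) Y)"
    using assms by (intro sdom_blk) (auto simp: Dom_def)
  have "sdom {..<N+M} (\<lambda>j a c. blk X (\<lambda>_ _ _. 0) Y j (h a) (h c))"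
    using s sdom_reindex[OF b] by blast
  then have "sdom {..<N+M} (tdsum N X Y)"
    by (subst sdom_cong) (auto simp: tdsum_def mdsum_def h_def)
  moreover have "is_tup m (N + M) (tdsum N X Y)"
    using assms by (auto simp: Dom_def is_tup_def is_mat_def tdsum_def mdsum_def fun_eq_iff)
  ultimately show ?thesis by (simp add: Dom_def)
qed

end

section \<open>Noncommutative functions respect intertwinings\<close>

locale nc_fun = nc_dom +
  fixes f :: ncfun
  assumes nc: "nc_function m Dom f"
begin

text \<open>X S = S Y says that the unipotent matrix with corner S commutes with the direct sum of X
  and Y. Conjugation by it fixes the direct sum, so it also commutes with the direct sum of f(X) and
  f(Y); the corner of that identity is the claim.\<close>

lemma intertwine_nat:
  assumes X: "X \<in> Dom N" and Y: "Y \<in> Dom M" and pos: "N > 0" "M > 0"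
    and S: "\<And>j i k. j < m \<Longrightarrow> i < N \<Longrightarrow> k < M \<Longrightarrow> (\<Sum>l<N. X j i l * S l k) = (\<Sum>l<M. S i l * Y j l k)"
    and ik: "i < N" "k < M"
  shows "(\<Sum>l<N. f N X i l * S l k) = (\<Sum>l<M. S i l * f M Y l k)"
proof -
  define V where "V c = (\<lambda>i k. if i = k \<and> i < N + M then 1 else if i < N \<and> N \<le> k \<and> k < N + M then c * S i (k - N) else 0)" for c :: complex
  have Vmat: "is_mat (N + M) (V c)" for c by (auto simp: V_def is_mat_def)
  have Vl: "mmul (N+M) (V c) A i k = (if i < N then A i k + c * (\<Sum>l<M. S i l * A (N + l) k) else A i k)"
    if "i < N + M" for A i k c
  proof -
    have e1: "(\<Sum>l<N. V c i l * A l k) = (if i < N then A i k else 0)"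
    proof -
      have "(\<Sum>l<N. V c i l * A l k) = (\<Sum>l<N. if l = i then A i k else 0)"
        by (intro sum.cong refl) (auto simp: V_def)
      then show ?thesis by simp
    qed
    have e2: "(\<Sum>l<M. V c i (N + l) * A (N + l) k) = (if i < N then c * (\<Sum>l<M. S i l * A (N + l) k) else A i k)"
    proof (cases "i < N")
      case True
      then show ?thesis by (simp add: V_def sum_distrib_left mult.assoc)
    next
      case False
      then have "(\<Sum>l<M. V c i (N + l) * A (N + l) k) = (\<Sum>l<M. if l = i - N then A i k else 0)"
        using that by (intro sum.cong refl) (auto simp: V_def)
      then show ?thesis using False that by auto
    qed
    show ?thesis unfolding mmul_def sum_lessThan_split e1 e2 by auto
  qed
  have Vr: "mmul (N+M) A (V c) i k = (if N \<le> k then A i k + c * (\<Sum>l<N. A i l * S l (k - N)) else A i k)"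
    if "k < N + M" for A i k c
  proof -
    have e2: "(\<Sum>l<M. A i (N + l) * V c (N + l) k) = (if N \<le> k then A i k else 0)"
    proof -
      have "(\<Sum>l<M. A i (N + l) * V c (N + l) k) = (\<Sum>l<M. if N + l = k then A i k else 0)"
        using that by (intro sum.cong refl) (auto simp: V_def)
      also have "\<dots> = (\<Sum>l<M. if l = k - N then (if N \<le> k then A i k else 0) else 0)"
        by (intro sum.cong refl) auto
      finally show ?thesis using that by auto
    qed
    have e1: "(\<Sum>l<N. A i l * V c l k) = (if N \<le> k then c * (\<Sum>l<N. A i l * S l (k - N)) else A i k)"
    proof (cases "N \<le> k")
      case True
      then show ?thesis using that by (auto simp: V_def sum_distrib_left mult_ac intro!: sum.cong)
    next
      case False
      then have "(\<Sum>l<N. A i l * V c l k) = (\<Sum>l<N. if l = k then A i k else 0)"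
        using that by (intro sum.cong refl) (auto simp: V_def)
      then show ?thesis using False that by auto
    qed
    show ?thesis unfolding mmul_def sum_lessThan_split e1 e2 by auto
  qed
  have inv: "mmul (N+M) (V c) (V (-c)) = mid (N+M)" for c
  proof (intro ext)
    fix i k
    show "mmul (N+M) (V c) (V (-c)) i k = mid (N+M) i k"
    proof (cases "i < N + M")
      case True
      have "(\<Sum>l<M. S i l * V (- c) (N + l) k) = (if N \<le> k \<and> k < N + M then S i (k - N) else 0)"
      proof -
        have "(\<Sum>l<M. S i l * V (- c) (N + l) k) = (\<Sum>l<M. if l = k - N then (if N \<le> k \<and> k < N + M then S i (k - N) else 0) else 0)"
          by (intro sum.cong refl) (auto simp: V_def)
        then show ?thesis by auto
      qed
      then show ?thesis unfolding Vl[OF True] by (auto simp: V_def mid_def)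
    next
      case False
      then show ?thesis by (auto simp: mmul_def V_def mid_def)
    qed
  qed
  have invm: "invertible_mat (N+M) (V 1) (V (-1))"
    using inv[of 1] inv[of "-1"] Vmat by (simp add: invertible_mat_def)
  define T where "T = tdsum N X Y"
  have TD: "T \<in> Dom (N + M)" unfolding T_def by (rule tdsum_Dom[OF X Y])
  have Tm: "is_mat (N + M) (T j)" if "j < m" for j
    using TD that by (simp add: Dom_def is_tup_def)
  have comm: "mmul (N+M) (V 1) (T j) = mmul (N+M) (T j) (V 1)" if j: "j < m" for j
  proof (intro ext)
    fix i k
    show "mmul (N+M) (V 1) (T j) i k = mmul (N+M) (T j) (V 1) i k"
    proof (cases "i < N + M \<and> k < N + M")
      case True
      have Xm: "is_mat N (X j)" "is_mat M (Y j)" using X Y j by (auto simp: Dom_def is_tup_def)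
      show ?thesis unfolding Vl[OF conjunct1[OF True]] Vr[OF conjunct2[OF True]]
        using True S[OF j, of i "k - N"] by (auto simp: T_def tdsum_def mdsum_def)
    next
      case False
      moreover have "is_mat (N+M) (mmul (N+M) (V 1) (T j))" "is_mat (N+M) (mmul (N+M) (T j) (V 1))"
        using Vmat Tm[OF j] is_mat_mmul by blast+
      ultimately show ?thesis unfolding is_mat_def by (auto simp: not_less)
    qed
  qed
  \<comment> \<open>By \<open>comm\<close> the conjugated tuple is T itself, so invariance under
    similarities becomes a commutation relation for f(T).\<close>
  have sim: "(\<lambda>j. if j < m then mmul (N+M) (mmul (N+M) (V 1) (T j)) (V (-1)) else mzero) = T"
  proof
    fix j show "(if j < m then mmul (N+M) (mmul (N+M) (V 1) (T j)) (V (-1)) else mzero) = T j"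
    proof (cases "j < m")
      case True
      then show ?thesis
        by (simp add: comm mmul_assoc inv mmul_mid_right Tm)
    next
      case False
      then show ?thesis using TD by (auto simp: Dom_def is_tup_def mzero_def)
    qed
  qed
  have fT: "f (N+M) T = mdsum N (f N X) (f M Y)"
  proof -
    have "\<forall>N>0. \<forall>M>0. \<forall>X\<in>Dom N. \<forall>Y\<in>Dom M. tdsum N X Y \<in> Dom (N + M) \<longrightarrow>
         f (N + M) (tdsum N X Y) = mdsum N (f N X) (f M Y)"
      using nc unfolding nc_function_def by (elim conjE)
    from this[rule_format, OF pos X Y] TD show ?thesis unfolding T_def by simp
  qed
  have "f (N+M) T = mmul (N+M) (mmul (N+M) (V 1) (f (N+M) T)) (V (-1))"
  proof -
    have "\<forall>N>0. \<forall>X\<in>Dom N. \<forall>S T. invertible_mat N S T \<longrightarrow>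
         (\<lambda>j. if j < m then mmul N (mmul N S (X j)) T else mzero) \<in> Dom N \<longrightarrow>
         f N (\<lambda>j. if j < m then mmul N (mmul N S (X j)) T else mzero) = mmul N (mmul N S (f N X)) T"
      using nc unfolding nc_function_def by (elim conjE)
    from this[rule_format, of "N+M" T "V 1" "V (-1)"] show ?thesis
      unfolding sim using TD invm pos by simp
  qed
  then have "mmul (N+M) (f (N+M) T) (V 1) = mmul (N+M) (mmul (N+M) (mmul (N+M) (V 1) (f (N+M) T)) (V (-1))) (V 1)"
    by simp
  also have "\<dots> = mmul (N+M) (V 1) (f (N+M) T)"
  proof -
    have "is_mat (N+M) (f (N+M) T)" using nc TD pos unfolding nc_function_def by auto
    then show ?thesis using inv[of "-1"] by (simp add: mmul_assoc mmul_mid_right)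
  qed
  finally have "mmul (N+M) (f (N+M) T) (V 1) i (N + k) = mmul (N+M) (V 1) (f (N+M) T) i (N + k)" by simp
  then show ?thesis using ik Vl[of i 1 "f (N+M) T" "N + k"] Vr[of "N + k" "f (N+M) T" 1 i]
    unfolding fT by (simp add: mdsum_def)
qed

definition en :: "'i set \<Rightarrow> nat \<Rightarrow> 'i" where
  "en I = (SOME h. bij_betw h {..<card I} I)"

definition toN :: "'i set \<Rightarrow> (nat \<Rightarrow> 'i \<Rightarrow> 'i \<Rightarrow> complex) \<Rightarrow> ctup" where
  "toN I X = (\<lambda>j a b. if j < m \<and> a < card I \<and> b < card I then X j (en I a) (en I b) else 0)"

text \<open>Transport of f to an arbitrary finite index set. Two enumerations differ by a
  permutation similarity, so on the domain the value does not depend on the choice made by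
  \<open>en\<close>.\<close>

definition fI :: "'i set \<Rightarrow> (nat \<Rightarrow> 'i \<Rightarrow> 'i \<Rightarrow> complex) \<Rightarrow> 'i \<Rightarrow> 'i \<Rightarrow> complex" where
  "fI I X i k = f (card I) (toN I X) (inv_into {..<card I} (en I) i) (inv_into {..<card I} (en I) k)"

lemma en_bij: "finite I \<Longrightarrow> bij_betw (en I) {..<card I} I"
  unfolding en_def using ex_bij_betw_nat_finite[of I] by (metis atLeast0LessThan someI_ex)

lemma fI_en: "finite I \<Longrightarrow> a < card I \<Longrightarrow> b < card I \<Longrightarrow> fI I X (en I a) (en I b) = f (card I) (toN I X) a b"
  unfolding fI_def using en_bij[of I] by (simp add: bij_betw_inv_into_left)

lemma toN_Dom:
  assumes "finite I" "sdom I X" shows "toN I X \<in> Dom (card I)"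
proof -
  have "sdom {..<card I} (\<lambda>j a b. X j (en I a) (en I b))"
    using sdom_reindex[OF en_bij[OF assms(1)]] assms(2) by blast
  then have "sdom {..<card I} (toN I X)"
    by (subst sdom_cong) (auto simp: toN_def)
  then show ?thesis by (auto simp: Dom_def is_tup_def toN_def is_mat_def fun_eq_iff)
qed

lemma sum_en: "finite I \<Longrightarrow> (\<Sum>a<card I. g (en I a)) = (\<Sum>i\<in>I. g i)"
  using sum.reindex_bij_betw[OF en_bij[of I], of g] by simp

lemma en_obtain: "finite I \<Longrightarrow> i \<in> I \<Longrightarrow> \<exists>a<card I. i = en I a"
  using en_bij[of I] by (auto simp: bij_betw_def)

lemma en_in: "finite I \<Longrightarrow> a < card I \<Longrightarrow> en I a \<in> I"
  using en_bij[of I] by (auto simp: bij_betw_def)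

lemma intertwine:
  assumes fin: "finite I" "finite J" and X: "sdom I X" and Y: "sdom J Y"
    and S: "\<And>j i k. j < m \<Longrightarrow> i \<in> I \<Longrightarrow> k \<in> J \<Longrightarrow> (\<Sum>l\<in>I. X j i l * S l k) = (\<Sum>l\<in>J. S i l * Y j l k)"
    and ik: "i \<in> I" "k \<in> J"
  shows "(\<Sum>l\<in>I. fI I X i l * S l k) = (\<Sum>l\<in>J. S i l * fI J Y l k)"
proof -
  obtain a where a: "a < card I" "i = en I a" using en_obtain fin ik by metis
  obtain b where b: "b < card J" "k = en J b" using en_obtain fin ik by metis
  have "(\<Sum>l<card I. f (card I) (toN I X) a l * S (en I l) (en J b))
      = (\<Sum>l<card J. S (en I a) (en J l) * f (card J) (toN J Y) l b)"
  proof (rule intertwine_nat)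
    show "toN I X \<in> Dom (card I)" "toN J Y \<in> Dom (card J)"
      using toN_Dom fin X Y by auto
    fix j i k assume *: "j < m" "i < card I" "k < card J"
    have "(\<Sum>l<card I. X j (en I i) (en I l) * S (en I l) (en J k)) = (\<Sum>l<card J. S (en I i) (en J l) * Y j (en J l) (en J k))"
      using S[OF *(1) en_in[OF fin(1) *(2)] en_in[OF fin(2) *(3)]]
      by (simp add: sum_en[OF fin(1), of "\<lambda>l. X j (en I i) l * S l (en J k)"] sum_en[OF fin(2), of "\<lambda>l. S (en I i) l * Y j l (en J k)"])
    then show "(\<Sum>l<card I. toN I X j i l * S (en I l) (en J k)) = (\<Sum>l<card J. S (en I i) (en J l) * toN J Y j l k)"
      using * by (simp add: toN_def)
  qed (use a b in auto)
  then have "(\<Sum>l<card I. fI I X i (en I l) * S (en I l) k) = (\<Sum>l<card J. S i (en J l) * fI J Y (en J l) k)"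
    using a b fin by (simp add: fI_en)
  then show ?thesis
    by (simp add: sum_en[OF fin(1), of "\<lambda>l. fI I X i l * S l k"] sum_en[OF fin(2), of "\<lambda>l. S i l * fI J Y l k"])
qed

text \<open>The enumeration picked for \<open>{..<N}\<close> may be a nontrivial permutation. Its
  permutation matrix intertwines X with the relabelled tuple, and \<open>intertwine_nat\<close>
  moves it through f.\<close>

lemma fI_nat:
  assumes X: "X \<in> Dom N" and ik: "i < N" "k < N"
  shows "fI {..<N} X i k = f N X i k"
proof -
  have sX: "sdom {..<N} X" using X by (simp add: Dom_def)
  let ?e = "en {..<N}"
  have b: "bij_betw ?e {..<N} {..<N}" using en_bij[of "{..<N}"] by simp
  have inj: "?e a = ?e c \<longleftrightarrow> a = c" if "a < N" "c < N" for a c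
    using b that by (auto simp: bij_betw_def inj_on_def)
  obtain a c where a: "a < N" "i = ?e a" and c: "c < N" "k = ?e c"
    using en_obtain[of "{..<N}"] ik by (metis card_lessThan finite_lessThan lessThan_iff)
  have eN: "?e l < N" if "l < N" for l using en_in[of "{..<N}" l] that by simp
  have "(\<Sum>l<N. f N X i l * (if l = ?e c then 1 else 0)) = (\<Sum>l<N. (if i = ?e l then 1 else 0) * f N (toN {..<N} X) l c)"
  proof (rule intertwine_nat[OF X])
    show "toN {..<N} X \<in> Dom N" using toN_Dom[OF _ sX] by simp
    fix j i k assume *: "j < m" "i < N" "k < N"
    obtain a where a: "a < N" "i = ?e a"
      using en_obtain[of "{..<N}"] * by (metis card_lessThan finite_lessThan lessThan_iff)
    have "(\<Sum>l<N. (if i = ?e l then 1 else 0) * toN {..<N} X j l k) = (\<Sum>l<N. if l = a then X j i (?e k) else 0)"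
      using * a inj by (intro sum.cong refl) (auto simp: toN_def)
    also have "\<dots> = (\<Sum>l<N. X j i l * (if l = ?e k then 1 else 0))"
      using a eN[OF *(3)] by (simp add: if_distrib cong: if_cong)
    finally show "(\<Sum>l<N. X j i l * (if l = ?e k then 1 else 0)) = (\<Sum>l<N. (if i = ?e l then 1 else 0) * toN {..<N} X j l k)" ..
  qed (use a c ik in auto)
  also have "\<dots> = (\<Sum>l<N. if l = a then f N (toN {..<N} X) a c else 0)"
    using a inj by (intro sum.cong refl) auto
  finally have "f N X i k = f N (toN {..<N} X) a c"
    using a c eN by (simp add: if_distrib cong: if_cong)
  then show ?thesis using fI_en[of "{..<N}" a c X] a c by simp
qed

end

section \<open>From local boundedness to analyticity on slices\<close>

lemma Inl_Plus_iff [simp]: "Inl a \<in> A <+> B \<longleftrightarrow> a \<in> A"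
  and Inr_Plus_iff [simp]: "Inr b \<in> A <+> B \<longleftrightarrow> b \<in> B"
  by auto

context nc_dom
begin

lemma sdom_perturb:
  assumes "finite I" "sdom I X"
  shows "\<exists>\<epsilon>>0. \<forall>t. cmod t < \<epsilon> \<longrightarrow> sdom I (\<lambda>j i k. X j i k + t * Z j i k)"
proof -
  obtain \<delta> where \<delta>: "\<delta> > 0" "\<And>Z. (\<forall>j<m. \<forall>i\<in>I. \<forall>k\<in>I. cmod (Z j i k) \<le> \<delta>) \<Longrightarrow> sdom I (\<lambda>j i k. X j i k + Z j i k)"
    using sdom_open[OF assms] by blast
  define M where "M = (\<Sum>j<m. \<Sum>i\<in>I. \<Sum>k\<in>I. cmod (Z j i k)) + 1"
  have M1: "M \<ge> 1" by (simp add: M_def sum_nonneg)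
  have M: "cmod (Z j i k) \<le> M" if "j < m" "i \<in> I" "k \<in> I" for j i k
  proof -
    have "cmod (Z j i k) \<le> (\<Sum>k\<in>I. cmod (Z j i k))"
      using assms that by (intro member_le_sum) auto
    also have "\<dots> \<le> (\<Sum>i\<in>I. \<Sum>k\<in>I. cmod (Z j i k))"
      using assms that by (intro member_le_sum[of i I "\<lambda>i. \<Sum>k\<in>I. cmod (Z j i k)"]) (auto intro: sum_nonneg)
    also have "\<dots> \<le> (\<Sum>j<m. \<Sum>i\<in>I. \<Sum>k\<in>I. cmod (Z j i k))"
      using assms that by (intro member_le_sum[of j "{..<m}" "\<lambda>j. \<Sum>i\<in>I. \<Sum>k\<in>I. cmod (Z j i k)"]) (auto intro!: sum_nonneg)
    finally show ?thesis by (simp add: M_def)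
  qed
  show ?thesis
  proof (intro exI[of _ "\<delta> / M"] conjI allI impI)
    show "\<delta> / M > 0" using \<delta> M1 by simp
    fix t :: complex assume t: "cmod t < \<delta> / M"
    show "sdom I (\<lambda>j i k. X j i k + t * Z j i k)"
    proof (rule \<delta>(2), intro allI ballI impI)
      fix j i k assume "j < m" "i \<in> I" "k \<in> I"
      then have "cmod (t * Z j i k) \<le> \<delta> / M * M"
        unfolding norm_mult using t M M1 \<delta>(1) by (intro mult_mono) auto
      then show "cmod (t * Z j i k) \<le> \<delta>" using M1 by simp
    qed
  qed
qed

end

locale nc_an = nc_fun +
  assumes lb: "loc_bdd_slices m Dom f"
begin

lemma fI_bdd:
  assumes "finite I" "I \<noteq> {}" "sdom I X"
  shows "\<exists>\<epsilon>>0. \<exists>B. \<forall>t. cmod t < \<epsilon> \<longrightarrow> sdom I (\<lambda>j i k. X j i k + t * Z j i k) \<longrightarrow>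
           (\<forall>i\<in>I. \<forall>k\<in>I. cmod (fI I (\<lambda>j i k. X j i k + t * Z j i k) i k) \<le> B)"
proof -
  have pos: "card I > 0" using assms by (simp add: card_gt_0_iff)
  have e: "toN I (\<lambda>j i k. X j i k + t * Z j i k) = tadd (toN I X) (tscale t (toN I Z))" for t
    by (auto simp: toN_def tadd_def madd_def tscale_def mscale_def fun_eq_iff)
  have tup: "is_tup m (card I) (toN I Z)" by (auto simp: is_tup_def is_mat_def toN_def fun_eq_iff)
  from lb pos tup toN_Dom[OF assms(1,3)] obtain \<epsilon> B where \<epsilon>: "\<epsilon> > 0"
    "\<And>t. cmod t < \<epsilon> \<Longrightarrow> tadd (toN I X) (tscale t (toN I Z)) \<in> Dom (card I) \<Longrightarrow>
       (\<forall>i k. cmod (f (card I) (tadd (toN I X) (tscale t (toN I Z))) i k) \<le> B)"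
    unfolding loc_bdd_slices_def by blast
  show ?thesis
  proof (rule exI[of _ \<epsilon>], intro conjI \<epsilon>(1), rule exI[of _ B], intro allI impI ballI)
    fix t i k assume t: "cmod t < \<epsilon>" "sdom I (\<lambda>j i k. X j i k + t * Z j i k)" "i \<in> I" "k \<in> I"
    have "tadd (toN I X) (tscale t (toN I Z)) \<in> Dom (card I)"
      using toN_Dom[OF assms(1) t(2)] e by simp
    then show "cmod (fI I (\<lambda>j i k. X j i k + t * Z j i k) i k) \<le> B"
      unfolding fI_def e using \<epsilon>(2)[OF t(1)] by blast
  qed
qed

text \<open>Two columns intertwine the block tuple: (1, 0) with X, and (c, 1) with Y because W = c
  (Y - X) gives c X + W = c Y. The first identifies the diagonal block of f, the second then yields
  the corner.\<close>

lemma fI_blk_diff: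
  fixes I :: "'i set"
  assumes fin: "finite I" and X: "sdom I X" and Y: "sdom I Y"
    and M: "sdom (I <+> I) (blk X W Y)"
    and W: "\<And>j i k. j < m \<Longrightarrow> i \<in> I \<Longrightarrow> k \<in> I \<Longrightarrow> W j i k = c * (Y j i k - X j i k)"
    and ik: "i \<in> I" "k \<in> I"
  shows "fI (I <+> I) (blk X W Y) (Inl i) (Inr k) = c * (fI I Y i k - fI I X i k)"
proof -
  let ?M = "blk X W Y" and ?J = "I <+> I"
  have finJ: "finite ?J" using fin by simp
  have 1: "fI ?J ?M (Inl i) (Inl k) = fI I X i k" if "i \<in> I" "k \<in> I" for i k
  proof -
    let ?S = "\<lambda>(p :: 'i + 'i) (k :: 'i). case p of Inl i \<Rightarrow> (if i = k then 1 else 0) | Inr _ \<Rightarrow> (0::complex)"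
    have "(\<Sum>l\<in>?J. fI ?J ?M (Inl i) l * ?S l k) = (\<Sum>l\<in>I. ?S (Inl i) l * fI I X l k)"
    proof (rule intertwine[where S = ?S, OF finJ fin M X])
      fix j p k assume *: "j < m" "p \<in> ?J" "k \<in> I"
      show "(\<Sum>l\<in>?J. ?M j p l * ?S l k) = (\<Sum>l\<in>I. ?S p l * X j l k)"
        using * fin by (cases p) (simp_all add: sum.Plus if_distrib[where f = "\<lambda>x. x * _"] if_distrib[where f = "\<lambda>x. _ * x"] cong: if_cong)
    qed (use that in auto)
    then show ?thesis
      using that fin by (simp add: sum.Plus if_distrib[where f = "\<lambda>x. x * _"] if_distrib[where f = "\<lambda>x. _ * x"] cong: if_cong)
  qed
  let ?S = "\<lambda>(p :: 'i + 'i) (k :: 'i). case p of Inl i \<Rightarrow> (if i = k then c else 0) | Inr i \<Rightarrow> (if i = k then 1 else (0::complex))"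
  have "(\<Sum>l\<in>?J. fI ?J ?M (Inl i) l * ?S l k) = (\<Sum>l\<in>I. ?S (Inl i) l * fI I Y l k)"
  proof (rule intertwine[where S = ?S, OF finJ fin M Y])
    fix j p k assume *: "j < m" "p \<in> ?J" "k \<in> I"
    show "(\<Sum>l\<in>?J. ?M j p l * ?S l k) = (\<Sum>l\<in>I. ?S p l * Y j l k)"
      using * fin by (cases p) (simp_all add: sum.Plus W algebra_simps sum_subtractf if_distrib[where f = "\<lambda>x. x * _"] if_distrib[where f = "\<lambda>x. _ * x"] cong: if_cong)
  qed (use ik in auto)
  then have "c * fI I X i k + fI ?J ?M (Inl i) (Inr k) = c * fI I Y i k"
    using ik fin by (simp add: 1 sum.Plus mult.commute if_distrib[where f = "\<lambda>x. x * _"] if_distrib[where f = "\<lambda>x. _ * x"] cong: if_cong)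
  then show ?thesis by (simp add: algebra_simps)
qed

text \<open>With \<epsilon> fixed, the corner \<epsilon> Z is \<epsilon>/h times the difference h Z
  of the two diagonal blocks. By \<open>fI_blk_diff\<close> the corner of f is then \<epsilon> times
  the difference quotient along Z, and the block tuples stay in the domain for all small h at
  once.\<close>

lemma block_setup:
  assumes fin: "finite I" and X: "sdom I X"
  obtains \<epsilon> \<delta> where "\<epsilon> \<noteq> (0::complex)" "\<delta> > 0"
    "sdom (I <+> I) (blk X (\<lambda>j i k. \<epsilon> * Z j i k) X)"
    "\<And>h. cmod h < \<delta> \<Longrightarrow> sdom I (\<lambda>j i k. X j i k + h * Z j i k)"
    "\<And>h. cmod h < \<delta> \<Longrightarrow> sdom (I <+> I) (blk X (\<lambda>j i k. \<epsilon> * Z j i k) (\<lambda>j i k. X j i k + h * Z j i k))"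
proof -
  let ?O = "\<lambda>(_::nat) _ _. 0 :: complex"
  have e1: "(\<lambda>j p q. blk X ?O X j p q + t * blk ?O Z ?O j p q) = blk X (\<lambda>j i k. t * Z j i k) X" for t
    by (auto simp: fun_eq_iff blk_def split: sum.splits)
  have e2: "(\<lambda>j p q. blk X (\<lambda>j i k. \<epsilon> * Z j i k) X j p q + h * blk ?O ?O Z j p q)
      = blk X (\<lambda>j i k. \<epsilon> * Z j i k) (\<lambda>j i k. X j i k + h * Z j i k)" for \<epsilon> h
    by (auto simp: fun_eq_iff blk_def split: sum.splits)
  obtain r where r: "r > 0" "\<And>t. cmod t < r \<Longrightarrow> sdom (I <+> I) (blk X (\<lambda>j i k. t * Z j i k) X)"
    using sdom_perturb[OF _ sdom_blk[OF fin fin X X], of "blk ?O Z ?O"] fin unfolding e1 by auto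
  define \<epsilon> where "\<epsilon> = complex_of_real (r/2)"
  have \<epsilon>: "\<epsilon> \<noteq> 0" "cmod \<epsilon> < r" using r by (auto simp: \<epsilon>_def)
  obtain r2 where r2: "r2 > 0" "\<And>h. cmod h < r2 \<Longrightarrow> sdom (I <+> I) (blk X (\<lambda>j i k. \<epsilon> * Z j i k) (\<lambda>j i k. X j i k + h * Z j i k))"
    using sdom_perturb[OF _ r(2)[OF \<epsilon>(2)], of "blk ?O ?O Z"] fin unfolding e2 by auto
  obtain r3 where r3: "r3 > 0" "\<And>h. cmod h < r3 \<Longrightarrow> sdom I (\<lambda>j i k. X j i k + h * Z j i k)"
    using sdom_perturb[OF fin X, of Z] by auto
  show thesis
    by (rule that[of \<epsilon> "min r2 r3"]) (use \<epsilon> r r2 r3 in auto)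
qed

text \<open>The difference quotients are corners of f at block tuples that run along a slice in h,
  so local boundedness at the block level bounds them.\<close>

lemma fI_Lip:
  assumes fin: "finite I" "I \<noteq> {}" and X: "sdom I X"
  shows "\<exists>\<delta>>0. \<exists>C. \<forall>h. cmod h < \<delta> \<longrightarrow> sdom I (\<lambda>j i k. X j i k + h * Z j i k) \<and>
     (\<forall>i\<in>I. \<forall>k\<in>I. cmod (fI I (\<lambda>j i k. X j i k + h * Z j i k) i k - fI I X i k) \<le> C * cmod h)"
proof -
  let ?O = "\<lambda>(_::nat) _ _. 0 :: complex"
  obtain \<epsilon> \<delta> where \<epsilon>: "\<epsilon> \<noteq> 0" "\<delta> > 0"
    "sdom (I <+> I) (blk X (\<lambda>j i k. \<epsilon> * Z j i k) X)"
    "\<And>h. cmod h < \<delta> \<Longrightarrow> sdom I (\<lambda>j i k. X j i k + h * Z j i k)"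
    "\<And>h. cmod h < \<delta> \<Longrightarrow> sdom (I <+> I) (blk X (\<lambda>j i k. \<epsilon> * Z j i k) (\<lambda>j i k. X j i k + h * Z j i k))"
    using block_setup[OF fin(1) X, of Z] by blast
  have e2: "(\<lambda>j p q. blk X (\<lambda>j i k. \<epsilon> * Z j i k) X j p q + h * blk ?O ?O Z j p q)
      = blk X (\<lambda>j i k. \<epsilon> * Z j i k) (\<lambda>j i k. X j i k + h * Z j i k)" for h
    by (auto simp: fun_eq_iff blk_def split: sum.splits)
  have "finite (I <+> I)" "I <+> I \<noteq> {}" using fin by auto
  from fI_bdd[OF this \<epsilon>(3), of "blk ?O ?O Z", unfolded e2]
  obtain r B where rB: "r > 0" "\<And>h p q. cmod h < r \<Longrightarrow> sdom (I <+> I) (blk X (\<lambda>j i k. \<epsilon> * Z j i k) (\<lambda>j i k. X j i k + h * Z j i k)) \<Longrightarrow>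
      p \<in> I <+> I \<Longrightarrow> q \<in> I <+> I \<Longrightarrow> cmod (fI (I <+> I) (blk X (\<lambda>j i k. \<epsilon> * Z j i k) (\<lambda>j i k. X j i k + h * Z j i k)) p q) \<le> B"
    by blast
  show ?thesis
  proof (rule exI[of _ "min \<delta> r"], rule conjI, use \<epsilon>(2) rB(1) in simp, rule exI[of _ "B / cmod \<epsilon>"], intro conjI allI impI ballI)
    fix h assume h: "cmod h < min \<delta> r"
    show s: "sdom I (\<lambda>j i k. X j i k + h * Z j i k)" using \<epsilon>(4) h by simp
    fix i k assume ik: "i \<in> I" "k \<in> I"
    show "cmod (fI I (\<lambda>j i k. X j i k + h * Z j i k) i k - fI I X i k) \<le> B / cmod \<epsilon> * cmod h"
    proof (cases "h = 0")
      case False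
      have "fI (I <+> I) (blk X (\<lambda>j i k. \<epsilon> * Z j i k) (\<lambda>j i k. X j i k + h * Z j i k)) (Inl i) (Inr k)
         = (\<epsilon> / h) * (fI I (\<lambda>j i k. X j i k + h * Z j i k) i k - fI I X i k)"
        by (rule fI_blk_diff) (use fin X s \<epsilon>(5) h ik False in auto)
      moreover have "cmod (fI (I <+> I) (blk X (\<lambda>j i k. \<epsilon> * Z j i k) (\<lambda>j i k. X j i k + h * Z j i k)) (Inl i) (Inr k)) \<le> B"
        using rB(2)[OF _ \<epsilon>(5)] h ik by auto
      ultimately have "cmod \<epsilon> / cmod h * cmod (fI I (\<lambda>j i k. X j i k + h * Z j i k) i k - fI I X i k) \<le> B"
        by (simp only: norm_mult norm_divide)
      then show ?thesis using \<epsilon>(1) False by (simp add: field_simps)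
    qed simp
  qed
qed

text \<open>One level higher, \<open>fI_Lip\<close> applies to the block tuple itself: the corner of
  f, which is \<epsilon> times the difference quotient, is continuous at h = 0. Its value there is
  \<epsilon> times the derivative.\<close>

lemma fI_diff:
  assumes fin: "finite I" "I \<noteq> {}" and X: "sdom I X" and ik: "i \<in> I" "k \<in> I"
  shows "\<exists>D. ((\<lambda>h. fI I (\<lambda>j i k. X j i k + h * Z j i k) i k) has_field_derivative D) (at 0)"
proof -
  let ?O = "\<lambda>(_::nat) _ _. 0 :: complex"
  obtain \<epsilon> \<delta> where \<epsilon>: "\<epsilon> \<noteq> 0" "\<delta> > 0"
    "sdom (I <+> I) (blk X (\<lambda>j i k. \<epsilon> * Z j i k) X)"
    "\<And>h. cmod h < \<delta> \<Longrightarrow> sdom I (\<lambda>j i k. X j i k + h * Z j i k)"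
    "\<And>h. cmod h < \<delta> \<Longrightarrow> sdom (I <+> I) (blk X (\<lambda>j i k. \<epsilon> * Z j i k) (\<lambda>j i k. X j i k + h * Z j i k))"
    using block_setup[OF fin(1) X, of Z] by blast
  define M where "M h = blk X (\<lambda>j i k. \<epsilon> * Z j i k) (\<lambda>j i k. X j i k + h * Z j i k)" for h
  have e2: "(\<lambda>j p q. M 0 j p q + h * blk ?O ?O Z j p q) = M h" for h
    by (auto simp: fun_eq_iff blk_def M_def split: sum.splits)
  have M0: "sdom (I <+> I) (M 0)" using \<epsilon>(3) by (simp add: M_def)
  have "finite (I <+> I)" "I <+> I \<noteq> {}" using fin by auto
  from fI_Lip[OF this M0, of "blk ?O ?O Z", unfolded e2]
  obtain r C where rC: "r > 0" "\<And>h p q. cmod h < r \<Longrightarrow> p \<in> I <+> I \<Longrightarrow> q \<in> I <+> I \<Longrightarrow>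
      cmod (fI (I <+> I) (M h) p q - fI (I <+> I) (M 0) p q) \<le> C * cmod h"
    by blast
  let ?g = "\<lambda>h. fI (I <+> I) (M h) (Inl i) (Inr k)"
  have "((\<lambda>h. ?g h - ?g 0) \<longlongrightarrow> 0) (at 0)"
  proof (rule Lim_null_comparison)
    show "((\<lambda>h::complex. C * cmod h) \<longlongrightarrow> 0) (at 0)" by (intro tendsto_eq_intros | simp)+
    show "\<forall>\<^sub>F h in at 0. norm (?g h - ?g 0) \<le> C * cmod h"
      unfolding eventually_at using rC ik by (intro exI[of _ r]) auto
  qed
  then have "(?g \<longlongrightarrow> ?g 0) (at 0)" by (simp add: LIM_zero_iff)
  then have "((\<lambda>h. ?g h / \<epsilon>) \<longlongrightarrow> ?g 0 / \<epsilon>) (at 0)" by (intro tendsto_divide tendsto_const) (use \<epsilon> in auto)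
  moreover have "\<forall>\<^sub>F h in at 0. ?g h / \<epsilon> = (fI I (\<lambda>j i k. X j i k + h * Z j i k) i k - fI I X i k) / h"
    unfolding eventually_at
  proof (intro exI[of _ \<delta>] conjI ballI impI \<epsilon>(2))
    fix h :: complex assume h: "h \<noteq> 0 \<and> dist h 0 < \<delta>"
    have "?g h = (\<epsilon> / h) * (fI I (\<lambda>j i k. X j i k + h * Z j i k) i k - fI I X i k)"
      unfolding M_def by (rule fI_blk_diff) (use fin X \<epsilon>(4,5) h ik in auto)
    then show "?g h / \<epsilon> = (fI I (\<lambda>j i k. X j i k + h * Z j i k) i k - fI I X i k) / h"
      using \<epsilon>(1) by simp
  qed
  ultimately have "((\<lambda>h. (fI I (\<lambda>j i k. X j i k + h * Z j i k) i k - fI I X i k) / h) \<longlongrightarrow> ?g 0 / \<epsilon>) (at 0)"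
    by (blast intro: Lim_transform_eventually)
  then show ?thesis unfolding DERIV_def by auto
qed

end

section \<open>Estimates for polynomials and power series\<close>

lemma poly_small_coeffs_zero:
  fixes b :: "nat \<Rightarrow> complex"
  assumes "\<epsilon> > 0" "\<And>z. 0 < cmod z \<Longrightarrow> cmod z < \<epsilon> \<Longrightarrow> cmod (\<Sum>k<K. b k * z ^ k) \<le> C * cmod z ^ K"
  shows "\<forall>k<K. b k = 0"
  using assms
proof (induction K arbitrary: b)
  case (Suc K)
  have ev: "\<forall>\<^sub>F z in at 0. 0 < cmod z \<and> cmod z < \<epsilon>"
    unfolding eventually_at using Suc.prems(1) by (intro exI[of _ \<epsilon>]) auto
  have "((\<lambda>z. \<Sum>k<Suc K. b k * z ^ k) \<longlongrightarrow> 0) (at 0)"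
  proof (rule Lim_null_comparison)
    show "\<forall>\<^sub>F z in at 0. cmod (\<Sum>k<Suc K. b k * z ^ k) \<le> C * cmod z ^ Suc K"
      using ev by eventually_elim (use Suc.prems in blast)
    show "((\<lambda>z::complex. C * cmod z ^ Suc K) \<longlongrightarrow> 0) (at 0)"
      by (rule tendsto_eq_intros refl | simp)+
  qed
  moreover have "((\<lambda>z::complex. \<Sum>k<Suc K. b k * z ^ k) \<longlongrightarrow> (\<Sum>k<Suc K. b k * 0 ^ k)) (at 0)"
    by (intro tendsto_intros)
  ultimately have "(\<Sum>k<Suc K. b k * 0 ^ k) = 0" using tendsto_unique[of "at (0::complex)"] by (metis at_neq_bot)
  then have b0: "b 0 = 0" by (simp add: sum.lessThan_Suc_shift)
  have "\<forall>k<K. b (Suc k) = 0"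
  proof (rule Suc.IH[OF Suc.prems(1)])
    fix z assume z: "0 < cmod z" "cmod z < \<epsilon>"
    have "(\<Sum>k<Suc K. b k * z ^ k) = z * (\<Sum>k<K. b (Suc k) * z ^ k)"
      by (simp add: sum.lessThan_Suc_shift b0 sum_distrib_left mult_ac del: sum.lessThan_Suc)
    then have "cmod z * cmod (\<Sum>k<K. b (Suc k) * z ^ k) \<le> cmod z * (C * cmod z ^ K)"
      using Suc.prems(2)[OF z] by (simp add: norm_mult mult_ac)
    then show "cmod (\<Sum>k<K. b (Suc k) * z ^ k) \<le> C * cmod z ^ K"
      using z by simp
  qed
  then show ?case using b0 by (metis Suc_less_eq less_Suc_eq_0_disj)
qed simp

text \<open>Convergence beyond radius 1 makes the coefficients absolutely summable, and the factor
  |z|^K can be taken out of the tail on the closed unit disc.\<close>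

lemma sums_remainder_bound:
  fixes g :: "complex \<Rightarrow> complex"
  assumes R: "R > 1" and s: "\<And>z. cmod z < R \<Longrightarrow> (\<lambda>n. a n * z ^ n) sums g z"
  shows "\<exists>C. \<forall>z. cmod z \<le> 1 \<longrightarrow> cmod (g z - (\<Sum>n<K. a n * z ^ n)) \<le> C * cmod z ^ K"
proof -
  define \<rho> where "\<rho> = (1 + R) / 2"
  have \<rho>: "1 < \<rho>" "\<rho> < R" using R by (auto simp: \<rho>_def)
  have "summable (\<lambda>n. a n * of_real \<rho> ^ n)"
    using s[of "of_real \<rho>"] \<rho> by (auto simp: sums_iff)
  then have sa: "summable (\<lambda>n. cmod (a n * 1 ^ n))"
    by (rule powser_insidea) (use \<rho> in auto)
  then have sa': "summable (\<lambda>n. cmod (a n))" by simp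
  define C where "C = (\<Sum>n. cmod (a (n + K)))"
  have "cmod (g z - (\<Sum>n<K. a n * z ^ n)) \<le> C * cmod z ^ K" if z: "cmod z \<le> 1" for z
  proof -
    have sz: "(\<lambda>n. a n * z ^ n) sums g z" using s R z by auto
    then have "(\<lambda>n. a (n + K) * z ^ (n + K)) sums (g z - (\<Sum>n<K. a n * z ^ n))"
      using sums_iff_shift[of "\<lambda>n. a n * z ^ n" K "g z - (\<Sum>n<K. a n * z ^ n)"] by simp
    then have e: "g z - (\<Sum>n<K. a n * z ^ n) = (\<Sum>n. a (n + K) * z ^ (n + K))" by (simp add: sums_iff)
    have sK: "summable (\<lambda>n. cmod (a (n + K)))" using sa' by (subst summable_iff_shift)
    have "cmod (\<Sum>n. a (n + K) * z ^ (n + K)) \<le> (\<Sum>n. cmod (a (n + K)) * cmod z ^ K)"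
    proof (rule norm_suminf_le)
      show "summable (\<lambda>n. cmod (a (n + K)) * cmod z ^ K)" using sK by (rule summable_mult2)
      fix n
      have "cmod z ^ (n + K) \<le> 1 * cmod z ^ K"
        unfolding power_add using z by (intro mult_right_mono power_le_one) auto
      then show "cmod (a (n + K) * z ^ (n + K)) \<le> cmod (a (n + K)) * cmod z ^ K"
        by (simp add: norm_mult norm_power mult_left_mono)
    qed
    also have "\<dots> = C * cmod z ^ K" using sK by (simp add: C_def suminf_mult2)
    finally show ?thesis unfolding e .
  qed
  then show ?thesis by blast
qed

context nc_dom
begin

text \<open>Put $C_t$ = shft + t wrap. Then $C_{z^K}$ is intertwined with $zX$, and $f$ is Lipschitz along
  $t \mapsto C_t$; hence the first row of $f$ at the shift lists the Taylor coefficients of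
  $z \mapsto f(zX)$ of order below $K$.\<close>

definition shft :: "nat \<Rightarrow> ctup \<Rightarrow> nat \<Rightarrow> nat \<times> nat \<Rightarrow> nat \<times> nat \<Rightarrow> complex" where
  "shft K X j p q = (if fst q = Suc (fst p) then X j (snd p) (snd q) else 0)"

definition wrap :: "nat \<Rightarrow> ctup \<Rightarrow> nat \<Rightarrow> nat \<times> nat \<Rightarrow> nat \<times> nat \<Rightarrow> complex" where
  "wrap K X j p q = (if Suc (fst p) = K \<and> fst q = 0 then X j (snd p) (snd q) else 0)"

lemma sum_shft:
  assumes "p \<in> {..<K} \<times> {..<N}"
  shows "(\<Sum>q\<in>{..<K} \<times> {..<N}. shft K X j p q * v q) = (if Suc (fst p) < K then (\<Sum>b<N. X j (snd p) b * v (Suc (fst p), b)) else 0)"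
proof -
  have "(\<Sum>q\<in>{..<K} \<times> {..<N}. shft K X j p q * v q) = (\<Sum>k<K. \<Sum>b<N. shft K X j p (k, b) * v (k, b))"
    by (simp add: sum.cartesian_product)
  also have "\<dots> = (\<Sum>k<K. if k = Suc (fst p) then (\<Sum>b<N. X j (snd p) b * v (Suc (fst p), b)) else 0)"
    by (intro sum.cong refl) (auto simp: shft_def)
  finally show ?thesis by auto
qed

lemma sum_wrap:
  assumes "p \<in> {..<K} \<times> {..<N}"
  shows "(\<Sum>q\<in>{..<K} \<times> {..<N}. wrap K X j p q * v q) = (if Suc (fst p) = K then (\<Sum>b<N. X j (snd p) b * v (0, b)) else 0)"
proof -
  have "(\<Sum>q\<in>{..<K} \<times> {..<N}. wrap K X j p q * v q) = (\<Sum>k<K. \<Sum>b<N. wrap K X j p (k, b) * v (k, b))"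
    by (simp add: sum.cartesian_product)
  also have "\<dots> = (\<Sum>k<K. if k = 0 then (if Suc (fst p) = K then (\<Sum>b<N. X j (snd p) b * v (0, b)) else 0) else 0)"
    by (intro sum.cong refl) (auto simp: wrap_def)
  finally show ?thesis using assms by auto
qed

lemma sdom_shft:
  assumes "sdom {..<N} X"
  shows "sdom ({..<K} \<times> {..<N}) (shft K X)"
proof -
  obtain q0 where q0: "q0 < 1" "\<And>j0 v. j0 < m \<Longrightarrow> (\<Sum>j\<in>cls j0. \<Sum>i<N. (cmod (\<Sum>k<N. X j i k * v k))\<^sup>2) \<le> q0 * (\<Sum>k<N. (cmod (v k))\<^sup>2)"
    using assms unfolding sdom_def by blast
  \<comment> \<open>A nonnegative q is needed at the end, where block 0, which the shift never
    reads, is added on the right-hand side.\<close>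
  define q where "q = max q0 (1/2)"
  have q: "q < 1" "q > 0" using q0 by (auto simp: q_def)
  have qb: "(\<Sum>j\<in>cls j0. \<Sum>i<N. (cmod (\<Sum>k<N. X j i k * v k))\<^sup>2) \<le> q * (\<Sum>k<N. (cmod (v k))\<^sup>2)" if "j0 < m" for j0 v
    by (rule order_trans[OF q0(2)[OF that]]) (intro mult_right_mono, auto simp: q_def intro: sum_nonneg)
  show ?thesis unfolding sdom_def
  proof (intro exI[of _ q] conjI allI impI q)
    fix j0 and v :: "nat \<times> nat \<Rightarrow> complex" assume j0: "j0 < m"
    let ?I = "{..<K} \<times> {..<N}"
    let ?V = "\<lambda>k. (\<Sum>b<N. (cmod (v (k, b)))\<^sup>2)"
    have "(\<Sum>j\<in>cls j0. \<Sum>p\<in>?I. (cmod (\<Sum>r\<in>?I. shft K X j p r * v r))\<^sup>2)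
       = (\<Sum>j\<in>cls j0. \<Sum>k<K. \<Sum>a<N. (if Suc k < K then (cmod (\<Sum>b<N. X j a b * v (Suc k, b)))\<^sup>2 else 0))"
      unfolding sum.cartesian_product by (intro sum.cong refl) (auto simp: sum_shft)
    also have "\<dots> = (\<Sum>k<K. if Suc k < K then (\<Sum>j\<in>cls j0. \<Sum>a<N. (cmod (\<Sum>b<N. X j a b * v (Suc k, b)))\<^sup>2) else 0)"
      by (subst sum.swap) (auto intro!: sum.cong)
    also have "\<dots> \<le> (\<Sum>k<K. if Suc k < K then q * ?V (Suc k) else 0)"
      by (intro sum_mono) (use qb[OF j0] in auto)
    also have "\<dots> \<le> q * (\<Sum>k<K. ?V k)"
    proof (cases K)
      case (Suc K')
      have "(\<Sum>k<K. if Suc k < K then q * ?V (Suc k) else 0) = (\<Sum>k<K'. q * ?V (Suc k))"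
        unfolding Suc by simp
      also have "\<dots> \<le> q * (\<Sum>k<K. ?V k)"
        unfolding Suc sum.lessThan_Suc_shift[of ?V] using q
        by (simp add: sum_distrib_left[symmetric] ring_distribs sum_nonneg)
      finally show ?thesis .
    qed simp
    also have "\<dots> = q * (\<Sum>p\<in>?I. (cmod (v p))\<^sup>2)" by (simp add: sum.cartesian_product)
    finally show "(\<Sum>j\<in>cls j0. \<Sum>p\<in>?I. (cmod (\<Sum>r\<in>?I. shft K X j p r * v r))\<^sup>2) \<le> q * (\<Sum>p\<in>?I. (cmod (v p))\<^sup>2)" .
  qed
qed

lemma tscale_Dom:
  assumes "X \<in> Dom N" shows "\<exists>R>1. \<forall>z. cmod z < R \<longrightarrow> tscale z X \<in> Dom N"
proof -
  have *: "is_tup m N (tscale z X)" for z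
    using assms by (auto simp: Dom_def is_tup_def is_mat_def tscale_def mscale_def)
  from assms have "sdom {..<N} X" by (simp add: Dom_def)
  from sdom_scale[OF this] obtain R where "R > 1" "\<And>z. cmod z < R \<Longrightarrow> sdom {..<N} (tscale z X)"
    unfolding tscale_def mscale_def by blast
  then show ?thesis using * by (auto simp: Dom_def)
qed

end

context nc_an
begin

lemma slice_power_series:
  assumes X: "X \<in> Dom N" and ab: "a < N" "b < N" and R: "R > 1" "\<And>z. cmod z < R \<Longrightarrow> tscale z X \<in> Dom N"
  shows "\<exists>c. \<forall>z. cmod z < R \<longrightarrow> (\<lambda>n. c n * z ^ n) sums f N (tscale z X) a b"
proof -
  define g where "g z = f N (tscale z X) a b" for z
  have "g holomorphic_on ball 0 R"
  proof (rule holomorphic_onI)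
    fix z :: complex assume z: "z \<in> ball 0 R"
    have sz: "sdom {..<N} (tscale z X)" using R(2)[of z] z by (simp add: Dom_def)
    obtain D where D: "((\<lambda>h. fI {..<N} (\<lambda>j i k. tscale z X j i k + h * X j i k) a b) has_field_derivative D) (at 0)"
      using fI_diff[OF _ _ sz] ab by blast
    have e: "(\<lambda>j i k. tscale z X j i k + h * X j i k) = tscale (h + z) X" for h
      by (auto simp: tscale_def mscale_def fun_eq_iff algebra_simps)
    have "((\<lambda>h. fI {..<N} (tscale (h + z) X) a b) has_field_derivative D) (at 0)" using D unfolding e .
    then have "((\<lambda>w. fI {..<N} (tscale w X) a b) has_field_derivative D) (at z)"
      using DERIV_shift[of "\<lambda>w. fI {..<N} (tscale w X) a b" D 0 z] by simp
    then have "(g has_field_derivative D) (at z)"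
    proof (rule has_field_derivative_transform_within_open)
      show "open (ball (0::complex) R)" by simp
      show "fI {..<N} (tscale w X) a b = g w" if "w \<in> ball 0 R" for w
        unfolding g_def using R(2)[of w] that ab by (intro fI_nat) auto
    qed (use z in auto)
    then show "g field_differentiable at z within ball 0 R"
      using field_differentiable_at_within field_differentiable_def by blast
  qed
  then have "(\<lambda>n. (deriv ^^ n) g 0 / fact n * (z - 0) ^ n) sums g z" if "z \<in> ball 0 R" for z
    using holomorphic_power_series that by blast
  then have "\<forall>z. cmod z < R \<longrightarrow> (\<lambda>n. (deriv ^^ n) g 0 / fact n * z ^ n) sums g z" by simp
  then show ?thesis by (intro exI[of _ "\<lambda>n. (deriv ^^ n) g 0 / fact n"]) (simp add: g_def[symmetric])
qed

text \<open>The column (1, z, ..., z^(K-1)) turns f(zX) into a polynomial in z whose coefficients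
  depend on t = z^K only. Replacing t by 0 costs O(|z|^K), and so does cutting off the power series
  of f(zX) at order K; two polynomials of degree below K that are this close coincide.\<close>

lemma cyclic_coeff:
  assumes X: "X \<in> Dom N" and ab: "a < N" "b < N" and R: "R > 1" "\<And>z. cmod z < R \<Longrightarrow> tscale z X \<in> Dom N"
    and c: "\<And>z. cmod z < R \<Longrightarrow> (\<lambda>n. c n * z ^ n) sums f N (tscale z X) a b" and K: "k < K"
  shows "fI ({..<K} \<times> {..<N}) (shft K X) (0, a) (k, b) = c k"
proof -
  let ?I = "{..<K} \<times> {..<N}"
  have fin: "finite ?I" "?I \<noteq> {}" using ab K by auto
  have sX: "sdom {..<N} X" using X by (simp add: Dom_def)
  have sE: "sdom ?I (shft K X)" by (rule sdom_shft[OF sX])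
  define C where "C t = (\<lambda>j p q. shft K X j p q + t * wrap K X j p q)" for t :: complex
  obtain \<delta> L where \<delta>: "\<delta> > 0" "\<And>t. cmod t < \<delta> \<Longrightarrow> sdom ?I (C t)"
    "\<And>t p q. cmod t < \<delta> \<Longrightarrow> p \<in> ?I \<Longrightarrow> q \<in> ?I \<Longrightarrow> cmod (fI ?I (C t) p q - fI ?I (shft K X) p q) \<le> L * cmod t"
    using fI_Lip[OF fin sE, of "wrap K X"] unfolding C_def by blast
  define \<alpha> where "\<alpha> t l = fI ?I (C t) (0, a) (l, b)" for t l
  define \<alpha>0 where "\<alpha>0 l = fI ?I (shft K X) (0, a) (l, b)" for l
  have key: "(\<Sum>l<K. \<alpha> (z ^ K) l * z ^ l) = f N (tscale z X) a b" if z: "cmod z < 1" "cmod (z ^ K) < \<delta>" for z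
  proof -
    have Dz: "tscale z X \<in> Dom N" using R z by auto
    let ?S = "\<lambda>(p :: nat \<times> nat) (k :: nat). if snd p = k then z ^ fst p else 0"
    have "(\<Sum>q\<in>?I. fI ?I (C (z ^ K)) (0, a) q * ?S q b) = (\<Sum>l<N. ?S (0, a) l * fI {..<N} (tscale z X) l b)"
    proof (rule intertwine[where S = ?S])
      show "sdom ?I (C (z ^ K))" using \<delta>(2) z by blast
      show "sdom {..<N} (tscale z X)" using Dz by (simp add: Dom_def)
      fix j p k assume *: "j < m" "p \<in> ?I" "k \<in> {..<N}"
      have s1: "(\<Sum>b<N. X j (snd p) b * ?S (l, b) k) = X j (snd p) k * z ^ l" for l
        using * by (simp add: if_distrib[where f = "\<lambda>x. _ * x"] cong: if_cong)
      have "(\<Sum>q\<in>?I. C (z ^ K) j p q * ?S q k) = (\<Sum>q\<in>?I. shft K X j p q * ?S q k) + z ^ K * (\<Sum>q\<in>?I. wrap K X j p q * ?S q k)"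
        by (simp add: C_def ring_distribs sum.distrib sum_distrib_left mult_ac)
      also have "\<dots> = z ^ Suc (fst p) * X j (snd p) k"
        using * unfolding sum_shft[OF *(2)] sum_wrap[OF *(2)] s1 by (auto simp: mult_ac)
      also have "\<dots> = (\<Sum>l<N. ?S p l * tscale z X j l k)"
        using * by (auto simp: tscale_def mscale_def if_distrib[where f = "\<lambda>x. x * _"] cong: if_cong)
      finally show "(\<Sum>q\<in>?I. C (z ^ K) j p q * ?S q k) = (\<Sum>l<N. ?S p l * tscale z X j l k)" .
    qed (use ab K fin in auto)
    moreover have "(\<Sum>q\<in>?I. fI ?I (C (z ^ K)) (0, a) q * ?S q b) = (\<Sum>l<K. \<alpha> (z ^ K) l * z ^ l)"
    proof -
      have "(\<Sum>q\<in>?I. fI ?I (C (z ^ K)) (0, a) q * ?S q b) = (\<Sum>l<K. \<Sum>e<N. fI ?I (C (z ^ K)) (0, a) (l, e) * ?S (l, e) b)"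
        unfolding sum.cartesian_product by (intro sum.cong refl) auto
      also have "\<dots> = (\<Sum>l<K. \<alpha> (z ^ K) l * z ^ l)"
        using ab by (intro sum.cong refl) (simp add: \<alpha>_def if_distrib[where f = "\<lambda>x. _ * x"] cong: if_cong)
      finally show ?thesis .
    qed
    moreover have "(\<Sum>l<N. ?S (0, a) l * fI {..<N} (tscale z X) l b) = f N (tscale z X) a b"
      using ab Dz by (simp add: fI_nat if_distrib[where f = "\<lambda>x. x * _"] cong: if_cong)
    ultimately show ?thesis by simp
  qed
  obtain C2 where C2: "\<And>z. cmod z \<le> 1 \<Longrightarrow> cmod (f N (tscale z X) a b - (\<Sum>n<K. c n * z ^ n)) \<le> C2 * cmod z ^ K"
    using sums_remainder_bound[OF R(1) c] by blast
  have "\<forall>l<K. \<alpha>0 l - c l = 0"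
  proof (rule poly_small_coeffs_zero[where \<epsilon> = "min 1 \<delta>" and C = "real K * L + C2"])
    show "min 1 \<delta> > 0" using \<delta> by simp
    fix z assume z: "0 < cmod z" "cmod z < min 1 \<delta>"
    have zK: "cmod (z ^ K) < \<delta>"
    proof -
      obtain K' where K': "K = Suc K'" using K by (cases K) auto
      have "cmod (z ^ K) \<le> cmod z * 1" unfolding K' power_Suc norm_mult norm_power
        using z by (intro mult_left_mono power_le_one) auto
      then show ?thesis using z by simp
    qed
    have "L \<ge> 0"
    proof (rule ccontr)
      assume "\<not> L \<ge> 0"
      then have "L * cmod z < 0" using z by (simp add: mult_neg_pos)
      moreover have "0 \<le> L * cmod z" by (rule order_trans[OF norm_ge_zero \<delta>(3)[of z "(0,a)" "(0,a)"]]) (use z ab K in auto)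
      ultimately show False by simp
    qed
    have "(\<Sum>k<K. (\<alpha>0 k - c k) * z ^ k) = (\<Sum>k<K. (\<alpha>0 k - \<alpha> (z ^ K) k) * z ^ k) + (f N (tscale z X) a b - (\<Sum>n<K. c n * z ^ n))"
      using key[of z] z zK by (simp add: algebra_simps sum_subtractf sum.distrib)
    also have "cmod \<dots> \<le> (\<Sum>k<K. L * cmod z ^ K) + C2 * cmod z ^ K"
    proof (intro norm_triangle_le add_mono)
      show "cmod (f N (tscale z X) a b - (\<Sum>n<K. c n * z ^ n)) \<le> C2 * cmod z ^ K" using C2 z by auto
      show "cmod (\<Sum>k<K. (\<alpha>0 k - \<alpha> (z ^ K) k) * z ^ k) \<le> (\<Sum>k<K. L * cmod z ^ K)"
      proof (intro order_trans[OF norm_sum] sum_mono)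
        fix k assume "k \<in> {..<K}"
        then have "cmod (\<alpha>0 k - \<alpha> (z ^ K) k) \<le> L * cmod z ^ K"
          using \<delta>(3)[OF zK, of "(0,a)" "(k,b)"] ab K by (auto simp: \<alpha>_def \<alpha>0_def norm_minus_commute norm_power)
        moreover have "cmod z ^ k \<le> 1" using z by (intro power_le_one) auto
        ultimately have "cmod (\<alpha>0 k - \<alpha> (z ^ K) k) * cmod z ^ k \<le> (L * cmod z ^ K) * 1"
          using \<open>L \<ge> 0\<close> by (intro mult_mono) auto
        then show "cmod ((\<alpha>0 k - \<alpha> (z ^ K) k) * z ^ k) \<le> L * cmod z ^ K"
          by (simp add: norm_mult norm_power)
      qed
    qed
    finally show "cmod (\<Sum>k<K. (\<alpha>0 k - c k) * z ^ k) \<le> (real K * L + C2) * cmod z ^ K"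
      by (simp add: algebra_simps)
  qed
  then show ?thesis using K by (simp add: \<alpha>0_def)
qed

end

lemma wpow_Nil: "wpow N X [] = mid N" and wpow_Cons: "wpow N X (j # w) = mmul N (X j) (wpow N X w)"
  by (simp_all add: wpow_def)

lemma wpow_tscale: "wpow N (tscale z X) w i k = z ^ length w * wpow N X w i k"
  by (induction w arbitrary: i k)
     (simp_all add: wpow_Nil wpow_Cons mmul_def tscale_def mscale_def sum_distrib_left mult_ac)

lemma is_mat_wpow: "is_tup m N X \<Longrightarrow> w \<in> all_words m \<Longrightarrow> is_mat N (wpow N X w)"
  by (induction w) (auto simp: wpow_Nil wpow_Cons all_words_def is_tup_def intro!: is_mat_mmul)

lemma words_all: "w \<in> words m l \<longleftrightarrow> w \<in> all_words m \<and> length w = l"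
  by (auto simp: words_def all_words_def)

lemma finite_words [simp]: "finite (words m l)"
  using finite_lists_length_eq[of "{..<m}" l] by (simp add: words_def conj_commute)

lemma words_length: "w \<in> words m l \<Longrightarrow> length w = l"
  by (simp add: words_def)

context nc_an
begin

definition fockset :: "nat \<Rightarrow> nat list set" where
  "fockset K = {w \<in> all_words m. length w < K}"

lemma finite_fockset: "finite (fockset K)"
proof -
  have "fockset K = (\<Union>l<K. words m l)" by (auto simp: fockset_def words_all)
  then show ?thesis by simp
qed

text \<open>Matrix entries of the left creation operators of the full Fock space; restricting both
  indices to \<open>fockset K\<close> truncates them.\<close>

definition crea :: "nat \<Rightarrow> nat list \<Rightarrow> nat list \<Rightarrow> complex" where
  "crea j u w = (if u = j # w then 1 else 0)"

text \<open>The shift built from $X$ and the truncated creation operators on words are intertwined by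
  evaluation of words at $X$, so the homogeneous part at $X$ is a combination of words whose
  coefficients do not depend on $X$.\<close>

lemma fock_formula:
  assumes X: "X \<in> Dom N" and ab: "a < N" "b < N" and K: "0 < K"
    and \<epsilon>: "cmod \<epsilon> \<le> 1" "sdom (fockset K) (\<lambda>j u w. \<epsilon> * crea j u w)" and \<epsilon>X: "tscale \<epsilon> X \<in> Dom N"
  shows "fI ({..<K} \<times> {..<N}) (shft K (tscale \<epsilon> X)) (0, a) (K - 1, b)
    = (\<Sum>w\<in>words m (K - 1). wpow N X w a b * fI (fockset K) (\<lambda>j u w. \<epsilon> * crea j u w) w [])"
proof -
  let ?I = "{..<K} \<times> {..<N}" and ?L = "\<lambda>j u w. \<epsilon> * crea j u w"
  \<comment> \<open>Block k is paired with words of length K - 1 - k, so that one shift step matches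
    one creation step. In the column of the empty word only the last block survives, in the rows of
    block 0 only words of length K - 1; these are the two sides to be compared.\<close>
  let ?S = "\<lambda>(p::nat \<times> nat) (w::nat list). if Suc (fst p + length w) = K then wpow N X w (snd p) b else 0"
  have sX: "sdom {..<N} (tscale \<epsilon> X)" using \<epsilon>X by (simp add: Dom_def)
  have emp: "[] \<in> fockset K" using K by (simp add: fockset_def all_words_def)
  have "(\<Sum>q\<in>?I. fI ?I (shft K (tscale \<epsilon> X)) (0, a) q * ?S q []) = (\<Sum>w\<in>fockset K. ?S (0, a) w * fI (fockset K) ?L w [])"
  proof (rule intertwine[where S = ?S, OF _ finite_fockset sdom_shft[OF sX] \<epsilon>(2)])
    fix j p w assume *: "j < m" "p \<in> ?I" "w \<in> fockset K"
    have "(\<Sum>q\<in>?I. shft K (tscale \<epsilon> X) j p q * ?S q w) =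
      (if Suc (Suc (fst p + length w)) = K then \<epsilon> * wpow N X (j # w) (snd p) b else 0)"
      unfolding sum_shft[OF *(2)]
      by (auto simp: wpow_Cons mmul_def tscale_def mscale_def sum_distrib_left mult_ac)
    also have "\<dots> = (\<Sum>u\<in>fockset K. if u = j # w then ?S p u * \<epsilon> else 0)"
    proof -
      have "j # w \<in> fockset K" if "Suc (Suc (fst p + length w)) = K"
        using that * by (auto simp: fockset_def all_words_def)
      then show ?thesis using finite_fockset by (simp add: mult.commute)
    qed
    also have "\<dots> = (\<Sum>u\<in>fockset K. ?S p u * ?L j u w)"
      by (intro sum.cong refl) (auto simp: crea_def)
    finally show "(\<Sum>q\<in>?I. shft K (tscale \<epsilon> X) j p q * ?S q w) = (\<Sum>u\<in>fockset K. ?S p u * ?L j u w)" .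
  qed (use ab K emp in auto)
  moreover have "(\<Sum>q\<in>?I. fI ?I (shft K (tscale \<epsilon> X)) (0, a) q * ?S q []) = fI ?I (shft K (tscale \<epsilon> X)) (0, a) (K - 1, b)"
  proof -
    have "(\<Sum>q\<in>?I. fI ?I (shft K (tscale \<epsilon> X)) (0, a) q * ?S q []) = (\<Sum>q\<in>?I. if q = (K - 1, b) then fI ?I (shft K (tscale \<epsilon> X)) (0, a) (K - 1, b) else 0)"
      using ab K by (intro sum.cong refl) (auto simp: wpow_Nil mid_def)
    then show ?thesis using ab K by simp
  qed
  moreover have "(\<Sum>w\<in>fockset K. ?S (0, a) w * fI (fockset K) ?L w []) = (\<Sum>w\<in>words m (K - 1). wpow N X w a b * fI (fockset K) ?L w [])"
  proof (rule sum.mono_neutral_cong_right[OF finite_fockset])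
    show "words m (K - 1) \<subseteq> fockset K" using K by (auto simp: words_all fockset_def)
    show "\<forall>i\<in>fockset K - words m (K - 1). ?S (0, a) i * fI (fockset K) ?L i [] = 0"
      by (auto simp: words_all fockset_def)
    show "?S (0, a) x * fI (fockset K) ?L x [] = wpow N X x a b * fI (fockset K) ?L x []" if "x \<in> words m (K - 1)" for x
      using that K by (auto simp: words_all)
  qed
  ultimately show ?thesis by simp
qed

text \<open>The creation operators need not lie in the domain, only small multiples of them do. They
  and X are therefore scaled by the same factor, which homogeneity of degree l removes
  again.\<close>

theorem taylor_taylor_exists:
  "\<exists>c. (\<forall>w. w \<notin> all_words m \<longrightarrow> c w = 0) \<and>
      (\<forall>N>0. \<forall>X\<in>Dom N. \<forall>i k. (\<lambda>l. \<Sum>w\<in>words m l. c w * wpow N X w i k) sums (f N X i k))"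
proof -
  have "\<forall>K. \<exists>r. 0 < r \<and> r < 1 \<and> sdom (fockset K) (\<lambda>j u w. complex_of_real r * crea j u w)"
  proof
    fix K
    obtain \<epsilon> where "\<epsilon> > 0" "\<And>t. cmod t < \<epsilon> \<Longrightarrow> sdom (fockset K) (\<lambda>j u w. t * crea j u w)"
      using sdom_perturb[OF finite_fockset sdom_zero, of K crea] by auto
    then show "\<exists>r. 0 < r \<and> r < 1 \<and> sdom (fockset K) (\<lambda>j u w. complex_of_real r * crea j u w)"
      by (intro exI[of _ "min (1/2) (\<epsilon>/2)"]) auto
  qed
  then obtain r where r: "\<And>K. 0 < r K" "\<And>K. r K < 1" "\<And>K. sdom (fockset K) (\<lambda>j u w. complex_of_real (r K) * crea j u w)"
    by metis
  \<comment> \<open>Words of length l live in the Fock space truncated below l + 1, hence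
    \<open>Suc\<close>. The division undoes the scaling by r.\<close>
  define c where "c w = (if w \<in> all_words m then fI (fockset (Suc (length w))) (\<lambda>j u v. complex_of_real (r (Suc (length w))) * crea j u v) w []
      / complex_of_real (r (Suc (length w))) ^ length w else 0)" for w
  have main: "(\<lambda>l. \<Sum>w\<in>words m l. c w * wpow N X w a b) sums (f N X a b)"
    if X: "X \<in> Dom N" and ab: "a < N" "b < N" for N X a b
  proof -
    obtain R where R: "R > 1" "\<And>z. cmod z < R \<Longrightarrow> tscale z X \<in> Dom N" using tscale_Dom[OF X] by blast
    obtain p where p: "\<And>z. cmod z < R \<Longrightarrow> (\<lambda>n. p n * z ^ n) sums f N (tscale z X) a b"
      using slice_power_series[OF X ab R] by blast
    have "p l = (\<Sum>w\<in>words m l. c w * wpow N X w a b)" for l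
    proof -
      define \<epsilon> where "\<epsilon> = complex_of_real (r (Suc l))"
      have \<epsilon>: "cmod \<epsilon> < 1" "\<epsilon> \<noteq> 0" "cmod \<epsilon> \<le> 1" using r(1,2)[of "Suc l"] by (auto simp: \<epsilon>_def)
      have \<epsilon>X: "tscale \<epsilon> X \<in> Dom N" using R \<epsilon> by auto
      obtain R' where R': "R' > 1" "\<And>z. cmod z < R' \<Longrightarrow> tscale z (tscale \<epsilon> X) \<in> Dom N" using tscale_Dom[OF \<epsilon>X] by blast
      obtain p' where p': "\<And>z. cmod z < R' \<Longrightarrow> (\<lambda>n. p' n * z ^ n) sums f N (tscale z (tscale \<epsilon> X)) a b"
        using slice_power_series[OF \<epsilon>X ab R'] by blast
      have "(\<lambda>n. (p n * \<epsilon> ^ n) * z ^ n) sums f N (tscale z (tscale \<epsilon> X)) a b" if "cmod z < R" for z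
      proof -
        have "cmod (z * \<epsilon>) \<le> cmod z * 1" unfolding norm_mult using \<epsilon> by (intro mult_left_mono) auto
        then have "(\<lambda>n. p n * (z * \<epsilon>) ^ n) sums f N (tscale (z * \<epsilon>) X) a b" using p that by auto
        then show ?thesis by (simp add: tscale_def mscale_def mult_ac power_mult_distrib)
      qed
      then have c1: "fI ({..<Suc l} \<times> {..<N}) (shft (Suc l) (tscale \<epsilon> X)) (0, a) (l, b) = p l * \<epsilon> ^ l"
        using cyclic_coeff[OF \<epsilon>X ab _ _ , of "min R R'" "\<lambda>n. p n * \<epsilon> ^ n" l "Suc l"] R R' by auto
      have "fI ({..<Suc l} \<times> {..<N}) (shft (Suc l) (tscale \<epsilon> X)) (0, a) (l, b)
        = (\<Sum>w\<in>words m l. wpow N X w a b * fI (fockset (Suc l)) (\<lambda>j u w. \<epsilon> * crea j u w) w [])"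
        using fock_formula[OF X ab _ \<epsilon>(3) _ \<epsilon>X, of "Suc l"] r(3)[of "Suc l"] by (simp add: \<epsilon>_def)
      also have "\<dots> = (\<Sum>w\<in>words m l. wpow N X w a b * (c w * \<epsilon> ^ l))"
        using \<epsilon>(2) by (intro sum.cong refl) (auto simp: c_def words_all \<epsilon>_def)
      also have "\<dots> = (\<Sum>w\<in>words m l. c w * wpow N X w a b) * \<epsilon> ^ l"
        unfolding sum_distrib_right by (intro sum.cong refl) (simp add: mult_ac)
      finally show ?thesis using c1 \<epsilon>(2) by simp
    qed
    moreover have "tscale 1 X = X" by (simp add: tscale_def mscale_def)
    ultimately show ?thesis using p[of 1] R by simp
  qed
  have out: "(\<lambda>l. \<Sum>w\<in>words m l. c w * wpow N X w i k) sums (f N X i k)"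
    if "N > 0" "X \<in> Dom N" "\<not> (i < N \<and> k < N)" for N X i k
  proof -
    have "f N X i k = 0" using nc that unfolding nc_function_def is_mat_def by (metis not_le)
    moreover have "wpow N X w i k = 0" if "w \<in> words m l" for w l
      using is_mat_wpow[of m N X w] that \<open>X \<in> Dom N\<close> \<open>\<not> (i < N \<and> k < N)\<close>
      unfolding words_all Dom_def is_mat_def by (auto simp: not_less)
    ultimately show ?thesis by (simp add: sum.neutral)
  qed
  show ?thesis
  proof (intro exI[of _ c] conjI allI ballI impI)
    show "c w = 0" if "w \<notin> all_words m" for w using that by (simp add: c_def)
    fix N X i k assume "N > (0::nat)" "X \<in> Dom N"
    then show "(\<lambda>l. \<Sum>w\<in>words m l. c w * wpow N X w i k) sums (f N X i k)"
      using main out by blast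
  qed
qed

end

context nc_dom
begin

text \<open>Words are separated by weighted shifts along their letters.\<close>

lemma wpow_path:
  assumes "r + length v \<le> n"
    and X: "\<And>j i k. X j i k = (if k = Suc i \<and> i < length w \<and> w ! i = j then \<epsilon> else 0)" and n: "n = length w"
  shows "wpow (Suc n) X v r (r + length v) = (if take (length v) (drop r w) = v then \<epsilon> ^ length v else 0)"
  using assms(1)
proof (induction v arbitrary: r)
  case Nil
  then show ?case by (simp add: wpow_Nil mid_def)
next
  case (Cons j v)
  have r: "r < length w" using Cons.prems n by simp
  have "wpow (Suc n) X (j # v) r (r + length (j # v)) = (\<Sum>l<Suc n. if l = Suc r then (if w ! r = j then \<epsilon> else 0) * wpow (Suc n) X v (Suc r) (Suc r + length v) else 0)"
    unfolding wpow_Cons mmul_def X using r by (intro sum.cong refl) auto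
  also have "\<dots> = (if w ! r = j then \<epsilon> else 0) * wpow (Suc n) X v (Suc r) (Suc r + length v)"
    using r n by (subst sum.delta) auto
  also have "\<dots> = (if w ! r = j then \<epsilon> else 0) * (if take (length v) (drop (Suc r) w) = v then \<epsilon> ^ length v else 0)"
    using Cons.prems by (subst Cons.IH) auto
  finally show ?case using r by (auto simp: Cons_nth_drop_Suc[symmetric])
qed

text \<open>Along the path tuple of w the entry (0, n) of a word of length n is 1 for w and 0 for
  every other word. Scaling the tuple by t separates the degrees, because a power series that
  vanishes near 0 has zero coefficients.\<close>

lemma homogeneous_zero:
  assumes z: "\<And>N X. N > 0 \<Longrightarrow> X \<in> Dom N \<Longrightarrow> \<forall>i k. (\<lambda>l. \<Sum>w\<in>words m l. d w * wpow N X w i k) sums 0"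
    and w: "w \<in> all_words m"
  shows "d w = 0"
proof -
  define n where "n = length w"
  define Y :: ctup where "Y = (\<lambda>j i k. if k = Suc i \<and> i < length w \<and> w ! i = j then 1 else 0)"
  obtain \<epsilon>0 where \<epsilon>0: "\<epsilon>0 > 0" "\<And>t. cmod t < \<epsilon>0 \<Longrightarrow> sdom {..<Suc n} (\<lambda>j i k. t * Y j i k)"
    using sdom_perturb[OF finite_lessThan sdom_zero, of "Suc n" Y] by auto
  have D: "tscale t Y \<in> Dom (Suc n)" if "cmod t < \<epsilon>0" for t
  proof -
    have "w ! i < m" if "i < length w" for i using w that by (auto simp: all_words_def subset_iff)
    then have "is_tup m (Suc n) (tscale t Y)"
      by (fastforce simp: is_tup_def is_mat_def tscale_def mscale_def Y_def n_def fun_eq_iff)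
    then show ?thesis using \<epsilon>0(2)[OF that] by (simp add: Dom_def tscale_def mscale_def)
  qed
  define q where "q l = (\<Sum>v\<in>words m l. d v * wpow (Suc n) Y v 0 n)" for l
  have s: "(\<lambda>l. q l * t ^ l) sums 0" if "cmod t < \<epsilon>0" for t
  proof -
    have "(\<lambda>l. \<Sum>v\<in>words m l. d v * wpow (Suc n) (tscale t Y) v 0 n) sums 0" using z[OF _ D[OF that]] by blast
    moreover have "(\<Sum>v\<in>words m l. d v * wpow (Suc n) (tscale t Y) v 0 n) = q l * t ^ l" for l
      unfolding q_def sum_distrib_right wpow_tscale by (intro sum.cong refl) (simp add: words_length)
    ultimately show ?thesis by simp
  qed
  have "q n = 0"
  proof (rule ccontr)
    assume qn: "q n \<noteq> 0"
    show False
    \<comment> \<open>\<open>powser_0_nonzero\<close> isolates a zero by a coefficient of positive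
      degree, so degree 0 is read off at t = 0.\<close>
    proof (cases "n = 0")
      case True
      have "(\<lambda>l. q l * 0 ^ l) sums 0" using s[of 0] \<epsilon>0 by simp
      then show False using qn True by (simp add: sums_iff)
    next
      case False
      have "\<And>x. norm (x - 0) < \<epsilon>0 \<Longrightarrow> (\<lambda>l. q l * (x - 0) ^ l) sums 0" using s by simp
      from powser_0_nonzero[OF \<epsilon>0(1) this refl qn] False
      obtain s where s0: "s > 0" "\<And>z. z \<in> cball (0::complex) s - {0} \<Longrightarrow> False" by auto
      have "complex_of_real s \<in> cball 0 s - {0}" using s0 by simp
      with s0 show False by blast
    qed
  qed
  moreover have "q n = (\<Sum>v\<in>words m n. if v = w then d w else 0)"
    unfolding q_def
  proof (intro sum.cong refl)
    fix v assume v: "v \<in> words m n"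
    then show "d v * wpow (Suc n) Y v 0 n = (if v = w then d w else 0)"
      using wpow_path[of 0 v n Y w 1] by (auto simp: words_length n_def Y_def)
  qed
  moreover have "w \<in> words m n" using w by (simp add: words_all n_def)
  ultimately show ?thesis by simp
qed

lemma taylor_taylor_unique:
  assumes "\<forall>w. w \<notin> all_words m \<longrightarrow> c w = 0" "\<forall>w. w \<notin> all_words m \<longrightarrow> d w = 0"
    "\<forall>N>0. \<forall>X\<in>Dom N. \<forall>i k. (\<lambda>l. \<Sum>w\<in>words m l. c w * wpow N X w i k) sums (f N X i k)"
    "\<forall>N>0. \<forall>X\<in>Dom N. \<forall>i k. (\<lambda>l. \<Sum>w\<in>words m l. d w * wpow N X w i k) sums (f N X i k)"
  shows "c = d"
proof
  fix w
  have "c w - d w = 0" if "w \<in> all_words m"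
  proof (rule homogeneous_zero[OF _ that])
    fix N X assume "N > (0::nat)" "X \<in> Dom N"
    then have "(\<lambda>l. (\<Sum>w\<in>words m l. c w * wpow N X w i k) - (\<Sum>w\<in>words m l. d w * wpow N X w i k)) sums (f N X i k - f N X i k)" for i k
      using assms(3,4) by (intro sums_diff) auto
    then show "\<forall>i k. (\<lambda>l. \<Sum>w\<in>words m l. (c w - d w) * wpow N X w i k) sums 0"
      by (simp add: left_diff_distrib sum_subtractf)
  qed
  then show "c w = d w" using assms(1,2) by (cases "w \<in> all_words m") auto
qed

lemma tt_coeff_eqI:
  assumes "\<forall>w. w \<notin> all_words m \<longrightarrow> c w = 0"
    "\<And>N X i k. N > 0 \<Longrightarrow> X \<in> Dom N \<Longrightarrow> (\<lambda>l. \<Sum>w\<in>words m l. c w * wpow N X w i k) sums (f N X i k)"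
  shows "tt_coeff m Dom f = c"
  unfolding tt_coeff_def
proof (rule the_equality)
  show *: "(\<forall>w. w \<notin> all_words m \<longrightarrow> c w = 0) \<and>
      (\<forall>N>0. \<forall>X\<in>Dom N. \<forall>i k. (\<lambda>l. \<Sum>w\<in>words m l. c w * wpow N X w i k) sums (f N X i k))"
    using assms by blast
  show "d = c" if "(\<forall>w. w \<notin> all_words m \<longrightarrow> d w = 0) \<and>
      (\<forall>N>0. \<forall>X\<in>Dom N. \<forall>i k. (\<lambda>l. \<Sum>w\<in>words m l. d w * wpow N X w i k) sums (f N X i k))" for d
    using taylor_taylor_unique[of d c f] that * by (elim conjE)
qed

lemma tt_coeff_props:
  assumes "f \<in> A_class m Dom"
  shows "w \<notin> all_words m \<Longrightarrow> tt_coeff m Dom f w = 0"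
    "N > 0 \<Longrightarrow> X \<in> Dom N \<Longrightarrow> (\<lambda>l. \<Sum>w\<in>words m l. tt_coeff m Dom f w * wpow N X w i k) sums (f N X i k)"
proof -
  interpret nc_an m cl f
    by unfold_locales (use assms in \<open>auto simp: A_class_def\<close>)
  obtain c where c: "\<forall>w. w \<notin> all_words m \<longrightarrow> c w = 0"
      "\<forall>N>0. \<forall>X\<in>Dom N. \<forall>i k. (\<lambda>l. \<Sum>w\<in>words m l. c w * wpow N X w i k) sums (f N X i k)"
    using taylor_taylor_exists by blast
  then have "tt_coeff m Dom f = c" by (intro tt_coeff_eqI) auto
  then show "w \<notin> all_words m \<Longrightarrow> tt_coeff m Dom f w = 0"
    "N > 0 \<Longrightarrow> X \<in> Dom N \<Longrightarrow> (\<lambda>l. \<Sum>w\<in>words m l. tt_coeff m Dom f w * wpow N X w i k) sums (f N X i k)"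
    using c by auto
qed

end

section \<open>Traces and contractions\<close>

lemma is_mat_madj [simp]: "is_mat N (madj A) \<longleftrightarrow> is_mat N A"
  by (auto simp: is_mat_def madj_def)

lemma mtrace_commute: "mtrace N (mmul N A B) = mtrace N (mmul N B A)"
proof -
  have "(\<Sum>i<N. \<Sum>l<N. A i l * B l i) = (\<Sum>l<N. \<Sum>i<N. A i l * B l i)" by (rule sum.swap)
  then show ?thesis by (simp add: mtrace_def mmul_def mult.commute)
qed

lemma ntr_commute: "ntr N (mmul N A B) = ntr N (mmul N B A)"
  by (simp add: ntr_def mtrace_commute)

lemma madj_mmul: "madj (mmul N A B) = mmul N (madj B) (madj A)"
  by (simp add: madj_def mmul_def fun_eq_iff mult.commute)

lemma madj_madj [simp]: "madj (madj A) = A"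
  by (simp add: madj_def)

lemma madj_mid [simp]: "madj (mid N) = mid N"
  by (auto simp: madj_def mid_def fun_eq_iff)

lemma ntr_madj: "ntr N (madj A) = cnj (ntr N A)"
  by (simp add: ntr_def mtrace_def madj_def)

lemma ntr_mid: "N > 0 \<Longrightarrow> ntr N (mid N) = 1"
  by (simp add: ntr_def mtrace_def mid_def)

text \<open>Operator norm at most 1, expressed by quadratic forms instead of the supremum in
  \<open>mnorm\<close>.\<close>

definition contr :: "nat \<Rightarrow> cmat \<Rightarrow> bool" where
  "contr N A \<longleftrightarrow> (\<forall>v. (\<Sum>i<N. (cmod (\<Sum>k<N. A i k * v k))\<^sup>2) \<le> (\<Sum>k<N. (cmod (v k))\<^sup>2))"

lemma mmul_vec: "(\<Sum>k<N. mmul N A B i k * v k) = (\<Sum>l<N. A i l * (\<Sum>k<N. B l k * v k))"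
proof -
  have "(\<Sum>k<N. mmul N A B i k * v k) = (\<Sum>k<N. \<Sum>l<N. A i l * (B l k * v k))"
    by (simp add: mmul_def sum_distrib_right mult.assoc)
  also have "\<dots> = (\<Sum>l<N. \<Sum>k<N. A i l * (B l k * v k))" by (rule sum.swap)
  finally show ?thesis by (simp add: sum_distrib_left)
qed

lemma contr_mmul: "contr N A \<Longrightarrow> contr N B \<Longrightarrow> contr N (mmul N A B)"
  unfolding contr_def mmul_vec by (meson order_trans)

lemma contr_mid: "contr N (mid N)"
proof -
  have "(\<Sum>k<N. mid N i k * v k) = (if i < N then v i else 0)" for i and v :: "nat \<Rightarrow> complex"
  proof -
    have "(\<Sum>k<N. mid N i k * v k) = (\<Sum>k<N. if k = i then v i else 0)"
      by (intro sum.cong refl) (auto simp: mid_def)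
    then show ?thesis by simp
  qed
  then show ?thesis by (simp add: contr_def)
qed

lemma contr_zero: "contr N (\<lambda>i k. 0)"
  by (simp add: contr_def sum_nonneg)

lemma complex_Cauchy_Schwarz: "(cmod (\<Sum>k\<in>I. a k * b k))\<^sup>2 \<le> (\<Sum>k\<in>I. (cmod (a k))\<^sup>2) * (\<Sum>k\<in>I. (cmod (b k))\<^sup>2)"
proof -
  have "cmod (\<Sum>k\<in>I. a k * b k) \<le> (\<Sum>k\<in>I. cmod (a k) * cmod (b k))"
    by (rule order_trans[OF norm_sum]) (simp add: norm_mult)
  then have "(cmod (\<Sum>k\<in>I. a k * b k))\<^sup>2 \<le> (\<Sum>k\<in>I. cmod (a k) * cmod (b k))\<^sup>2"
    by (intro power_mono) auto
  also have "\<dots> \<le> (\<Sum>k\<in>I. (cmod (a k))\<^sup>2) * (\<Sum>k\<in>I. (cmod (b k))\<^sup>2)"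
    by (rule Cauchy_Schwarz_ineq_sum)
  finally show ?thesis .
qed

text \<open>With y = A^* v the squared norm of y equals the inner product of v with A y, so |y|^2 <=
  |v| |A y| <= |v| |y|.\<close>

lemma contr_madj:
  assumes "contr N A" shows "contr N (madj A)"
  unfolding contr_def
proof
  fix v
  define y where "y i = (\<Sum>k<N. madj A i k * v k)" for i
  define S where "S = (\<Sum>i<N. (cmod (y i))\<^sup>2)"
  have cy: "cnj (y i) = (\<Sum>k<N. A k i * cnj (v k))" for i by (simp add: y_def madj_def)
  have S0: "S \<ge> 0" by (simp add: S_def sum_nonneg)
  have "complex_of_real S = (\<Sum>i<N. cnj (y i) * y i)"
    by (simp only: S_def of_real_sum complex_norm_square mult.commute)
  also have "\<dots> = (\<Sum>i<N. \<Sum>k<N. cnj (v k) * (A k i * y i))"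
    by (simp add: cy sum_distrib_left sum_distrib_right mult_ac)
  also have "\<dots> = (\<Sum>k<N. cnj (v k) * (\<Sum>i<N. A k i * y i))"
    by (subst sum.swap) (simp add: sum_distrib_left)
  finally have "S = cmod (\<Sum>k<N. cnj (v k) * (\<Sum>i<N. A k i * y i))"
    using S0 by (metis abs_of_nonneg norm_of_real)
  then have "S\<^sup>2 \<le> (\<Sum>k<N. (cmod (cnj (v k)))\<^sup>2) * (\<Sum>k<N. (cmod (\<Sum>i<N. A k i * y i))\<^sup>2)"
    using complex_Cauchy_Schwarz[of "\<lambda>k. cnj (v k)" "\<lambda>k. \<Sum>i<N. A k i * y i" "{..<N}"] by (simp only:)
  also have "\<dots> \<le> (\<Sum>k<N. (cmod (v k))\<^sup>2) * S"
    using assms by (auto simp: contr_def S_def intro!: mult_left_mono sum_nonneg)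
  finally have "S * S \<le> (\<Sum>k<N. (cmod (v k))\<^sup>2) * S" by (simp add: power2_eq_square)
  then have "S \<le> (\<Sum>k<N. (cmod (v k))\<^sup>2)"
    using S0 by (cases "S = 0") (auto simp: sum_nonneg mult_le_cancel_right)
  then show "(\<Sum>i<N. (cmod (\<Sum>k<N. madj A i k * v k))\<^sup>2) \<le> (\<Sum>k<N. (cmod (v k))\<^sup>2)"
    by (simp add: S_def y_def)
qed

lemma contr_col:
  assumes "contr N A" "k < N" shows "(\<Sum>i<N. (cmod (A i k))\<^sup>2) \<le> 1"
proof -
  let ?v = "\<lambda>l. if l = k then (1::complex) else 0"
  have "(\<Sum>l<N. A i l * ?v l) = A i k" for i
    using assms(2) by (simp add: if_distrib cong: if_cong)
  moreover have "(\<Sum>l<N. (cmod (?v l))\<^sup>2) = 1"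
    using assms(2) by (simp add: if_distrib[where f = "\<lambda>x. (cmod x)\<^sup>2"] cong: if_cong)
  moreover have "(\<Sum>i<N. (cmod (\<Sum>l<N. A i l * ?v l))\<^sup>2) \<le> (\<Sum>l<N. (cmod (?v l))\<^sup>2)"
    using assms(1) unfolding contr_def by (rule spec)
  ultimately show ?thesis by simp
qed

lemma contr_entry:
  assumes "contr N A" "i < N" "k < N" shows "cmod (A i k) \<le> 1"
proof -
  have "(cmod (A i k))\<^sup>2 \<le> (\<Sum>i<N. (cmod (A i k))\<^sup>2)"
    using assms by (intro member_le_sum) auto
  then have "(cmod (A i k))\<^sup>2 \<le> 1\<^sup>2" using contr_col[OF assms(1,3)] by simp
  then show ?thesis by (rule power2_le_imp_le) simp
qed

lemma contr_ntr: assumes "contr N A" shows "cmod (ntr N A) \<le> 1"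
proof (cases "N = 0")
  case False
  have "cmod (mtrace N A) \<le> (\<Sum>i<N. 1)"
    unfolding mtrace_def by (intro order_trans[OF norm_sum] sum_mono contr_entry[OF assms]) auto
  then show ?thesis using False by (simp add: ntr_def norm_divide)
qed (simp add: ntr_def)

section \<open>Loop equations for trace moments\<close>

text \<open>The letter $(j, b)$ stands for $X_j$, or for $X_j^*$ if $b$ holds.\<close>

type_synonym letter = "nat \<times> bool"

definition lt :: "ctup \<Rightarrow> letter \<Rightarrow> cmat" where
  "lt X x = (if snd x then madj (X (fst x)) else X (fst x))"

primrec W :: "nat \<Rightarrow> ctup \<Rightarrow> letter list \<Rightarrow> cmat" where
  "W N X [] = mid N"
| "W N X (x # w) = mmul N (lt X x) (W N X w)"

lemma is_mat_lt: "is_tup m N X \<Longrightarrow> is_mat N (lt X x)"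
  unfolding lt_def is_tup_def by (cases "fst x < m") (auto simp: is_mat_def madj_def)

lemma is_mat_W: "is_tup m N X \<Longrightarrow> is_mat N (W N X w)"
  by (induction w) (auto intro: is_mat_mmul is_mat_lt)

lemma W_append: "is_tup m N X \<Longrightarrow> W N X (p @ q) = mmul N (W N X p) (W N X q)"
  by (induction p) (simp_all add: mmul_mid_left is_mat_W mmul_assoc)

lemma W_single: "is_tup m N X \<Longrightarrow> W N X [x] = lt X x"
  by (simp add: mmul_mid_right is_mat_lt)

lemma W_snoc: "is_tup m N X \<Longrightarrow> W N X (p @ [x]) = mmul N (W N X p) (lt X x)"
  by (simp only: W_append W_single)

definition adjw :: "letter list \<Rightarrow> letter list" where
  "adjw w = rev (map (\<lambda>x. (fst x, \<not> snd x)) w)"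

lemma W_adjw: "is_tup m N X \<Longrightarrow> W N X (adjw w) = madj (W N X w)"
proof (induction w)
  case (Cons x w)
  have "W N X (adjw (x # w)) = mmul N (W N X (adjw w)) (W N X [(fst x, \<not> snd x)])"
    using Cons.prems by (simp only: adjw_def list.map rev.simps W_append)
  also have "W N X [(fst x, \<not> snd x)] = madj (lt X x)"
    using Cons.prems by (simp only: W_single) (simp add: lt_def)
  finally show ?case using Cons by (simp add: madj_mmul)
qed (simp add: adjw_def)

text \<open>A product of normalised traces. Products are needed because the loop equation for a
  single trace cuts it into two.\<close>

primrec T :: "nat \<Rightarrow> ctup \<Rightarrow> letter list list \<Rightarrow> complex" where
  "T N X [] = 1"
| "T N X (w # ws) = ntr N (W N X w) * T N X ws"

text \<open>Splitting terms of the loop equation: summing the first-order change of the word $p\,w$ over a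
  basis of the matrix units cuts its trace in two at every letter of $w$ that matches.\<close>

fun sd :: "nat \<Rightarrow> ctup \<Rightarrow> nat \<Rightarrow> nat \<Rightarrow> letter list \<Rightarrow> letter list \<Rightarrow> complex" where
  "sd N X j i p [] = 0"
| "sd N X j i p (x # w) =
     (if x = (j, False) then ntr N (W N X p) * ntr N (W N X ((i, False) # w)) else 0)
   - (if x = (i, True) then ntr N (W N X (p @ [(j, True)])) * ntr N (W N X w) else 0)
   + sd N X j i (p @ [x]) w"

text \<open>First-order change of a letter under $X \mapsto X + s\,(u v^*) X$, where the tuple is read
  as one column of length $mN$ and $u$, $v$ are indexed accordingly; for adjoint letters the sign
  accounts for the conjugate of the imaginary parameter $s$.\<close>

definition dlt :: "nat \<Rightarrow> nat \<Rightarrow> (nat \<Rightarrow> complex) \<Rightarrow> (nat \<Rightarrow> complex) \<Rightarrow> ctup \<Rightarrow> letter \<Rightarrow> cmat" where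
  "dlt m N u v X x = (\<lambda>i k. if fst x < m \<and> i < N \<and> k < N then
     (if snd x then - (\<Sum>l<m*N. u l * cnj (X (l div N) (l mod N) i)) * cnj (v (fst x * N + k))
      else u (fst x * N + i) * (\<Sum>l<m*N. cnj (v l) * X (l div N) (l mod N) k)) else 0)"

primrec dW :: "nat \<Rightarrow> nat \<Rightarrow> (nat \<Rightarrow> complex) \<Rightarrow> (nat \<Rightarrow> complex) \<Rightarrow> ctup \<Rightarrow> letter list \<Rightarrow> cmat" where
  "dW m N u v X [] = mzero"
| "dW m N u v X (x # w) = madd (mmul N (dlt m N u v X x) (W N X w)) (mmul N (lt X x) (dW m N u v X w))"

primrec dT :: "nat \<Rightarrow> nat \<Rightarrow> (nat \<Rightarrow> complex) \<Rightarrow> (nat \<Rightarrow> complex) \<Rightarrow> ctup \<Rightarrow> letter list list \<Rightarrow> complex" where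
  "dT m N u v X [] = 0"
| "dT m N u v X (w # ws) = ntr N (dW m N u v X w) * T N X ws + ntr N (W N X w) * dT m N u v X ws"

text \<open>Polarisation: this identity holds for forms that are linear in the first and antilinear in the
  second argument, and it reduces their vanishing to the diagonal.\<close>

definition pol :: "((nat \<Rightarrow> complex) \<Rightarrow> (nat \<Rightarrow> complex) \<Rightarrow> complex) \<Rightarrow> bool" where
  "pol Q \<longleftrightarrow> (\<forall>u w. (\<Sum>k<4::nat. \<i> ^ k * Q (\<lambda>a. u a + \<i> ^ k * w a) (\<lambda>a. u a + \<i> ^ k * w a)) = 4 * Q u w)"

lemma pol_add: "pol Q \<Longrightarrow> pol R \<Longrightarrow> pol (\<lambda>u v. Q u v + R u v)"
  by (simp add: pol_def ring_distribs sum.distrib)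

lemma pol_cmult: "pol Q \<Longrightarrow> pol (\<lambda>u v. c * Q u v)"
  unfolding pol_def by (simp add: mult.left_commute[of _ c] sum_distrib_left[symmetric])

lemma pol_cmult2: "pol Q \<Longrightarrow> pol (\<lambda>u v. Q u v * c)"
  using pol_cmult[of Q c] by (simp add: mult.commute)

lemma pol_zero: "pol (\<lambda>u v. 0)"
  by (simp add: pol_def)

lemma pol_sum: "(\<And>x. x \<in> I \<Longrightarrow> pol (Q x)) \<Longrightarrow> pol (\<lambda>u v. \<Sum>x\<in>I. Q x u v)"
  by (induction I rule: infinite_finite_induct) (auto intro: pol_add pol_zero)

lemma sum4: "(\<Sum>k<4::nat. f k) = f 0 + f 1 + f 2 + f (3::nat)" for f :: "nat \<Rightarrow> complex"
  by (simp add: numeral_eq_Suc)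

lemma pol_basic: "pol (\<lambda>u v. u a * cnj (v b))"
  unfolding pol_def sum4
  by (simp add: power2_eq_square power3_eq_cube algebra_simps)

text \<open>For an adjoint letter \<open>dlt\<close> has u inside the sum and v outside. For u = v
  this is minus the conjugate transpose of the plain letter, and placing u and v in this way keeps
  the expression linear in u and antilinear in v.\<close>

lemma pol_dlt: "pol (\<lambda>u v. dlt m N u v X x i k)"
proof -
  have "pol (\<lambda>u v. \<Sum>l<m*N. (u l * cnj (v (fst x * N + k))) * - cnj (X (l div N) (l mod N) i))"
    by (intro pol_sum pol_cmult2 pol_basic)
  moreover have "pol (\<lambda>u v. \<Sum>l<m*N. (u (fst x * N + i) * cnj (v l)) * X (l div N) (l mod N) k)"
    by (intro pol_sum pol_cmult2 pol_basic)
  moreover have "pol (\<lambda>u v. dlt m N u v X x i k)" if "\<not> (fst x < m \<and> i < N \<and> k < N)"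
    using that by (simp only: dlt_def if_False pol_zero)
  ultimately show ?thesis
    by (cases "fst x < m \<and> i < N \<and> k < N"; cases "snd x")
       (simp_all add: dlt_def sum_distrib_left sum_distrib_right sum_negf mult_ac pol_zero)
qed

lemma pol_dW: "pol (\<lambda>u v. dW m N u v X w i k)"
proof (induction w arbitrary: i k)
  case (Cons x w)
  have "pol (\<lambda>u v. (\<Sum>l<N. dlt m N u v X x i l * W N X w l k) + (\<Sum>l<N. lt X x i l * dW m N u v X w l k))"
    by (intro pol_add pol_sum pol_cmult pol_cmult2 pol_dlt Cons)
  then show ?case by (simp add: madd_def mmul_def)
qed (simp add: mzero_def pol_zero)

lemma pol_dT: "pol (\<lambda>u v. dT m N u v X ws)"
proof (induction ws)
  case (Cons w ws)
  have "pol (\<lambda>u v. (\<Sum>i<N. dW m N u v X w i i) * inverse (of_nat N) * T N X ws + ntr N (W N X w) * dT m N u v X ws)"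
    by (intro pol_add pol_sum pol_cmult pol_cmult2 pol_dW Cons)
  then show ?case by (simp add: ntr_def mtrace_def divide_inverse)
qed (simp add: pol_zero)

definition unv :: "nat \<Rightarrow> nat \<Rightarrow> complex" where
  "unv p = (\<lambda>l. if l = p then 1 else 0)"

lemma div_mod_flat: "a < N \<Longrightarrow> (j * N + a) div N = j" "a < N \<Longrightarrow> (j * N + a) mod N = (a::nat)"
  by auto

lemma flat_less: "j < m \<Longrightarrow> a < N \<Longrightarrow> j * N + a < m * (N::nat)"
proof -
  assume "j < m" "a < N"
  then have "j * N + a < Suc j * N" by simp
  also have "\<dots> \<le> m * N" using \<open>j < m\<close> by (intro mult_le_mono1) simp
  finally show ?thesis .
qed

lemma flat_inj: "a < N \<Longrightarrow> b < N \<Longrightarrow> j * N + a = i * N + b \<longleftrightarrow> j = i \<and> a = (b::nat)"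
  using div_mod_flat by metis

lemma dlt_unv:
  assumes "j < m" "i < m" "a < N" "b < N" "r < N" "c < N" "fst x < m"
  shows "dlt m N (unv (j*N+a)) (unv (i*N+b)) X x r c
    = (if snd x then (if fst x = i \<and> c = b then - cnj (X j a r) else 0)
       else (if fst x = j \<and> r = a then X i b c else 0))"
proof -
  have s1: "(\<Sum>l<m*N. unv (j*N+a) l * cnj (X (l div N) (l mod N) r)) = cnj (X j a r)"
  proof -
    have "(\<Sum>l<m*N. unv (j*N+a) l * cnj (X (l div N) (l mod N) r)) = (\<Sum>l<m*N. if l = j*N+a then cnj (X j a r) else 0)"
      using assms by (intro sum.cong refl) (auto simp: unv_def div_mod_flat)
    then show ?thesis using flat_less[of j m a N] assms by simp
  qed
  have s2: "(\<Sum>l<m*N. cnj (unv (i*N+b) l) * X (l div N) (l mod N) c) = X i b c"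
  proof -
    have "(\<Sum>l<m*N. cnj (unv (i*N+b) l) * X (l div N) (l mod N) c) = (\<Sum>l<m*N. if l = i*N+b then X i b c else 0)"
      using assms by (intro sum.cong refl) (auto simp: unv_def div_mod_flat)
    then show ?thesis using flat_less[of i m b N] assms by simp
  qed
  show ?thesis using assms by (auto simp: dlt_def s1 s2) (auto simp: unv_def flat_inj)
qed

lemma is_mat_dW: "is_tup m N X \<Longrightarrow> is_mat N (dW m N u v X w)"
proof (induction w)
  case (Cons x w)
  have "is_mat N (dlt m N u v X x)" by (auto simp: is_mat_def dlt_def)
  moreover have "is_mat N (madd A B)" if "is_mat N A" "is_mat N B" for A B
    using that by (auto simp: is_mat_def madd_def)
  ultimately show ?case using Cons by (auto intro!: is_mat_mmul is_mat_W is_mat_lt)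
qed (simp add: is_mat_def mzero_def)

lemma mmul_madd_left: "mmul N (madd A B) C = madd (mmul N A C) (mmul N B C)"
  by (simp add: mmul_def madd_def fun_eq_iff ring_distribs sum.distrib)

lemma mmul_madd_right: "mmul N C (madd A B) = madd (mmul N C A) (mmul N C B)"
  by (simp add: mmul_def madd_def fun_eq_iff ring_distribs sum.distrib)

lemma ntr_madd: "ntr N (madd A B) = ntr N A + ntr N B"
  by (simp add: ntr_def mtrace_def madd_def sum.distrib add_divide_distrib)

lemma mtrace_ntr: "mtrace N A = of_nat N * ntr N A"
  by (cases "N = 0") (simp_all add: ntr_def mtrace_def)

text \<open>The indices a and b decouple: a plain letter contributes the diagonal entry a of P times
  the diagonal entry b of X_i Q, an adjoint letter minus the diagonal entry a of P X_j^* times that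
  of Q at b. Summation gives two separate traces, which is the cut.\<close>

lemma sum_dlt_unv_diag:
  assumes j: "j < m" "i < m" and X: "is_tup m N X"
  shows "(\<Sum>a<N. \<Sum>b<N. mmul N P (mmul N (dlt m N (unv (j*N+a)) (unv (i*N+b)) X x) Q) a b)
     = (if x = (j, False) then mtrace N P * mtrace N (mmul N (X i) Q) else 0)
     - (if x = (i, True) then mtrace N (mmul N P (madj (X j))) * mtrace N Q else 0)"
proof (cases "fst x < m")
  case False
  then show ?thesis using j by (auto simp: mmul_def dlt_def)
next
  case x: True
  show ?thesis
  proof (cases "snd x")
    case False
    have D: "mmul N (dlt m N (unv (j*N+a)) (unv (i*N+b)) X x) Q r c = (if r = a then (if fst x = j then mmul N (X i) Q b c else 0) else 0)"
      if "a < N" "b < N" "r < N" for a b r c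
    proof -
      have "mmul N (dlt m N (unv (j*N+a)) (unv (i*N+b)) X x) Q r c = (\<Sum>l<N. (if fst x = j \<and> r = a then X i b l else 0) * Q l c)"
        unfolding mmul_def by (intro sum.cong refl) (use dlt_unv[of j m i a N b r _ x X] j x that False in simp)
      then show ?thesis by (auto simp: mmul_def)
    qed
    have "mmul N P (mmul N (dlt m N (unv (j*N+a)) (unv (i*N+b)) X x) Q) a b = (if fst x = j then P a a * mmul N (X i) Q b b else 0)"
      if "a < N" "b < N" for a b
    proof -
      have "mmul N P (mmul N (dlt m N (unv (j*N+a)) (unv (i*N+b)) X x) Q) a b
        = (\<Sum>r<N. if r = a then P a a * (if fst x = j then mmul N (X i) Q b b else 0) else 0)"
        unfolding mmul_def[of N P] by (intro sum.cong refl) (use D that in auto)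
      then show ?thesis using that by simp
    qed
    then have "(\<Sum>a<N. \<Sum>b<N. mmul N P (mmul N (dlt m N (unv (j*N+a)) (unv (i*N+b)) X x) Q) a b)
      = (\<Sum>a<N. \<Sum>b<N. if fst x = j then P a a * mmul N (X i) Q b b else 0)"
      by (intro sum.cong refl) auto
    also have "\<dots> = (if fst x = j then mtrace N P * mtrace N (mmul N (X i) Q) else 0)"
      by (simp add: mtrace_def sum_product)
    finally show ?thesis using False by (cases x) auto
  next
    case True
    have D: "mmul N (dlt m N (unv (j*N+a)) (unv (i*N+b)) X x) Q r c = (if fst x = i then - cnj (X j a r) * Q b c else 0)"
      if "a < N" "b < N" "r < N" for a b r c
    proof -
      have "mmul N (dlt m N (unv (j*N+a)) (unv (i*N+b)) X x) Q r c = (\<Sum>l<N. if l = b then (if fst x = i then - cnj (X j a r) * Q b c else 0) else 0)"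
        unfolding mmul_def by (intro sum.cong refl) (use dlt_unv[of j m i a N b r _ x X] j x that True in auto)
      then show ?thesis using that by simp
    qed
    have "mmul N P (mmul N (dlt m N (unv (j*N+a)) (unv (i*N+b)) X x) Q) a b = (if fst x = i then - (mmul N P (madj (X j)) a a * Q b b) else 0)"
      if "a < N" "b < N" for a b
    proof -
      have "mmul N P (mmul N (dlt m N (unv (j*N+a)) (unv (i*N+b)) X x) Q) a b
        = (\<Sum>r<N. P a r * (if fst x = i then - cnj (X j a r) * Q b b else 0))"
        unfolding mmul_def[of N P] by (intro sum.cong refl) (use D that in auto)
      then show ?thesis by (simp add: mmul_def madj_def sum_distrib_right sum_negf mult.assoc)
    qed
    then have "(\<Sum>a<N. \<Sum>b<N. mmul N P (mmul N (dlt m N (unv (j*N+a)) (unv (i*N+b)) X x) Q) a b)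
      = (\<Sum>a<N. \<Sum>b<N. if fst x = i then - (mmul N P (madj (X j)) a a * Q b b) else 0)"
      by (intro sum.cong refl) auto
    also have "\<dots> = (if fst x = i then - (mtrace N (mmul N P (madj (X j))) * mtrace N Q) else 0)"
      by (simp add: mtrace_def sum_product sum_negf)
    finally show ?thesis using True by (cases x) auto
  qed
qed

lemma sum_dW_diag:
  assumes j: "j < m" "i < m" and X: "is_tup m N X"
  shows "(\<Sum>a<N. \<Sum>b<N. mmul N (W N X p) (dW m N (unv (j*N+a)) (unv (i*N+b)) X w) a b) = (of_nat N)\<^sup>2 * sd N X j i p w"
proof (induction w arbitrary: p)
  case Nil
  then show ?case by (simp add: mzero_def mmul_def)
next
  case (Cons x w)
  have "(\<Sum>a<N. \<Sum>b<N. mmul N (W N X p) (dW m N (unv (j*N+a)) (unv (i*N+b)) X (x # w)) a b)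
    = (\<Sum>a<N. \<Sum>b<N. mmul N (W N X p) (mmul N (dlt m N (unv (j*N+a)) (unv (i*N+b)) X x) (W N X w)) a b)
      + (\<Sum>a<N. \<Sum>b<N. mmul N (W N X (p @ [x])) (dW m N (unv (j*N+a)) (unv (i*N+b)) X w) a b)"
    unfolding W_snoc[OF X] dW.simps mmul_madd_right mmul_assoc by (simp add: madd_def sum.distrib)
  also have "\<dots> = (of_nat N)\<^sup>2 * sd N X j i p (x # w)"
    unfolding Cons sum_dlt_unv_diag[OF j X] unfolding sd.simps W_snoc[OF X]
    by (simp add: mtrace_ntr power2_eq_square algebra_simps lt_def)
  finally show ?case .
qed

text \<open>Here the derivative falls on another trace than the one that holds R. The sum over a and
  b glues the two words into one normalised trace, which stays bounded, whereas a cut as in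
  \<open>sum_dlt_unv_diag\<close> yields two unnormalised traces, of order N^2. This is why mixed
  terms drop out to leading order.\<close>

lemma sum_dlt_unv_cross:
  assumes j: "j < m" "i < m" and X: "is_tup m N X"
  shows "(\<Sum>a<N. \<Sum>b<N. R a b * ntr N (mmul N P (mmul N (dlt m N (unv (j*N+a)) (unv (i*N+b)) X x) Q)))
     = (if x = (j, False) then ntr N (mmul N P (mmul N R (mmul N (X i) Q))) else 0)
     - (if x = (i, True) then ntr N (mmul N (mmul N P (madj (X j))) (mmul N R Q)) else 0)"
proof (cases "fst x < m")
  case False
  then show ?thesis using j by (auto simp: mmul_def dlt_def ntr_def mtrace_def)
next
  case x: True
  show ?thesis
  proof (cases "snd x")
    case False
    have D: "mmul N (dlt m N (unv (j*N+a)) (unv (i*N+b)) X x) Q r c = (if r = a then (if fst x = j then mmul N (X i) Q b c else 0) else 0)"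
      if "a < N" "b < N" "r < N" for a b r c
    proof -
      have "mmul N (dlt m N (unv (j*N+a)) (unv (i*N+b)) X x) Q r c = (\<Sum>l<N. (if fst x = j \<and> r = a then X i b l else 0) * Q l c)"
        unfolding mmul_def by (intro sum.cong refl) (use dlt_unv[of j m i a N b r _ x X] j x that False in simp)
      then show ?thesis by (auto simp: mmul_def)
    qed
    have "mmul N P (mmul N (dlt m N (unv (j*N+a)) (unv (i*N+b)) X x) Q) e e = (if fst x = j then P e a * mmul N (X i) Q b e else 0)"
      if "a < N" "b < N" for a b e
    proof -
      have "mmul N P (mmul N (dlt m N (unv (j*N+a)) (unv (i*N+b)) X x) Q) e e
        = (\<Sum>r<N. if r = a then P e a * (if fst x = j then mmul N (X i) Q b e else 0) else 0)"
        unfolding mmul_def[of N P] by (intro sum.cong refl) (use D that in auto)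
      then show ?thesis using that by simp
    qed
    then have "(\<Sum>a<N. \<Sum>b<N. R a b * ntr N (mmul N P (mmul N (dlt m N (unv (j*N+a)) (unv (i*N+b)) X x) Q)))
      = (\<Sum>a<N. \<Sum>b<N. R a b * ((\<Sum>e<N. if fst x = j then P e a * mmul N (X i) Q b e else 0) / of_nat N))"
      unfolding ntr_def mtrace_def by (intro sum.cong refl) auto
    also have "\<dots> = (if fst x = j then (\<Sum>a<N. \<Sum>b<N. \<Sum>e<N. P e a * (R a b * mmul N (X i) Q b e)) / of_nat N else 0)"
      by (simp add: sum_distrib_left sum_divide_distrib mult_ac)
    also have "(\<Sum>a<N. \<Sum>b<N. \<Sum>e<N. P e a * (R a b * mmul N (X i) Q b e)) = mtrace N (mmul N P (mmul N R (mmul N (X i) Q)))"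
    proof -
      have "(\<Sum>a<N. \<Sum>b<N. \<Sum>e<N. P e a * (R a b * mmul N (X i) Q b e)) = (\<Sum>a<N. \<Sum>e<N. \<Sum>b<N. P e a * (R a b * mmul N (X i) Q b e))"
        by (intro sum.cong refl sum.swap)
      also have "\<dots> = (\<Sum>e<N. \<Sum>a<N. \<Sum>b<N. P e a * (R a b * mmul N (X i) Q b e))" by (rule sum.swap)
      also have "\<dots> = mtrace N (mmul N P (mmul N R (mmul N (X i) Q)))"
        unfolding mtrace_def mmul_def[of N P] mmul_def[of N R] by (simp add: sum_distrib_left)
      finally show ?thesis .
    qed
    finally show ?thesis using False by (cases x) (auto simp: ntr_def)
  next
    case True
    have D: "mmul N (dlt m N (unv (j*N+a)) (unv (i*N+b)) X x) Q r c = (if fst x = i then - cnj (X j a r) * Q b c else 0)"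
      if "a < N" "b < N" "r < N" for a b r c
    proof -
      have "mmul N (dlt m N (unv (j*N+a)) (unv (i*N+b)) X x) Q r c = (\<Sum>l<N. if l = b then (if fst x = i then - cnj (X j a r) * Q b c else 0) else 0)"
        unfolding mmul_def by (intro sum.cong refl) (use dlt_unv[of j m i a N b r _ x X] j x that True in auto)
      then show ?thesis using that by simp
    qed
    have "mmul N P (mmul N (dlt m N (unv (j*N+a)) (unv (i*N+b)) X x) Q) e e = (if fst x = i then - (mmul N P (madj (X j)) e a * Q b e) else 0)"
      if "a < N" "b < N" for a b e
    proof -
      have "mmul N P (mmul N (dlt m N (unv (j*N+a)) (unv (i*N+b)) X x) Q) e e
        = (\<Sum>r<N. P e r * (if fst x = i then - cnj (X j a r) * Q b e else 0))"
        unfolding mmul_def[of N P] by (intro sum.cong refl) (use D that in auto)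
      then show ?thesis by (simp add: mmul_def madj_def sum_distrib_right sum_negf mult.assoc)
    qed
    then have "(\<Sum>a<N. \<Sum>b<N. R a b * ntr N (mmul N P (mmul N (dlt m N (unv (j*N+a)) (unv (i*N+b)) X x) Q)))
      = (\<Sum>a<N. \<Sum>b<N. R a b * ((\<Sum>e<N. if fst x = i then - (mmul N P (madj (X j)) e a * Q b e) else 0) / of_nat N))"
      unfolding ntr_def mtrace_def by (intro sum.cong refl) auto
    also have "\<dots> = (if fst x = i then - (\<Sum>a<N. \<Sum>b<N. \<Sum>e<N. mmul N P (madj (X j)) e a * (R a b * Q b e)) / of_nat N else 0)"
      by (simp add: sum_distrib_left sum_divide_distrib sum_negf mult_ac)
    also have "(\<Sum>a<N. \<Sum>b<N. \<Sum>e<N. mmul N P (madj (X j)) e a * (R a b * Q b e)) = mtrace N (mmul N (mmul N P (madj (X j))) (mmul N R Q))"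
    proof -
      have "(\<Sum>a<N. \<Sum>b<N. \<Sum>e<N. mmul N P (madj (X j)) e a * (R a b * Q b e)) = (\<Sum>a<N. \<Sum>e<N. \<Sum>b<N. mmul N P (madj (X j)) e a * (R a b * Q b e))"
        by (intro sum.cong refl sum.swap)
      also have "\<dots> = (\<Sum>e<N. \<Sum>a<N. \<Sum>b<N. mmul N P (madj (X j)) e a * (R a b * Q b e))" by (rule sum.swap)
      also have "\<dots> = mtrace N (mmul N (mmul N P (madj (X j))) (mmul N R Q))"
        unfolding mtrace_def mmul_def[of N "mmul N P (madj (X j))"] mmul_def[of N R] by (simp add: sum_distrib_left)
      finally show ?thesis .
    qed
    finally show ?thesis using True by (cases x) (auto simp: ntr_def)
  qed
qed

definition contr_tup :: "nat \<Rightarrow> ctup \<Rightarrow> bool" where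
  "contr_tup N X \<longleftrightarrow> (\<forall>j. contr N (X j))"

lemma contr_lt: "contr_tup N X \<Longrightarrow> contr N (lt X x)"
  by (auto simp: contr_tup_def lt_def contr_madj)

lemma contr_W: "contr_tup N X \<Longrightarrow> contr N (W N X w)"
  by (induction w) (auto intro: contr_mid contr_mmul contr_lt)

lemma T_bound: "contr_tup N X \<Longrightarrow> cmod (T N X ws) \<le> 1"
proof (induction ws)
  case (Cons w ws)
  have "cmod (ntr N (W N X w)) * cmod (T N X ws) \<le> 1 * 1"
    by (intro mult_mono Cons contr_ntr contr_W) auto
  then show ?case by (simp add: norm_mult)
qed simp

text \<open>Leibniz rule over the letters. Both terms of \<open>sum_dlt_unv_cross\<close> are
  normalised traces of contractions, hence the constant 2 per letter.\<close>

lemma sum_dW_cross_bound: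
  assumes j: "j < m" "i < m" and X: "is_tup m N X" "contr_tup N X" and R: "contr N R"
  shows "cmod (\<Sum>a<N. \<Sum>b<N. R a b * ntr N (mmul N (W N X p) (dW m N (unv (j*N+a)) (unv (i*N+b)) X w))) \<le> 2 * real (length w)"
proof (induction w arbitrary: p)
  case Nil
  then show ?case by (simp add: mzero_def mmul_def ntr_def mtrace_def)
next
  case (Cons x w)
  have "(\<Sum>a<N. \<Sum>b<N. R a b * ntr N (mmul N (W N X p) (dW m N (unv (j*N+a)) (unv (i*N+b)) X (x # w))))
    = (\<Sum>a<N. \<Sum>b<N. R a b * ntr N (mmul N (W N X p) (mmul N (dlt m N (unv (j*N+a)) (unv (i*N+b)) X x) (W N X w))))
      + (\<Sum>a<N. \<Sum>b<N. R a b * ntr N (mmul N (W N X (p @ [x])) (dW m N (unv (j*N+a)) (unv (i*N+b)) X w)))"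
    unfolding W_snoc[OF X(1)] dW.simps mmul_madd_right mmul_assoc by (simp add: ntr_madd sum.distrib ring_distribs)
  also have "cmod \<dots> \<le> 2 + 2 * real (length w)"
  proof (intro norm_triangle_le add_mono Cons)
    have "cmod (ntr N (mmul N (W N X p) (mmul N R (mmul N (X i) (W N X w))))) \<le> 1"
      "cmod (ntr N (mmul N (mmul N (W N X p) (madj (X j))) (mmul N R (W N X w)))) \<le> 1"
      using X R by (auto simp: contr_tup_def intro!: contr_ntr contr_mmul contr_W contr_madj)
    then show "cmod (\<Sum>a<N. \<Sum>b<N. R a b * ntr N (mmul N (W N X p) (mmul N (dlt m N (unv (j*N+a)) (unv (i*N+b)) X x) (W N X w)))) \<le> 2"
      unfolding sum_dlt_unv_cross[OF j X(1)] by (intro order_trans[OF norm_triangle_ineq4]) auto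
  qed
  finally show ?case by simp
qed

lemma sum_dT_bound:
  assumes j: "j < m" "i < m" and X: "is_tup m N X" "contr_tup N X" and R: "contr N R"
  shows "cmod (\<Sum>a<N. \<Sum>b<N. R a b * dT m N (unv (j*N+a)) (unv (i*N+b)) X ws) \<le> 2 * real (sum_list (map length ws))"
proof (induction ws)
  case (Cons w ws)
  let ?d = "\<lambda>a b. dW m N (unv (j*N+a)) (unv (i*N+b)) X w"
  have eq: "(\<Sum>a<N. \<Sum>b<N. R a b * dT m N (unv (j*N+a)) (unv (i*N+b)) X (w # ws))
    = (\<Sum>a<N. \<Sum>b<N. R a b * ntr N (?d a b)) * T N X ws
      + ntr N (W N X w) * (\<Sum>a<N. \<Sum>b<N. R a b * dT m N (unv (j*N+a)) (unv (i*N+b)) X ws)"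
    unfolding dT.simps distrib_left sum.distrib sum_distrib_left sum_distrib_right
    by (intro arg_cong2[where f = "(+)"] sum.cong refl) (simp_all only: mult_ac)
  have "cmod ((\<Sum>a<N. \<Sum>b<N. R a b * ntr N (?d a b)) * T N X ws
      + ntr N (W N X w) * (\<Sum>a<N. \<Sum>b<N. R a b * dT m N (unv (j*N+a)) (unv (i*N+b)) X ws)) \<le> 2 * real (length w) * 1 + 1 * (2 * real (sum_list (map length ws)))"
  proof (rule order_trans[OF norm_triangle_ineq], rule add_mono)
    have 1: "mmul N (W N X []) (?d a b) = ?d a b" for a b
      by (simp add: mmul_mid_left is_mat_dW[OF X(1)])
    have "cmod (\<Sum>a<N. \<Sum>b<N. R a b * ntr N (?d a b)) \<le> 2 * real (length w)"
      using sum_dW_cross_bound[OF j X R, of "[]" w] unfolding 1 .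
    from mult_mono[OF this T_bound[OF X(2), of ws]]
    show "cmod ((\<Sum>a<N. \<Sum>b<N. R a b * ntr N (?d a b)) * T N X ws) \<le> 2 * real (length w) * 1"
      unfolding norm_mult by simp
    show "cmod (ntr N (W N X w) * (\<Sum>a<N. \<Sum>b<N. R a b * dT m N (unv (j*N+a)) (unv (i*N+b)) X ws)) \<le> 1 * (2 * real (sum_list (map length ws)))"
      unfolding norm_mult by (rule mult_mono[OF contr_ntr[OF contr_W[OF X(2)]] Cons.IH]) simp_all
  qed
  then show ?case unfolding eq by simp
qed simp

section \<open>Measurability of words, traces and their derivatives\<close>

lemma measurable_entry: "(\<lambda>X::ctup. X j i k) \<in> borel_measurable borel"
proof -
  have "continuous_on UNIV (\<lambda>X::ctup. X j i k)"
    using continuous_on_product_then_coordinatewise[OF continuous_on_product_then_coordinatewise[OF continuous_on_product_coordinates]] .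
  then show ?thesis by (rule borel_measurable_continuous_onI)
qed

lemma measurable_entry_mat: "(\<lambda>A::cmat. A i k) \<in> borel_measurable borel"
proof -
  have "continuous_on UNIV (\<lambda>A::cmat. A i k)"
    using continuous_on_product_then_coordinatewise[OF continuous_on_product_coordinates] .
  then show ?thesis by (rule borel_measurable_continuous_onI)
qed

lemma measurable_cnj [measurable]: "cnj \<in> borel_measurable borel"
  by (intro borel_measurable_continuous_onI continuous_intros)

lemma borel_measurable_cnj: "f \<in> borel_measurable M \<Longrightarrow> (\<lambda>x. cnj (f x)) \<in> borel_measurable M"
  by measurable

lemma borel_measurable_if_const:
  fixes f :: "'a \<Rightarrow> 'b :: {topological_space, zero}"
  shows "f \<in> borel_measurable M \<Longrightarrow> (\<lambda>x. if c then f x else 0) \<in> borel_measurable M"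
  by (cases c) simp_all

lemma measurable_lt: "(\<lambda>X. lt X x i k) \<in> borel_measurable borel"
  by (cases "snd x") (auto simp: lt_def madj_def intro: measurable_entry borel_measurable_cnj)

lemma measurable_W: "(\<lambda>X. W N X w i k) \<in> borel_measurable borel"
proof (induction w arbitrary: i k)
  case (Cons x w)
  then show ?case
    by (simp add: mmul_def) (intro borel_measurable_sum borel_measurable_times measurable_lt)
qed simp

lemma measurable_dlt: "(\<lambda>X. dlt m N u v X x i k) \<in> borel_measurable borel"
proof (cases "fst x < m \<and> i < N \<and> k < N")
  case True
  then show ?thesis unfolding dlt_def
    by (cases "snd x") (simp_all, (intro borel_measurable_sum borel_measurable_times borel_measurable_uminus
      borel_measurable_const borel_measurable_cnj measurable_entry)+)
next
  case False
  show ?thesis unfolding dlt_def by (simp only: False if_False borel_measurable_const)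
qed

lemma measurable_dW: "(\<lambda>X. dW m N u v X w i k) \<in> borel_measurable borel"
proof (induction w arbitrary: i k)
  case (Cons x w)
  then show ?case
    by (simp add: mmul_def madd_def)
       (intro borel_measurable_add borel_measurable_sum borel_measurable_times measurable_lt measurable_dlt measurable_W)
qed (simp add: mzero_def)

lemma measurable_ntr: "(\<And>i. (\<lambda>X. A X i i) \<in> borel_measurable M) \<Longrightarrow> (\<lambda>X. ntr N (A X)) \<in> borel_measurable M"
  unfolding ntr_def mtrace_def divide_inverse
  by (intro borel_measurable_times borel_measurable_sum borel_measurable_const)

lemma measurable_T: "(\<lambda>X. T N X ws) \<in> borel_measurable borel"
  by (induction ws) (auto intro!: borel_measurable_times measurable_ntr measurable_W)

lemma measurable_dT: "(\<lambda>X. dT m N u v X ws) \<in> borel_measurable borel"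
  by (induction ws) (auto intro!: borel_measurable_add borel_measurable_times measurable_ntr measurable_W measurable_dW measurable_T)

lemma measurable_sd: "(\<lambda>X. sd N X j i p w) \<in> borel_measurable borel"
proof (induction w arbitrary: p)
  case (Cons x w)
  show ?case unfolding sd.simps
    by (intro borel_measurable_add borel_measurable_diff Cons borel_measurable_if_const
      borel_measurable_times measurable_ntr measurable_W)
qed simp

lemma measurable_act_col: "act_col m N U \<in> borel_measurable borel"
proof -
  have "(\<lambda>X. act_col m N U X j i k) \<in> borel_measurable borel" for j i k
    unfolding act_col_def
    by (intro borel_measurable_if_const borel_measurable_sum borel_measurable_times borel_measurable_const measurable_entry)
  then show ?thesis
    by (intro measurable_coordinatewise_then_product)
qed

section \<open>The boundary and its symmetry group\<close>

context nc_dom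
begin

definition bdry :: "nat \<Rightarrow> ctup set" where
  "bdry N = {X. is_tup m N X \<and> (\<forall>j0<m. (\<lambda>i k. \<Sum>j\<in>cls j0. mmul N (madj (X j)) (X j) i k) = mid N)}"

definition grp :: "nat \<Rightarrow> cmat set" where
  "grp N = {U. unitary (m * N) U \<and> (\<forall>a<m*N. \<forall>b<m*N. cl (a div N) \<noteq> cl (b div N) \<longrightarrow> U a b = 0)}"

text \<open>The common form of the properties by which \<open>haar_torus\<close> and
  \<open>haar_sphere\<close> are described.\<close>

definition inv_meas :: "nat \<Rightarrow> ctup measure \<Rightarrow> bool" where
  "inv_meas N M \<longleftrightarrow> sets M = sets borel \<and> prob_space M \<and> (AE X in M. X \<in> bdry N) \<and>
     (\<forall>U\<in>grp N. distr M borel (act_col m N U) = M)"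

lemma self_cls: "j < m \<Longrightarrow> j \<in> cls j"
  by (simp add: cls_def)

lemma bdry_norm:
  assumes X: "X \<in> bdry N" and j0: "j0 < m"
  shows "(\<Sum>j\<in>cls j0. \<Sum>i<N. (cmod (\<Sum>k<N. X j i k * v k))\<^sup>2) = (\<Sum>k<N. (cmod (v k))\<^sup>2)"
proof -
  define y where "y j i = (\<Sum>k<N. X j i k * v k)" for j i
  have G: "(\<Sum>j\<in>cls j0. \<Sum>i<N. cnj (X j i k) * X j i l) = mid N k l" for k l
    using X j0 unfolding bdry_def mmul_def madj_def by (auto dest!: spec[of _ j0] simp: fun_eq_iff)
  have "complex_of_real (\<Sum>j\<in>cls j0. \<Sum>i<N. (cmod (y j i))\<^sup>2) = (\<Sum>j\<in>cls j0. \<Sum>i<N. cnj (y j i) * y j i)"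
    by (simp only: of_real_sum complex_norm_square mult.commute)
  also have "\<dots> = (\<Sum>j\<in>cls j0. \<Sum>i<N. \<Sum>k<N. \<Sum>l<N. cnj (v k) * v l * (cnj (X j i k) * X j i l))"
    unfolding y_def cnj_sum complex_cnj_mult sum_product by (intro sum.cong refl) (simp only: mult_ac)
  also have "\<dots> = (\<Sum>j\<in>cls j0. \<Sum>k<N. \<Sum>l<N. \<Sum>i<N. cnj (v k) * v l * (cnj (X j i k) * X j i l))"
  proof (rule sum.cong[OF refl])
    fix j
    have "(\<Sum>i<N. \<Sum>k<N. \<Sum>l<N. cnj (v k) * v l * (cnj (X j i k) * X j i l)) = (\<Sum>k<N. \<Sum>i<N. \<Sum>l<N. cnj (v k) * v l * (cnj (X j i k) * X j i l))"
      by (rule sum.swap)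
    also have "\<dots> = (\<Sum>k<N. \<Sum>l<N. \<Sum>i<N. cnj (v k) * v l * (cnj (X j i k) * X j i l))"
      by (rule sum.cong[OF refl], rule sum.swap)
    finally show "(\<Sum>i<N. \<Sum>k<N. \<Sum>l<N. cnj (v k) * v l * (cnj (X j i k) * X j i l)) = (\<Sum>k<N. \<Sum>l<N. \<Sum>i<N. cnj (v k) * v l * (cnj (X j i k) * X j i l))" .
  qed
  also have "\<dots> = (\<Sum>k<N. \<Sum>j\<in>cls j0. \<Sum>l<N. \<Sum>i<N. cnj (v k) * v l * (cnj (X j i k) * X j i l))"
    by (rule sum.swap)
  also have "\<dots> = (\<Sum>k<N. \<Sum>l<N. \<Sum>j\<in>cls j0. \<Sum>i<N. cnj (v k) * v l * (cnj (X j i k) * X j i l))"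
    by (rule sum.cong[OF refl], rule sum.swap)
  also have "\<dots> = (\<Sum>k<N. \<Sum>l<N. cnj (v k) * v l * mid N k l)"
    by (simp only: sum_distrib_left[symmetric] G)
  also have "\<dots> = (\<Sum>k<N. \<Sum>l<N. if l = k then cnj (v k) * v k else 0)"
    by (intro sum.cong refl) (auto simp: mid_def)
  also have "\<dots> = (\<Sum>k<N. v k * cnj (v k))"
    by (intro sum.cong refl) (simp add: mult.commute)
  also have "\<dots> = complex_of_real (\<Sum>k<N. (cmod (v k))\<^sup>2)"
    by (simp only: of_real_sum complex_norm_square)
  finally show ?thesis unfolding y_def of_real_eq_iff .
qed

lemma bdry_tup: "X \<in> bdry N \<Longrightarrow> is_tup m N X"
  by (simp add: bdry_def)

lemma bdry_contr:
  assumes X: "X \<in> bdry N" shows "contr_tup N X"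
  unfolding contr_tup_def
proof
  fix j
  show "contr N (X j)"
  proof (cases "j < m")
    case True
    show ?thesis unfolding contr_def
    proof
      fix v
      have "(\<Sum>i<N. (cmod (\<Sum>k<N. X j i k * v k))\<^sup>2) \<le> (\<Sum>j\<in>cls j. \<Sum>i<N. (cmod (\<Sum>k<N. X j i k * v k))\<^sup>2)"
        by (rule member_le_sum[of j "cls j" "\<lambda>j. \<Sum>i<N. (cmod (\<Sum>k<N. X j i k * v k))\<^sup>2"]) (auto simp: self_cls True intro: sum_nonneg)
      then show "(\<Sum>i<N. (cmod (\<Sum>k<N. X j i k * v k))\<^sup>2) \<le> (\<Sum>k<N. (cmod (v k))\<^sup>2)"
        by (simp add: bdry_norm[OF X True])
    qed
  next
    case False
    then show ?thesis using bdry_tup[OF X] contr_zero by (simp add: is_tup_def)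
  qed
qed

text \<open>The Cayley transform of $i t\,v v^*$, which makes Ut unitary.\<close>

definition rot :: "nat \<Rightarrow> (nat \<Rightarrow> complex) \<Rightarrow> real \<Rightarrow> complex" where
  "rot N v t = 2 * \<i> * t / (1 - \<i> * t * (\<Sum>l<m*N. (cmod (v l))\<^sup>2))"

definition Ut :: "nat \<Rightarrow> (nat \<Rightarrow> complex) \<Rightarrow> real \<Rightarrow> cmat" where
  "Ut N v t = (\<lambda>a b. if a < m*N \<and> b < m*N then (if a = b then 1 else 0) + rot N v t * v a * cnj (v b) else 0)"

lemma rot_denom: "cmod (1 - \<i> * complex_of_real t * complex_of_real n) \<ge> 1"
proof -
  have "\<bar>Re (1 - \<i> * complex_of_real t * complex_of_real n)\<bar> \<le> cmod (1 - \<i> * complex_of_real t * complex_of_real n)"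
    by (rule abs_Re_le_cmod)
  then show ?thesis by simp
qed

text \<open>Subtracting 2it leaves -2 t^2 n over the Cayley denominator 1 - itn, where n is the
  squared norm of v; that denominator has real part 1 and so modulus at least 1.\<close>

lemma rot_expand:
  shows "\<exists>C\<ge>0. \<forall>t. 0 < t \<and> t \<le> 1 \<longrightarrow> cmod (rot N v t - 2 * \<i> * t) \<le> C * t\<^sup>2"
proof -
  define n where "n = (\<Sum>l<m*N. (cmod (v l))\<^sup>2)"
  have n: "n \<ge> 0" by (simp add: n_def sum_nonneg)
  have "cmod (rot N v t - 2 * \<i> * t) \<le> (2 * n) * t\<^sup>2" if t: "0 < t" "t \<le> 1" for t
  proof -
    let ?D = "1 - \<i> * complex_of_real t * complex_of_real n"
    have D: "cmod ?D \<ge> 1" by (rule rot_denom)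
    then have D0: "?D \<noteq> 0" by (metis norm_zero not_one_le_zero)
    have "rot N v t - 2 * \<i> * t = - 2 * t\<^sup>2 * n / ?D"
      using D0 unfolding rot_def n_def[symmetric] by (simp add: field_simps power2_eq_square)
    then have "cmod (rot N v t - 2 * \<i> * t) = 2 * t\<^sup>2 * n / cmod ?D"
      using n by (simp add: norm_divide norm_mult norm_power)
    also have "\<dots> \<le> 2 * t\<^sup>2 * n / 1"
      using D n by (intro divide_left_mono) (auto intro: mult_pos_pos)
    finally show ?thesis by (simp add: mult_ac)
  qed
  then show ?thesis using n by (intro exI[of _ "2 * n"]) auto
qed

text \<open>The condition on the scalar s that makes 1 + s v v^* unitary: the product of this matrix
  with its adjoint is 1 plus the left-hand side times v v^*.\<close>

lemma rot_unit:
  "rot N v t + cnj (rot N v t) + rot N v t * cnj (rot N v t) * (\<Sum>l<m*N. (cmod (v l))\<^sup>2) = 0"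
proof -
  define n where "n = (\<Sum>l<m*N. (cmod (v l))\<^sup>2)"
  let ?D = "1 - \<i> * complex_of_real t * complex_of_real n"
  have D0: "?D \<noteq> 0" using rot_denom[of t n] by (metis norm_zero not_one_le_zero)
  have "cmod (1 + \<i> * complex_of_real t * complex_of_real n) \<ge> 1" using rot_denom[of "-t" n] by simp
  then have E0: "1 + \<i> * complex_of_real t * complex_of_real n \<noteq> 0" by (metis norm_zero not_one_le_zero)
  let ?E = "1 + \<i> * complex_of_real t * complex_of_real n"
  let ?s = "rot N v t"
  have sD: "?s * ?D = 2 * \<i> * t" using D0 by (simp add: rot_def n_def[symmetric])
  have cE: "cnj ?s * ?E = - (2 * \<i> * t)"
    using arg_cong[OF sD, of cnj] by simp
  have gen: "(s + c + s * c * n) * (D * E) = (s * D) * E + (c * E) * D + (s * D) * (c * E) * n" for s c n D E :: complex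
    by (simp add: algebra_simps)
  have "(?s + cnj ?s + ?s * cnj ?s * n) * (?D * ?E) = (?s * ?D) * ?E + (cnj ?s * ?E) * ?D + (?s * ?D) * (cnj ?s * ?E) * n"
    by (rule gen)
  also have "\<dots> = 0" unfolding sD cE by (simp add: algebra_simps)
  finally show ?thesis using D0 E0 unfolding n_def[symmetric] mult_eq_0_iff by blast
qed

text \<open>A vector supported in one class makes v v^* block diagonal.\<close>

lemma Ut_grp:
  assumes v: "\<And>a b. a < m*N \<Longrightarrow> b < m*N \<Longrightarrow> v a \<noteq> 0 \<Longrightarrow> v b \<noteq> 0 \<Longrightarrow> cl (a div N) = cl (b div N)"
  shows "Ut N v t \<in> grp N"
proof -
  let ?s = "rot N v t"
  have n: "(\<Sum>l<m*N. cnj (v l) * v l) = complex_of_real (\<Sum>l<m*N. (cmod (v l))\<^sup>2)"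
    by (simp add: complex_norm_square mult.commute del: of_real_power)
  have "mmul (m*N) (madj (Ut N v t)) (Ut N v t) = mid (m*N)"
  proof (intro ext)
    fix a b
    show "mmul (m*N) (madj (Ut N v t)) (Ut N v t) a b = mid (m*N) a b"
    proof (cases "a < m*N \<and> b < m*N")
      case True
      have gen: "e + s * x * y + c * y * x + c * s * x * y * S = e + (s + c + s * c * S) * (x * y)" for e s x y c S :: complex
        by (simp add: algebra_simps)
      have "mmul (m*N) (madj (Ut N v t)) (Ut N v t) a b =
         (\<Sum>l<m*N. ((if l = a then 1 else 0) + cnj ?s * cnj (v l) * v a) * ((if l = b then 1 else 0) + ?s * v l * cnj (v b)))"
        unfolding mmul_def madj_def using True by (intro sum.cong refl) (auto simp: Ut_def)
      also have "\<dots> = (\<Sum>l<m*N. (if l = a then (if a = b then 1 else 0) + ?s * v a * cnj (v b) else 0)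
          + (if l = b then cnj ?s * cnj (v b) * v a else 0) + (cnj ?s * cnj (v l) * v a) * (?s * v l * cnj (v b)))"
      proof (rule sum.cong[OF refl])
        fix l
        have gen: "((if l = a then 1 else 0) + x) * ((if l = b then 1 else 0) + y)
          = (if l = a then (if l = b then 1 else 0) + y else 0) + (if l = b then x else 0) + x * y" for x y :: complex
          by (cases "l = a"; cases "l = b") (simp_all add: distrib_left distrib_right)
        show "((if l = a then 1 else 0) + cnj ?s * cnj (v l) * v a) * ((if l = b then 1 else 0) + ?s * v l * cnj (v b))
          = (if l = a then (if a = b then 1 else 0) + ?s * v a * cnj (v b) else 0)
          + (if l = b then cnj ?s * cnj (v b) * v a else 0) + (cnj ?s * cnj (v l) * v a) * (?s * v l * cnj (v b))"
          unfolding gen by (cases "l = a"; cases "l = b") simp_all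
      qed
      also have "\<dots> = (if a = b then 1 else 0) + ?s * v a * cnj (v b) + cnj ?s * cnj (v b) * v a
          + (\<Sum>l<m*N. (cnj ?s * cnj (v l) * v a) * (?s * v l * cnj (v b)))"
        using True by (simp only: sum.distrib sum.delta finite_lessThan lessThan_iff if_True)
      also have "(\<Sum>l<m*N. (cnj ?s * cnj (v l) * v a) * (?s * v l * cnj (v b))) = cnj ?s * ?s * v a * cnj (v b) * (\<Sum>l<m*N. cnj (v l) * v l)"
        unfolding sum_distrib_left by (rule sum.cong[OF refl]) (simp only: mult_ac)
      also have "(if a = b then 1 else 0) + ?s * v a * cnj (v b) + cnj ?s * cnj (v b) * v a + \<dots>
          = (if a = b then 1 else 0) + (?s + cnj ?s + ?s * cnj ?s * (\<Sum>l<m*N. cnj (v l) * v l)) * (v a * cnj (v b))"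
        by (rule gen)
      finally show ?thesis unfolding n rot_unit using True by (simp add: mid_def)
    next
      case False
      then show ?thesis by (auto simp: mmul_def madj_def Ut_def mid_def)
    qed
  qed
  moreover have "Ut N v t a b = 0" if "a < m*N" "b < m*N" "cl (a div N) \<noteq> cl (b div N)" for a b
    using v[of a b] that by (auto simp: Ut_def)
  ultimately show ?thesis by (auto simp: grp_def unitary_def is_mat_def Ut_def)
qed

lemma act_Ut:
  assumes "j < m" "i < N" "k < N"
  shows "act_col m N (Ut N v t) X j i k = X j i k + rot N v t * (v (j*N+i) * (\<Sum>l<m*N. cnj (v l) * X (l div N) (l mod N) k))"
proof -
  have f: "j * N + i < m * N" using flat_less assms by blast
  have "act_col m N (Ut N v t) X j i k = (\<Sum>l<m*N. (if l = j*N+i then X j i k else 0) + rot N v t * (v (j*N+i) * (cnj (v l) * X (l div N) (l mod N) k)))"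
    unfolding act_col_def using assms f
    by (simp only: simp_thms if_True, intro sum.cong[OF refl])
       (simp add: Ut_def distrib_right div_mod_flat mult.assoc)
  then show ?thesis using f by (simp only: sum.distrib sum.delta finite_lessThan lessThan_iff if_True sum_distrib_left)
qed

end

context nc_dom
begin

text \<open>$G$ is the derivative of $F$ along Ut at $t = 0$, up to the factor $2i$, uniformly on the boundary.\<close>

definition fo :: "nat \<Rightarrow> (nat \<Rightarrow> complex) \<Rightarrow> (ctup \<Rightarrow> complex) \<Rightarrow> (ctup \<Rightarrow> complex) \<Rightarrow> bool" where
  "fo N v F G \<longleftrightarrow> (\<exists>C. \<forall>X\<in>bdry N. \<forall>t. 0 < t \<and> t \<le> 1 \<longrightarrow> cmod (F X) \<le> C \<and> cmod (G X) \<le> C \<and>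
     cmod (F (act_col m N (Ut N v t) X) - F X - 2 * \<i> * complex_of_real t * G X) \<le> C * t\<^sup>2)"

lemma fo_const: "fo N v (\<lambda>X. c) (\<lambda>X. 0)"
  unfolding fo_def by (intro exI[of _ "cmod c"]) simp

lemma fo_add:
  assumes "fo N v F1 G1" "fo N v F2 G2"
  shows "fo N v (\<lambda>X. F1 X + F2 X) (\<lambda>X. G1 X + G2 X)"
proof -
  obtain C1 where C1: "\<And>X t. X \<in> bdry N \<Longrightarrow> 0 < t \<Longrightarrow> t \<le> 1 \<Longrightarrow> cmod (F1 X) \<le> C1 \<and> cmod (G1 X) \<le> C1 \<and>
     cmod (F1 (act_col m N (Ut N v t) X) - F1 X - 2 * \<i> * complex_of_real t * G1 X) \<le> C1 * t\<^sup>2"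
    using assms(1) unfolding fo_def by blast
  obtain C2 where C2: "\<And>X t. X \<in> bdry N \<Longrightarrow> 0 < t \<Longrightarrow> t \<le> 1 \<Longrightarrow> cmod (F2 X) \<le> C2 \<and> cmod (G2 X) \<le> C2 \<and>
     cmod (F2 (act_col m N (Ut N v t) X) - F2 X - 2 * \<i> * complex_of_real t * G2 X) \<le> C2 * t\<^sup>2"
    using assms(2) unfolding fo_def by blast
  show ?thesis unfolding fo_def
  proof (intro exI[of _ "C1 + C2"] ballI allI impI conjI)
    fix X and t :: real assume X: "X \<in> bdry N" and t: "0 < t \<and> t \<le> 1"
    note c1 = C1[OF X conjunct1[OF t] conjunct2[OF t]] and c2 = C2[OF X conjunct1[OF t] conjunct2[OF t]]
    show "cmod (F1 X + F2 X) \<le> C1 + C2" "cmod (G1 X + G2 X) \<le> C1 + C2"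
      using c1 c2 norm_triangle_ineq[of "F1 X" "F2 X"] norm_triangle_ineq[of "G1 X" "G2 X"] by linarith+
    have "F1 (act_col m N (Ut N v t) X) + F2 (act_col m N (Ut N v t) X) - (F1 X + F2 X) - 2 * \<i> * complex_of_real t * (G1 X + G2 X)
      = (F1 (act_col m N (Ut N v t) X) - F1 X - 2 * \<i> * complex_of_real t * G1 X)
      + (F2 (act_col m N (Ut N v t) X) - F2 X - 2 * \<i> * complex_of_real t * G2 X)"
      by (simp add: algebra_simps)
    also have "cmod \<dots> \<le> C1 * t\<^sup>2 + C2 * t\<^sup>2"
      by (rule order_trans[OF norm_triangle_ineq], rule add_mono) (use c1 c2 in auto)
    finally show "cmod (F1 (act_col m N (Ut N v t) X) + F2 (act_col m N (Ut N v t) X) - (F1 X + F2 X) - 2 * \<i> * complex_of_real t * (G1 X + G2 X)) \<le> (C1 + C2) * t\<^sup>2"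
      by (simp only: distrib_right)
  qed
qed

lemma fo_mult:
  assumes "fo N v F1 G1" "fo N v F2 G2"
  shows "fo N v (\<lambda>X. F1 X * F2 X) (\<lambda>X. G1 X * F2 X + F1 X * G2 X)"
proof -
  obtain C1 where C1: "\<And>X t. X \<in> bdry N \<Longrightarrow> 0 < t \<Longrightarrow> t \<le> 1 \<Longrightarrow> cmod (F1 X) \<le> C1 \<and> cmod (G1 X) \<le> C1 \<and>
     cmod (F1 (act_col m N (Ut N v t) X) - F1 X - 2 * \<i> * complex_of_real t * G1 X) \<le> C1 * t\<^sup>2"
    using assms(1) unfolding fo_def by blast
  obtain C2 where C2: "\<And>X t. X \<in> bdry N \<Longrightarrow> 0 < t \<Longrightarrow> t \<le> 1 \<Longrightarrow> cmod (F2 X) \<le> C2 \<and> cmod (G2 X) \<le> C2 \<and>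
     cmod (F2 (act_col m N (Ut N v t) X) - F2 X - 2 * \<i> * complex_of_real t * G2 X) \<le> C2 * t\<^sup>2"
    using assms(2) unfolding fo_def by blast
  show ?thesis unfolding fo_def
  \<comment> \<open>11 = 4 + 4 + 3, the coefficients of the three remainder terms estimated
    below.\<close>
  proof (intro exI[of _ "11 * (C1 * C2)"] ballI allI impI conjI)
    fix X and t :: real assume X: "X \<in> bdry N" and t: "0 < t \<and> t \<le> 1"
    note c1 = C1[OF X conjunct1[OF t] conjunct2[OF t]] and c2 = C2[OF X conjunct1[OF t] conjunct2[OF t]]
    have C: "C1 \<ge> 0" "C2 \<ge> 0" "C1 * C2 \<ge> 0" proof -
      show "C1 \<ge> 0" using c1 norm_ge_zero[of "F1 X"] by linarith
      moreover show "C2 \<ge> 0" using c2 norm_ge_zero[of "F2 X"] by linarith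
      ultimately show "C1 * C2 \<ge> 0" by simp
    qed
    have m1: "cmod (F1 X) * cmod (F2 X) \<le> C1 * C2" "cmod (G1 X) * cmod (F2 X) \<le> C1 * C2"
        "cmod (F1 X) * cmod (G2 X) \<le> C1 * C2" "cmod (G1 X) * cmod (G2 X) \<le> C1 * C2"
      using c1 c2 C by (auto intro!: mult_mono)
    show "cmod (F1 X * F2 X) \<le> 11 * (C1 * C2)" unfolding norm_mult using m1 C(3) by linarith
    show "cmod (G1 X * F2 X + F1 X * G2 X) \<le> 11 * (C1 * C2)"
      using m1 C(3) norm_triangle_ineq[of "G1 X * F2 X" "F1 X * G2 X"] unfolding norm_mult by linarith
    define \<tau> where "\<tau> = 2 * \<i> * complex_of_real t"
    have \<tau>: "cmod \<tau> = 2 * t" using t by (simp add: \<tau>_def norm_mult)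
    define a where "a = F1 (act_col m N (Ut N v t) X) - F1 X - \<tau> * G1 X"
    define b where "b = F2 (act_col m N (Ut N v t) X) - F2 X - \<tau> * G2 X"
    have ab: "cmod a \<le> C1 * t\<^sup>2" "cmod b \<le> C2 * t\<^sup>2" using c1 c2 by (auto simp: a_def b_def \<tau>_def)
    have t2: "t\<^sup>2 \<le> 1" using t by (simp add: power_le_one)
    have F2': "cmod (F2 X + \<tau> * G2 X + b) \<le> 4 * C2"
    proof -
      have "cmod (F2 X + \<tau> * G2 X + b) \<le> cmod (F2 X) + cmod \<tau> * cmod (G2 X) + cmod b"
        by (metis norm_add_rule_thm norm_mult norm_triangle_le order_refl)
      also have "cmod \<tau> * cmod (G2 X) \<le> 2 * C2" unfolding \<tau> using t c2 C by (intro mult_mono) auto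
      also have "cmod b \<le> C2 * 1" using ab t2 C by (meson mult_left_mono order_trans)
      finally show ?thesis using c2 by simp
    qed
    have F1': "cmod (F1 X + \<tau> * G1 X) \<le> 3 * C1"
    proof -
      have "cmod (F1 X + \<tau> * G1 X) \<le> cmod (F1 X) + cmod \<tau> * cmod (G1 X)"
        by (metis norm_mult norm_triangle_ineq)
      also have "cmod \<tau> * cmod (G1 X) \<le> 2 * C1" unfolding \<tau> using t c1 C by (intro mult_mono) auto
      finally show ?thesis using c1 by simp
    qed
    have e: "F1 (act_col m N (Ut N v t) X) = F1 X + \<tau> * G1 X + a" "F2 (act_col m N (Ut N v t) X) = F2 X + \<tau> * G2 X + b"
      by (simp_all add: a_def b_def)
    have gen: "(x + \<tau> * x' + a) * (y + \<tau> * y' + b) - x * y - \<tau> * (x' * y + x * y')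
       = \<tau> * \<tau> * (x' * y') + a * (y + \<tau> * y' + b) + (x + \<tau> * x') * b" for x x' y y' :: complex
      by (simp add: algebra_simps)
    have "F1 (act_col m N (Ut N v t) X) * F2 (act_col m N (Ut N v t) X) - F1 X * F2 X - \<tau> * (G1 X * F2 X + F1 X * G2 X)
      = \<tau> * \<tau> * (G1 X * G2 X) + a * (F2 X + \<tau> * G2 X + b) + (F1 X + \<tau> * G1 X) * b"
      unfolding e by (rule gen)
    also have "cmod \<dots> \<le> cmod (\<tau> * \<tau> * (G1 X * G2 X)) + cmod (a * (F2 X + \<tau> * G2 X + b)) + cmod ((F1 X + \<tau> * G1 X) * b)"
      by (meson add_mono norm_triangle_ineq order_refl order_trans)
    also have "\<dots> \<le> 4 * t\<^sup>2 * (C1 * C2) + (C1 * t\<^sup>2) * (4 * C2) + (3 * C1) * (C2 * t\<^sup>2)"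
    proof (intro add_mono)
      show "cmod (\<tau> * \<tau> * (G1 X * G2 X)) \<le> 4 * t\<^sup>2 * (C1 * C2)"
        using m1 by (simp add: norm_mult \<tau> power2_eq_square mult_left_mono)
      show "cmod (a * (F2 X + \<tau> * G2 X + b)) \<le> (C1 * t\<^sup>2) * (4 * C2)"
        unfolding norm_mult using ab F2' C by (intro mult_mono) auto
      show "cmod ((F1 X + \<tau> * G1 X) * b) \<le> (3 * C1) * (C2 * t\<^sup>2)"
        unfolding norm_mult using ab F1' C by (intro mult_mono) auto
    qed
    also have "\<dots> = 11 * (C1 * C2) * t\<^sup>2" by (simp add: algebra_simps)
    finally show "cmod (F1 (act_col m N (Ut N v t) X) * F2 (act_col m N (Ut N v t) X) - F1 X * F2 X - 2 * \<i> * complex_of_real t * (G1 X * F2 X + F1 X * G2 X)) \<le> 11 * (C1 * C2) * t\<^sup>2"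
      unfolding \<tau>_def .
  qed
qed

lemma fo_sum:
  "finite I \<Longrightarrow> (\<And>x. x \<in> I \<Longrightarrow> fo N v (F x) (G x)) \<Longrightarrow> fo N v (\<lambda>X. \<Sum>x\<in>I. F x X) (\<lambda>X. \<Sum>x\<in>I. G x X)"
proof (induction I rule: finite_induct)
  case empty
  then show ?case using fo_const[of N v 0] by simp
next
  case (insert x I)
  then show ?case using fo_add[of N v "F x" "G x"] by simp
qed

lemma fo_cong:
  assumes "fo N v F G" "\<And>X. F X = F' X" "\<And>X. X \<in> bdry N \<Longrightarrow> G X = G' X" shows "fo N v F' G'"
proof -
  have "F = F'" using assms(2) by auto
  then show ?thesis using assms(1,3) unfolding fo_def by simp
qed

lemma fo_entry:
  assumes "j < m" "i < N" "k < N"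
  shows "fo N v (\<lambda>X. X j i k) (\<lambda>X. v (j*N+i) * (\<Sum>l<m*N. cnj (v l) * X (l div N) (l mod N) k))"
proof -
  obtain C where C: "C \<ge> 0" "\<And>t. 0 < t \<Longrightarrow> t \<le> 1 \<Longrightarrow> cmod (rot N v t - 2 * \<i> * t) \<le> C * t\<^sup>2"
    using rot_expand[of N v] by blast
  define G where "G X = v (j*N+i) * (\<Sum>l<m*N. cnj (v l) * X (l div N) (l mod N) k)" for X :: ctup
  define B where "B = cmod (v (j*N+i)) * (\<Sum>l<m*N. cmod (v l)) "
  have B: "B \<ge> 0" by (simp add: B_def sum_nonneg)
  have GB: "cmod (G X) \<le> B" if X: "X \<in> bdry N" for X
  proof -
    have "cmod (\<Sum>l<m*N. cnj (v l) * X (l div N) (l mod N) k) \<le> (\<Sum>l<m*N. cmod (v l))"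
    proof (intro order_trans[OF norm_sum] sum_mono)
      fix l assume "l \<in> {..<m*N}"
      then have "l mod N < N" using assms by simp
      then have "cmod (X (l div N) (l mod N) k) \<le> 1"
        using bdry_contr[OF X] assms contr_entry unfolding contr_tup_def by blast
      then show "cmod (cnj (v l) * X (l div N) (l mod N) k) \<le> cmod (v l)"
        by (simp add: norm_mult mult_left_le)
    qed
    then show ?thesis unfolding G_def B_def norm_mult by (intro mult_left_mono) auto
  qed
  show ?thesis unfolding fo_def G_def[symmetric]
  proof (intro exI[of _ "1 + B + C * B"] ballI allI impI conjI)
    fix X and t :: real assume X: "X \<in> bdry N" and t: "0 < t \<and> t \<le> 1"
    have "cmod (X j i k) \<le> 1" using bdry_contr[OF X] assms contr_entry unfolding contr_tup_def by blast
    then show "cmod (X j i k) \<le> 1 + B + C * B" using B C by (simp add: add_increasing2)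
    show "cmod (G X) \<le> 1 + B + C * B" using GB[OF X] B C by (simp add: add_increasing2)
    have "act_col m N (Ut N v t) X j i k - X j i k - 2 * \<i> * t * G X = (rot N v t - 2 * \<i> * t) * G X"
      unfolding act_Ut[OF assms] G_def[symmetric] by (simp add: algebra_simps)
    then have "cmod (act_col m N (Ut N v t) X j i k - X j i k - 2 * \<i> * t * G X) = cmod (rot N v t - 2 * \<i> * t) * cmod (G X)"
      by (simp only: norm_mult)
    also have "\<dots> \<le> (C * t\<^sup>2) * B"
      by (intro mult_mono C GB X) (use t C in auto)
    also have "\<dots> \<le> (1 + B + C * B) * t\<^sup>2" using B by (simp add: algebra_simps)
    finally show "cmod (act_col m N (Ut N v t) X j i k - X j i k - 2 * \<i> * t * G X) \<le> (1 + B + C * B) * t\<^sup>2" .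
  qed
qed

lemma fo_cnj:
  assumes "fo N v F G" shows "fo N v (\<lambda>X. cnj (F X)) (\<lambda>X. - cnj (G X))"
proof -
  obtain C where C: "\<And>X t. X \<in> bdry N \<Longrightarrow> 0 < t \<Longrightarrow> t \<le> 1 \<Longrightarrow> cmod (F X) \<le> C \<and> cmod (G X) \<le> C \<and>
     cmod (F (act_col m N (Ut N v t) X) - F X - 2 * \<i> * complex_of_real t * G X) \<le> C * t\<^sup>2"
    using assms unfolding fo_def by blast
  have e: "cnj (F (act_col m N (Ut N v t) X)) - cnj (F X) - 2 * \<i> * complex_of_real t * - cnj (G X)
     = cnj (F (act_col m N (Ut N v t) X) - F X - 2 * \<i> * complex_of_real t * G X)" for t X
    by simp
  show ?thesis unfolding fo_def e complex_mod_cnj norm_minus_cancel using C by blast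
qed

lemma fo_zero_letter:
  assumes "\<not> (fst x < m \<and> i < N \<and> k < N)"
  shows "fo N v (\<lambda>X. lt X x i k) (\<lambda>X. dlt m N v v X x i k)"
proof -
  have "lt X x i k = 0" if "X \<in> bdry N" for X
  proof (cases "fst x < m")
    case True
    then show ?thesis using assms is_mat_lt[OF bdry_tup[OF that], of x] by (auto simp: is_mat_def not_less)
  next
    case False
    then have "X (fst x) = (\<lambda>i k. 0)" using bdry_tup[OF that] by (simp add: is_tup_def)
    then show ?thesis by (simp add: lt_def madj_def)
  qed
  moreover have "lt (act_col m N U X) x i k = 0" for U X
    using assms by (auto simp: lt_def madj_def act_col_def)
  moreover have "dlt m N v v X x i k = 0" for X using assms by (auto simp: dlt_def)
  ultimately show ?thesis unfolding fo_def by (intro exI[of _ 0]) simp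
qed

lemma fo_lt: "fo N v (\<lambda>X. lt X x i k) (\<lambda>X. dlt m N v v X x i k)"
proof (cases "fst x < m \<and> i < N \<and> k < N")
  case True
  show ?thesis
  proof (cases "snd x")
    case False
    show ?thesis
      by (rule fo_cong[OF fo_entry[of "fst x" i N k v]]) (use True False in \<open>auto simp: lt_def dlt_def\<close>)
  next
    case s: True
    show ?thesis
      by (rule fo_cong[OF fo_cnj[OF fo_entry[of "fst x" k N i v]]])
         (use True s in \<open>auto simp: lt_def madj_def dlt_def mult.commute\<close>)
  qed
next
  case False
  then show ?thesis by (rule fo_zero_letter)
qed

lemma fo_W: "fo N v (\<lambda>X. W N X w i k) (\<lambda>X. dW m N v v X w i k)"
proof (induction w arbitrary: i k)
  case Nil
  then show ?case using fo_const[of N v "mid N i k"] by (simp add: mzero_def)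
next
  case (Cons x w)
  have "fo N v (\<lambda>X. \<Sum>l<N. lt X x i l * W N X w l k) (\<lambda>X. \<Sum>l<N. dlt m N v v X x i l * W N X w l k + lt X x i l * dW m N v v X w l k)"
    by (intro fo_sum fo_mult fo_lt Cons) auto
  then show ?case by (simp add: mmul_def madd_def sum.distrib)
qed

lemma fo_ntr_W: "fo N v (\<lambda>X. ntr N (W N X w)) (\<lambda>X. ntr N (dW m N v v X w))"
proof -
  have "fo N v (\<lambda>X. (\<Sum>i<N. W N X w i i) * inverse (of_nat N)) (\<lambda>X. (\<Sum>i<N. dW m N v v X w i i) * inverse (of_nat N) + (\<Sum>i<N. W N X w i i) * 0)"
    by (intro fo_mult fo_sum fo_W fo_const) auto
  then show ?thesis by (simp add: ntr_def mtrace_def divide_inverse)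
qed

lemma fo_T: "fo N v (\<lambda>X. T N X ws) (\<lambda>X. dT m N v v X ws)"
proof (induction ws)
  case Nil
  then show ?case using fo_const[of N v 1] by simp
next
  case (Cons w ws)
  then show ?case using fo_mult[OF fo_ntr_W Cons] by simp
qed

lemma bounded_integrable:
  fixes F :: "ctup \<Rightarrow> complex"
  assumes M: "inv_meas N M" and F: "F \<in> borel_measurable borel" and b: "\<And>X. X \<in> bdry N \<Longrightarrow> cmod (F X) \<le> B"
  shows "integrable M F" "cmod (\<integral>X. F X \<partial>M) \<le> B"
proof -
  interpret prob_space M using M by (simp add: inv_meas_def)
  have ae: "AE X in M. cmod (F X) \<le> B" using M b unfolding inv_meas_def by (auto elim: eventually_mono)
  have meas: "F \<in> borel_measurable M" using M F unfolding inv_meas_def by (simp cong: measurable_cong_sets)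
  show i: "integrable M F" by (rule integrable_const_bound[OF ae meas])
  have "cmod (\<integral>X. F X \<partial>M) \<le> (\<integral>X. cmod (F X) \<partial>M)" by (rule integral_norm_bound)
  also have "\<dots> \<le> (\<integral>X. B \<partial>M)" using i ae by (intro integral_mono_AE) auto
  finally show "cmod (\<integral>X. F X \<partial>M) \<le> B" by (simp add: prob_space)
qed

lemma inv_meas_integral:
  fixes F :: "ctup \<Rightarrow> complex"
  assumes M: "inv_meas N M" and F: "F \<in> borel_measurable borel" and U: "U \<in> grp N"
  shows "(\<integral>X. F (act_col m N U X) \<partial>M) = (\<integral>X. F X \<partial>M)"
proof -
  have d: "distr M borel (act_col m N U) = M" using M U by (simp add: inv_meas_def)
  have "act_col m N U \<in> measurable M borel" using M measurable_act_col unfolding inv_meas_def by (simp cong: measurable_cong_sets)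
  then have "(\<integral>X. F X \<partial>distr M borel (act_col m N U)) = (\<integral>X. F (act_col m N U X) \<partial>M)"
    by (rule integral_distr[OF _ F])
  then show ?thesis unfolding d by simp
qed

text \<open>The integral of F does not change along \<open>Ut\<close>, so 2it times the integral of
  G is of order t^2. Division by t and t -> 0 leave zero.\<close>

lemma fo_integral:
  assumes M: "inv_meas N M" and F: "fo N v F G" "F \<in> borel_measurable borel" "G \<in> borel_measurable borel"
    and v: "\<And>a b. a < m*N \<Longrightarrow> b < m*N \<Longrightarrow> v a \<noteq> 0 \<Longrightarrow> v b \<noteq> 0 \<Longrightarrow> cl (a div N) = cl (b div N)"
  shows "integrable M G" "(\<integral>X. G X \<partial>M) = 0"
proof -
  obtain C where C: "\<And>X t. X \<in> bdry N \<Longrightarrow> 0 < t \<Longrightarrow> t \<le> 1 \<Longrightarrow> cmod (F X) \<le> C \<and> cmod (G X) \<le> C \<and>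
     cmod (F (act_col m N (Ut N v t) X) - F X - 2 * \<i> * complex_of_real t * G X) \<le> C * t\<^sup>2"
    using F unfolding fo_def by blast
  have FC: "cmod (F X) \<le> C" "cmod (G X) \<le> C" if "X \<in> bdry N" for X using C[OF that, of 1] by auto
  show iG: "integrable M G" using bounded_integrable[OF M F(3) FC(2)] by blast
  have iF: "integrable M F" using bounded_integrable[OF M F(2) FC(1)] by blast
  have key: "2 * t * cmod (\<integral>X. G X \<partial>M) \<le> C * t\<^sup>2" if t: "0 < t" "t \<le> 1" for t
  proof -
    let ?U = "Ut N v t"
    have m': "(\<lambda>X. F (act_col m N ?U X)) \<in> borel_measurable borel"
      using measurable_compose[OF measurable_act_col F(2)] .
    define D where "D X = F (act_col m N ?U X) - F X - 2 * \<i> * complex_of_real t * G X" for X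
    have mD: "D \<in> borel_measurable borel" unfolding D_def
      by (intro borel_measurable_diff borel_measurable_times borel_measurable_const m' F)
    have D: "integrable M D" "cmod (\<integral>X. D X \<partial>M) \<le> C * t\<^sup>2"
      using bounded_integrable[OF M mD] C t unfolding D_def by blast+
    have "integrable M (\<lambda>X. D X + F X + 2 * \<i> * complex_of_real t * G X)"
      using D(1) iF iG by simp
    then have iU: "integrable M (\<lambda>X. F (act_col m N ?U X))" by (simp add: D_def)
    have "(\<integral>X. D X \<partial>M) = (\<integral>X. F (act_col m N ?U X) \<partial>M) - (\<integral>X. F X \<partial>M) - 2 * \<i> * complex_of_real t * (\<integral>X. G X \<partial>M)"
      unfolding D_def using iU iF iG by simp
    also have "\<dots> = - (2 * \<i> * complex_of_real t * (\<integral>X. G X \<partial>M))"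
      using inv_meas_integral[OF M F(2) Ut_grp[OF v]] by simp
    finally have "cmod (\<integral>X. D X \<partial>M) = 2 * t * cmod (\<integral>X. G X \<partial>M)"
      using t by (simp add: norm_mult)
    then show ?thesis using D(2) by simp
  qed
  show "(\<integral>X. G X \<partial>M) = 0"
  proof (rule ccontr)
    assume "(\<integral>X. G X \<partial>M) \<noteq> 0"
    then have g: "cmod (\<integral>X. G X \<partial>M) > 0" by simp
    define g where "g = cmod (\<integral>X. G X \<partial>M)"
    have g0: "g > 0" using g by (simp add: g_def)
    have "2 * cmod (\<integral>X. G X \<partial>M) \<le> C" using key[of 1] by simp
    then have C0: "C > 0" using g by linarith
    \<comment> \<open>At this t the estimate 2g <= C t collides with C t <= g.\<close>
    define t where "t = min 1 (g / C)"
    have t: "0 < t" "t \<le> 1" "C * t \<le> g" using g0 C0 by (auto simp: t_def min_def field_simps)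
    have "2 * g \<le> C * t" using key[OF t(1,2)] t(1) unfolding g_def[symmetric] by (simp add: power2_eq_square)
    then show False using t(3) g0 by simp
  qed
qed

end

section \<open>Trace moments for large N\<close>

definition posw :: "letter list \<Rightarrow> bool" where "posw w \<longleftrightarrow> (\<forall>x\<in>set w. \<not> snd x)"
definition negw :: "letter list \<Rightarrow> bool" where "negw w \<longleftrightarrow> (\<forall>x\<in>set w. snd x)"

lemma T_adjw: "is_tup m N X \<Longrightarrow> T N X (map adjw ws) = cnj (T N X ws)"
  by (induction ws) (simp_all add: W_adjw ntr_madj)

context nc_dom
begin

text \<open>The loop equation. \<open>fo_integral\<close> is applied to an entry (a, b) of R times
  \<open>T\<close>, and polarisation turns the rank one directions v v^* into matrix units. Summed
  over a and b, the derivative of R gives N^2 times \<open>sd\<close>, while the derivative of the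
  remaining traces stays bounded by \<open>sum_dT_bound\<close>; hence the rate 1/N^2.\<close>

lemma sd_est:
  assumes M: "inv_meas N M" and N: "N > 0" and ji: "j < m" "i < m" "cl j = cl i"
  shows "cmod (\<integral>X. sd N X j i [] R * T N X ws \<partial>M) \<le> 2 * real (sum_list (map length ws)) / (real N)\<^sup>2"
proof -
  define G where "G a b u v X = dW m N u v X R a b * T N X ws + W N X R a b * dT m N u v X ws" for a b u v X
  have polG: "pol (\<lambda>u v. G a b u v X)" for a b X
    unfolding G_def by (intro pol_add pol_cmult pol_cmult2 pol_dW pol_dT)
  have mG: "G a b u v \<in> borel_measurable borel" for a b u v
    unfolding G_def[abs_def] by (intro borel_measurable_add borel_measurable_times measurable_dW measurable_T measurable_W measurable_dT)
  have "integrable M (G a b (unv (j*N+a)) (unv (i*N+b))) \<and> (\<integral>X. G a b (unv (j*N+a)) (unv (i*N+b)) X \<partial>M) = 0"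
    if ab: "a < N" "b < N" for a b
  proof -
    let ?u = "unv (j*N+a)" and ?w = "unv (i*N+b)"
    \<comment> \<open>The four polarisation vectors. Both unit vectors sit in the class of j and i,
      so each combination is supported in one class and \<open>Ut\<close> stays in the
      group.\<close>
    define v where "v k = (\<lambda>l. ?u l + \<i> ^ k * ?w l)" for k :: nat
    have supp: "cl (l div N) = cl j" if "v k l \<noteq> 0" for k l
      using that ab ji by (auto simp: v_def unv_def div_mod_flat split: if_splits)
    have fo: "fo N (v k) (\<lambda>X. W N X R a b * T N X ws) (G a b (v k) (v k))" for k
      unfolding G_def[abs_def] by (intro fo_mult fo_W fo_T)
    have mF: "(\<lambda>X. W N X R a b * T N X ws) \<in> borel_measurable borel"
      by (intro borel_measurable_times measurable_W measurable_T)
    have int: "integrable M (G a b (v k) (v k))" "(\<integral>X. G a b (v k) (v k) X \<partial>M) = 0" for k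
      using fo_integral[OF M fo mF mG] supp by metis+
    have e: "G a b ?u ?w X = (\<Sum>k<4::nat. \<i> ^ k * G a b (v k) (v k) X) / 4" for X
      using polG[of a b X] unfolding pol_def v_def by simp
    have e': "G a b ?u ?w = (\<lambda>X. (\<Sum>k<4::nat. \<i> ^ k * G a b (v k) (v k) X) / 4)" using e by blast
    have "integrable M (\<lambda>X. (\<Sum>k<4::nat. \<i> ^ k * G a b (v k) (v k) X) / 4)"
      by (intro integrable_divide Bochner_Integration.integrable_sum integrable_mult_right int(1))
    moreover have "(\<integral>X. (\<Sum>k<4::nat. \<i> ^ k * G a b (v k) (v k) X) / 4 \<partial>M) = 0"
      using int by simp
    ultimately show ?thesis unfolding e' by simp
  qed
  then have Gi: "integrable M (G a b (unv (j*N+a)) (unv (i*N+b)))" "(\<integral>X. G a b (unv (j*N+a)) (unv (i*N+b)) X \<partial>M) = 0"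
    if "a < N" "b < N" for a b using that by auto
  define H where "H X = (\<Sum>a<N. \<Sum>b<N. W N X R a b * dT m N (unv (j*N+a)) (unv (i*N+b)) X ws)" for X
  define S where "S X = (of_nat N)\<^sup>2 * (sd N X j i [] R * T N X ws)" for X
  let ?L = "2 * real (sum_list (map length ws))"
  have mH: "H \<in> borel_measurable borel" unfolding H_def[abs_def]
    by (intro borel_measurable_sum borel_measurable_times measurable_W measurable_dT)
  have HB: "cmod (H X) \<le> ?L" if "X \<in> bdry N" for X
    unfolding H_def by (rule sum_dT_bound[OF ji(1,2) bdry_tup[OF that] bdry_contr[OF that] contr_W[OF bdry_contr[OF that]]])
  note H = bounded_integrable[OF M mH HB]
  have sum: "(\<Sum>a<N. \<Sum>b<N. G a b (unv (j*N+a)) (unv (i*N+b)) X) = S X + H X" if X: "X \<in> bdry N" for X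
  proof -
    have "(\<Sum>a<N. \<Sum>b<N. dW m N (unv (j*N+a)) (unv (i*N+b)) X R a b) = (of_nat N)\<^sup>2 * sd N X j i [] R"
      using sum_dW_diag[OF ji(1,2) bdry_tup[OF X], of "[]" R] by (simp add: mmul_mid_left is_mat_dW[OF bdry_tup[OF X]])
    then show ?thesis by (simp add: G_def sum.distrib H_def S_def sum_distrib_right[symmetric] mult.assoc[symmetric])
  qed
  have iG: "integrable M (\<lambda>X. \<Sum>a<N. \<Sum>b<N. G a b (unv (j*N+a)) (unv (i*N+b)) X)"
    by (intro Bochner_Integration.integrable_sum Gi) auto
  have zG: "(\<integral>X. (\<Sum>a<N. \<Sum>b<N. G a b (unv (j*N+a)) (unv (i*N+b)) X) \<partial>M) = 0"
    by (subst Bochner_Integration.integral_sum, use iG Gi in auto)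
  have ae: "AE X in M. X \<in> bdry N" using M by (simp add: inv_meas_def)
  have cong: "f \<in> borel_measurable borel \<Longrightarrow> f \<in> borel_measurable M" for f :: "ctup \<Rightarrow> complex"
    using M unfolding inv_meas_def by (simp cong: measurable_cong_sets)
  have mS: "S \<in> borel_measurable borel" unfolding S_def[abs_def]
    by (intro borel_measurable_times borel_measurable_const measurable_sd measurable_T)
  have mSum: "(\<lambda>X. \<Sum>a<N. \<Sum>b<N. G a b (unv (j*N+a)) (unv (i*N+b)) X) \<in> borel_measurable borel"
    by (intro borel_measurable_sum mG)
  have "(\<integral>X. S X + H X \<partial>M) = 0"
    unfolding zG[symmetric]
  proof (rule integral_cong_AE)
    show "(\<lambda>X. S X + H X) \<in> borel_measurable M" "(\<lambda>X. \<Sum>a<N. \<Sum>b<N. G a b (unv (j*N+a)) (unv (i*N+b)) X) \<in> borel_measurable M"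
      by (intro cong borel_measurable_add mS mH mSum)+
    show "AE X in M. S X + H X = (\<Sum>a<N. \<Sum>b<N. G a b (unv (j*N+a)) (unv (i*N+b)) X)"
      using ae by eventually_elim (simp only: sum)
  qed
  moreover have iSH: "integrable M (\<lambda>X. S X + H X)"
  proof (rule Bochner_Integration.integrable_cong_AE_imp[OF iG])
    show "(\<lambda>X. S X + H X) \<in> borel_measurable M" by (intro cong borel_measurable_add mS mH)
    show "AE X in M. (\<Sum>a<N. \<Sum>b<N. G a b (unv (j*N+a)) (unv (i*N+b)) X) = S X + H X"
      using ae by eventually_elim (simp only: sum)
  qed
  moreover have iS: "integrable M S" using Bochner_Integration.integrable_diff[OF iSH H(1)] by simp
  ultimately have "(\<integral>X. S X \<partial>M) = - (\<integral>X. H X \<partial>M)"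
    using Bochner_Integration.integral_add[OF iS H(1)] by (simp only: eq_neg_iff_add_eq_0)
  then have "cmod (\<integral>X. S X \<partial>M) \<le> ?L" using H(2) by simp
  moreover have "(\<integral>X. S X \<partial>M) = (of_nat N)\<^sup>2 * (\<integral>X. sd N X j i [] R * T N X ws \<partial>M)"
    unfolding S_def by (rule integral_mult_right_zero)
  ultimately have "(real N)\<^sup>2 * cmod (\<integral>X. sd N X j i [] R * T N X ws \<partial>M) \<le> ?L"
    by (simp only: norm_mult norm_power norm_of_nat)
  then show ?thesis using N by (simp add: pos_le_divide_eq mult.commute)
qed

end

locale nc_meas = nc_dom +
  fixes \<omega> :: "nat \<Rightarrow> ctup measure" and d :: nat
  assumes inv: "\<And>N. 0 < N \<Longrightarrow> inv_meas N (\<omega> N)"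
    and card_cls: "\<And>j. j < m \<Longrightarrow> card (cls j) = d"
begin

text \<open>Asymptotically null in mean. The uniform bound and measurability belong to the notion
  because they give integrability, hence closure under sums.\<close>

definition tz :: "(nat \<Rightarrow> ctup \<Rightarrow> complex) \<Rightarrow> bool" where
  "tz F \<longleftrightarrow> ((\<lambda>N. \<integral>X. F N X \<partial>\<omega> N) \<longlongrightarrow> 0) sequentially \<and> (\<exists>B. \<forall>N X. X \<in> bdry N \<longrightarrow> cmod (F N X) \<le> B)
     \<and> (\<forall>N. F N \<in> borel_measurable borel)"

lemma tz_integrable: "tz F \<Longrightarrow> N > 0 \<Longrightarrow> integrable (\<omega> N) (F N)"
  unfolding tz_def using bounded_integrable(1)[OF inv] by blast

lemma tz_add: assumes "tz F" "tz G" shows "tz (\<lambda>N X. F N X + G N X)"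
proof -
  have "((\<lambda>N. (\<integral>X. F N X \<partial>\<omega> N) + (\<integral>X. G N X \<partial>\<omega> N)) \<longlongrightarrow> 0 + 0) sequentially"
    using assms unfolding tz_def by (intro tendsto_add) auto
  moreover have "\<forall>\<^sub>F N in sequentially. (\<integral>X. F N X \<partial>\<omega> N) + (\<integral>X. G N X \<partial>\<omega> N) = (\<integral>X. F N X + G N X \<partial>\<omega> N)"
    using eventually_gt_at_top[of 0] by eventually_elim (simp add: tz_integrable[OF assms(1)] tz_integrable[OF assms(2)])
  ultimately have 1: "((\<lambda>N. \<integral>X. F N X + G N X \<partial>\<omega> N) \<longlongrightarrow> 0) sequentially"
    by (simp only: add_0) (blast intro: Lim_transform_eventually)
  obtain B B' where "\<And>N X. X \<in> bdry N \<Longrightarrow> cmod (F N X) \<le> B" "\<And>N X. X \<in> bdry N \<Longrightarrow> cmod (G N X) \<le> B'"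
    using assms unfolding tz_def by blast
  then have "\<And>N X. X \<in> bdry N \<Longrightarrow> cmod (F N X + G N X) \<le> B + B'"
    by (meson add_mono norm_triangle_ineq order_trans)
  then show ?thesis using 1 assms unfolding tz_def by (auto intro!: borel_measurable_add)
qed

lemma tz_uminus: "tz F \<Longrightarrow> tz (\<lambda>N X. - F N X)"
  unfolding tz_def using tendsto_minus by fastforce

lemma tz_diff: "tz F \<Longrightarrow> tz G \<Longrightarrow> tz (\<lambda>N X. F N X - G N X)"
  using tz_add[OF _ tz_uminus] by simp

lemma tz_zero: "tz (\<lambda>N X. 0)"
  unfolding tz_def by auto

lemma tz_sum: "finite I \<Longrightarrow> (\<And>x. x \<in> I \<Longrightarrow> tz (F x)) \<Longrightarrow> tz (\<lambda>N X. \<Sum>x\<in>I. F x N X)"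
  by (induction I rule: finite_induct) (auto intro: tz_add tz_zero)

text \<open>The measure at level 0 is unconstrained, so the two functions are compared from level 1
  on. The bound at level 0 is supplied separately because \<open>tz\<close> asks for one bound over
  all N.\<close>

lemma tz_cong: 
  assumes "tz F" "\<And>N X. N > 0 \<Longrightarrow> X \<in> bdry N \<Longrightarrow> F N X = G N X" "\<And>N. G N \<in> borel_measurable borel" "\<And>X. X \<in> bdry 0 \<Longrightarrow> cmod (G 0 X) \<le> Bz"
  shows "tz G"
proof -
  have eq: "(\<integral>X. F N X \<partial>\<omega> N) = (\<integral>X. G N X \<partial>\<omega> N)" if N: "N > 0" for N
  proof (rule integral_cong_AE)
    have s: "sets (\<omega> N) = sets borel" using inv[OF N] by (simp add: inv_meas_def)
    show "F N \<in> borel_measurable (\<omega> N)" "G N \<in> borel_measurable (\<omega> N)"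
      using assms(1,3) s unfolding tz_def by (simp_all cong: measurable_cong_sets)
    show "AE X in \<omega> N. F N X = G N X" using inv[OF N] assms(2)[OF N] unfolding inv_meas_def by (auto elim: eventually_mono)
  qed
  have "\<forall>\<^sub>F N in sequentially. (\<integral>X. F N X \<partial>\<omega> N) = (\<integral>X. G N X \<partial>\<omega> N)"
    using eventually_gt_at_top[of 0] by eventually_elim (rule eq)
  then have 1: "((\<lambda>N. \<integral>X. G N X \<partial>\<omega> N) \<longlongrightarrow> 0) sequentially"
    using assms(1) unfolding tz_def by (blast intro: Lim_transform_eventually)
  obtain B where "\<And>N X. X \<in> bdry N \<Longrightarrow> cmod (F N X) \<le> B" using assms(1) unfolding tz_def by blast
  note B = this
  have "cmod (G N X) \<le> max B Bz" if X: "X \<in> bdry N" for N X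
  proof (cases "N = 0")
    case True
    then have "cmod (G N X) \<le> Bz" using assms(4)[of X] X by simp
    then show ?thesis by simp
  next
    case False
    then have "cmod (G N X) \<le> B" using B[OF X] assms(2)[OF _ X] by simp
    then show ?thesis by simp
  qed
  then show ?thesis using 1 assms(3) unfolding tz_def by blast
qed

lemma tz_sd:
  assumes "j < m" "i < m" "cl j = cl i" shows "tz (\<lambda>N X. sd N X j i [] R * T N X ws)"
proof -
  have b: "cmod (sd N X j i p w) \<le> 2 * real (length w)" if X: "X \<in> bdry N" for N X p w
  proof (induction w arbitrary: p)
    case (Cons x w)
    have c: "cmod (ntr N (W N X u)) \<le> 1" for u by (intro contr_ntr contr_W bdry_contr X)
    have c2: "cmod (ntr N (W N X u) * ntr N (W N X u')) \<le> 1" for u u'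
      unfolding norm_mult using mult_mono[OF c[of u] c[of u']] by simp
    have "cmod (sd N X j i p (x # w)) \<le> 1 + 1 + 2 * real (length w)"
      unfolding sd.simps
      by (rule order_trans[OF norm_triangle_ineq], rule add_mono[OF _ Cons],
          rule order_trans[OF norm_triangle_ineq4], rule add_mono)
         (use c2[of p "(i, False) # w"] c2[of "p @ [(j, True)]" w] in \<open>auto simp del: W.simps\<close>)
    then show ?case by simp
  qed simp
  have "cmod (sd N X j i [] R * T N X ws) \<le> 2 * real (length R)" if X: "X \<in> bdry N" for N X
    unfolding norm_mult using mult_mono[OF b[OF X] T_bound[OF bdry_contr[OF X]]] by simp
  moreover have "((\<lambda>N. \<integral>X. sd N X j i [] R * T N X ws \<partial>\<omega> N) \<longlongrightarrow> 0) sequentially"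
  proof (rule Lim_null_comparison)
    show "\<forall>\<^sub>F N in sequentially. norm (\<integral>X. sd N X j i [] R * T N X ws \<partial>\<omega> N) \<le> 2 * real (sum_list (map length ws)) / (real N)\<^sup>2"
      using eventually_gt_at_top[of 0] by eventually_elim (rule sd_est[OF inv _ assms])
    show "((\<lambda>N. 2 * real (sum_list (map length ws)) / (real N)\<^sup>2) \<longlongrightarrow> 0) sequentially"
    proof -
      have "((\<lambda>N. L / (real N)\<^sup>2) \<longlongrightarrow> 0) sequentially" for L :: real by real_asymp
      then show ?thesis .
    qed
  qed
  ultimately show ?thesis unfolding tz_def
    by (auto intro!: borel_measurable_times measurable_sd measurable_T)
qed

text \<open>Positive letters trigger only the first kind of cut. A cut inside q leaves on its left
  the trace of a nonempty positive word shorter than n, which is null by H; so the starting point of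
  \<open>sd\<close> may be moved past q in the limit.\<close>

lemma sd_pos_tail:
  assumes H: "\<And>p ws. posw p \<Longrightarrow> p \<noteq> [] \<Longrightarrow> length p < n \<Longrightarrow> tz (\<lambda>N X. T N X (p # ws))"
    and "posw p" "p \<noteq> []" "posw q" "length p + length q \<le> n"
  shows "tz (\<lambda>N X. (sd N X j i p (q @ rest) - sd N X j i (p @ q) rest) * T N X ws)"
  using assms(2-)
proof (induction q arbitrary: p)
  case Nil
  then show ?case using tz_zero by simp
next
  case (Cons x q)
  have x: "\<not> snd x" using Cons.prems by (simp add: posw_def)
  have 1: "tz (\<lambda>N X. if x = (j, False) then T N X (p # ((i, False) # q @ rest) # ws) else 0)"
    using H[of p "((i, False) # q @ rest) # ws"] Cons.prems tz_zero by (cases "x = (j, False)") auto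
  have 2: "tz (\<lambda>N X. (sd N X j i (p @ [x]) (q @ rest) - sd N X j i ((p @ [x]) @ q) rest) * T N X ws)"
    using Cons.prems by (intro Cons.IH) (auto simp: posw_def)
  have "(if x = (j, False) then T N X (p # ((i, False) # q @ rest) # ws) else 0)
       + (sd N X j i (p @ [x]) (q @ rest) - sd N X j i ((p @ [x]) @ q) rest) * T N X ws
     = (sd N X j i p ((x # q) @ rest) - sd N X j i (p @ x # q) rest) * T N X ws" for N X
    using x by (cases x) (simp add: algebra_simps)
  then show ?case using tz_add[OF 1 2] by simp
qed

lemma T_bdry: "X \<in> bdry N \<Longrightarrow> cmod (T N X ws) \<le> 1"
  by (intro T_bound bdry_contr)

lemma tz_letter_out:
  assumes "x \<in> set p" "\<not> fst x < m" shows "tz (\<lambda>N X. T N X (p # ws))"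
proof -
  have z: "W N X p = mzero" if X: "X \<in> bdry N" for N X
  proof -
    obtain a b where p: "p = a @ x # b" using assms by (meson split_list)
    have "lt X x = mzero" using bdry_tup[OF X] assms by (auto simp: is_tup_def lt_def madj_def mzero_def)
    then show ?thesis unfolding p using bdry_tup[OF X] by (simp add: W_append) (simp add: mmul_def mzero_def)
  qed
  show ?thesis
    by (rule tz_cong[OF tz_zero, where Bz = 1])
       (auto simp: z ntr_def mtrace_def mzero_def intro: measurable_T[of _ "p # ws", simplified] T_bdry[of _ _ "p # ws", simplified])
qed

text \<open>Loop equation with i and j equal to the first letter. The cut before that letter has the
  empty word on its left, whose trace is 1, and returns the whole trace; every other cut contains a
  shorter nonempty positive word, null by induction. Rotation invariance alone would not do, since
  the factors \<open>ws\<close> may compensate the phase.\<close>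

lemma tz_pos: "posw p \<Longrightarrow> p \<noteq> [] \<Longrightarrow> tz (\<lambda>N X. T N X (p # ws))"
proof (induction "length p" arbitrary: p ws rule: less_induct)
  case less
  obtain x q where p: "p = x # q" using less.prems by (cases p) auto
  show ?case
  proof (cases "fst x < m")
    case False
    then show ?thesis using tz_letter_out[of x p] p by simp
  next
    case True
    define j where "j = fst x"
    have x: "x = (j, False)" using less.prems p by (cases x) (auto simp: posw_def j_def)
    have jm: "j < m" using True by (simp add: j_def)
    have t1: "tz (\<lambda>N X. sd N X j j [] p * T N X ws)" by (rule tz_sd) (use jm in auto)
    have t2: "tz (\<lambda>N X. (sd N X j j [x] (q @ []) - sd N X j j ([x] @ q) []) * T N X ws)"
      by (rule sd_pos_tail[where n = "length p"]) (use less p in \<open>auto simp: posw_def\<close>)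
    have t3: "tz (\<lambda>N X. sd N X j j [] p * T N X ws - (sd N X j j [x] (q @ []) - sd N X j j ([x] @ q) []) * T N X ws)"
      by (rule tz_diff[OF t1 t2])
    show ?thesis
    proof (rule tz_cong[OF t3, where Bz = 1])
      fix N X assume "N > (0::nat)"
      then show "sd N X j j [] p * T N X ws - (sd N X j j [x] (q @ []) - sd N X j j ([x] @ q) []) * T N X ws = T N X (p # ws)"
        using p x by (simp add: ntr_mid algebra_simps)
    qed (use measurable_T T_bdry in blast)+
  qed
qed

lemma tz_cnj: "tz F \<Longrightarrow> tz (\<lambda>N X. cnj (F N X))"
proof -
  assume F: "tz F"
  have "((\<lambda>N. cnj (\<integral>X. F N X \<partial>\<omega> N)) \<longlongrightarrow> cnj 0) sequentially"
    using F unfolding tz_def by (intro tendsto_cnj) auto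
  then show ?thesis using F unfolding tz_def by (auto intro: borel_measurable_cnj)
qed

lemma tz_neg:
  assumes "negw p" "p \<noteq> []" shows "tz (\<lambda>N X. T N X (p # ws))"
proof -
  have "tz (\<lambda>N X. T N X (adjw p # map adjw ws))"
    by (rule tz_pos) (use assms in \<open>auto simp: posw_def negw_def adjw_def\<close>)
  from tz_cnj[OF this] show ?thesis
  proof (rule tz_cong[where Bz = 1])
    fix N X assume X: "X \<in> bdry N"
    show "cnj (T N X (adjw p # map adjw ws)) = T N X (p # ws)"
      using W_adjw[OF bdry_tup[OF X], of p] T_adjw[OF bdry_tup[OF X], of ws] by (simp add: ntr_madj)
  qed (use measurable_T T_bdry in blast)+
qed

text \<open>Mirror image of \<open>sd_pos_tail\<close>: a cut at an adjoint letter leaves on its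
  right a negative word, and the trailing letter y keeps that word nonempty, so
  \<open>tz_neg\<close> applies.\<close>

lemma sd_neg_tail:
  assumes "negw q" "snd y"
  shows "tz (\<lambda>N X. (sd N X j i p (q @ [y]) - sd N X j i (p @ q) [y]) * T N X ws)"
  using assms
proof (induction q arbitrary: p)
  case Nil
  then show ?case using tz_zero by simp
next
  case (Cons x q)
  have x: "snd x" using Cons.prems by (simp add: negw_def)
  have 1: "tz (\<lambda>N X. if x = (i, True) then T N X ((q @ [y]) # (p @ [(j, True)]) # ws) else 0)"
    using tz_neg[of "q @ [y]" "(p @ [(j, True)]) # ws"] Cons.prems tz_zero by (cases "x = (i, True)") (auto simp: negw_def)
  have 2: "tz (\<lambda>N X. (sd N X j i (p @ [x]) (q @ [y]) - sd N X j i ((p @ [x]) @ q) [y]) * T N X ws)"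
    using Cons.prems by (intro Cons.IH) (auto simp: negw_def)
  have "(sd N X j i (p @ [x]) (q @ [y]) - sd N X j i ((p @ [x]) @ q) [y]) * T N X ws
      - (if x = (i, True) then T N X ((q @ [y]) # (p @ [(j, True)]) # ws) else 0)
     = (sd N X j i p ((x # q) @ [y]) - sd N X j i (p @ x # q) [y]) * T N X ws" for N X
    using x by (cases x) (simp add: algebra_simps)
  then show ?case using tz_diff[OF 2 1] by simp
qed

text \<open>Loop equation for the word X_j p q X_k^*. Cuts inside p and q are null, so only the two
  cuts that split off an empty word survive: the one at the front replaces X_j by X_i, the one at
  the end requires k = i and replaces X_k^* by X_j^*.\<close>

lemma tz_pos_neg:
  assumes "posw p" "negw q" "j < m" "i < m" "cl j = cl i"
  shows "tz (\<lambda>N X. ntr N (W N X ((i, False) # p @ q @ [(k, True)]))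
      - (if k = i then ntr N (W N X ((j, False) # p @ q @ [(j, True)])) else 0))"
proof -
  let ?r = "q @ [(k, True)]" and ?x = "(j, False)"
  have t1: "tz (\<lambda>N X. sd N X j i [] (?x # p @ ?r) * T N X [])" by (rule tz_sd) (use assms in auto)
  have t2: "tz (\<lambda>N X. (sd N X j i [?x] (p @ ?r) - sd N X j i ([?x] @ p) ?r) * T N X [])"
    by (rule sd_pos_tail[where n = "Suc (length p)"]) (use assms tz_pos in \<open>auto simp: posw_def simp del: T.simps\<close>)
  have t3: "tz (\<lambda>N X. (sd N X j i ([?x] @ p) ?r - sd N X j i (([?x] @ p) @ q) [(k, True)]) * T N X [])"
    by (rule sd_neg_tail) (use assms in auto)
  have t: "tz (\<lambda>N X. sd N X j i [] (?x # p @ ?r) * T N X []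
     - ((sd N X j i [?x] (p @ ?r) - sd N X j i ([?x] @ p) ?r) * T N X []
      + (sd N X j i ([?x] @ p) ?r - sd N X j i (([?x] @ p) @ q) [(k, True)]) * T N X []))"
    by (intro tz_diff tz_add t1 t2 t3)
  show ?thesis
  proof (rule tz_cong[OF t, where Bz = 2])
    fix N X assume N: "N > (0::nat)"
    show "sd N X j i [] (?x # p @ ?r) * T N X []
     - ((sd N X j i [?x] (p @ ?r) - sd N X j i ([?x] @ p) ?r) * T N X []
      + (sd N X j i ([?x] @ p) ?r - sd N X j i (([?x] @ p) @ q) [(k, True)]) * T N X [])
      = ntr N (W N X ((i, False) # p @ q @ [(k, True)]))
      - (if k = i then ntr N (W N X ((j, False) # p @ q @ [(j, True)])) else 0)"
      using N by (simp add: ntr_mid)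
  next
    fix X assume X: "X \<in> bdry 0"
    have "cmod (ntr 0 (W 0 X u)) \<le> 1" for u by (intro contr_ntr contr_W bdry_contr X)
    then show "cmod (ntr 0 (W 0 X ((i, False) # p @ q @ [(k, True)])) - (if k = i then ntr 0 (W 0 X ((j, False) # p @ q @ [(j, True)])) else 0)) \<le> 2"
      by (intro order_trans[OF norm_triangle_ineq4]) (simp add: ntr_def)
  qed (intro borel_measurable_diff borel_measurable_if_const measurable_ntr measurable_W)
qed

text \<open>Spells X^w (X^v)^* as a word in letters; its normalised trace is the inner product of
  the two monomials at level N.\<close>

definition gramw :: "nat list \<Rightarrow> nat list \<Rightarrow> letter list" where
  "gramw w v = map (\<lambda>j. (j, False)) w @ rev (map (\<lambda>j. (j, True)) v)"

text \<open>Induction on both words. Different first letters give zero by \<open>tz_pos_neg\<close>.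
  For a common first letter the limit behaviour is the same for all letters i of its class, and by
  cyclicity the sum over the class contains the sum of X_i^* X_i, which is the identity on the
  boundary. So the d equal contributions add up to the shorter moment, and each step costs a factor
  1/d.\<close>

theorem gram_limit:
  assumes "length w = length v" "set w \<subseteq> {..<m}" "set v \<subseteq> {..<m}"
  shows "((\<lambda>N. \<integral>X. ntr N (W N X (gramw w v)) \<partial>\<omega> N) \<longlongrightarrow> (if w = v then 1 / of_nat d ^ length w else 0)) sequentially"
  using assms
proof (induction w v rule: list_induct2)
  case Nil
  have "\<forall>\<^sub>F N in sequentially. 1 = (\<integral>X. ntr N (W N X (gramw [] [])) \<partial>\<omega> N)"
    using eventually_gt_at_top[of 0]
  proof eventually_elim
    case (elim N)
    interpret prob_space "\<omega> N" using inv[OF elim] by (simp add: inv_meas_def)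
    show ?case using elim by (simp add: gramw_def ntr_mid prob_space)
  qed
  then show ?case by (auto intro: Lim_transform_eventually[OF tendsto_const])
next
  case (Cons a w b v)
  have am: "a < m" "b < m" using Cons.prems by auto
  let ?p = "map (\<lambda>j. (j, False)) w" and ?q = "rev (map (\<lambda>j. (j, True)) v)"
  have pq: "posw ?p" "negw ?q" by (auto simp: posw_def negw_def)
  have g: "gramw (a # w) (b # v) = (a, False) # ?p @ ?q @ [(b, True)]" by (simp add: gramw_def)
  have g': "gramw w v = ?p @ ?q" by (simp add: gramw_def)
  show ?case
  proof (cases "a = b")
    case False
    have "tz (\<lambda>N X. ntr N (W N X ((a, False) # ?p @ ?q @ [(b, True)])) - (if b = a then ntr N (W N X ((a, False) # ?p @ ?q @ [(a, True)])) else 0))"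
      by (rule tz_pos_neg[OF pq am(1) am(1)]) simp
    then show ?thesis using False unfolding tz_def g by auto
  next
    case True
    let ?R = "\<lambda>i. (i, False) # ?p @ ?q @ [(i, True)]"
    have bd: "cmod (ntr N (W N X u)) \<le> 1" if "X \<in> bdry N" for u N X by (intro contr_ntr contr_W bdry_contr that)
    have ms: "(\<lambda>X. ntr N (W N X u)) \<in> borel_measurable borel" for u N by (intro measurable_ntr measurable_W)
    have int: "integrable (\<omega> N) (\<lambda>X. ntr N (W N X u))" if "N > 0" for N u
      using bounded_integrable(1)[OF inv[OF that] ms bd] by blast
    have "tz (\<lambda>N X. ntr N (W N X (?R i)) - ntr N (W N X (?R a)))" if "i \<in> cls a" for i
      using tz_pos_neg[OF pq am(1), of i i] that by (simp add: cls_def)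
    then have t: "tz (\<lambda>N X. \<Sum>i\<in>cls a. (ntr N (W N X (?R i)) - ntr N (W N X (?R a))))"
      by (intro tz_sum) auto
    have tr: "(\<Sum>i\<in>cls a. ntr N (W N X (?R i))) = ntr N (W N X (gramw w v))" if X: "X \<in> bdry N" for N X
    proof -
      have tup: "is_tup m N X" by (rule bdry_tup[OF X])
      let ?Y = "W N X (?p @ ?q)"
      have 1: "ntr N (W N X (?R i)) = ntr N (mmul N ?Y (mmul N (madj (X i)) (X i)))" for i
      proof -
        have "W N X (?R i) = mmul N (X i) (mmul N ?Y (madj (X i)))"
          using W_snoc[OF tup, of "?p @ ?q" "(i, True)"] by (simp add: lt_def)
        then show ?thesis by (simp add: ntr_commute[of N "X i"] mmul_assoc)
      qed
      have "(\<Sum>i\<in>cls a. ntr N (W N X (?R i))) = ntr N (mmul N ?Y (\<lambda>r c. \<Sum>i\<in>cls a. mmul N (madj (X i)) (X i) r c))"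
      proof -
        have "(\<Sum>i\<in>cls a. mtrace N (mmul N ?Y (mmul N (madj (X i)) (X i)))) = mtrace N (mmul N ?Y (\<lambda>r c. \<Sum>i\<in>cls a. mmul N (madj (X i)) (X i) r c))"
          unfolding mtrace_def mmul_def[of N ?Y] sum_distrib_left
          by (subst sum.swap, rule sum.cong[OF refl], rule sum.swap)
        then show ?thesis by (simp only: 1) (simp only: ntr_def sum_divide_distrib[symmetric])
      qed
      also have "(\<lambda>r c. \<Sum>i\<in>cls a. mmul N (madj (X i)) (X i) r c) = mid N"
        using X am by (simp add: bdry_def)
      finally show ?thesis by (simp add: mmul_mid_right is_mat_W[OF tup] g')
    qed
    let ?I = "\<lambda>N u. \<integral>X. ntr N (W N X u) \<partial>\<omega> N"
    have e: "(\<integral>X. (\<Sum>i\<in>cls a. (ntr N (W N X (?R i)) - ntr N (W N X (?R a)))) \<partial>\<omega> N) = ?I N (gramw w v) - of_nat d * ?I N (?R a)" if N: "N > 0" for N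
    proof -
      have "(\<integral>X. (\<Sum>i\<in>cls a. (ntr N (W N X (?R i)) - ntr N (W N X (?R a)))) \<partial>\<omega> N)
        = (\<integral>X. (\<Sum>i\<in>cls a. ntr N (W N X (?R i))) - of_nat d * ntr N (W N X (?R a)) \<partial>\<omega> N)"
        by (simp add: sum_subtractf card_cls am)
      also have "\<dots> = (\<integral>X. (\<Sum>i\<in>cls a. ntr N (W N X (?R i))) \<partial>\<omega> N) - of_nat d * ?I N (?R a)"
      proof -
        have "integrable (\<omega> N) (\<lambda>X. \<Sum>i\<in>cls a. ntr N (W N X (?R i)))" "integrable (\<omega> N) (\<lambda>X. of_nat d * ntr N (W N X (?R a)))"
          by (intro Bochner_Integration.integrable_sum integrable_mult_right int[OF N])+
        from Bochner_Integration.integral_diff[OF this] show ?thesis by (simp only: integral_mult_right_zero)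
      qed
      also have "(\<integral>X. (\<Sum>i\<in>cls a. ntr N (W N X (?R i))) \<partial>\<omega> N) = ?I N (gramw w v)"
      proof (rule integral_cong_AE)
        have s: "sets (\<omega> N) = sets borel" using inv[OF N] by (simp add: inv_meas_def)
        show "(\<lambda>X. \<Sum>i\<in>cls a. ntr N (W N X (?R i))) \<in> borel_measurable (\<omega> N)" "(\<lambda>X. ntr N (W N X (gramw w v))) \<in> borel_measurable (\<omega> N)"
          unfolding measurable_cong_sets[OF s refl] by (intro borel_measurable_sum ms)+
        show "AE X in \<omega> N. (\<Sum>i\<in>cls a. ntr N (W N X (?R i))) = ntr N (W N X (gramw w v))"
          using inv[OF N] tr unfolding inv_meas_def by (auto elim: eventually_mono)
      qed
      finally show ?thesis .
    qed
    have d: "d > 0" using card_cls[OF am(1)] self_cls[OF am(1)] by (metis card_gt_0_iff empty_iff finite_cls)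
    have "((\<lambda>N. \<integral>X. (\<Sum>i\<in>cls a. (ntr N (W N X (?R i)) - ntr N (W N X (?R a)))) \<partial>\<omega> N) \<longlongrightarrow> 0) sequentially"
      using t by (simp add: tz_def)
    then have l1: "((\<lambda>N. ?I N (gramw w v) - of_nat d * ?I N (?R a)) \<longlongrightarrow> 0) sequentially"
      by (rule Lim_transform_eventually) (rule eventually_mono[OF eventually_gt_at_top[of 0] e])
    have l2: "((\<lambda>N. ?I N (gramw w v)) \<longlongrightarrow> (if w = v then 1 / of_nat d ^ length w else 0)) sequentially"
      using Cons by auto
    have "((\<lambda>N. (?I N (gramw w v) - (?I N (gramw w v) - of_nat d * ?I N (?R a))) / of_nat d) \<longlongrightarrow> ((if w = v then 1 / of_nat d ^ length w else 0) - 0) / of_nat d) sequentially"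
      by (intro tendsto_divide tendsto_diff l1 l2 tendsto_const) (use d in auto)
    then show ?thesis unfolding g using True d by (auto simp: field_simps)
  qed
qed

end

section \<open>Haar measure by Gram--Schmidt\<close>

definition orth :: "nat \<Rightarrow> nat \<Rightarrow> cmat \<Rightarrow> bool" where
  "orth n k Q \<longleftrightarrow> (\<forall>i<k. \<forall>j<k. (\<Sum>a<n. cnj (Q a i) * Q a j) = (if i = j then 1 else 0))"

text \<open>Matrix entries of Q Q^* for the first k columns of Q, the orthogonal projection onto
  their span once they are orthonormal.\<close>

definition prj :: "nat \<Rightarrow> cmat \<Rightarrow> nat \<Rightarrow> nat \<Rightarrow> complex" where
  "prj k Q a b = (\<Sum>i<k. Q a i * cnj (Q b i))"

lemma prj_diag: "prj k Q a a = complex_of_real (\<Sum>i<k. (cmod (Q a i))\<^sup>2)"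
  by (simp only: prj_def of_real_sum complex_norm_square)

lemma prj_idem:
  assumes "orth n k Q"
  shows "(\<Sum>a<n. prj k Q c a * prj k Q a b) = prj k Q c b"
proof -
  have "(\<Sum>a<n. prj k Q c a * prj k Q a b) = (\<Sum>a<n. \<Sum>i<k. \<Sum>j<k. Q c i * cnj (Q b j) * (cnj (Q a i) * Q a j))"
    unfolding prj_def sum_product by (intro sum.cong refl) (simp only: mult_ac)
  also have "\<dots> = (\<Sum>i<k. \<Sum>a<n. \<Sum>j<k. Q c i * cnj (Q b j) * (cnj (Q a i) * Q a j))" by (rule sum.swap)
  also have "\<dots> = (\<Sum>i<k. \<Sum>j<k. \<Sum>a<n. Q c i * cnj (Q b j) * (cnj (Q a i) * Q a j))"
    by (rule sum.cong[OF refl], rule sum.swap)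
  also have "\<dots> = (\<Sum>i<k. \<Sum>j<k. if j = i then Q c i * cnj (Q b i) else 0)"
    unfolding sum_distrib_left[symmetric] using assms by (intro sum.cong refl) (auto simp: orth_def)
  finally show ?thesis by (simp add: prj_def)
qed

lemma cnj_prj: "cnj (prj k Q a b) = prj k Q b a"
  by (simp add: prj_def mult.commute)

text \<open>The squared distance of the unit vector e_b from the span of the columns. Summed over b
  it counts the missing dimensions.\<close>

lemma prj_defect:
  assumes "orth n k Q" "b < n"
  shows "(\<Sum>a<n. (cmod ((if a = b then 1 else 0) - prj k Q a b))\<^sup>2) = 1 - (\<Sum>i<k. (cmod (Q b i))\<^sup>2)"
proof -
  have "complex_of_real (\<Sum>a<n. (cmod ((if a = b then 1 else 0) - prj k Q a b))\<^sup>2)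
    = (\<Sum>a<n. ((if a = b then 1 else 0) - prj k Q a b) * cnj ((if a = b then 1 else 0) - prj k Q a b))"
    by (simp only: of_real_sum complex_norm_square)
  also have "\<dots> = (\<Sum>a<n. (if a = b then 1 - prj k Q b b - prj k Q b b else 0) + prj k Q b a * prj k Q a b)"
    by (intro sum.cong refl) (auto simp: cnj_prj algebra_simps)
  also have "\<dots> = 1 - prj k Q b b"
    using assms(2) by (simp add: sum.distrib prj_idem[OF assms(1)])
  also have "\<dots> = complex_of_real (1 - (\<Sum>i<k. (cmod (Q b i))\<^sup>2))" by (simp only: prj_diag of_real_diff of_real_1)
  finally show ?thesis by (simp only: of_real_eq_iff)
qed

lemma orth_rows_le:
  assumes "orth n k Q" "b < n" shows "(\<Sum>i<k. (cmod (Q b i))\<^sup>2) \<le> 1"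
  using prj_defect[OF assms] sum_nonneg[of "{..<n}" "\<lambda>a. (cmod ((if a = b then 1 else 0) - prj k Q a b))\<^sup>2"] by simp

lemma orth_col_norm:
  assumes "orth n k Q" "i < k" shows "(\<Sum>a<n. (cmod (Q a i))\<^sup>2) = 1"
proof -
  have "complex_of_real (\<Sum>a<n. (cmod (Q a i))\<^sup>2) = (\<Sum>a<n. cnj (Q a i) * Q a i)"
    by (simp only: of_real_sum complex_norm_square mult.commute)
  also have "\<dots> = 1" using assms by (simp add: orth_def)
  finally show ?thesis by (simp only: of_real_eq_1_iff)
qed

lemma unitary_orth: "unitary n U \<longleftrightarrow> is_mat n U \<and> orth n n U"
proof
  assume U: "unitary n U"
  have "(\<Sum>a<n. cnj (U a i) * U a j) = mid n i j" for i j
    using U unfolding unitary_def mmul_def madj_def by (auto simp: fun_eq_iff)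
  then show "is_mat n U \<and> orth n n U" using U by (auto simp: unitary_def orth_def mid_def)
next
  assume U: "is_mat n U \<and> orth n n U"
  then have "mmul n (madj U) U i j = mid n i j" for i j
    by (cases "i < n \<and> j < n") (auto simp: mmul_def madj_def mid_def orth_def is_mat_def)
  then show "unitary n U" using U by (auto simp: unitary_def)
qed

text \<open>The n orthonormal columns have total mass n and no row has mass above 1, so each of the
  n rows has mass exactly 1. All defects in \<open>prj_defect\<close> vanish, which makes the
  projection the identity.\<close>

lemma unitary_right_inverse:
  assumes U: "unitary n U" shows "mmul n U (madj U) = mid n"
proof -
  have o: "orth n n U" and im: "is_mat n U" using U by (auto simp: unitary_orth)
  have "(\<Sum>b<n. 1 - (\<Sum>i<n. (cmod (U b i))\<^sup>2)) = real n - (\<Sum>i<n. \<Sum>b<n. (cmod (U b i))\<^sup>2)"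
    by (simp add: sum_subtractf) (rule sum.swap)
  also have "\<dots> = 0" using orth_col_norm[OF o] by simp
  finally have z: "1 - (\<Sum>i<n. (cmod (U b i))\<^sup>2) = 0" if "b < n" for b
    using orth_rows_le[OF o] that by (subst (asm) sum_nonneg_eq_0_iff) auto
  have "prj n U a b = (if a = b then 1 else 0)" if ab: "a < n" "b < n" for a b
  proof -
    have "(\<Sum>a<n. (cmod ((if a = b then 1 else 0) - prj n U a b))\<^sup>2) = 0"
      using prj_defect[OF o ab(2)] z[OF ab(2)] by simp
    then have "(cmod ((if a = b then 1 else 0) - prj n U a b))\<^sup>2 = 0"
      using ab(1) by (subst (asm) sum_nonneg_eq_0_iff) auto
    then show ?thesis by simp
  qed
  moreover have "mmul n U (madj U) a b = prj n U a b" for a b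
    by (simp add: mmul_def madj_def prj_def)
  moreover have "is_mat n (mmul n U (madj U))" using im by (intro is_mat_mmul) auto
  ultimately show ?thesis
    by (intro ext, rename_tac a b, case_tac "a < n \<and> b < n") (auto simp: mid_def is_mat_def not_less)
qed

lemma unitary_madj: "unitary n U \<Longrightarrow> unitary n (madj U)"
  using unitary_right_inverse[of n U] by (auto simp: unitary_def)

text \<open>The k columns have total mass k < n, so some row b has mass below 1. The component of
  e_b orthogonal to the columns is then nonzero and can be normalised.\<close>

lemma orth_extend:
  assumes o: "orth n k Q" and k: "k < n"
  shows "\<exists>v. orth n (Suc k) (\<lambda>a i. if i = k then v a else Q a i)"
proof -
  have "(\<Sum>b<n. \<Sum>i<k. (cmod (Q b i))\<^sup>2) = (\<Sum>i<k. \<Sum>b<n. (cmod (Q b i))\<^sup>2)" by (rule sum.swap)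
  also have "\<dots> = real k" using orth_col_norm[OF o] by simp
  finally have "(\<Sum>b<n. \<Sum>i<k. (cmod (Q b i))\<^sup>2) < (\<Sum>b<n. 1)" using k by simp
  then obtain b where b: "b < n" "(\<Sum>i<k. (cmod (Q b i))\<^sup>2) < 1"
    by (metis (no_types, lifting) lessThan_iff not_le sum_mono)
  define s where "s = 1 - (\<Sum>i<k. (cmod (Q b i))\<^sup>2)"
  have s: "s > 0" using b by (simp add: s_def)
  define y where "y a = (if a = b then 1 else 0) - prj k Q a b" for a
  have ny: "(\<Sum>a<n. (cmod (y a))\<^sup>2) = s" unfolding y_def s_def by (rule prj_defect[OF o b(1)])
  have yQ: "(\<Sum>a<n. cnj (Q a i) * y a) = 0" if i: "i < k" for i
  proof -
    have "(\<Sum>a<n. cnj (Q a i) * prj k Q a b) = (\<Sum>a<n. \<Sum>j<k. cnj (Q b j) * (cnj (Q a i) * Q a j))"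
      unfolding prj_def sum_distrib_left by (intro sum.cong refl) (simp only: mult_ac)
    also have "\<dots> = (\<Sum>j<k. cnj (Q b j) * (\<Sum>a<n. cnj (Q a i) * Q a j))"
      by (subst sum.swap) (simp only: sum_distrib_left)
    also have "\<dots> = (\<Sum>j<k. if j = i then cnj (Q b i) else 0)"
      using o i by (intro sum.cong refl) (auto simp: orth_def)
    also have "\<dots> = cnj (Q b i)" using i by simp
    finally have 1: "(\<Sum>a<n. cnj (Q a i) * prj k Q a b) = cnj (Q b i)" .
    have "(\<Sum>a<n. cnj (Q a i) * y a) = (\<Sum>a<n. (if a = b then cnj (Q b i) else 0) - cnj (Q a i) * prj k Q a b)"
      unfolding y_def by (intro sum.cong refl) (auto simp: algebra_simps)
    also have "\<dots> = 0" using b by (simp add: sum_subtractf 1)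
    finally show ?thesis .
  qed
  define v where "v a = y a / complex_of_real (sqrt s)" for a
  have vv: "(\<Sum>a<n. cnj (v a) * v a) = 1"
  proof -
    have "(\<Sum>a<n. cnj (v a) * v a) = complex_of_real (\<Sum>a<n. (cmod (v a))\<^sup>2)"
      by (simp only: of_real_sum complex_norm_square mult.commute)
    also have "(\<Sum>a<n. (cmod (v a))\<^sup>2) = (\<Sum>a<n. (cmod (y a))\<^sup>2) / s"
      using s by (simp add: v_def norm_divide power_divide sum_divide_distrib)
    finally show ?thesis using s ny by simp
  qed
  have vQ: "(\<Sum>a<n. cnj (Q a i) * v a) = 0" if "i < k" for i
    using yQ[OF that] by (simp add: v_def sum_divide_distrib[symmetric])
  have Qv: "(\<Sum>a<n. cnj (v a) * Q a i) = 0" if "i < k" for i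
    using arg_cong[OF vQ[OF that], of cnj] by (simp add: mult.commute)
  show ?thesis
    by (intro exI[of _ v]) (use o vv vQ Qv in \<open>auto simp: orth_def less_Suc_eq\<close>)
qed

lemma orth_complete:
  assumes "orth n k Q" "k \<le> n"
  shows "\<exists>Q'. orth n n Q' \<and> (\<forall>a. \<forall>i<k. Q' a i = Q a i)"
proof -
  have "\<exists>Q'. orth n (k + l) Q' \<and> (\<forall>a. \<forall>i<k. Q' a i = Q a i)" if "k + l \<le> n" for l
    using that
  proof (induction l)
    case (Suc l)
    then obtain Q' where Q': "orth n (k + l) Q'" "\<forall>a. \<forall>i<k. Q' a i = Q a i" by auto
    obtain v where "orth n (Suc (k + l)) (\<lambda>a i. if i = k + l then v a else Q' a i)"
      using orth_extend[OF Q'(1)] Suc.prems by auto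
    then show ?case using Q'(2) by (intro exI[of _ "\<lambda>a i. if i = k + l then v a else Q' a i"]) auto
  qed (use assms in auto)
  from this[of "n - k"] show ?thesis using assms(2) by simp
qed

definition gsres :: "nat \<Rightarrow> cmat \<Rightarrow> nat \<Rightarrow> cmat \<Rightarrow> nat \<Rightarrow> complex" where
  "gsres n G k Q a = G a k - (\<Sum>i<k. Q a i * (\<Sum>b<n. cnj (Q b i) * G b k))"

text \<open>Gram-Schmidt on the columns of G. A vanishing residual yields a zero column, because
  division by zero is 0; \<open>AE_gs_unitary\<close> shows that this almost never happens.\<close>

primrec gsq :: "nat \<Rightarrow> cmat \<Rightarrow> nat \<Rightarrow> cmat" where
  "gsq n G 0 = mzero"
| "gsq n G (Suc k) = (\<lambda>a i. if i = k then gsres n G k (gsq n G k) a / complex_of_real (sqrt (\<Sum>b<n. (cmod (gsres n G k (gsq n G k) b))\<^sup>2))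
      else gsq n G k a i)"

lemma gsq_is_mat: "is_mat n G \<Longrightarrow> k \<le> n \<Longrightarrow> is_mat n (gsq n G k)"
proof (induction k)
  case (Suc k)
  then have "is_mat n (gsq n G k)" by simp
  then show ?case using Suc.prems by (auto simp: is_mat_def gsres_def)
qed (simp add: is_mat_def mzero_def)

lemma gsq_orth_step:
  assumes o: "orth n k (gsq n G k)" and nz: "(\<Sum>b<n. (cmod (gsres n G k (gsq n G k) b))\<^sup>2) \<noteq> 0"
  shows "orth n (Suc k) (gsq n G (Suc k))"
proof -
  let ?Q = "gsq n G k"
  define y where "y = gsres n G k ?Q"
  define s where "s = (\<Sum>b<n. (cmod (y b))\<^sup>2)"
  have s: "s > 0" using nz sum_nonneg[of "{..<n}" "\<lambda>b. (cmod (y b))\<^sup>2"] unfolding s_def y_def by (simp add: order_less_le)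
  have yQ: "(\<Sum>a<n. cnj (?Q a i) * y a) = 0" if i: "i < k" for i
  proof -
    have "(\<Sum>a<n. cnj (?Q a i) * (\<Sum>j<k. ?Q a j * (\<Sum>b<n. cnj (?Q b j) * G b k)))
       = (\<Sum>a<n. \<Sum>j<k. (\<Sum>b<n. cnj (?Q b j) * G b k) * (cnj (?Q a i) * ?Q a j))"
      unfolding sum_distrib_left[of "cnj (?Q _ i)"] by (intro sum.cong refl) (simp only: mult_ac)
    also have "\<dots> = (\<Sum>j<k. (\<Sum>b<n. cnj (?Q b j) * G b k) * (\<Sum>a<n. cnj (?Q a i) * ?Q a j))"
      by (subst sum.swap) (simp only: sum_distrib_left)
    also have "\<dots> = (\<Sum>j<k. if j = i then (\<Sum>b<n. cnj (?Q b i) * G b k) else 0)"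
      using o i by (intro sum.cong refl) (auto simp: orth_def)
    also have "\<dots> = (\<Sum>b<n. cnj (?Q b i) * G b k)" using i by simp
    finally show ?thesis by (simp add: y_def gsres_def right_diff_distrib sum_subtractf)
  qed
  define v where "v a = y a / complex_of_real (sqrt s)" for a
  have vv: "(\<Sum>a<n. cnj (v a) * v a) = 1"
  proof -
    have "(\<Sum>a<n. cnj (v a) * v a) = complex_of_real (\<Sum>a<n. (cmod (v a))\<^sup>2)"
      by (simp only: of_real_sum complex_norm_square mult.commute)
    also have "(\<Sum>a<n. (cmod (v a))\<^sup>2) = (\<Sum>a<n. (cmod (y a))\<^sup>2) / s"
      using s by (simp add: v_def norm_divide power_divide sum_divide_distrib)
    finally show ?thesis using s by (simp add: s_def)
  qed
  have vQ: "(\<Sum>a<n. cnj (?Q a i) * v a) = 0" if "i < k" for i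
    using yQ[OF that] by (simp add: v_def sum_divide_distrib[symmetric])
  have Qv: "(\<Sum>a<n. cnj (v a) * ?Q a i) = 0" if "i < k" for i
    using arg_cong[OF vQ[OF that], of cnj] by (simp add: mult.commute)
  have "gsq n G (Suc k) = (\<lambda>a i. if i = k then v a else ?Q a i)"
    by (simp only: gsq.simps v_def y_def s_def)
  then show ?thesis using o vv vQ Qv by (auto simp: orth_def less_Suc_eq)
qed

lemma unitary_inner:
  assumes "unitary n U"
  shows "(\<Sum>b<n. cnj (\<Sum>c<n. U b c * x c) * (\<Sum>c<n. U b c * y c)) = (\<Sum>c<n. cnj (x c) * y c)"
proof -
  have o: "orth n n U" using assms by (simp add: unitary_orth)
  have "(\<Sum>b<n. cnj (\<Sum>c<n. U b c * x c) * (\<Sum>c<n. U b c * y c)) = (\<Sum>b<n. \<Sum>c<n. \<Sum>e<n. cnj (x c) * y e * (cnj (U b c) * U b e))"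
    unfolding cnj_sum complex_cnj_mult sum_product by (intro sum.cong refl) (simp only: mult_ac)
  also have "\<dots> = (\<Sum>c<n. \<Sum>b<n. \<Sum>e<n. cnj (x c) * y e * (cnj (U b c) * U b e))" by (rule sum.swap)
  also have "\<dots> = (\<Sum>c<n. \<Sum>e<n. \<Sum>b<n. cnj (x c) * y e * (cnj (U b c) * U b e))"
    by (rule sum.cong[OF refl], rule sum.swap)
  also have "\<dots> = (\<Sum>c<n. \<Sum>e<n. if e = c then cnj (x c) * y c else 0)"
    unfolding sum_distrib_left[symmetric] using o by (intro sum.cong refl) (auto simp: orth_def)
  finally show ?thesis by simp
qed

lemma unitary_norm:
  assumes "unitary n U"
  shows "(\<Sum>b<n. (cmod (\<Sum>c<n. U b c * x c))\<^sup>2) = (\<Sum>c<n. (cmod (x c))\<^sup>2)"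
proof -
  have "complex_of_real (\<Sum>b<n. (cmod (\<Sum>c<n. U b c * x c))\<^sup>2) = complex_of_real (\<Sum>c<n. (cmod (x c))\<^sup>2)"
    unfolding of_real_sum complex_norm_square using unitary_inner[OF assms, of x x] by (simp only: mult.commute)
  then show ?thesis by (simp only: of_real_eq_iff)
qed

text \<open>Gram-Schmidt uses linear combinations of columns, which commute with U, and coefficients
  made of inner products, which U preserves. This is what hands left invariance from the random
  matrix to its orthonormalisation.\<close>

lemma gsq_equivariant:
  assumes U: "unitary n U"
  shows "gsq n (mmul n U G) k = mmul n U (gsq n G k)"
proof (induction k)
  case (Suc k)
  let ?Q = "gsq n G k"
  have res: "gsres n (mmul n U G) k (mmul n U ?Q) a = (\<Sum>c<n. U a c * gsres n G k ?Q c)" for a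
  proof -
    have i: "(\<Sum>b<n. cnj (mmul n U ?Q b i) * mmul n U G b k) = (\<Sum>b<n. cnj (?Q b i) * G b k)" for i
      using unitary_inner[OF U, of "\<lambda>c. ?Q c i" "\<lambda>c. G c k"] by (simp only: mmul_def)
    have "gsres n (mmul n U G) k (mmul n U ?Q) a = (\<Sum>c<n. U a c * G c k) - (\<Sum>i<k. \<Sum>c<n. U a c * (?Q c i * (\<Sum>b<n. cnj (?Q b i) * G b k)))"
      unfolding gsres_def i by (simp only: mmul_def sum_distrib_right mult.assoc)
    also have "(\<Sum>i<k. \<Sum>c<n. U a c * (?Q c i * (\<Sum>b<n. cnj (?Q b i) * G b k))) = (\<Sum>c<n. U a c * (\<Sum>i<k. ?Q c i * (\<Sum>b<n. cnj (?Q b i) * G b k)))"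
      by (subst sum.swap) (simp only: sum_distrib_left)
    finally show ?thesis by (simp add: gsres_def right_diff_distrib sum_subtractf)
  qed
  have nrm: "(\<Sum>b<n. (cmod (gsres n (mmul n U G) k (mmul n U ?Q) b))\<^sup>2) = (\<Sum>b<n. (cmod (gsres n G k ?Q b))\<^sup>2)"
    unfolding res by (rule unitary_norm[OF U])
  show ?case
  proof (intro ext)
    fix a i
    show "gsq n (mmul n U G) (Suc k) a i = mmul n U (gsq n G (Suc k)) a i"
    proof (cases "i = k")
      case True
      have "gsq n (mmul n U G) (Suc k) a i = (\<Sum>c<n. U a c * gsres n G k ?Q c) / complex_of_real (sqrt (\<Sum>b<n. (cmod (gsres n G k ?Q b))\<^sup>2))"
        using True by (simp only: gsq.simps Suc nrm if_True refl) (simp only: res)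
      also have "\<dots> = mmul n U (gsq n G (Suc k)) a i"
        using True by (simp add: mmul_def sum_divide_distrib)
      finally show ?thesis .
    next
      case False
      then show ?thesis by (simp add: Suc) (simp add: mmul_def)
    qed
  qed
qed (simp add: mmul_def mzero_def)

text \<open>Columns of different blocks have disjoint supports, so their inner products vanish and
  Gram-Schmidt mixes only columns of one block.\<close>

lemma gsq_supp:
  assumes G: "\<And>a b. r a \<noteq> r b \<Longrightarrow> G a b = 0"
  shows "r a \<noteq> r b \<Longrightarrow> gsq n G k a b = 0"
proof (induction k arbitrary: a b)
  case (Suc k)
  have "gsres n G k (gsq n G k) a = 0" if "r a \<noteq> r k"
  proof -
    have "gsq n G k a i * (\<Sum>b<n. cnj (gsq n G k b i) * G b k) = 0" for i
    proof (cases "r a = r i")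
      case True
      then have "cnj (gsq n G k b i) * G b k = 0" for b
        using Suc.IH[of b i] G[of b k] that by (cases "r b = r i") auto
      then have "(\<Sum>b<n. cnj (gsq n G k b i) * G b k) = 0" by (intro sum.neutral ballI)
      then show ?thesis by simp
    qed (use Suc.IH in simp)
    then have "(\<Sum>i<k. gsq n G k a i * (\<Sum>b<n. cnj (gsq n G k b i) * G b k)) = 0" by (intro sum.neutral ballI)
    then show ?thesis using G[OF that] by (simp add: gsres_def)
  qed
  then show ?case using Suc by auto
qed (simp add: mzero_def)

lemma gsq_cong:
  assumes "\<And>a i. i < k \<Longrightarrow> G a i = G' a i" shows "gsq n G k = gsq n G' k"
  using assms
proof (induction k)
  case (Suc k)
  then have "gsq n G k = gsq n G' k" by simp
  moreover have "gsres n G k Q = gsres n G' k Q" for Q using Suc.prems by (auto simp: gsres_def fun_eq_iff)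
  ultimately show ?case by (simp only: gsq.simps)
qed simp

lemma borel_measurable_cmod: "f \<in> borel_measurable M \<Longrightarrow> (\<lambda>x. cmod (f x)) \<in> borel_measurable M"
  by (rule measurable_compose[OF _ borel_measurable_norm])

lemma borel_measurable_of_real_comp: "f \<in> borel_measurable M \<Longrightarrow> (\<lambda>x. complex_of_real (f x)) \<in> borel_measurable M"
  by (rule measurable_compose[OF _ borel_measurable_of_real])

lemma measurable_gsq: "(\<lambda>G. gsq n G k a i) \<in> borel_measurable borel"
proof (induction k arbitrary: a i)
  case (Suc k)
  have res: "(\<lambda>G. gsres n G k (gsq n G k) a) \<in> borel_measurable borel" for a
    unfolding gsres_def
    by (intro borel_measurable_diff borel_measurable_sum borel_measurable_times measurable_entry_mat borel_measurable_cnj Suc)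
  have "(\<lambda>G. complex_of_real (sqrt (\<Sum>b<n. (cmod (gsres n G k (gsq n G k) b))\<^sup>2))) \<in> borel_measurable borel"
    by (intro borel_measurable_of_real_comp measurable_compose[OF _ borel_measurable_continuous_onI[OF continuous_on_real_sqrt[OF continuous_on_id]]] borel_measurable_sum borel_measurable_power borel_measurable_cmod res)
  then show ?case using Suc res by (cases "i = k") (auto intro: borel_measurable_divide)
qed (simp add: mzero_def)

text \<open>Counting inside the block of k: its rows carry a total mass equal to the number of
  earlier columns in that block. This is smaller than the number of rows since k itself is still to
  come, so the masses cannot all be 1.\<close>

lemma gsq_defect_exists:
  assumes o: "orth n k (gsq n G k)" and G: "\<And>a b. r a \<noteq> r b \<Longrightarrow> G a b = 0" and k: "k < n"
  shows "\<exists>a<n. r a = r k \<and> (\<Sum>i<k. (cmod (gsq n G k a i))\<^sup>2) \<noteq> 1"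
proof (rule ccontr)
  let ?Q = "gsq n G k" and ?A = "{a. a < n \<and> r a = r k}"
  assume "\<not> ?thesis"
  then have "(\<Sum>a\<in>?A. \<Sum>i<k. (cmod (?Q a i))\<^sup>2) = (\<Sum>a\<in>?A. 1)" by (intro sum.cong refl) auto
  moreover have "(\<Sum>a\<in>?A. \<Sum>i<k. (cmod (?Q a i))\<^sup>2) = (\<Sum>i<k. \<Sum>a\<in>?A. (cmod (?Q a i))\<^sup>2)" by (rule sum.swap)
  moreover have "(\<Sum>a\<in>?A. (cmod (?Q a i))\<^sup>2) = (if r i = r k then 1 else 0)" if "i < k" for i
  proof (cases "r i = r k")
    case True
    have "(\<Sum>a\<in>?A. (cmod (?Q a i))\<^sup>2) = (\<Sum>a<n. (cmod (?Q a i))\<^sup>2)"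
      using gsq_supp[of r G, OF G] True by (intro sum.mono_neutral_left) auto
    then show ?thesis using True orth_col_norm[OF o that] by simp
  next
    case False
    then show ?thesis using gsq_supp[of r G, OF G] by (auto intro!: sum.neutral)
  qed
  ultimately have "real (card ?A) = (\<Sum>i<k. if r i = r k then 1 else 0)" by simp
  also have "\<dots> = real (card {i. i < k \<and> r i = r k})"
    by (simp add: sum.If_cases Int_def conj_commute)
  finally have "card ?A = card {i. i < k \<and> r i = r k}" by simp
  moreover have "{i. i < k \<and> r i = r k} \<subset> ?A" using k by auto
  then have "card {i. i < k \<and> r i = r k} < card ?A" by (intro psubset_card_mono) auto
  ultimately show False by simp
qed

section \<open>Lebesgue measure on block matrices\<close>

definition supp :: "(nat \<times> nat) set \<Rightarrow> cmat set" where
  "supp D = {M. \<forall>a b. (a, b) \<notin> D \<longrightarrow> M a b = 0}"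

definition emb :: "(nat \<times> nat) set \<Rightarrow> (nat \<times> nat \<Rightarrow> complex) \<Rightarrow> cmat" where
  "emb D g = (\<lambda>a b. if (a, b) \<in> D then g (a, b) else 0)"

text \<open>Lebesgue measure in the entries of D, pushed forward along the extension by zero so that
  it lives on the Borel sets of \<open>cmat\<close>.\<close>

definition leb :: "(nat \<times> nat) set \<Rightarrow> cmat measure" where
  "leb D = distr (PiM D (\<lambda>_. lborel)) borel (emb D)"

interpretation LP: product_sigma_finite "\<lambda>_ :: nat \<times> nat. lborel :: complex measure"
  by unfold_locales

lemma measurable_cmatI:
  assumes "\<And>a b. (\<lambda>x. f x a b) \<in> borel_measurable M" shows "f \<in> measurable M (borel :: cmat measure)"
  by (intro measurable_coordinatewise_then_product assms)

lemma measurable_emb: "emb D \<in> measurable (PiM D (\<lambda>_. lborel)) borel"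
proof (rule measurable_cmatI)
  fix a b
  show "(\<lambda>g. emb D g a b) \<in> borel_measurable (PiM D (\<lambda>_. lborel))"
    by (cases "(a, b) \<in> D") (auto simp: emb_def intro!: measurable_component_singleton[of "(a,b)" D "\<lambda>_. lborel", unfolded measurable_lborel2])
qed

lemma sets_leb [simp]: "sets (leb D) = sets borel" "space (leb D) = UNIV"
  by (simp_all add: leb_def)

lemma nn_integral_leb: "F \<in> borel_measurable borel \<Longrightarrow> (\<integral>\<^sup>+M. F M \<partial>leb D) = (\<integral>\<^sup>+g. F (emb D g) \<partial>PiM D (\<lambda>_. lborel))"
  unfolding leb_def by (subst nn_integral_distr[OF measurable_emb]) simp_all

lemma emeasure_leb: "A \<in> sets borel \<Longrightarrow> emeasure (leb D) A = emeasure (PiM D (\<lambda>_. lborel)) (emb D -` A \<inter> space (PiM D (\<lambda>_. lborel)))"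
  unfolding leb_def by (rule emeasure_distr[OF measurable_emb])

lemma supp_sets: "supp D \<in> sets borel"
proof -
  have "supp D = (\<Inter>a. \<Inter>b. {M. (a, b) \<notin> D \<longrightarrow> M a b = 0})" by (auto simp: supp_def)
  moreover have "{M :: cmat. (a, b) \<notin> D \<longrightarrow> M a b = 0} \<in> sets borel" for a b
  proof (cases "(a, b) \<in> D")
    case False
    have "(\<lambda>M::cmat. M a b) -` {0} \<inter> space borel \<in> sets borel"
      by (rule measurable_sets[OF measurable_entry_mat]) simp
    then show ?thesis using False by (simp add: vimage_def)
  qed simp
  ultimately show ?thesis by auto
qed

lemma AE_supp: "AE M in leb D. M \<in> supp D"
  unfolding leb_def
  by (subst AE_distr_iff[OF measurable_emb]) (use supp_sets in \<open>auto simp: supp_def emb_def\<close>)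

lemma lborel_translate:
  fixes c :: complex
  assumes "A \<in> sets borel" shows "emeasure lborel ((\<lambda>x. x + c) -` A) = emeasure lborel A"
proof -
  have "emeasure lborel A = emeasure (distr lborel borel ((+) c)) A" by (simp only: lborel_distr_plus)
  also have "\<dots> = emeasure lborel ((+) c -` A \<inter> space lborel)" by (rule emeasure_distr) (use assms in auto)
  finally show ?thesis by (simp add: vimage_def add.commute)
qed

lemma leb_translate:
  assumes D: "finite D" and Z: "Z \<in> supp D" and F: "F \<in> borel_measurable borel"
  shows "(\<integral>\<^sup>+M. F (\<lambda>a b. M a b + Z a b) \<partial>leb D) = (\<integral>\<^sup>+M. F M \<partial>leb D)"
proof -
  let ?P = "PiM D (\<lambda>_. lborel :: complex measure)"
  define Tr where "Tr g = (\<lambda>p\<in>D. g p + Z (fst p) (snd p))" for g :: "nat \<times> nat \<Rightarrow> complex"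
  have mT: "Tr \<in> measurable ?P ?P"
    unfolding Tr_def by (intro measurable_restrict) simp
  have d: "distr ?P ?P Tr = ?P"
  proof (rule LP.PiM_eqI[OF D])
    fix A :: "nat \<times> nat \<Rightarrow> complex set" assume A: "\<And>p. p \<in> D \<Longrightarrow> A p \<in> sets lborel"
    have "Tr -` PiE D A \<inter> space ?P = PiE D (\<lambda>p. (\<lambda>x. x + Z (fst p) (snd p)) -` A p)"
      by (auto simp: Tr_def space_PiM PiE_iff extensional_def) (metis fst_conv snd_conv)
    then have "emeasure (distr ?P ?P Tr) (PiE D A) = emeasure ?P (PiE D (\<lambda>p. (\<lambda>x. x + Z (fst p) (snd p)) -` A p))"
      using A D by (subst emeasure_distr[OF mT]) (auto intro!: sets_PiM_I_finite)
    also have "\<dots> = (\<Prod>p\<in>D. emeasure lborel ((\<lambda>x. x + Z (fst p) (snd p)) -` A p))"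
    proof (rule LP.emeasure_PiM[OF D])
      fix p assume "p \<in> D"
      have "(\<lambda>x::complex. x + Z (fst p) (snd p)) \<in> measurable borel borel" by simp
      from measurable_sets[OF this, of "A p"] show "(\<lambda>x. x + Z (fst p) (snd p)) -` A p \<in> sets lborel"
        using A[OF \<open>p \<in> D\<close>] by simp
    qed
    also have "\<dots> = (\<Prod>p\<in>D. emeasure lborel (A p))"
      using A by (intro prod.cong refl lborel_translate) simp
    finally show "emeasure (distr ?P ?P Tr) (PiE D A) = (\<Prod>p\<in>D. emeasure lborel (A p))" .
  qed simp
  have e: "(\<lambda>a b. emb D g a b + Z a b) = emb D (Tr g)" for g
    using Z by (auto simp: emb_def Tr_def supp_def fun_eq_iff)
  have mF: "(\<lambda>M. F (\<lambda>a b. M a b + Z a b)) \<in> borel_measurable borel"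
    by (rule measurable_compose[OF _ F], rule measurable_cmatI)
       (intro borel_measurable_add measurable_entry_mat borel_measurable_const)
  have "(\<integral>\<^sup>+M. F (\<lambda>a b. M a b + Z a b) \<partial>leb D) = (\<integral>\<^sup>+g. F (emb D (Tr g)) \<partial>?P)"
    by (simp only: nn_integral_leb[OF mF] e)
  also have "\<dots> = (\<integral>\<^sup>+g. F (emb D g) \<partial>distr ?P ?P Tr)"
    by (subst nn_integral_distr[OF mT]) (simp_all add: measurable_compose[OF measurable_emb F])
  finally show ?thesis unfolding d by (simp only: nn_integral_leb[OF F])
qed

definition entrybox :: "(nat \<times> nat) set \<Rightarrow> real \<Rightarrow> cmat set" where
  "entrybox D k = {M. \<forall>(a, b)\<in>D. cmod (M a b) \<le> k}"

lemma entrybox_sets: assumes "finite D" shows "entrybox D k \<in> sets borel"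
proof -
  have "entrybox D k = (\<Inter>p\<in>D. {M. cmod (M (fst p) (snd p)) \<le> k})" by (fastforce simp: entrybox_def)
  moreover have "{M :: cmat. cmod (M a b) \<le> k} \<in> sets borel" for a b
  proof -
    have "(\<lambda>M::cmat. M a b) -` (cball 0 k) \<inter> space borel \<in> sets borel"
      by (rule measurable_sets[OF measurable_entry_mat]) simp
    then show ?thesis by (simp add: vimage_def)
  qed
  ultimately show ?thesis using assms by (cases "D = {}") auto
qed

lemma emeasure_box:
  assumes "finite D" shows "emeasure (leb D) (entrybox D k) = (\<Prod>p\<in>D. emeasure lborel (cball (0::complex) k))"
proof -
  have "emb D -` entrybox D k \<inter> space (PiM D (\<lambda>_. lborel)) = PiE D (\<lambda>_. cball 0 k)"
    by (auto simp: emb_def entrybox_def space_PiM PiE_iff extensional_def)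
  then show ?thesis using assms by (simp add: emeasure_leb entrybox_sets LP.emeasure_PiM)
qed

lemma emeasure_box_finite: "finite D \<Longrightarrow> emeasure (leb D) (entrybox D k) < \<infinity>"
  using emeasure_lborel_cball_finite[of "0::complex" k]
  by (simp add: emeasure_box power_less_top_ennreal)

lemma emeasure_box_pos:
  assumes "finite D" "k > 0" shows "emeasure (leb D) (entrybox D k) > 0"
proof -
  have "emeasure lborel (cball (0::complex) k) \<noteq> 0"
  proof -
    have "unit_ball_vol 2 * k\<^sup>2 > 0" using assms(2) unit_ball_vol_pos[of 2] by (intro mult_pos_pos) auto
    moreover have eq: "emeasure lborel (cball (0::complex) k) = ennreal (unit_ball_vol 2 * k\<^sup>2)"
      using assms(2) emeasure_cball[of k "0::complex"] by simp
    ultimately show ?thesis unfolding eq ennreal_eq_0_iff by linarith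
  qed
  then have "(\<Prod>p\<in>D. emeasure lborel (cball (0::complex) k)) \<noteq> 0" using assms by (simp add: prod_zero_iff)
  then show ?thesis using assms by (simp add: emeasure_box zero_less_iff_neq_zero)
qed

lemma sigma_finite_leb: assumes "finite D" shows "sigma_finite_measure (leb D)"
proof
  show "\<exists>A. countable A \<and> A \<subseteq> sets (leb D) \<and> \<Union>A = space (leb D) \<and> (\<forall>a\<in>A. emeasure (leb D) a \<noteq> \<infinity>)"
  proof (intro exI[of _ "range (\<lambda>k::nat. entrybox D (real k))"] conjI)
    show "\<Union>(range (\<lambda>k::nat. entrybox D (real k))) = space (leb D)"
    proof -
      have "\<exists>k::nat. M \<in> entrybox D (real k)" for M
      proof -
        obtain k :: nat where k: "(\<Sum>p\<in>D. cmod (M (fst p) (snd p))) \<le> real k" using real_arch_simple by blast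
        have "cmod (M a b) \<le> real k" if "(a, b) \<in> D" for a b
          using member_le_sum[of "(a,b)" D "\<lambda>p. cmod (M (fst p) (snd p))"] that assms k by simp
        then show ?thesis by (auto simp: entrybox_def)
      qed
      then show ?thesis by auto
    qed
    show "\<forall>a\<in>range (\<lambda>k::nat. entrybox D (real k)). emeasure (leb D) a \<noteq> \<infinity>"
      using emeasure_box_finite[OF assms] by (metis (no_types, lifting) imageE less_irrefl)
  qed (use entrybox_sets[OF assms] in auto)
qed

section \<open>Haar measure on the block diagonal unitary group\<close>

definition blkset :: "nat \<Rightarrow> (nat \<Rightarrow> nat) \<Rightarrow> (nat \<times> nat) set" where
  "blkset n r = {(a, b). a < n \<and> b < n \<and> r a = r b}"

lemma finite_blkset [simp]: "finite (blkset n r)"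
  by (rule finite_subset[of _ "{..<n} \<times> {..<n}"]) (auto simp: blkset_def)

definition ugrp :: "nat \<Rightarrow> (nat \<Rightarrow> nat) \<Rightarrow> cmat set" where
  "ugrp n r = {U. unitary n U \<and> (\<forall>a<n. \<forall>b<n. r a \<noteq> r b \<longrightarrow> U a b = 0)}"

lemma ugrp_supp: assumes "U \<in> ugrp n r" shows "U \<in> supp (blkset n r)"
proof -
  have "U a b = 0" if "(a, b) \<notin> blkset n r" for a b
    using assms that by (cases "a < n \<and> b < n") (auto simp: ugrp_def blkset_def unitary_def is_mat_def not_less)
  then show ?thesis by (auto simp: supp_def)
qed

lemma supp_is_mat: "M \<in> supp (blkset n r) \<Longrightarrow> is_mat n M"
  by (auto simp: supp_def blkset_def is_mat_def not_less)

lemma supp_block: "M \<in> supp (blkset n r) \<Longrightarrow> r a \<noteq> r b \<Longrightarrow> M a b = 0"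
  by (auto simp: supp_def blkset_def)

lemma supp_mmul:
  assumes "A \<in> supp (blkset n r)" "B \<in> supp (blkset n r)" shows "mmul n A B \<in> supp (blkset n r)"
proof -
  have "mmul n A B a b = 0" if "(a, b) \<notin> blkset n r" for a b
    unfolding mmul_def
  proof (rule sum.neutral, rule ballI)
    fix l assume "l \<in> {..<n}"
    have "(a, l) \<notin> blkset n r \<or> (l, b) \<notin> blkset n r" using that by (auto simp: blkset_def)
    then show "A a l * B l b = 0" using assms by (auto simp: supp_def)
  qed
  then show ?thesis by (auto simp: supp_def)
qed

lemma ugrp_madj: "U \<in> ugrp n r \<Longrightarrow> madj U \<in> ugrp n r"
  by (auto simp: ugrp_def unitary_madj) (auto simp: madj_def)

lemma measurable_mmul_const: "mmul n U \<in> measurable borel borel"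
  by (rule measurable_cmatI) (auto simp: mmul_def intro!: borel_measurable_sum borel_measurable_times measurable_entry_mat)

text \<open>The Hilbert-Schmidt unit ball. Invariant under unitary left multiplication and of
  positive finite measure, it serves as window in \<open>leb_unitary_invariant\<close> and as
  normalisation in \<open>haar\<close>.\<close>

definition hsb :: "nat \<Rightarrow> cmat set" where
  "hsb n = {M. (\<Sum>b<n. \<Sum>a<n. (cmod (M a b))\<^sup>2) \<le> 1}"

lemma hsb_sets: "hsb n \<in> sets borel"
proof -
  have "(\<lambda>M::cmat. \<Sum>b<n. \<Sum>a<n. (cmod (M a b))\<^sup>2) \<in> borel_measurable borel"
    by (intro borel_measurable_sum borel_measurable_power borel_measurable_cmod measurable_entry_mat)
  from measurable_sets[OF this, of "{..1}"] show ?thesis by (simp add: hsb_def vimage_def)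
qed

lemma hsb_mmul: "unitary n U \<Longrightarrow> mmul n U M \<in> hsb n \<longleftrightarrow> M \<in> hsb n"
  by (simp add: hsb_def mmul_def unitary_norm)

lemma hsb_entry:
  assumes "M \<in> hsb n" "a < n" "b < n" shows "cmod (M a b) \<le> 1"
proof -
  have "(cmod (M a b))\<^sup>2 \<le> (\<Sum>a<n. (cmod (M a b))\<^sup>2)" using assms by (intro member_le_sum) auto
  also have "\<dots> \<le> (\<Sum>b<n. \<Sum>a<n. (cmod (M a b))\<^sup>2)"
    using assms by (intro member_le_sum[of b "{..<n}" "\<lambda>b. \<Sum>a<n. (cmod (M a b))\<^sup>2"]) (auto intro: sum_nonneg)
  also have "\<dots> \<le> 1\<^sup>2" using assms by (simp add: hsb_def)
  finally show ?thesis by (rule power2_le_imp_le) simp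
qed

lemma hsb_finite: "emeasure (leb (blkset n r)) (hsb n) < \<infinity>"
proof -
  have "hsb n \<subseteq> entrybox (blkset n r) 1" using hsb_entry by (auto simp: entrybox_def blkset_def)
  then have "emeasure (leb (blkset n r)) (hsb n) \<le> emeasure (leb (blkset n r)) (entrybox (blkset n r) 1)"
    by (intro emeasure_mono) (auto simp: entrybox_sets)
  then show ?thesis using emeasure_box_finite[OF finite_blkset] by (rule le_less_trans)
qed

lemma hsb_pos: "emeasure (leb (blkset n r)) (hsb n) > 0"
proof -
  \<comment> \<open>With this bound the n^2 squared entries add up to at most (n/(n+1))^2. Entries
    off the blocks vanish only almost everywhere, hence the comparison by
    \<open>emeasure_mono_AE\<close>.\<close>
  let ?k = "1 / (real n + 1)"
  have "emeasure (leb (blkset n r)) (entrybox (blkset n r) ?k) \<le> emeasure (leb (blkset n r)) (hsb n)"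
  proof (rule emeasure_mono_AE)
    show "AE M in leb (blkset n r). M \<in> entrybox (blkset n r) ?k \<longrightarrow> M \<in> hsb n"
      using AE_supp
    proof eventually_elim
      case (elim M)
      show ?case
      proof
        assume bx: "M \<in> entrybox (blkset n r) ?k"
        have "cmod (M a b) \<le> ?k" for a b
          using bx elim by (cases "(a, b) \<in> blkset n r") (auto simp: entrybox_def supp_def)
        then have "(\<Sum>b<n. \<Sum>a<n. (cmod (M a b))\<^sup>2) \<le> (\<Sum>b<n. \<Sum>a<n. ?k\<^sup>2)"
          by (intro sum_mono power_mono) auto
        also have "\<dots> = (real n / (real n + 1))\<^sup>2" by (simp add: power2_eq_square)
        also have "\<dots> \<le> 1" by (intro power_le_one) auto
        finally show "M \<in> hsb n" by (simp add: hsb_def)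
      qed
    qed
  qed (use hsb_sets in auto)
  then show ?thesis using emeasure_box_pos[OF finite_blkset, of ?k] by (auto intro: less_le_trans)
qed

text \<open>Invariance is derived from translations instead of a Jacobian. The integral of F(Ux),
  times the volume of the ball, is the double integral of F(Ux) B(y - Ux). Exchanging the order and
  translating x by U^* y gives F(Ux + y) B(x), by the symmetry of the ball; a last translation in y
  removes Ux, and the volume cancels.\<close>

lemma leb_unitary_invariant:
  assumes U: "U \<in> ugrp n r" and F: "F \<in> borel_measurable borel"
  shows "(\<integral>\<^sup>+M. F (mmul n U M) \<partial>leb (blkset n r)) = (\<integral>\<^sup>+M. F M \<partial>leb (blkset n r))"
proof -
  let ?L = "leb (blkset n r)"
  interpret sigma_finite_measure ?L by (rule sigma_finite_leb) simp
  interpret P: pair_sigma_finite ?L ?L ..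
  have un: "unitary n U" using U by (simp add: ugrp_def)
  have un': "unitary n (madj U)" by (rule unitary_madj[OF un])
  define B :: "cmat \<Rightarrow> ennreal" where "B M = indicator (hsb n) M" for M
  have mB: "B \<in> borel_measurable borel" unfolding B_def[abs_def] using hsb_sets by simp
  have me1: "(\<lambda>z. (fst z :: cmat) a b) \<in> borel_measurable (?L \<Otimes>\<^sub>M ?L)" for a b
    by (rule measurable_compose[OF measurable_fst]) (simp add: measurable_entry_mat cong: measurable_cong_sets)
  have me2: "(\<lambda>z. (snd z :: cmat) a b) \<in> borel_measurable (?L \<Otimes>\<^sub>M ?L)" for a b
    by (rule measurable_compose[OF measurable_snd]) (simp add: measurable_entry_mat cong: measurable_cong_sets)
  have bL: "f \<in> borel_measurable borel \<Longrightarrow> f \<in> borel_measurable ?L" for f :: "cmat \<Rightarrow> ennreal"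
    by (simp cong: measurable_cong_sets)
  have mul1: "(\<lambda>z. mmul n U (fst z)) \<in> measurable (?L \<Otimes>\<^sub>M ?L) borel"
    by (rule measurable_cmatI) (auto simp: mmul_def intro!: borel_measurable_sum borel_measurable_times me1)
  have UU: "mmul n U (mmul n (madj U) y) = y" if "y \<in> supp (blkset n r)" for y
    by (simp add: mmul_assoc[symmetric] unitary_right_inverse[OF un] mmul_mid_left supp_is_mat[OF that])
  have mmul_add: "mmul n U (\<lambda>a b. x a b + y a b) = (\<lambda>a b. mmul n U x a b + mmul n U y a b)" for x y
    by (simp add: mmul_def fun_eq_iff distrib_left sum.distrib)
  have Us: "mmul n U x \<in> supp (blkset n r)" "mmul n (madj U) x \<in> supp (blkset n r)" if "x \<in> supp (blkset n r)" for x
    using supp_mmul[OF ugrp_supp[OF U] that] supp_mmul[OF ugrp_supp[OF ugrp_madj[OF U]] that] .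
  have neg: "(\<lambda>a b. - x a b) \<in> supp (blkset n r)" if "x \<in> supp (blkset n r)" for x
    using that by (auto simp: supp_def)
  define K where "K x y = F (mmul n U x) * B (\<lambda>a b. y a b + - mmul n U x a b)" for x y
  have mK: "(\<lambda>(x, y). K x y) \<in> borel_measurable (?L \<Otimes>\<^sub>M ?L)"
    unfolding K_def case_prod_beta
    by (intro borel_measurable_times_ennreal measurable_compose[OF mul1 F] measurable_compose[OF _ mB] measurable_cmatI borel_measurable_add borel_measurable_uminus me2)
       (simp add: mmul_def, intro borel_measurable_sum borel_measurable_times borel_measurable_const me1)
  have "(\<integral>\<^sup>+x. F (mmul n U x) \<partial>?L) * emeasure ?L (hsb n) = (\<integral>\<^sup>+x. F (mmul n U x) * emeasure ?L (hsb n) \<partial>?L)"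
    by (rule nn_integral_multc[symmetric]) (rule bL, rule measurable_compose[OF measurable_mmul_const F])
  also have "\<dots> = (\<integral>\<^sup>+x. \<integral>\<^sup>+y. K x y \<partial>?L \<partial>?L)"
  proof (rule nn_integral_cong_AE, use AE_supp in eventually_elim)
    case (elim x)
    have "emeasure ?L (hsb n) = (\<integral>\<^sup>+y. B y \<partial>?L)" unfolding B_def using hsb_sets by simp
    also have "\<dots> = (\<integral>\<^sup>+y. B (\<lambda>a b. y a b + - mmul n U x a b) \<partial>?L)"
      by (rule leb_translate[symmetric, OF finite_blkset neg[OF Us(1)[OF elim]] mB])
    finally have "F (mmul n U x) * emeasure ?L (hsb n) = F (mmul n U x) * (\<integral>\<^sup>+y. B (\<lambda>a b. y a b + - mmul n U x a b) \<partial>?L)" by simp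
    also have "\<dots> = (\<integral>\<^sup>+y. K x y \<partial>?L)" unfolding K_def
      by (subst nn_integral_cmult[symmetric], rule bL, rule measurable_compose[OF _ mB], rule measurable_cmatI)
         (intro borel_measurable_add measurable_entry_mat borel_measurable_const, simp)
    finally show ?case .
  qed
  also have "\<dots> = (\<integral>\<^sup>+y. \<integral>\<^sup>+x. K x y \<partial>?L \<partial>?L)"
    by (rule P.Fubini'[OF mK, symmetric])
  also have "\<dots> = (\<integral>\<^sup>+y. \<integral>\<^sup>+x. B x * F (\<lambda>a b. mmul n U x a b + y a b) \<partial>?L \<partial>?L)"
  proof (rule nn_integral_cong_AE, use AE_supp in eventually_elim)
    case (elim y)
    have mKy: "(\<lambda>x. K x y) \<in> borel_measurable borel" unfolding K_def
      by (intro borel_measurable_times_ennreal measurable_compose[OF measurable_mmul_const F] measurable_compose[OF _ mB] measurable_cmatI borel_measurable_add borel_measurable_uminus borel_measurable_const)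
         (simp add: mmul_def, intro borel_measurable_sum borel_measurable_times borel_measurable_const measurable_entry_mat)
    have e: "K (\<lambda>a b. x a b + mmul n (madj U) y a b) y = B x * F (\<lambda>a b. mmul n U x a b + y a b)" for x
    proof -
      have "B (\<lambda>a b. - mmul n U x a b) = B x"
        using hsb_mmul[OF un, of x] by (simp add: B_def indicator_def) (simp add: hsb_def)
      then show ?thesis unfolding K_def mmul_add UU[OF elim] by (simp add: mult.commute)
    qed
    have "(\<integral>\<^sup>+x. K x y \<partial>?L) = (\<integral>\<^sup>+x. K (\<lambda>a b. x a b + mmul n (madj U) y a b) y \<partial>?L)"
      by (rule leb_translate[symmetric, OF finite_blkset Us(2)[OF elim] mKy])
    also have "\<dots> = (\<integral>\<^sup>+x. B x * F (\<lambda>a b. mmul n U x a b + y a b) \<partial>?L)" by (simp only: e)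
    finally show ?case .
  qed
  also have "\<dots> = (\<integral>\<^sup>+x. \<integral>\<^sup>+y. B x * F (\<lambda>a b. mmul n U x a b + y a b) \<partial>?L \<partial>?L)"
  proof (rule P.Fubini')
    show "(\<lambda>(x, y). B x * F (\<lambda>a b. mmul n U x a b + y a b)) \<in> borel_measurable (?L \<Otimes>\<^sub>M ?L)"
      unfolding case_prod_beta
      by (intro borel_measurable_times_ennreal measurable_compose[OF _ F] measurable_compose[OF measurable_fst bL[OF mB]] measurable_cmatI borel_measurable_add me2)
         (simp add: mmul_def, intro borel_measurable_sum borel_measurable_times borel_measurable_const me1)
  qed
  also have "\<dots> = (\<integral>\<^sup>+x. B x * (\<integral>\<^sup>+y. F y \<partial>?L) \<partial>?L)"
  proof (rule nn_integral_cong_AE, use AE_supp in eventually_elim)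
    case (elim x)
    have mFx: "(\<lambda>y. F (\<lambda>a b. y a b + mmul n U x a b)) \<in> borel_measurable borel"
      by (rule measurable_compose[OF _ F], rule measurable_cmatI) (intro borel_measurable_add measurable_entry_mat borel_measurable_const)
    have "(\<integral>\<^sup>+y. B x * F (\<lambda>a b. y a b + mmul n U x a b) \<partial>?L) = B x * (\<integral>\<^sup>+y. F y \<partial>?L)"
      by (subst nn_integral_cmult[OF bL[OF mFx]]) (simp only: leb_translate[OF finite_blkset Us(1)[OF elim] F])
    then show ?case by (simp only: add.commute)
  qed
  also have "\<dots> = (\<integral>\<^sup>+y. F y \<partial>?L) * emeasure ?L (hsb n)"
    by (subst nn_integral_multc[OF bL[OF mB]]) (simp add: B_def[abs_def] hsb_sets mult.commute)
  finally have "(\<integral>\<^sup>+x. F (mmul n U x) \<partial>?L) * emeasure ?L (hsb n) = (\<integral>\<^sup>+y. F y \<partial>?L) * emeasure ?L (hsb n)" .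
  then have "(\<integral>\<^sup>+x. F (mmul n U x) \<partial>?L) * emeasure ?L (hsb n) / emeasure ?L (hsb n) = (\<integral>\<^sup>+y. F y \<partial>?L) * emeasure ?L (hsb n) / emeasure ?L (hsb n)"
    by simp
  then show ?thesis
    using hsb_pos[of n r] hsb_finite[of n r] by (simp add: ennreal_mult_divide_eq less_top)
qed

lemma sets_eq_const:
  fixes f :: "'a::topological_space \<Rightarrow> complex"
  assumes "f \<in> borel_measurable borel" shows "{x. f x = c} \<in> sets borel"
proof -
  have "f -` {c} \<inter> space borel \<in> sets borel" by (rule measurable_sets[OF assms]) simp
  then show ?thesis by (simp add: vimage_def)
qed

lemma sets_INT2:
  fixes S :: "nat \<Rightarrow> nat \<Rightarrow> 'a::topological_space set"
  assumes "\<And>a b. S a b \<in> sets borel" shows "(\<Inter>a. \<Inter>b. S a b) \<in> sets borel"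
  using assms by (intro sets.countable_INT'') simp_all

lemma sets_INT1:
  fixes S :: "nat \<Rightarrow> 'a::topological_space set"
  assumes "\<And>a. S a \<in> sets borel" shows "(\<Inter>a. S a) \<in> sets borel"
  using sets_INT2[of "\<lambda>a b. S a"] assms by simp

lemma ennreal_nat_mult_bounded_zero:
  fixes c B :: ennreal
  assumes "B < \<infinity>" "\<And>K::nat. of_nat K * c \<le> B" shows "c = 0"
proof -
  have "c \<le> B" using assms(2)[of 1] by simp
  then have cf: "c < top" using assms(1) by simp
  obtain x where x: "c = ennreal x" "x \<ge> 0" using cf by (cases c) auto
  obtain b where b: "B = ennreal b" "b \<ge> 0" using assms(1) by (cases B) auto
  have le: "real K * x \<le> b" for K
  proof -
    have "ennreal (real K * x) \<le> ennreal b"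
      using assms(2)[of K] x b by (simp add: ennreal_mult ennreal_of_nat_eq_real_of_nat)
    then show ?thesis using b by (simp add: ennreal_le_iff)
  qed
  have "x = 0"
  proof (rule ccontr)
    assume "x \<noteq> 0"
    then obtain K :: nat where "b < real K * x" using x reals_Archimedean3[of x] by auto
    then show False using le[of K] by simp
  qed
  then show ?thesis using x by simp
qed

text \<open>S meets each line in the direction of the entry (a, k) at most once, so translates by
  distinct amounts are disjoint. They have equal measure and lie in one box of finite measure, which
  leaves only measure zero.\<close>

lemma null_by_translates:
  assumes D: "finite D" and S: "S \<in> sets borel" "S \<subseteq> entrybox D j"
    and p: "(a, k) \<in> D"
    and disj: "\<And>M z w. (\<lambda>x y. M x y + (if x = a \<and> y = k then z else 0)) \<in> S \<Longrightarrow>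
        (\<lambda>x y. M x y + (if x = a \<and> y = k then w else 0)) \<in> S \<Longrightarrow> z = (w :: complex)"
  shows "emeasure (leb D) S = 0"
proof -
  define E where "E z = (\<lambda>x y. if x = a \<and> y = k then z else (0::complex))" for z
  have E: "E z \<in> supp D" for z using p by (auto simp: E_def supp_def)
  \<comment> \<open>Infinitely many distinct shifts of size at most 1, so all translates stay in the
    box enlarged by 1.\<close>
  define t where "t i = complex_of_real (1 / (real i + 1))" for i
  define A where "A i = {M. (\<lambda>x y. M x y + E (t i) x y) \<in> S}" for i :: nat
  have mA: "(\<lambda>M x y. M x y + E (t i) x y) \<in> measurable borel (borel :: cmat measure)" for i
    by (rule measurable_cmatI) (intro borel_measurable_add measurable_entry_mat borel_measurable_const)
  have As: "A i \<in> sets borel" for i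
    using measurable_sets[OF mA S(1), of i] by (simp add: A_def vimage_def)
  have eA: "emeasure (leb D) (A i) = emeasure (leb D) S" for i
  proof -
    have "emeasure (leb D) (A i) = (\<integral>\<^sup>+M. indicator S (\<lambda>x y. M x y + E (t i) x y) \<partial>leb D)"
    proof -
      have "emeasure (leb D) (A i) = (\<integral>\<^sup>+M. indicator (A i) M \<partial>leb D)" using As by simp
      then show ?thesis by (simp add: A_def indicator_def)
    qed
    also have "\<dots> = (\<integral>\<^sup>+M. indicator S M \<partial>leb D)"
      by (rule leb_translate[OF D E]) (use S(1) in simp)
    finally show ?thesis using S(1) by simp
  qed
  have dA: "disjoint_family A"
  proof (unfold disjoint_family_on_def, intro ballI impI)
    fix i j :: nat assume ij: "i \<noteq> j"
    show "A i \<inter> A j = {}"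
    proof (rule ccontr)
      assume "A i \<inter> A j \<noteq> {}"
      then obtain M where "M \<in> A i" "M \<in> A j" by auto
      then have "t i = t j" using disj[of M "t i" "t j"] by (simp add: A_def E_def)
      then show False using ij by (simp add: t_def)
    qed
  qed
  have sub: "A i \<subseteq> entrybox D (j + 1)" for i
  proof
    fix M assume M: "M \<in> A i"
    have "cmod (M x y) \<le> j + 1" if "(x, y) \<in> D" for x y
    proof -
      have "cmod (M x y + E (t i) x y) \<le> j" using M S(2) that by (auto simp: A_def entrybox_def)
      moreover have "cmod (t i) \<le> 1" unfolding t_def norm_of_real by simp
      then have "cmod (E (t i) x y) \<le> 1" by (auto simp: E_def)
      moreover have "cmod (M x y) \<le> cmod (M x y + E (t i) x y) + cmod (E (t i) x y)"
        using norm_triangle_ineq4[of "M x y + E (t i) x y" "E (t i) x y"] by simp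
      ultimately show ?thesis by linarith
    qed
    then show "M \<in> entrybox D (j + 1)" by (auto simp: entrybox_def)
  qed
  show ?thesis
  proof (rule ennreal_nat_mult_bounded_zero[OF emeasure_box_finite[OF D, of "j + 1"]])
    fix K :: nat
    have "of_nat K * emeasure (leb D) S = (\<Sum>i<K. emeasure (leb D) (A i))" by (simp add: eA)
    also have "\<dots> = emeasure (leb D) (\<Union>i<K. A i)"
      by (rule sum_emeasure) (use As dA in \<open>auto simp: disjoint_family_on_def\<close>)
    also have "\<dots> \<le> emeasure (leb D) (entrybox D (j + 1))"
      by (rule emeasure_mono) (use sub entrybox_sets[OF D] in auto)
    finally show "of_nat K * emeasure (leb D) S \<le> emeasure (leb D) (entrybox D (j + 1))" .
  qed
qed

text \<open>Matrices whose residual at step k vanishes although it depends on the entry (a, k); the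
  condition on \<open>prj\<close> expresses that dependence. The box makes the set bounded, as
  \<open>null_by_translates\<close> requires.\<close>

definition gsbad :: "nat \<Rightarrow> (nat \<Rightarrow> nat) \<Rightarrow> real \<Rightarrow> nat \<Rightarrow> nat \<Rightarrow> cmat set" where
  "gsbad n r j a k = {G \<in> entrybox (blkset n r) j. (\<forall>b<n. gsres n G k (gsq n G k) b = 0) \<and> prj k (gsq n G k) a a \<noteq> 1}"

text \<open>Adding z to the entry (a, k) leaves the earlier columns alone and changes row a of the
  residual by z (1 - \<open>prj\<close> a a). This is affine in z with nonzero slope, so it vanishes
  for at most one z.\<close>

lemma gs_null:
  assumes p: "(a, k) \<in> blkset n r"
  shows "gsbad n r j a k \<in> null_sets (leb (blkset n r))"
proof -
  let ?S = "gsbad n r j a k"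
  have an: "a < n" using p by (simp add: blkset_def)
  have res: "(\<lambda>G. gsres n G k (gsq n G k) b) \<in> borel_measurable borel" for b
    unfolding gsres_def
    by (intro borel_measurable_diff borel_measurable_sum borel_measurable_times measurable_entry_mat borel_measurable_cnj measurable_gsq)
  have pm: "(\<lambda>G. prj k (gsq n G k) a a) \<in> borel_measurable borel"
    unfolding prj_def by (intro borel_measurable_sum borel_measurable_times borel_measurable_cnj measurable_gsq)
  have Se: "?S = (entrybox (blkset n r) j \<inter> (\<Inter>b. {G. b < n \<longrightarrow> gsres n G k (gsq n G k) b = 0})) - {G. prj k (gsq n G k) a a = 1}"
    unfolding gsbad_def by blast
  have "{G. b < n \<longrightarrow> gsres n G k (gsq n G k) b = 0} \<in> sets borel" for b
    using sets_eq_const[OF res[of b], of 0] by (cases "b < n") auto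
  then have "(\<Inter>b. {G. b < n \<longrightarrow> gsres n G k (gsq n G k) b = 0}) \<in> sets borel"
    by (rule sets_INT1)
  then have ms: "?S \<in> sets borel" unfolding Se
    by (intro sets.Diff sets.Int sets_eq_const[OF pm, of 1] entrybox_sets[OF finite_blkset])
  have "emeasure (leb (blkset n r)) ?S = 0"
  proof (rule null_by_translates[OF finite_blkset ms _ p])
    show "?S \<subseteq> entrybox (blkset n r) j" by (auto simp: gsbad_def)
    fix M z w
    define Mz where "Mz z = (\<lambda>x y. M x y + (if x = a \<and> y = k then z else 0))" for z :: complex
    assume 1: "(\<lambda>x y. M x y + (if x = a \<and> y = k then z else 0)) \<in> ?S"
      and 2: "(\<lambda>x y. M x y + (if x = a \<and> y = k then w else 0)) \<in> ?S"
    have q: "gsq n (Mz z) k = gsq n M k" for z by (rule gsq_cong) (simp add: Mz_def)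
    have r: "gsres n (Mz z) k (gsq n M k) a = gsres n M k (gsq n M k) a + z * (1 - prj k (gsq n M k) a a)" for z
    proof -
      let ?Q = "gsq n M k"
      have "(\<Sum>b<n. cnj (?Q b i) * Mz z b k) = (\<Sum>b<n. cnj (?Q b i) * M b k) + cnj (?Q a i) * z" for i
      proof -
        have "(\<Sum>b<n. cnj (?Q b i) * Mz z b k) = (\<Sum>b<n. cnj (?Q b i) * M b k + (if b = a then cnj (?Q a i) * z else 0))"
          unfolding Mz_def by (intro sum.cong refl) (auto simp: distrib_left)
        then show ?thesis using an by (simp add: sum.distrib)
      qed
      then have "gsres n (Mz z) k ?Q a = M a k + z - (\<Sum>i<k. ?Q a i * ((\<Sum>b<n. cnj (?Q b i) * M b k) + cnj (?Q a i) * z))"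
        by (simp add: gsres_def Mz_def)
      also have "(\<Sum>i<k. ?Q a i * ((\<Sum>b<n. cnj (?Q b i) * M b k) + cnj (?Q a i) * z)) = (\<Sum>i<k. ?Q a i * (\<Sum>b<n. cnj (?Q b i) * M b k)) + prj k ?Q a a * z"
        unfolding prj_def distrib_left sum.distrib sum_distrib_right by (simp only: mult.assoc)
      finally show ?thesis by (simp add: gsres_def algebra_simps)
    qed
    have m: "gsres n (Mz u) k (gsq n (Mz u) k) a = 0 \<and> prj k (gsq n (Mz u) k) a a \<noteq> 1" if "Mz u \<in> ?S" for u
      using that an by (simp add: gsbad_def)
    have "Mz z \<in> ?S" unfolding Mz_def by (rule 1)
    from m[OF this] have e: "gsres n M k (gsq n M k) a + z * (1 - prj k (gsq n M k) a a) = 0 \<and> prj k (gsq n M k) a a \<noteq> 1"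
      unfolding q r .
    have "Mz w \<in> ?S" unfolding Mz_def by (rule 2)
    from m[OF this] have e': "gsres n M k (gsq n M k) a + w * (1 - prj k (gsq n M k) a a) = 0 \<and> prj k (gsq n M k) a a \<noteq> 1"
      unfolding q r .
    have gen: "z = w" if "x + z * (1 - y) = 0 \<and> y \<noteq> 1" "x + w * (1 - y) = 0 \<and> y \<noteq> 1" for x y :: complex
    proof -
      have "(z - w) * (1 - y) = (x + z * (1 - y)) - (x + w * (1 - y))" by (simp add: algebra_simps)
      also have "\<dots> = 0" using that by simp
      finally show ?thesis using that by simp
    qed
    show "z = w" by (rule gen[OF e e'])
  qed
  then show ?thesis using ms by (intro null_setsI) simp_all
qed

text \<open>The boxes exhaust all matrices, so countably many null sets are removed. At each step k
  \<open>gsq_defect_exists\<close> then supplies a row a in the block of k for which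
  \<open>gsbad\<close> rules out a vanishing residual, and the next column can be
  normalised.\<close>

lemma AE_gs_unitary: "AE G in leb (blkset n r). gsq n G n \<in> ugrp n r"
proof -
  let ?D = "blkset n r"
  have "AE G in leb ?D. \<forall>k a j. (a, k) \<in> ?D \<longrightarrow> G \<notin> gsbad n r (real j) a k"
  proof (subst AE_all_countable, rule allI, subst AE_all_countable, rule allI, subst AE_all_countable, rule allI)
    fix k a and j :: nat
    show "AE G in leb ?D. (a, k) \<in> ?D \<longrightarrow> G \<notin> gsbad n r (real j) a k"
    proof (cases "(a, k) \<in> ?D")
      case True
      from AE_not_in[OF gs_null[OF True, where j = "real j"]] show ?thesis by (rule eventually_mono) simp
    qed simp
  qed
  then show ?thesis using AE_supp
  proof eventually_elim
    case (elim G)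
    have G0: "G a b = 0" if "r a \<noteq> r b" for a b using supp_block[OF elim(2) that] .
    obtain j :: nat where j: "G \<in> entrybox ?D (real j)"
    proof -
      obtain k :: nat where k: "(\<Sum>p\<in>?D. cmod (G (fst p) (snd p))) \<le> real k" using real_arch_simple by blast
      have "cmod (G a b) \<le> real k" if "(a, b) \<in> ?D" for a b
        using member_le_sum[of "(a,b)" ?D "\<lambda>p. cmod (G (fst p) (snd p))"] that k by simp
      then show ?thesis using that[of k] by (auto simp: entrybox_def)
    qed
    have "orth n k (gsq n G k)" if "k \<le> n" for k
      using that
    proof (induction k)
      case 0
      then show ?case by (simp add: orth_def)
    next
      case (Suc k)
      then have o: "orth n k (gsq n G k)" and kn: "k < n" by auto
      obtain a where a: "a < n" "r a = r k" "(\<Sum>i<k. (cmod (gsq n G k a i))\<^sup>2) \<noteq> 1"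
        using gsq_defect_exists[OF o G0 kn] by blast
      have "prj k (gsq n G k) a a \<noteq> 1" using a(3) by (simp only: prj_diag of_real_eq_1_iff) simp
      moreover have "(a, k) \<in> ?D" using a kn by (simp add: blkset_def)
      ultimately have "\<not> (\<forall>b<n. gsres n G k (gsq n G k) b = 0)"
        using elim(1)[rule_format, of a k j] j by (simp add: gsbad_def)
      then obtain b where b: "b < n" "gsres n G k (gsq n G k) b \<noteq> 0" by blast
      then have "0 < (cmod (gsres n G k (gsq n G k) b))\<^sup>2" by simp
      also have "\<dots> \<le> (\<Sum>b<n. (cmod (gsres n G k (gsq n G k) b))\<^sup>2)"
        using b(1) by (intro member_le_sum) auto
      finally have "(\<Sum>b<n. (cmod (gsres n G k (gsq n G k) b))\<^sup>2) \<noteq> 0" by simp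
      then show ?case by (rule gsq_orth_step[OF o])
    qed
    then have o: "orth n n (gsq n G n)" by simp
    moreover have "is_mat n (gsq n G n)" by (rule gsq_is_mat[OF supp_is_mat[OF elim(2)]]) simp
    ultimately have "unitary n (gsq n G n)" by (simp add: unitary_orth)
    moreover have "gsq n G n a b = 0" if "r a \<noteq> r b" for a b by (rule gsq_supp[of r, OF G0 that])
    ultimately show ?case by (auto simp: ugrp_def)
  qed
qed

lemma ugrp_sets: "ugrp n r \<in> sets borel"
proof -
  have "ugrp n r = (\<Inter>a. \<Inter>b. {U. (n \<le> a \<or> n \<le> b \<longrightarrow> U a b = 0) \<and> mmul n (madj U) U a b = mid n a b \<and> (a < n \<and> b < n \<and> r a \<noteq> r b \<longrightarrow> U a b = 0)})"
  proof -
    have "ugrp n r = {U. (\<forall>a b. n \<le> a \<or> n \<le> b \<longrightarrow> U a b = 0) \<and> (\<forall>a b. mmul n (madj U) U a b = mid n a b) \<and> (\<forall>a b. a < n \<and> b < n \<and> r a \<noteq> r b \<longrightarrow> U a b = 0)}"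
      unfolding ugrp_def unitary_def is_mat_def fun_eq_iff by blast
    also have "\<dots> = (\<Inter>a. \<Inter>b. {U. (n \<le> a \<or> n \<le> b \<longrightarrow> U a b = 0) \<and> mmul n (madj U) U a b = mid n a b \<and> (a < n \<and> b < n \<and> r a \<noteq> r b \<longrightarrow> U a b = 0)})"
      by blast
    finally show ?thesis .
  qed
  moreover have "{U. (n \<le> a \<or> n \<le> b \<longrightarrow> U a b = 0) \<and> mmul n (madj U) U a b = mid n a b \<and> (a < n \<and> b < n \<and> r a \<noteq> r b \<longrightarrow> U a b = 0)} \<in> sets borel" for a b
  proof -
    have "{U :: cmat. P \<longrightarrow> U a b = 0} \<in> sets borel" for P
      using sets_eq_const[OF measurable_entry_mat[of a b], of 0] by (cases P) auto
    moreover have "{U. mmul n (madj U) U a b = mid n a b} \<in> sets borel"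
      unfolding mmul_def madj_def
      by (intro sets_eq_const borel_measurable_sum borel_measurable_times borel_measurable_cnj measurable_entry_mat)
    ultimately show ?thesis unfolding Collect_conj_eq by (intro sets.Int)
  qed
  ultimately show ?thesis by (simp only:) (rule sets_INT2)
qed

text \<open>The random matrix is uniform on the ball of block matrices, a law invariant under left
  multiplication by the group; \<open>gsq_equivariant\<close> passes the invariance on.\<close>

definition haar :: "nat \<Rightarrow> (nat \<Rightarrow> nat) \<Rightarrow> cmat measure" where
  "haar n r = distr (uniform_measure (leb (blkset n r)) (hsb n)) borel (\<lambda>G. gsq n G n)"

lemma measurable_gs: "(\<lambda>G. gsq n G n) \<in> measurable borel borel"
  by (rule measurable_cmatI) (rule measurable_gsq)

lemma measurable_gs': "(\<lambda>G. gsq n G n) \<in> measurable (uniform_measure (leb (blkset n r)) (hsb n)) borel"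
  using measurable_gs by (simp cong: measurable_cong_sets)

lemma sets_haar [simp]: "sets (haar n r) = sets borel" "space (haar n r) = UNIV"
  by (simp_all add: haar_def)

lemma prob_haar: "prob_space (haar n r)"
proof -
  interpret U: prob_space "uniform_measure (leb (blkset n r)) (hsb n)"
    using hsb_pos[of n r] hsb_finite[of n r] by (intro prob_space_uniform_measure) auto
  show ?thesis unfolding haar_def by (rule U.prob_space_distr[OF measurable_gs'])
qed

lemma AE_haar: "AE U in haar n r. U \<in> ugrp n r"
  unfolding haar_def
proof (subst AE_distr_iff[OF measurable_gs'])
  show "{x \<in> space borel. x \<in> ugrp n r} \<in> sets borel" using ugrp_sets by simp
  show "AE x in uniform_measure (leb (blkset n r)) (hsb n). gsq n x n \<in> ugrp n r"
    by (rule AE_uniform_measureI, simp add: hsb_sets, rule eventually_mono[OF AE_gs_unitary]) simp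
qed

lemma haar_left_invariant:
  assumes U: "U \<in> ugrp n r" shows "distr (haar n r) borel (mmul n U) = haar n r"
proof (rule measure_eqI)
  let ?L = "leb (blkset n r)" and ?g = "\<lambda>G. gsq n G n"
  have un: "unitary n U" using U by (simp add: ugrp_def)
  have em: "emeasure (haar n r) A = emeasure ?L (hsb n \<inter> ?g -` A) / emeasure ?L (hsb n)" if "A \<in> sets borel" for A
  proof -
    have "?g -` A \<in> sets borel" using measurable_sets[OF measurable_gs that] by simp
    then show ?thesis unfolding haar_def
      using that hsb_sets by (subst emeasure_distr[OF measurable_gs' that]) simp
  qed
  fix A assume "A \<in> sets (distr (haar n r) borel (mmul n U))"
  then have A: "A \<in> sets borel" by simp
  have mU: "mmul n U \<in> measurable (haar n r) borel" using measurable_mmul_const by (simp cong: measurable_cong_sets)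
  have pre: "mmul n U -` A \<in> sets borel" using measurable_sets[OF measurable_mmul_const A] by simp
  let ?S = "hsb n \<inter> ?g -` A"
  have S: "?S \<in> sets borel" using measurable_sets[OF measurable_gs A] hsb_sets by auto
  have Seq: "hsb n \<inter> ?g -` (mmul n U -` A) = mmul n U -` ?S"
    by (auto simp: gsq_equivariant[OF un] hsb_mmul[OF un])
  have "emeasure ?L (mmul n U -` ?S) = (\<integral>\<^sup>+M. indicator ?S (mmul n U M) \<partial>?L)"
  proof -
    have "mmul n U -` ?S \<in> sets borel" using measurable_sets[OF measurable_mmul_const S] by simp
    then have "emeasure ?L (mmul n U -` ?S) = (\<integral>\<^sup>+M. indicator (mmul n U -` ?S) M \<partial>?L)" by simp
    then show ?thesis by (simp add: indicator_def)
  qed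
  also have "\<dots> = (\<integral>\<^sup>+M. indicator ?S M \<partial>?L)"
    by (rule leb_unitary_invariant[OF U]) (use S in simp)
  also have "\<dots> = emeasure ?L ?S" using S by simp
  finally show "emeasure (distr (haar n r) borel (mmul n U)) A = emeasure (haar n r) A"
    using A pre by (simp add: emeasure_distr[OF mU A] em Seq)
qed simp

section \<open>Existence and uniqueness of the invariant measure on the boundary\<close>

lemma act_col_mmul:
  "act_col m N (mmul (m*N) U V) X = act_col m N U (act_col m N V X)"
proof (intro ext)
  fix j i k
  show "act_col m N (mmul (m*N) U V) X j i k = act_col m N U (act_col m N V X) j i k"
  proof (cases "j < m \<and> i < N \<and> k < N")
    case True
    have e: "act_col m N V X (l div N) (l mod N) k = (\<Sum>e<m*N. V l e * X (e div N) (e mod N) k)" if "l < m * N" for l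
    proof -
      have "l div N < m" using that True by (simp add: less_mult_imp_div_less)
      moreover have "l mod N < N" using True by simp
      moreover have "(l div N) * N + l mod N = l" by simp
      ultimately show ?thesis using True by (simp add: act_col_def)
    qed
    have "act_col m N U (act_col m N V X) j i k = (\<Sum>l<m*N. \<Sum>e<m*N. U (j*N+i) l * (V l e * X (e div N) (e mod N) k))"
      unfolding act_col_def[of m N U] using True by (simp add: e sum_distrib_left)
    also have "\<dots> = (\<Sum>e<m*N. \<Sum>l<m*N. U (j*N+i) l * (V l e * X (e div N) (e mod N) k))" by (rule sum.swap)
    also have "\<dots> = act_col m N (mmul (m*N) U V) X j i k"
      using True by (simp add: act_col_def mmul_def sum_distrib_right mult.assoc)
    finally show ?thesis by simp
  next
    case False
    then show ?thesis by (auto simp: act_col_def)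
  qed
qed

lemma sum_flat: "(\<Sum>l<m*N. g (l div N) (l mod N)) = (\<Sum>j<m. \<Sum>i<N. g j i)" for g :: "nat \<Rightarrow> nat \<Rightarrow> 'a::comm_monoid_add"
proof -
  have "(\<Sum>l<m*N. g (l div N) (l mod N)) = (\<Sum>(j, i)\<in>{..<m} \<times> {..<N}. g j i)"
  proof (rule sum.reindex_bij_witness[where i = "\<lambda>(j, i). j * N + i" and j = "\<lambda>l. (l div N, l mod N)"])
    fix l assume l: "l \<in> {..<m*N}"
    then have "N > 0" by (cases "N = 0") auto
    then show "(l div N, l mod N) \<in> {..<m} \<times> {..<N}" using l by (simp add: less_mult_imp_div_less)
  qed (auto simp: flat_less)
  then show ?thesis by (simp add: sum.cartesian_product)
qed

context nc_dom
begin

definition lab :: "nat \<Rightarrow> nat \<Rightarrow> nat" where "lab N a = cl (a div N)"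

lemma grp_ugrp: "grp N = ugrp (m * N) (lab N)"
  by (simp add: grp_def ugrp_def lab_def)

lemma bdryI:
  assumes "is_tup m N X" "\<And>j0 i k. j0 < m \<Longrightarrow> i < N \<Longrightarrow> k < N \<Longrightarrow> (\<Sum>j\<in>cls j0. \<Sum>l<N. cnj (X j l i) * X j l k) = (if i = k then 1 else 0)"
  shows "X \<in> bdry N"
proof -
  have "(\<Sum>j\<in>cls j0. mmul N (madj (X j)) (X j) i k) = mid N i k" if j0: "j0 < m" for j0 i k
  proof (cases "i < N \<and> k < N")
    case True
    then show ?thesis using assms(2)[OF j0] by (simp add: mmul_def madj_def mid_def)
  next
    case False
    have "mmul N (madj (X j)) (X j) i k = 0" if "j \<in> cls j0" for j
    proof -
      have "is_mat N (X j)" using assms(1) that cls_less by (auto simp: is_tup_def)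
      then have "is_mat N (mmul N (madj (X j)) (X j))" by (intro is_mat_mmul) auto
      then show ?thesis using False by (auto simp: is_mat_def not_less)
    qed
    then show ?thesis using False by (auto simp: mid_def)
  qed
  then show ?thesis using assms(1) by (auto simp: bdry_def fun_eq_iff)
qed

lemma bdry_gram:
  assumes "X \<in> bdry N" "j0 < m" "i < N" "k < N"
  shows "(\<Sum>j\<in>cls j0. \<Sum>l<N. cnj (X j l i) * X j l k) = (if i = k then 1 else 0)"
proof -
  have "(\<lambda>i k. \<Sum>j\<in>cls j0. mmul N (madj (X j)) (X j) i k) = mid N" using assms by (simp add: bdry_def)
  from fun_cong[OF fun_cong[OF this], of i k] show ?thesis using assms by (simp add: mmul_def madj_def mid_def)
qed

lemma cls_sum_flat:
  "(\<Sum>j\<in>cls j0. \<Sum>i<N. g j i) = (\<Sum>l<m*N. if lab N l = cl j0 then g (l div N) (l mod N) else 0)"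
proof -
  have "(\<Sum>j\<in>cls j0. \<Sum>i<N. g j i) = (\<Sum>j\<in>{j \<in> {..<m}. cl j = cl j0}. \<Sum>i<N. g j i)"
    by (rule sum.cong) (auto simp: cls_def)
  also have "\<dots> = (\<Sum>j<m. if cl j = cl j0 then (\<Sum>i<N. g j i) else 0)"
    by (rule sum.inter_filter) simp
  also have "\<dots> = (\<Sum>j<m. \<Sum>i<N. if cl j = cl j0 then g j i else 0)"
    by (intro sum.cong refl) auto
  also have "\<dots> = (\<Sum>l<m*N. if lab N l = cl j0 then g (l div N) (l mod N) else 0)"
    using sum_flat[of "\<lambda>j i. if cl j = cl j0 then g j i else 0" N m] by (simp add: lab_def)
  finally show ?thesis .
qed

lemma act_bdry:
  assumes U: "U \<in> grp N" and X: "X \<in> bdry N" shows "act_col m N U X \<in> bdry N"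
proof (rule bdryI)
  show "is_tup m N (act_col m N U X)" by (auto simp: is_tup_def is_mat_def act_col_def fun_eq_iff)
  have un: "unitary (m*N) U" using U by (simp add: grp_def)
  have U0: "U a b = 0" if "lab N a \<noteq> lab N b" for a b
    using supp_block[OF ugrp_supp[of U "m * N" "lab N"] that] U unfolding grp_ugrp by simp
  fix j0 i k assume *: "j0 < m" "i < N" "k < N"
  \<comment> \<open>Column i of X cut down to the rows of one class. U is block diagonal, so it
    commutes with the cut and \<open>unitary_inner\<close> applies to each class.\<close>
  define x where "x i l = (if lab N l = cl j0 then X (l div N) (l mod N) i else 0)" for i l
  have a: "(if lab N l = cl j0 then act_col m N U X (l div N) (l mod N) i else 0) = (\<Sum>e<m*N. U l e * x i e)"
    if "l < m*N" "i < N" for l i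
  proof (cases "lab N l = cl j0")
    case True
    have "l div N < m" "l mod N < N" "(l div N) * N + l mod N = l"
      using that by (auto simp: less_mult_imp_div_less)
    then have "act_col m N U X (l div N) (l mod N) i = (\<Sum>e<m*N. U l e * X (e div N) (e mod N) i)"
      using that by (simp add: act_col_def)
    also have "\<dots> = (\<Sum>e<m*N. U l e * x i e)"
      using U0[of l] True by (intro sum.cong refl) (auto simp: x_def)
    finally show ?thesis using True by simp
  next
    case False
    then have "(\<Sum>e<m*N. U l e * x i e) = 0" using U0[of l] by (intro sum.neutral) (auto simp: x_def)
    then show ?thesis using False by simp
  qed
  have "(\<Sum>j\<in>cls j0. \<Sum>l<N. cnj (act_col m N U X j l i) * act_col m N U X j l k)
      = (\<Sum>l<m*N. cnj (\<Sum>e<m*N. U l e * x i e) * (\<Sum>e<m*N. U l e * x k e))"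
    unfolding cls_sum_flat
    by (rule sum.cong[OF refl]) (use * a[symmetric] in simp)
  also have "\<dots> = (\<Sum>l<m*N. cnj (x i l) * x k l)" by (rule unitary_inner[OF un])
  also have "\<dots> = (\<Sum>j\<in>cls j0. \<Sum>l<N. cnj (X j l i) * X j l k)"
    unfolding cls_sum_flat by (rule sum.cong[OF refl]) (simp add: x_def)
  finally show "(\<Sum>j\<in>cls j0. \<Sum>l<N. cnj (act_col m N U X j l i) * act_col m N U X j l k) = (if i = k then 1 else 0)"
    using bdry_gram[OF X *] by simp
qed

lemma bdry_sets: "bdry N \<in> sets borel"
proof -
  define P where "P j a b = {X :: ctup. ((m \<le> j \<or> N \<le> a \<or> N \<le> b) \<longrightarrow> X j a b = 0) \<and>
     (j < m \<longrightarrow> (\<Sum>i\<in>cls j. mmul N (madj (X i)) (X i) a b) = mid N a b)}" for j a b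
  have "P j a b \<in> sets borel" for j a b
  proof -
    have "{X :: ctup. Q \<longrightarrow> X j a b = 0} \<in> sets borel" for Q
      using sets_eq_const[OF measurable_entry[of j a b], of 0] by (cases Q) auto
    moreover have "{X :: ctup. Q \<longrightarrow> (\<Sum>i\<in>cls j. mmul N (madj (X i)) (X i) a b) = mid N a b} \<in> sets borel" for Q
    proof (cases Q)
      case True
      have "{X :: ctup. (\<Sum>i\<in>cls j. mmul N (madj (X i)) (X i) a b) = mid N a b} \<in> sets borel"
        unfolding mmul_def madj_def
        by (intro sets_eq_const borel_measurable_sum borel_measurable_times borel_measurable_cnj measurable_entry)
      then show ?thesis using True by simp
    qed simp
    ultimately show ?thesis unfolding P_def Collect_conj_eq by (intro sets.Int)
  qed
  then have "(\<Inter>a. \<Inter>b. P j a b) \<in> sets borel" for j by (intro sets_INT2)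
  then have "(\<Inter>j. \<Inter>a. \<Inter>b. P j a b) \<in> sets borel" by (rule sets_INT1)
  moreover have "bdry N = (\<Inter>j. \<Inter>a. \<Inter>b. P j a b)"
  proof (rule set_eqI)
    fix X
    have "X \<in> bdry N \<longleftrightarrow> (\<forall>j a b. ((m \<le> j \<or> N \<le> a \<or> N \<le> b) \<longrightarrow> X j a b = 0) \<and> (j < m \<longrightarrow> (\<Sum>i\<in>cls j. mmul N (madj (X i)) (X i) a b) = mid N a b))"
      unfolding bdry_def is_tup_def is_mat_def fun_eq_iff mem_Collect_eq by (meson not_less)
    also have "\<dots> \<longleftrightarrow> X \<in> (\<Inter>j. \<Inter>a. \<Inter>b. P j a b)" by (simp only: P_def INT_iff mem_Collect_eq UNIV_I ball_UNIV simp_thms)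
    finally show "X \<in> bdry N \<longleftrightarrow> X \<in> (\<Inter>j. \<Inter>a. \<Inter>b. P j a b)" .
  qed
  ultimately show ?thesis by simp
qed

lemma measurable_ctupI:
  assumes "\<And>j a b. (\<lambda>x. f x j a b) \<in> borel_measurable M" shows "f \<in> measurable M (borel :: ctup measure)"
  by (rule measurable_coordinatewise_then_product, rule measurable_coordinatewise_then_product, rule measurable_coordinatewise_then_product, rule assms)

lemma measurable_act_joint:
  assumes "sets M = sets borel" "sets M' = sets borel"
  shows "(\<lambda>z. act_col m N (fst z) (snd z)) \<in> measurable (M \<Otimes>\<^sub>M M') borel"
proof (rule measurable_ctupI)
  fix j i k
  have m1: "(\<lambda>z. fst z a b) \<in> borel_measurable (M \<Otimes>\<^sub>M M')" for a b
    by (rule measurable_compose[OF measurable_fst]) (simp add: measurable_entry_mat assms cong: measurable_cong_sets)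
  have m2: "(\<lambda>z. snd z a b c) \<in> borel_measurable (M \<Otimes>\<^sub>M M')" for a b c
    by (rule measurable_compose[OF measurable_snd]) (simp add: measurable_entry assms cong: measurable_cong_sets)
  show "(\<lambda>z. act_col m N (fst z) (snd z) j i k) \<in> borel_measurable (M \<Otimes>\<^sub>M M')"
    unfolding act_col_def
    by (intro borel_measurable_if_const borel_measurable_sum borel_measurable_times m1 m2)
qed

lemma measurable_act_mat: "(\<lambda>U. act_col m N U X) \<in> measurable borel borel"
  by (rule measurable_ctupI, unfold act_col_def)
     (intro borel_measurable_if_const borel_measurable_sum borel_measurable_times measurable_entry_mat borel_measurable_const)

abbreviation HG :: "nat \<Rightarrow> cmat measure" where "HG N \<equiv> haar (m * N) (lab N)"

text \<open>Left multiplication by V on the group becomes the action of V on the orbit of x0, so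
  left invariance of the Haar law carries over to its image.\<close>

lemma inv_meas_orbit:
  assumes x0: "x0 \<in> bdry N"
  shows "inv_meas N (distr (HG N) borel (\<lambda>U. act_col m N U x0))"
proof -
  interpret H: prob_space "HG N" by (rule prob_haar)
  have mm: "(\<lambda>U. act_col m N U x0) \<in> measurable (HG N) borel"
    using measurable_act_mat by (simp cong: measurable_cong_sets)
  show ?thesis unfolding inv_meas_def
  proof (intro conjI ballI)
    show "prob_space (distr (HG N) borel (\<lambda>U. act_col m N U x0))" by (rule H.prob_space_distr[OF mm])
    show "AE X in distr (HG N) borel (\<lambda>U. act_col m N U x0). X \<in> bdry N"
    proof (subst AE_distr_iff[OF mm])
      show "{x \<in> space borel. x \<in> bdry N} \<in> sets borel" using bdry_sets by simp
      show "AE U in HG N. act_col m N U x0 \<in> bdry N"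
        using AE_haar by eventually_elim (rule act_bdry[OF _ x0], simp add: grp_ugrp)
    qed
    fix V assume V: "V \<in> grp N"
    have mV: "mmul (m*N) V \<in> measurable (HG N) borel" using measurable_mmul_const by (simp cong: measurable_cong_sets)
    have "distr (distr (HG N) borel (\<lambda>U. act_col m N U x0)) borel (act_col m N V)
       = distr (HG N) borel (act_col m N V \<circ> (\<lambda>U. act_col m N U x0))"
      by (rule distr_distr[OF measurable_act_col mm])
    also have "act_col m N V \<circ> (\<lambda>U. act_col m N U x0) = (\<lambda>U. act_col m N U x0) \<circ> mmul (m*N) V"
      by (simp add: fun_eq_iff act_col_mmul)
    also have "distr (HG N) borel ((\<lambda>U. act_col m N U x0) \<circ> mmul (m*N) V) = distr (distr (HG N) borel (mmul (m*N) V)) borel (\<lambda>U. act_col m N U x0)"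
      by (rule distr_distr[symmetric, OF measurable_act_mat mV])
    also have "distr (HG N) borel (mmul (m*N) V) = HG N"
      using haar_left_invariant[of V "m*N" "lab N"] V by (simp add: grp_ugrp)
    finally show "distr (distr (HG N) borel (\<lambda>U. act_col m N U x0)) borel (act_col m N V) = distr (HG N) borel (\<lambda>U. act_col m N U x0)" .
  qed simp
qed

text \<open>Taking adjoints is inversion on the group, so this image of the left invariant law is
  right invariant.\<close>

definition HR :: "nat \<Rightarrow> cmat measure" where "HR N = distr (HG N) borel madj"

lemma measurable_madj: "madj \<in> measurable borel borel"
  by (rule measurable_cmatI) (simp add: madj_def borel_measurable_cnj measurable_entry_mat)

lemma measurable_mmul_right: "(\<lambda>u. mmul n u v) \<in> measurable borel borel"
  by (rule measurable_cmatI, unfold mmul_def)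
     (intro borel_measurable_sum borel_measurable_times measurable_entry_mat borel_measurable_const)

lemma HR_right_invariant:
  assumes v: "v \<in> grp N" shows "distr (HR N) borel (\<lambda>u. mmul (m*N) u v) = HR N"
proof -
  have mm: "madj \<in> measurable (HG N) borel" using measurable_madj by (simp cong: measurable_cong_sets)
  have v': "madj v \<in> ugrp (m*N) (lab N)" using v ugrp_madj by (simp add: grp_ugrp)
  have mV: "mmul (m*N) (madj v) \<in> measurable (HG N) borel" using measurable_mmul_const by (simp cong: measurable_cong_sets)
  have "distr (HR N) borel (\<lambda>u. mmul (m*N) u v) = distr (HG N) borel ((\<lambda>u. mmul (m*N) u v) \<circ> madj)"
    unfolding HR_def by (rule distr_distr[OF measurable_mmul_right mm])
  also have "(\<lambda>u. mmul (m*N) u v) \<circ> madj = madj \<circ> mmul (m*N) (madj v)"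
    by (simp add: fun_eq_iff madj_mmul)
  also have "distr (HG N) borel (madj \<circ> mmul (m*N) (madj v)) = distr (distr (HG N) borel (mmul (m*N) (madj v))) borel madj"
    by (rule distr_distr[symmetric, OF measurable_madj mV])
  also have "\<dots> = HR N" by (simp add: haar_left_invariant[OF v'] HR_def)
  finally show ?thesis .
qed

lemma AE_HR: "AE u in HR N. u \<in> grp N"
proof -
  have mm: "madj \<in> measurable (HG N) borel" using measurable_madj by (simp cong: measurable_cong_sets)
  show ?thesis unfolding HR_def
    by (subst AE_distr_iff[OF mm]) (use ugrp_sets AE_haar[of "m*N" "lab N"] ugrp_madj in \<open>auto simp: grp_ugrp elim: eventually_mono\<close>)
qed

text \<open>Invariance allows M(A) to be averaged over the group with \<open>HR\<close>. After
  exchanging the integrals, each x is v x0 by transitivity and right invariance absorbs v, so the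
  inner integral is independent of x. The result does not mention M, which is uniqueness.\<close>

lemma inv_meas_emeasure:
  assumes M: "inv_meas N M" and tr: "\<And>x. x \<in> bdry N \<Longrightarrow> \<exists>v\<in>grp N. x = act_col m N v x0" and A: "A \<in> sets borel"
  shows "emeasure M A = (\<integral>\<^sup>+u. indicator A (act_col m N u x0) \<partial>HR N)"
proof -
  have sM: "sets M = sets borel" and pM: "prob_space M" using M by (auto simp: inv_meas_def)
  interpret M: prob_space M by (rule pM)
  have mm: "madj \<in> measurable (HG N) borel" using measurable_madj by (simp cong: measurable_cong_sets)
  interpret G: prob_space "HG N" by (rule prob_haar)
  interpret H: prob_space "HR N" unfolding HR_def by (rule G.prob_space_distr[OF mm])
  have sH: "sets (HR N) = sets borel" by (simp add: HR_def)
  interpret P: pair_sigma_finite "HR N" M ..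
  have spM: "space M = UNIV" using sets_eq_imp_space_eq[OF sM] by simp
  let ?c = "\<integral>\<^sup>+u. indicator A (act_col m N u x0) \<partial>HR N"
  have mj: "(\<lambda>(u, x). indicator A (act_col m N u x) :: ennreal) \<in> borel_measurable (HR N \<Otimes>\<^sub>M M)"
    unfolding case_prod_beta by (rule measurable_compose[OF measurable_act_joint[OF sH sM]]) (use A in simp)
  have mi: "(\<lambda>u. indicator A (act_col m N u x0) :: ennreal) \<in> borel_measurable borel"
    by (rule measurable_compose[OF measurable_act_mat]) (use A in simp)
  have "emeasure M A = (\<integral>\<^sup>+u. emeasure M A \<partial>HR N)" by (simp add: H.emeasure_space_1)
  also have "\<dots> = (\<integral>\<^sup>+u. \<integral>\<^sup>+x. indicator A (act_col m N u x) \<partial>M \<partial>HR N)"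
  proof (rule nn_integral_cong_AE, use AE_HR in eventually_elim)
    case (elim u)
    have ma: "act_col m N u \<in> measurable M borel" using measurable_act_col sM by (simp cong: measurable_cong_sets)
    have "emeasure M A = emeasure (distr M borel (act_col m N u)) A" using M elim by (simp add: inv_meas_def)
    also have "\<dots> = (\<integral>\<^sup>+x. indicator A x \<partial>distr M borel (act_col m N u))" using A by simp
    also have "\<dots> = (\<integral>\<^sup>+x. indicator A (act_col m N u x) \<partial>M)"
      by (rule nn_integral_distr[OF ma]) (use A in simp)
    finally show ?case .
  qed
  also have "\<dots> = (\<integral>\<^sup>+x. \<integral>\<^sup>+u. indicator A (act_col m N u x) \<partial>HR N \<partial>M)"
    by (rule P.Fubini'[symmetric, OF mj])
  also have "\<dots> = (\<integral>\<^sup>+x. ?c \<partial>M)"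
  proof (rule nn_integral_cong_AE)
    have ae: "AE x in M. x \<in> bdry N" using M by (simp add: inv_meas_def)
    show "AE x in M. (\<integral>\<^sup>+u. indicator A (act_col m N u x) \<partial>HR N) = ?c"
      using ae
    proof eventually_elim
      case (elim x)
      obtain v where v: "v \<in> grp N" "x = act_col m N v x0" using tr[OF elim] by blast
      have mv: "(\<lambda>u. mmul (m*N) u v) \<in> measurable (HR N) borel" using measurable_mmul_right sH by (simp cong: measurable_cong_sets)
      have "(\<integral>\<^sup>+u. indicator A (act_col m N u x) \<partial>HR N) = (\<integral>\<^sup>+u. indicator A (act_col m N (mmul (m*N) u v) x0) \<partial>HR N)"
        by (simp add: v(2) act_col_mmul)
      also have "\<dots> = (\<integral>\<^sup>+u. indicator A (act_col m N u x0) \<partial>distr (HR N) borel (\<lambda>u. mmul (m*N) u v))"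
        by (subst nn_integral_distr[OF mv]) (simp_all add: mi)
      finally show ?case by (simp only: HR_right_invariant[OF v(1)])
    qed
  qed
  also have "\<dots> = ?c" by (simp add: M.emeasure_space_1)
  finally show ?thesis .
qed

theorem inv_meas_ex1:
  assumes x0: "x0 \<in> bdry N" and tr: "\<And>x. x \<in> bdry N \<Longrightarrow> \<exists>v\<in>grp N. x = act_col m N v x0"
  shows "\<exists>!M. inv_meas N M"
proof (rule ex_ex1I)
  show "\<exists>M. inv_meas N M" using inv_meas_orbit[OF x0] by blast
  fix M M' assume M: "inv_meas N M" "inv_meas N M'"
  show "M = M'"
  proof (rule measure_eqI)
    show "sets M = sets M'" using M by (simp add: inv_meas_def)
    fix A assume "A \<in> sets M"
    then have A: "A \<in> sets borel" using M by (simp add: inv_meas_def)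
    show "emeasure M A = emeasure M' A"
      by (simp only: inv_meas_emeasure[OF M(1) tr A] inv_meas_emeasure[OF M(2) tr A])
  qed
qed

end

section \<open>Vector operations, monomials and homogeneous parts\<close>

lemma mdsum_add: "mdsum N (madd A A') (madd B B') = madd (mdsum N A B) (mdsum N A' B')"
  by (auto simp: mdsum_def madd_def fun_eq_iff)

lemma mdsum_scale: "mdsum N (mscale c A) (mscale c B) = mscale c (mdsum N A B)"
  by (auto simp: mdsum_def mscale_def fun_eq_iff)

lemma mmul_mscale: "mmul N A (mscale c B) = mscale c (mmul N A B)" "mmul N (mscale c A) B = mscale c (mmul N A B)"
  by (simp_all add: mmul_def mscale_def fun_eq_iff sum_distrib_left mult_ac)

lemma mmul_mdsum: "mmul (N + M) (mdsum N A B) (mdsum N C D) = mdsum N (mmul N A C) (mmul M B D)"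
proof (intro ext)
  fix i k
  show "mmul (N + M) (mdsum N A B) (mdsum N C D) i k = mdsum N (mmul N A C) (mmul M B D) i k"
    unfolding mmul_def sum_lessThan_split by (auto simp: mdsum_def)
qed

lemma mid_mdsum: "mid (N + M) = mdsum N (mid N) (mid M)"
  by (auto simp: mid_def mdsum_def fun_eq_iff)

lemma wpow_tdsum: "wpow (N + M) (tdsum N X Y) w = mdsum N (wpow N X w) (wpow M Y w)"
  by (induction w) (simp_all add: wpow_Nil wpow_Cons mid_mdsum tdsum_def mmul_mdsum)

lemma wpow_similar:
  assumes S: "invertible_mat N S R" and w: "w \<in> all_words m" and X: "is_tup m N X"
  shows "wpow N (\<lambda>j. if j < m then mmul N (mmul N S (X j)) R else mzero) w = mmul N (mmul N S (wpow N X w)) R"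
  using w
proof (induction w)
  case Nil
  then show ?case using S by (simp add: wpow_Nil invertible_mat_def mmul_mid_right)
next
  case (Cons j w)
  then have j: "j < m" and w: "w \<in> all_words m" by (auto simp: all_words_def)
  have "mmul N R (mmul N S (wpow N X w)) = wpow N X w"
    using S is_mat_wpow[OF X w] by (simp add: invertible_mat_def mmul_assoc[symmetric] mmul_mid_left)
  then have e: "mmul N R (mmul N S (mmul N (wpow N X w) R)) = mmul N (wpow N X w) R"
    by (metis mmul_assoc)
  show ?case using j by (simp add: wpow_Cons Cons.IH[OF w] mmul_assoc e)
qed

lemma tup_entries_bounded:
  assumes "is_tup m N X" shows "\<exists>M\<ge>0. \<forall>j i k. cmod (X j i k) \<le> M"
proof (intro exI[of _ "\<Sum>j<m. \<Sum>i<N. \<Sum>k<N. cmod (X j i k)"] conjI allI)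
  show "0 \<le> (\<Sum>j<m. \<Sum>i<N. \<Sum>k<N. cmod (X j i k))" by (intro sum_nonneg) auto
  fix j i k
  show "cmod (X j i k) \<le> (\<Sum>j<m. \<Sum>i<N. \<Sum>k<N. cmod (X j i k))"
  proof (cases "j < m \<and> i < N \<and> k < N")
    case True
    have "cmod (X j i k) \<le> (\<Sum>k<N. cmod (X j i k))"
      using True by (intro member_le_sum) auto
    also have "\<dots> \<le> (\<Sum>i<N. \<Sum>k<N. cmod (X j i k))"
      using True by (intro member_le_sum[of i "{..<N}" "\<lambda>i. \<Sum>k<N. cmod (X j i k)"]) (auto intro: sum_nonneg)
    also have "\<dots> \<le> (\<Sum>j<m. \<Sum>i<N. \<Sum>k<N. cmod (X j i k))"
      using True by (intro member_le_sum[of j "{..<m}" "\<lambda>j. \<Sum>i<N. \<Sum>k<N. cmod (X j i k)"]) (auto intro!: sum_nonneg)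
    finally show ?thesis .
  next
    case False
    then have "X j i k = 0" using assms by (cases "j < m") (auto simp: is_tup_def is_mat_def not_less)
    moreover have "0 \<le> (\<Sum>j<m. \<Sum>i<N. \<Sum>k<N. cmod (X j i k))" by (intro sum_nonneg) auto
    ultimately show ?thesis by simp
  qed
qed

lemma wpow_bounded:
  assumes "\<And>j i k. cmod (X j i k) \<le> M" "M \<ge> 0"
  shows "cmod (wpow N X w i k) \<le> (real N * M) ^ length w"
proof (induction w arbitrary: i k)
  case Nil
  then show ?case by (simp add: wpow_Nil mid_def)
next
  case (Cons j w)
  have "cmod (wpow N X (j # w) i k) \<le> (\<Sum>l<N. cmod (X j i l) * cmod (wpow N X w l k))"
    unfolding wpow_Cons mmul_def by (rule order_trans[OF norm_sum]) (simp add: norm_mult)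
  also have "\<dots> \<le> (\<Sum>l<N. M * (real N * M) ^ length w)"
    using assms Cons by (intro sum_mono mult_mono) auto
  finally show ?case by simp
qed

definition monf :: "nat list \<Rightarrow> ncfun" where "monf w = (\<lambda>N X. wpow N X w)"

context nc_dom
begin

lemma Dom_tup: "X \<in> Dom N \<Longrightarrow> is_tup m N X"
  by (simp add: Dom_def)

lemma A_mono:
  assumes w: "w \<in> all_words m" shows "monf w \<in> A_class m Dom"
proof -
  have "nc_function m Dom (monf w)"
    unfolding nc_function_def monf_def
    using is_mat_wpow[OF Dom_tup w] wpow_tdsum wpow_similar[OF _ w Dom_tup] by auto
  moreover have "loc_bdd_slices m Dom (monf w)"
    unfolding loc_bdd_slices_def
  proof (intro allI impI ballI)
    fix N X Z assume X: "X \<in> Dom N" and Z: "is_tup m N Z"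
    obtain M where M: "M \<ge> 0" "\<And>j i k. cmod (X j i k) \<le> M" using tup_entries_bounded[OF Dom_tup[OF X]] by blast
    obtain M' where M': "M' \<ge> 0" "\<And>j i k. cmod (Z j i k) \<le> M'" using tup_entries_bounded[OF Z] by blast
    have "cmod (monf w N (tadd X (tscale t Z)) i k) \<le> (real N * (M + M')) ^ length w" if t: "cmod t < 1" for t i k
      unfolding monf_def
    proof (rule wpow_bounded)
      fix j i k
      have "cmod (X j i k + t * Z j i k) \<le> cmod (X j i k) + cmod t * cmod (Z j i k)"
        by (metis norm_mult norm_triangle_ineq)
      also have "\<dots> \<le> M + 1 * M'" using M M' t by (intro add_mono mult_mono) auto
      finally show "cmod (tadd X (tscale t Z) j i k) \<le> M + M'"
        by (simp add: tadd_def madd_def tscale_def mscale_def)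
    qed (use M M' in simp)
    then show "\<exists>\<epsilon>>0. \<exists>B. \<forall>t. cmod t < \<epsilon> \<longrightarrow> tadd X (tscale t Z) \<in> Dom N \<longrightarrow> (\<forall>i k. cmod (monf w N (tadd X (tscale t Z)) i k) \<le> B)"
      using zero_less_one by blast
  qed
  ultimately show ?thesis by (simp add: A_class_def)
qed

lemma nc_functionD:
  assumes "nc_function m Dom f" "N > 0" "X \<in> Dom N"
  shows "is_mat N (f N X)"
    "M > 0 \<Longrightarrow> Y \<in> Dom M \<Longrightarrow> tdsum N X Y \<in> Dom (N + M) \<Longrightarrow> f (N + M) (tdsum N X Y) = mdsum N (f N X) (f M Y)"
    "invertible_mat N S R \<Longrightarrow> (\<lambda>j. if j < m then mmul N (mmul N S (X j)) R else mzero) \<in> Dom N \<Longrightarrow>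
         f N (\<lambda>j. if j < m then mmul N (mmul N S (X j)) R else mzero) = mmul N (mmul N S (f N X)) R"
  using assms unfolding nc_function_def by auto

lemma loc_bdd_slicesD:
  assumes "loc_bdd_slices m Dom f" "N > 0" "X \<in> Dom N" "is_tup m N Z"
  shows "\<exists>\<epsilon>>0. \<exists>B. \<forall>t. cmod t < \<epsilon> \<longrightarrow> tadd X (tscale t Z) \<in> Dom N \<longrightarrow> (\<forall>i k. cmod (f N (tadd X (tscale t Z)) i k) \<le> B)"
  using assms unfolding loc_bdd_slices_def by simp

lemma A_scale:
  assumes "f \<in> A_class m Dom" shows "fscale c f \<in> A_class m Dom"
proof -
  have f: "nc_function m Dom f" "loc_bdd_slices m Dom f" using assms by (auto simp: A_class_def)
  have "nc_function m Dom (fscale c f)"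
    unfolding nc_function_def
  proof (intro conjI allI impI ballI)
    fix N X assume N: "N > (0::nat)" "X \<in> Dom N"
    show "is_mat N (fscale c f N X)" using nc_functionD(1)[OF f(1) N] by (auto simp: fscale_def mscale_def is_mat_def)
    show "fscale c f (N + M) (tdsum N X Y) = mdsum N (fscale c f N X) (fscale c f M Y)"
      if "M > 0" "Y \<in> Dom M" "tdsum N X Y \<in> Dom (N + M)" for M Y
      using nc_functionD(2)[OF f(1) N that] by (simp add: fscale_def mdsum_scale)
    show "fscale c f N (\<lambda>j. if j < m then mmul N (mmul N S (X j)) R else mzero) = mmul N (mmul N S (fscale c f N X)) R"
      if "invertible_mat N S R" "(\<lambda>j. if j < m then mmul N (mmul N S (X j)) R else mzero) \<in> Dom N" for S R
      using nc_functionD(3)[OF f(1) N that] by (simp add: fscale_def mmul_mscale)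
  qed
  moreover have "loc_bdd_slices m Dom (fscale c f)"
    unfolding loc_bdd_slices_def
  proof (intro allI impI ballI)
    fix N X Z assume N: "N > (0::nat)" and X: "X \<in> Dom N" and Z: "is_tup m N Z"
    from loc_bdd_slicesD[OF f(2) N X Z] obtain \<epsilon> B where ef1: "\<epsilon> > 0"
      and ef2: "\<forall>t. cmod t < \<epsilon> \<longrightarrow> tadd X (tscale t Z) \<in> Dom N \<longrightarrow> (\<forall>i k. cmod (f N (tadd X (tscale t Z)) i k) \<le> B)"
      by (elim exE conjE)
    note \<epsilon> = ef1 ef2[rule_format]
    have bd: "cmod (fscale c f N (tadd X (tscale t Z)) i k) \<le> cmod c * B" if "cmod t < \<epsilon>" "tadd X (tscale t Z) \<in> Dom N" for t i k
      using \<epsilon>(2)[OF that] by (simp add: fscale_def mscale_def norm_mult mult_left_mono)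
    show "\<exists>\<epsilon>>0. \<exists>B. \<forall>t. cmod t < \<epsilon> \<longrightarrow> tadd X (tscale t Z) \<in> Dom N \<longrightarrow> (\<forall>i k. cmod (fscale c f N (tadd X (tscale t Z)) i k) \<le> B)"
      by (rule exI[of _ \<epsilon>], intro conjI \<epsilon>(1), rule exI[of _ "cmod c * B"], intro allI impI bd)
  qed
  ultimately show ?thesis by (simp add: A_class_def)
qed

lemma A_add:
  assumes "f \<in> A_class m Dom" "g \<in> A_class m Dom" shows "fadd f g \<in> A_class m Dom"
proof -
  have f: "nc_function m Dom f" "loc_bdd_slices m Dom f" and g: "nc_function m Dom g" "loc_bdd_slices m Dom g"
    using assms by (auto simp: A_class_def)
  have "nc_function m Dom (fadd f g)"
    unfolding nc_function_def
  proof (intro conjI allI impI ballI)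
    fix N X assume N: "N > (0::nat)" "X \<in> Dom N"
    show "is_mat N (fadd f g N X)" using nc_functionD(1)[OF f(1) N] nc_functionD(1)[OF g(1) N] by (auto simp: fadd_def madd_def is_mat_def)
    show "fadd f g (N + M) (tdsum N X Y) = mdsum N (fadd f g N X) (fadd f g M Y)"
      if "M > 0" "Y \<in> Dom M" "tdsum N X Y \<in> Dom (N + M)" for M Y
      using nc_functionD(2)[OF f(1) N that] nc_functionD(2)[OF g(1) N that] by (simp add: fadd_def mdsum_add)
    show "fadd f g N (\<lambda>j. if j < m then mmul N (mmul N S (X j)) R else mzero) = mmul N (mmul N S (fadd f g N X)) R"
      if "invertible_mat N S R" "(\<lambda>j. if j < m then mmul N (mmul N S (X j)) R else mzero) \<in> Dom N" for S R
      using nc_functionD(3)[OF f(1) N that] nc_functionD(3)[OF g(1) N that] by (simp add: fadd_def mmul_madd_left mmul_madd_right)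
  qed
  moreover have "loc_bdd_slices m Dom (fadd f g)"
    unfolding loc_bdd_slices_def
  proof (intro allI impI ballI)
    fix N X Z assume N: "N > (0::nat)" and X: "X \<in> Dom N" and Z: "is_tup m N Z"
    from loc_bdd_slicesD[OF f(2) N X Z] obtain \<epsilon> B where ef1: "\<epsilon> > 0"
      and ef2: "\<forall>t. cmod t < \<epsilon> \<longrightarrow> tadd X (tscale t Z) \<in> Dom N \<longrightarrow> (\<forall>i k. cmod (f N (tadd X (tscale t Z)) i k) \<le> B)"
      by (elim exE conjE)
    note \<epsilon> = ef1 ef2[rule_format]
    from loc_bdd_slicesD[OF g(2) N X Z] obtain \<epsilon>' B' where eg1: "\<epsilon>' > 0"
      and eg2: "\<forall>t. cmod t < \<epsilon>' \<longrightarrow> tadd X (tscale t Z) \<in> Dom N \<longrightarrow> (\<forall>i k. cmod (g N (tadd X (tscale t Z)) i k) \<le> B')"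
      by (elim exE conjE)
    note \<epsilon>' = eg1 eg2[rule_format]
    have bd: "cmod (fadd f g N (tadd X (tscale t Z)) i k) \<le> B + B'" if "cmod t < min \<epsilon> \<epsilon>'" "tadd X (tscale t Z) \<in> Dom N" for t i k
    proof -
      have "cmod (f N (tadd X (tscale t Z)) i k + g N (tadd X (tscale t Z)) i k) \<le> cmod (f N (tadd X (tscale t Z)) i k) + cmod (g N (tadd X (tscale t Z)) i k)"
        by (rule norm_triangle_ineq)
      also have "\<dots> \<le> B + B'" using \<epsilon>(2) \<epsilon>'(2) that by (intro add_mono) auto
      finally show ?thesis by (simp add: fadd_def madd_def)
    qed
    show "\<exists>\<epsilon>>0. \<exists>B. \<forall>t. cmod t < \<epsilon> \<longrightarrow> tadd X (tscale t Z) \<in> Dom N \<longrightarrow> (\<forall>i k. cmod (fadd f g N (tadd X (tscale t Z)) i k) \<le> B)"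
      by (rule exI[of _ "min \<epsilon> \<epsilon>'"], intro conjI, use \<epsilon>(1) \<epsilon>'(1) in simp, rule exI[of _ "B + B'"], intro allI impI bd)
  qed
  ultimately show ?thesis by (simp add: A_class_def)
qed

abbreviation coef :: "ncfun \<Rightarrow> nat list \<Rightarrow> complex" where "coef \<equiv> tt_coeff m Dom"

lemma coef_add:
  assumes f: "f \<in> A_class m Dom" and g: "g \<in> A_class m Dom"
  shows "coef (fadd f g) = (\<lambda>w. coef f w + coef g w)"
proof (rule tt_coeff_eqI)
  fix N X i k assume *: "N > (0::nat)" "X \<in> Dom N"
  show "(\<lambda>l. \<Sum>w\<in>words m l. (coef f w + coef g w) * wpow N X w i k) sums fadd f g N X i k"
    using sums_add[OF tt_coeff_props(2)[OF f *, of i k] tt_coeff_props(2)[OF g *, of i k]]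
    by (simp add: distrib_right sum.distrib fadd_def madd_def)
qed (use tt_coeff_props(1)[OF f] tt_coeff_props(1)[OF g] in simp)

lemma coef_scale:
  assumes f: "f \<in> A_class m Dom" shows "coef (fscale c f) = (\<lambda>w. c * coef f w)"
proof (rule tt_coeff_eqI)
  fix N X i k assume *: "N > (0::nat)" "X \<in> Dom N"
  show "(\<lambda>l. \<Sum>w\<in>words m l. (c * coef f w) * wpow N X w i k) sums fscale c f N X i k"
    using sums_mult[OF tt_coeff_props(2)[OF f *, of i k], of c]
    by (simp add: sum_distrib_left mult.assoc fscale_def mscale_def)
qed (use tt_coeff_props(1)[OF f] in simp)

lemma coef_zero: "coef fzero = (\<lambda>w. 0)"
  by (rule tt_coeff_eqI) (auto simp: fzero_def mzero_def)

lemma coef_mono: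
  assumes w: "w \<in> all_words m" shows "coef (monf w) = (\<lambda>v. if v = w then 1 else 0)"
proof (rule tt_coeff_eqI)
  fix N X i k assume *: "N > (0::nat)" "X \<in> Dom N"
  have "(\<Sum>v\<in>words m l. (if v = w then 1 else 0) * wpow N X v i k) = (if l = length w then wpow N X w i k else 0)" for l
  proof -
    have "(\<Sum>v\<in>words m l. (if v = w then 1 else 0) * wpow N X v i k) = (\<Sum>v\<in>words m l. if v = w then wpow N X w i k else 0)"
      by (intro sum.cong refl) auto
    then show ?thesis using w by (auto simp: words_all)
  qed
  then show "(\<lambda>l. \<Sum>v\<in>words m l. (if v = w then 1 else 0) * wpow N X v i k) sums monf w N X i k"
    using sums_single[of "length w" "\<lambda>_. wpow N X w i k"] by (simp add: monf_def)
qed (use w in auto)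

lemma coef_zero_imp_zero:
  assumes f: "f \<in> A_class m Dom" and z: "\<And>w. w \<in> all_words m \<Longrightarrow> coef f w = 0" shows "eq_on Dom f fzero"
  unfolding eq_on_def
proof (intro allI impI ballI ext)
  fix N X i k assume *: "N > (0::nat)" "X \<in> Dom N"
  have "(\<lambda>l. \<Sum>w\<in>words m l. coef f w * wpow N X w i k) = (\<lambda>l. 0)"
    using z by (auto simp: words_all intro!: sum.neutral)
  then have "(\<lambda>l. 0 :: complex) sums f N X i k" using tt_coeff_props(2)[OF f *, of i k] by simp
  then show "f N X i k = fzero N X i k" by (simp add: sums_iff fzero_def mzero_def)
qed

definition hpart :: "(nat list \<Rightarrow> complex) \<Rightarrow> nat \<Rightarrow> nat \<Rightarrow> ctup \<Rightarrow> cmat" where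
  "hpart c l N X = (\<lambda>i k. \<Sum>w\<in>words m l. c w * wpow N X w i k)"

lemma bdry_scale_Dom:
  assumes X: "X \<in> bdry N" and z: "cmod z < 1" shows "tscale z X \<in> Dom N"
proof -
  have "sdom {..<N} (tscale z X)"
    unfolding sdom_def
  proof (intro exI[of _ "(cmod z)\<^sup>2"] conjI allI impI)
    show "(cmod z)\<^sup>2 < 1" using z by (simp add: power_less_one_iff)
    fix j0 v assume j0: "j0 < m"
    have "(\<Sum>j\<in>cls j0. \<Sum>i<N. (cmod (\<Sum>k<N. tscale z X j i k * v k))\<^sup>2)
       = (cmod z)\<^sup>2 * (\<Sum>j\<in>cls j0. \<Sum>i<N. (cmod (\<Sum>k<N. X j i k * v k))\<^sup>2)"
      by (simp add: tscale_def mscale_def mult.assoc sum_distrib_left[symmetric] norm_mult power_mult_distrib)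
    then show "(\<Sum>j\<in>cls j0. \<Sum>i\<in>{..<N}. (cmod (\<Sum>k\<in>{..<N}. tscale z X j i k * v k))\<^sup>2) \<le> (cmod z)\<^sup>2 * (\<Sum>k\<in>{..<N}. (cmod (v k))\<^sup>2)"
      by (simp add: bdry_norm[OF X j0])
  qed
  moreover have "is_tup m N (tscale z X)"
    using bdry_tup[OF X] by (auto simp: is_tup_def is_mat_def tscale_def mscale_def fun_eq_iff)
  ultimately show ?thesis by (simp add: Dom_def)
qed

lemma hpart_scale: "hpart c l N (tscale z X) i k = z ^ l * hpart c l N X i k"
  unfolding hpart_def wpow_tscale sum_distrib_left
  by (intro sum.cong refl) (simp add: words_length)

lemma hpart_sums:
  assumes f: "f \<in> A_class m Dom" and N: "N > 0" and X: "X \<in> bdry N" and z: "cmod z < 1"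
  shows "(\<lambda>l. hpart (coef f) l N X i k * z ^ l) sums f N (tscale z X) i k"
proof -
  have "(\<Sum>w\<in>words m l. coef f w * wpow N (tscale z X) w i k) = hpart (coef f) l N X i k * z ^ l" for l
    using hpart_scale[of "coef f" l N z X i k] by (simp add: hpart_def mult.commute)
  then show ?thesis using tt_coeff_props(2)[OF f N bdry_scale_Dom[OF X z], of i k] by simp
qed

lemma measurable_wpow: "(\<lambda>X. wpow N X w i k) \<in> borel_measurable borel"
proof (induction w arbitrary: i k)
  case Nil
  then show ?case by (simp add: wpow_Nil)
next
  case (Cons j w)
  then show ?case unfolding wpow_Cons mmul_def
    by (intro borel_measurable_sum borel_measurable_times measurable_entry)
qed

lemma measurable_hpart: "(\<lambda>X. hpart c l N X i k) \<in> borel_measurable borel"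
  unfolding hpart_def by (intro borel_measurable_sum borel_measurable_times borel_measurable_const measurable_wpow)

end

section \<open>The Hardy space\<close>

definition rt :: "nat \<Rightarrow> nat \<Rightarrow> complex" where
  "rt n j = exp (2 * of_real pi * \<i> * of_nat j / of_nat n)"

lemma norm_rt: "cmod (rt n j) = 1"
  by (simp add: rt_def)

lemma rt_cnj: "rt n j * cnj (rt n j) = 1"
  using norm_rt[of n j] by (simp add: complex_norm_square[symmetric])

lemma rt_power: "rt n j = rt n 1 ^ j"
proof -
  have "rt n 1 ^ j = exp (of_nat j * (2 * of_real pi * \<i> * of_nat 1 / of_nat n))"
    unfolding rt_def by (rule exp_of_nat_mult[symmetric])
  then show ?thesis by (simp add: rt_def mult_ac)
qed

lemma rt_pow_n: "n > 0 \<Longrightarrow> rt n j ^ n = 1"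
  unfolding rt_def by (rule complex_root_unity) simp

lemma rt_eq: "n > 0 \<Longrightarrow> rt n j = rt n l \<longleftrightarrow> j mod n = l mod n"
  unfolding rt_def by (rule complex_root_unity_eq) simp

lemma rt_sum:
  assumes n: "n > 0"
  shows "(\<Sum>k<n. rt n j ^ k * cnj (rt n l ^ k)) = (if j mod n = l mod n then of_nat n else 0)"
proof -
  define u where "u = rt n j * cnj (rt n l)"
  have e: "(\<Sum>k<n. rt n j ^ k * cnj (rt n l ^ k)) = (\<Sum>k<n. u ^ k)"
    by (simp add: u_def power_mult_distrib)
  have un: "u ^ n = 1"
    unfolding u_def power_mult_distrib complex_cnj_power[symmetric] using n by (simp add: rt_pow_n)
  have u1: "u = 1 \<longleftrightarrow> j mod n = l mod n"
  proof
    assume "u = 1"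
    then have "u * rt n l = rt n l" by simp
    then have "rt n j * (rt n l * cnj (rt n l)) = rt n l" by (simp only: u_def mult_ac)
    then have "rt n j = rt n l" by (simp only: rt_cnj mult_1_right)
    then show "j mod n = l mod n" using rt_eq[OF n] by simp
  next
    assume "j mod n = l mod n"
    then have "rt n j = rt n l" using rt_eq[OF n] by simp
    then show "u = 1" by (simp add: u_def rt_cnj)
  qed
  show ?thesis
  proof (cases "u = 1")
    case True
    then show ?thesis unfolding e using u1 by simp
  next
    case False
    then show ?thesis unfolding e using u1 geometric_sum[OF False, of n] un by simp
  qed
qed

definition dft :: "nat \<Rightarrow> (nat \<Rightarrow> complex) \<Rightarrow> nat \<Rightarrow> complex" where
  "dft n G l = (\<Sum>k<n. G k * cnj (rt n l ^ k)) / of_nat n"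

text \<open>Bessel's inequality for the characters of Z/n. The condition L <= n keeps the first L
  characters distinct and so orthogonal; the difference of the two sides is the mean square distance
  of G from its projection.\<close>

lemma dft_bessel:
  assumes n: "n > 0" and L: "L \<le> n"
  shows "(\<Sum>l<L. (cmod (dft n G l))\<^sup>2) \<le> (\<Sum>k<n. (cmod (G k))\<^sup>2) / real n"
proof -
  define a where "a l = dft n G l" for l
  define Q where "Q k = (\<Sum>l<L. a l * rt n l ^ k)" for k
  define A where "A = (\<Sum>l<L. (cmod (a l))\<^sup>2)"
  have na: "(\<Sum>k<n. G k * cnj (rt n l ^ k)) = of_nat n * a l" for l
    using n by (simp add: a_def dft_def)
  have cA: "complex_of_real A = (\<Sum>l<L. a l * cnj (a l))"
    unfolding A_def by (simp only: of_real_sum complex_norm_square)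
  have GQ: "(\<Sum>k<n. G k * cnj (Q k)) = of_nat n * complex_of_real A"
  proof -
    have "(\<Sum>k<n. G k * cnj (Q k)) = (\<Sum>k<n. \<Sum>l<L. cnj (a l) * (G k * cnj (rt n l ^ k)))"
      unfolding Q_def cnj_sum sum_distrib_left by (intro sum.cong refl) (simp add: mult_ac)
    also have "\<dots> = (\<Sum>l<L. cnj (a l) * (\<Sum>k<n. G k * cnj (rt n l ^ k)))"
      by (subst sum.swap) (simp only: sum_distrib_left)
    also have "\<dots> = of_nat n * complex_of_real A"
      unfolding na cA sum_distrib_left by (intro sum.cong refl) (simp only: mult_ac)
    finally show ?thesis .
  qed
  have QG: "(\<Sum>k<n. Q k * cnj (G k)) = of_nat n * complex_of_real A"
  proof -
    have "(\<Sum>k<n. Q k * cnj (G k)) = cnj (\<Sum>k<n. G k * cnj (Q k))" by (simp add: mult.commute)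
    then show ?thesis unfolding GQ by simp
  qed
  have QQ: "(\<Sum>k<n. Q k * cnj (Q k)) = of_nat n * complex_of_real A"
  proof -
    have "(\<Sum>k<n. Q k * cnj (Q k)) = (\<Sum>k<n. \<Sum>l<L. \<Sum>l'<L. a l * cnj (a l') * (rt n l ^ k * cnj (rt n l' ^ k)))"
      unfolding Q_def cnj_sum sum_product by (intro sum.cong refl) (simp add: mult_ac)
    also have "\<dots> = (\<Sum>l<L. \<Sum>k<n. \<Sum>l'<L. a l * cnj (a l') * (rt n l ^ k * cnj (rt n l' ^ k)))"
      by (rule sum.swap)
    also have "\<dots> = (\<Sum>l<L. \<Sum>l'<L. \<Sum>k<n. a l * cnj (a l') * (rt n l ^ k * cnj (rt n l' ^ k)))"
      by (rule sum.cong[OF refl], rule sum.swap)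
    also have "\<dots> = (\<Sum>l<L. \<Sum>l'<L. a l * cnj (a l') * (if l mod n = l' mod n then of_nat n else 0))"
      unfolding sum_distrib_left[symmetric] rt_sum[OF n] by simp
    also have "\<dots> = (\<Sum>l<L. \<Sum>l'<L. if l' = l then of_nat n * (a l * cnj (a l)) else 0)"
      using L by (intro sum.cong refl) auto
    also have "\<dots> = of_nat n * complex_of_real A"
      unfolding cA sum_distrib_left by simp
    finally show ?thesis .
  qed
  have "complex_of_real (\<Sum>k<n. (cmod (G k - Q k))\<^sup>2) = (\<Sum>k<n. (G k - Q k) * cnj (G k - Q k))"
    by (simp only: of_real_sum complex_norm_square)
  also have "\<dots> = (\<Sum>k<n. G k * cnj (G k)) - (\<Sum>k<n. G k * cnj (Q k)) - (\<Sum>k<n. Q k * cnj (G k)) + (\<Sum>k<n. Q k * cnj (Q k))"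
    by (simp add: algebra_simps sum.distrib sum_subtractf)
  also have "\<dots> = complex_of_real ((\<Sum>k<n. (cmod (G k))\<^sup>2) - real n * A)"
    unfolding GQ QG QQ by (simp only: of_real_sum of_real_diff of_real_mult complex_norm_square) simp
  finally have "(\<Sum>k<n. (cmod (G k - Q k))\<^sup>2) = (\<Sum>k<n. (cmod (G k))\<^sup>2) - real n * A"
    by (simp only: of_real_eq_iff)
  moreover have "(\<Sum>k<n. (cmod (G k - Q k))\<^sup>2) \<ge> 0" by (intro sum_nonneg) auto
  ultimately have "real n * A \<le> (\<Sum>k<n. (cmod (G k))\<^sup>2)" by linarith
  then show ?thesis using n unfolding A_def a_def by (simp add: pos_le_divide_eq mult.commute)
qed

text \<open>Aliasing: the n-th discrete coefficient collects all g j with j congruent to l modulo n.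
  For n > l all of these except g l lie at or beyond index n, so the error is at most a tail of an
  absolutely convergent series.\<close>

lemma dft_limit:
  assumes g: "summable (\<lambda>j. cmod (g j))"
  shows "((\<lambda>n. dft n (\<lambda>k. \<Sum>j. g j * (rt n 1 ^ k) ^ j) l) \<longlongrightarrow> g l) sequentially"
proof -
  define t where "t n = (\<Sum>j. cmod (g (j + n)))" for n
  have t0: "(t \<longlongrightarrow> 0) sequentially"
  proof -
    have e: "t = (\<lambda>n. (\<Sum>j. cmod (g j)) - (\<Sum>j<n. cmod (g j)))"
      unfolding t_def using suminf_minus_initial_segment[OF g] by (rule ext)
    have "((\<lambda>n. (\<Sum>j. cmod (g j)) - (\<Sum>j<n. cmod (g j))) \<longlongrightarrow> (\<Sum>j. cmod (g j)) - (\<Sum>j. cmod (g j))) sequentially"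
      by (intro tendsto_diff tendsto_const summable_LIMSEQ g)
    then show ?thesis by (simp only: e diff_self)
  qed
  have bnd: "cmod (dft n (\<lambda>k. \<Sum>j. g j * (rt n 1 ^ k) ^ j) l - g l) \<le> t n" if nl: "n > l" for n
  proof -
    have n: "n > 0" using nl by simp
    define h where "h j = (if j mod n = l mod n then g j else 0)" for j
    have sk: "(\<lambda>j. g j * (rt n 1 ^ k) ^ j) sums (\<Sum>j. g j * (rt n 1 ^ k) ^ j)" for k
      by (rule summable_sums, rule summable_norm_cancel) (simp add: norm_mult norm_power norm_rt g)
    have "(\<lambda>j. (\<Sum>k<n. g j * (rt n 1 ^ k) ^ j * cnj (rt n l ^ k)) / of_nat n) sums dft n (\<lambda>k. \<Sum>j. g j * (rt n 1 ^ k) ^ j) l"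
      unfolding dft_def by (intro sums_divide sums_sum sums_mult2 sk)
    note H = this
    have eq: "(\<Sum>k<n. g j * (rt n 1 ^ k) ^ j * cnj (rt n l ^ k)) / of_nat n = h j" for j
    proof -
      have "(\<Sum>k<n. g j * (rt n 1 ^ k) ^ j * cnj (rt n l ^ k)) = g j * (\<Sum>k<n. rt n j ^ k * cnj (rt n l ^ k))"
        unfolding sum_distrib_left
      proof (intro sum.cong refl)
        fix k
        have "(rt n 1 ^ k) ^ j = rt n j ^ k"
          by (subst rt_power[of n j]) (simp only: power_mult[symmetric] mult.commute)
        then show "g j * (rt n 1 ^ k) ^ j * cnj (rt n l ^ k) = g j * (rt n j ^ k * cnj (rt n l ^ k))"
          by (simp only: mult.assoc)
      qed
      then show ?thesis using n by (simp only: rt_sum[OF n] h_def) simp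
    qed
    have hs: "h sums dft n (\<lambda>k. \<Sum>j. g j * (rt n 1 ^ k) ^ j) l" using H by (simp only: eq)
    have nh: "summable (\<lambda>j. cmod (h j))"
      by (rule summable_comparison_test[OF _ g]) (auto simp: h_def)
    have init: "(\<Sum>j<n. h j) = g l"
    proof -
      have "(\<Sum>j<n. h j) = (\<Sum>j<n. if j = l then g l else 0)"
        using nl by (intro sum.cong refl) (auto simp: h_def)
      then show ?thesis using nl by simp
    qed
    have "dft n (\<lambda>k. \<Sum>j. g j * (rt n 1 ^ k) ^ j) l - g l = (\<Sum>j. h (j + n))"
      by (simp only: suminf_minus_initial_segment[OF sums_summable[OF hs], of n] init sums_unique[OF hs, symmetric])
    also have "cmod \<dots> \<le> (\<Sum>j. cmod (h (j + n)))"
      by (rule summable_norm) (subst summable_iff_shift, rule nh)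
    also have "\<dots> \<le> t n" unfolding t_def
    proof (rule suminf_le)
      show "cmod (h (j + n)) \<le> cmod (g (j + n))" for j by (simp add: h_def)
      show "summable (\<lambda>j. cmod (h (j + n)))" by (subst summable_iff_shift, rule nh)
      show "summable (\<lambda>j. cmod (g (j + n)))" by (subst summable_iff_shift, rule g)
    qed
    finally show ?thesis .
  qed
  have "\<forall>\<^sub>F n in sequentially. norm (dft n (\<lambda>k. \<Sum>j. g j * (rt n 1 ^ k) ^ j) l - g l) \<le> t n"
    by (rule eventually_mono[OF eventually_gt_at_top[of l]]) (rule bnd)
  then have "((\<lambda>n. dft n (\<lambda>k. \<Sum>j. g j * (rt n 1 ^ k) ^ j) l - g l) \<longlongrightarrow> 0) sequentially"
    by (rule Lim_null_comparison[OF _ t0])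
  then show ?thesis by (rule LIM_zero_cancel)
qed

definition hs :: "nat \<Rightarrow> cmat \<Rightarrow> real" where
  "hs N A = (\<Sum>i<N. \<Sum>l<N. (cmod (A l i))\<^sup>2)"

lemma hs_nonneg: "hs N A \<ge> 0"
  by (auto simp: hs_def intro!: sum_nonneg)

lemma ntr_hs: "ntr N (mmul N (madj A) A) = complex_of_real (hs N A / real N)"
proof -
  have "mtrace N (mmul N (madj A) A) = complex_of_real (hs N A)"
    unfolding hs_def of_real_sum complex_norm_square mtrace_def mmul_def madj_def by (simp only: mult.commute)
  then show ?thesis by (simp add: ntr_def)
qed

lemma measurable_hs: "(\<And>i k. (\<lambda>X. A X i k) \<in> borel_measurable M) \<Longrightarrow> (\<lambda>X. hs N (A X)) \<in> borel_measurable M"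
  unfolding hs_def by (intro borel_measurable_sum borel_measurable_power borel_measurable_cmod)

context nc_dom
begin

text \<open>A Borel measurable substitute for f(rX): the series is measurable on all of
  \<open>ctup\<close> and agrees with f(rX) on the boundary, hence almost everywhere.\<close>

definition fm :: "ncfun \<Rightarrow> nat \<Rightarrow> real \<Rightarrow> ctup \<Rightarrow> cmat" where
  "fm f N r X = (\<lambda>i k. \<Sum>l. hpart (coef f) l N X i k * of_real r ^ l)"

lemma measurable_fm: "(\<lambda>X. fm f N r X i k) \<in> borel_measurable borel"
  unfolding fm_def
  by (intro borel_measurable_suminf borel_measurable_times borel_measurable_const measurable_hpart)

lemma fm_eq:
  assumes "f \<in> A_class m Dom" "N > 0" "X \<in> bdry N" "0 < r" "r < 1"
  shows "f N (tscale (of_real r) X) = fm f N r X"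
  using hpart_sums[OF assms(1-3), of "of_real r"] assms(4,5) by (auto simp: fm_def fun_eq_iff sums_iff)

lemma hpart_abs_summable:
  assumes "f \<in> A_class m Dom" "N > 0" "X \<in> bdry N" "0 < r" "r < 1"
  shows "summable (\<lambda>l. cmod (hpart (coef f) l N X i k * of_real r ^ l))"
proof (rule powser_insidea)
  show "summable (\<lambda>l. hpart (coef f) l N X i k * (of_real ((1 + r) / 2)) ^ l)"
    using hpart_sums[OF assms(1-3), of "of_real ((1 + r) / 2)" i k] assms(4,5) by (auto simp: sums_iff simp del: of_real_add of_real_divide)
  show "norm (complex_of_real r) < norm (complex_of_real ((1 + r) / 2))"
    using assms(4,5) unfolding norm_of_real by simp
qed

lemma scal_grp:
  assumes "cmod z = 1" shows "mscale z (mid (m * N)) \<in> grp N"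
proof -
  have z: "z * cnj z = 1" using assms by (simp add: complex_norm_square[symmetric])
  have z': "cnj z * z = 1" using z by (simp only: mult.commute)
  have "mmul (m*N) (madj (mscale z (mid (m*N)))) (mscale z (mid (m*N))) = mid (m*N)"
  proof -
    have "madj (mscale z (mid (m*N))) = mscale (cnj z) (mid (m*N))"
      by (auto simp: madj_def mscale_def mid_def fun_eq_iff)
    then show ?thesis by (simp add: mmul_mscale mmul_mid_left) (simp add: mscale_def mult.assoc[symmetric] z z')
  qed
  then show ?thesis by (auto simp: grp_def unitary_def is_mat_def mscale_def mid_def)
qed

lemma act_scal:
  assumes X: "is_tup m N X" shows "act_col m N (mscale z (mid (m * N))) X = tscale z X"
proof (intro ext)
  fix j i k
  show "act_col m N (mscale z (mid (m * N))) X j i k = tscale z X j i k"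
  proof (cases "j < m \<and> i < N \<and> k < N")
    case True
    have "act_col m N (mscale z (mid (m * N))) X j i k = (\<Sum>l<m*N. if l = j*N+i then z * X j i k else 0)"
    proof -
      have "act_col m N (mscale z (mid (m * N))) X j i k = (\<Sum>l<m*N. mscale z (mid (m * N)) (j * N + i) l * X (l div N) (l mod N) k)"
        unfolding act_col_def using True by simp
      also have "\<dots> = (\<Sum>l<m*N. if l = j*N+i then z * X j i k else 0)"
      proof (intro sum.cong refl)
        fix l assume "l \<in> {..<m*N}"
        show "mscale z (mid (m * N)) (j * N + i) l * X (l div N) (l mod N) k = (if l = j*N+i then z * X j i k else 0)"
        proof (cases "l = j * N + i")
          case t: True
          have "l div N = j" "l mod N = i" using True unfolding t by simp_all
          moreover have "l < m * N" using \<open>l \<in> _\<close> by simp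
          ultimately show ?thesis using t by (simp add: mscale_def mid_def)
        next
          case False
          then show ?thesis by (simp add: mscale_def mid_def)
        qed
      qed
      finally show ?thesis .
    qed
    then show ?thesis using True flat_less[of j m i N] by (simp add: tscale_def mscale_def)
  next
    case False
    then show ?thesis using X by (cases "j < m") (auto simp: act_col_def tscale_def mscale_def is_tup_def is_mat_def not_less)
  qed
qed

lemma nn_integral_rotate:
  assumes M: "inv_meas N M" and z: "cmod z = 1" and F: "F \<in> borel_measurable borel"
  shows "(\<integral>\<^sup>+X. F (tscale z X) \<partial>M) = (\<integral>\<^sup>+X. F X \<partial>M)"
proof -
  let ?U = "mscale z (mid (m * N))"
  have ae: "AE X in M. X \<in> bdry N" using M by (simp add: inv_meas_def)
  have "act_col m N ?U \<in> measurable M borel" using M measurable_act_col unfolding inv_meas_def by (simp cong: measurable_cong_sets)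
  note ma = this
  have "(\<integral>\<^sup>+X. F X \<partial>M) = (\<integral>\<^sup>+X. F X \<partial>distr M borel (act_col m N ?U))"
    using M scal_grp[OF z] by (simp add: inv_meas_def)
  also have "\<dots> = (\<integral>\<^sup>+X. F (act_col m N ?U X) \<partial>M)"
    by (subst nn_integral_distr[OF ma]) (simp_all add: F)
  also have "\<dots> = (\<integral>\<^sup>+X. F (tscale z X) \<partial>M)"
    by (rule nn_integral_cong_AE, use ae in eventually_elim) (simp add: act_scal[OF bdry_tup])
  finally show ?thesis by simp
qed

text \<open>Rotation invariance replaces the integrand by its average over the n-th roots of unity,
  whose Fourier coefficients are the homogeneous parts up to aliasing. Bessel's inequality bounds
  the first L of them for every n >= L, and Fatou's lemma removes the aliasing as n grows.\<close>

lemma hardy_lower_bound: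
  assumes M: "inv_meas N M" and f: "f \<in> A_class m Dom" and N: "N > 0" and r: "0 < r" "r < 1"
  shows "(\<integral>\<^sup>+X. ennreal (\<Sum>l<L. r ^ (2*l) * hs N (hpart (coef f) l N X)) \<partial>M)
      \<le> (\<integral>\<^sup>+X. ennreal (hs N (fm f N r X)) \<partial>M)" (is "_ \<le> ?I")
proof -
  have ae: "AE X in M. X \<in> bdry N" and sM: "sets M = sets borel" using M by (auto simp: inv_meas_def)
  have cong: "g \<in> borel_measurable borel \<Longrightarrow> g \<in> borel_measurable M" for g :: "ctup \<Rightarrow> ennreal"
    using sM by (simp cong: measurable_cong_sets)
  define \<Phi> where "\<Phi> X = hs N (fm f N r X)" for X
  have m\<Phi>: "\<Phi> \<in> borel_measurable borel" unfolding \<Phi>_def by (rule measurable_hs[OF measurable_fm])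
  define \<Psi> where "\<Psi> n X = (\<Sum>k<n. \<Phi> (tscale (rt n 1 ^ k) X)) / real n" for n X
  have mts: "tscale z \<in> measurable borel borel" for z
    by (rule measurable_ctupI, unfold tscale_def mscale_def) (intro borel_measurable_times borel_measurable_const measurable_entry)
  have I\<Psi>: "(\<integral>\<^sup>+X. ennreal (\<Psi> n X) \<partial>M) = ?I" if n: "n > 0" for n
  proof -
    have "ennreal (\<Psi> n X) = ennreal (1 / real n) * (\<Sum>k<n. ennreal (\<Phi> (tscale (rt n 1 ^ k) X)))" for X
      unfolding \<Psi>_def \<Phi>_def by (simp add: sum_ennreal hs_nonneg ennreal_mult[symmetric] sum_nonneg)
    then have "(\<integral>\<^sup>+X. ennreal (\<Psi> n X) \<partial>M) = (\<integral>\<^sup>+X. ennreal (1 / real n) * (\<Sum>k<n. ennreal (\<Phi> (tscale (rt n 1 ^ k) X))) \<partial>M)"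
      by simp
    also have "\<dots> = ennreal (1 / real n) * (\<Sum>k<n. \<integral>\<^sup>+X. ennreal (\<Phi> (tscale (rt n 1 ^ k) X)) \<partial>M)"
    proof -
      have mk: "(\<lambda>X. ennreal (\<Phi> (tscale (rt n 1 ^ k) X))) \<in> borel_measurable M" for k
        by (rule cong, rule measurable_compose[OF measurable_compose[OF mts m\<Phi>] measurable_ennreal])
      show ?thesis by (subst nn_integral_cmult, rule borel_measurable_sum, rule mk, subst nn_integral_sum, rule mk, rule refl)
    qed
    finally have e1: "(\<integral>\<^sup>+X. ennreal (\<Psi> n X) \<partial>M) = ennreal (1 / real n) * (\<Sum>k<n. \<integral>\<^sup>+X. ennreal (\<Phi> (tscale (rt n 1 ^ k) X)) \<partial>M)" .
    have e2: "(\<integral>\<^sup>+X. ennreal (\<Phi> (tscale (rt n 1 ^ k) X)) \<partial>M) = ?I" for k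
      unfolding \<Phi>_def[symmetric]
      by (rule nn_integral_rotate[OF M]) (auto simp: norm_power norm_rt intro!: measurable_compose[OF m\<Phi> measurable_ennreal])
    have "(\<integral>\<^sup>+X. ennreal (\<Psi> n X) \<partial>M) = ennreal (1 / real n) * (\<Sum>k<n. ?I)"
      by (simp only: e1 e2)
    also have "\<dots> = (ennreal (1 / real n) * ennreal (real n)) * ?I"
      by (simp add: ennreal_of_nat_eq_real_of_nat mult.assoc)
    also have "ennreal (1 / real n) * ennreal (real n) = 1"
      using n by (simp add: ennreal_mult[symmetric])
    finally show ?thesis by simp
  qed
  define A where "A n l X = (\<lambda>i k. dft n (\<lambda>p. \<Sum>j. (hpart (coef f) j N X i k * of_real r ^ j) * (rt n 1 ^ p) ^ j) l)" for n l X
  define B where "B n X = (\<Sum>l<L. hs N (A n l X))" for n X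
  have mB: "B n \<in> borel_measurable borel" for n
    unfolding B_def A_def dft_def
    by (intro borel_measurable_sum measurable_hs borel_measurable_divide borel_measurable_times borel_measurable_suminf borel_measurable_const measurable_hpart)
  have rot: "fm f N r (tscale z X) i k = (\<Sum>j. (hpart (coef f) j N X i k * of_real r ^ j) * z ^ j)" for z X i k
    unfolding fm_def hpart_scale by (simp only: mult_ac)
  have BP: "B n X \<le> \<Psi> n X" if n: "n > 0" "L \<le> n" for n X
  proof -
    have "B n X = (\<Sum>i<N. \<Sum>k<N. \<Sum>l<L. (cmod (A n l X k i))\<^sup>2)"
      unfolding B_def hs_def by (subst sum.swap, rule sum.cong[OF refl], rule sum.swap)
    also have "\<dots> \<le> (\<Sum>i<N. \<Sum>k<N. (\<Sum>p<n. (cmod (fm f N r (tscale (rt n 1 ^ p) X) k i))\<^sup>2) / real n)"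
      unfolding A_def rot by (intro sum_mono dft_bessel n)
    also have "\<dots> = \<Psi> n X"
    proof -
      have "(\<Sum>i<N. \<Sum>k<N. \<Sum>p<n. (cmod (fm f N r (tscale (rt n 1 ^ p) X) k i))\<^sup>2) = (\<Sum>i<N. \<Sum>p<n. \<Sum>k<N. (cmod (fm f N r (tscale (rt n 1 ^ p) X) k i))\<^sup>2)"
        by (rule sum.cong[OF refl], rule sum.swap)
      also have "\<dots> = (\<Sum>p<n. \<Phi> (tscale (rt n 1 ^ p) X))" unfolding \<Phi>_def hs_def by (rule sum.swap)
      finally show ?thesis by (simp add: \<Psi>_def sum_divide_distrib[symmetric])
    qed
    finally show ?thesis .
  qed
  have lim: "((\<lambda>n. ennreal (B n X)) \<longlongrightarrow> ennreal (\<Sum>l<L. r ^ (2*l) * hs N (hpart (coef f) l N X))) sequentially" if X: "X \<in> bdry N" for X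
  proof -
    have "((\<lambda>n. B n X) \<longlongrightarrow> (\<Sum>l<L. hs N (\<lambda>i k. hpart (coef f) l N X i k * of_real r ^ l))) sequentially"
      unfolding B_def hs_def A_def
      by (intro tendsto_sum tendsto_power tendsto_norm dft_limit hpart_abs_summable[OF f N X r])
    moreover have "hs N (\<lambda>i k. hpart (coef f) l N X i k * of_real r ^ l) = r ^ (2*l) * hs N (hpart (coef f) l N X)" for l
      unfolding hs_def sum_distrib_left using r
      by (intro sum.cong refl) (simp add: norm_mult norm_power power_mult_distrib power_mult[symmetric] mult.commute)
    ultimately show ?thesis by (simp add: tendsto_ennrealI)
  qed
  have "(\<integral>\<^sup>+X. ennreal (\<Sum>l<L. r ^ (2*l) * hs N (hpart (coef f) l N X)) \<partial>M) = (\<integral>\<^sup>+X. liminf (\<lambda>n. ennreal (B n X)) \<partial>M)"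
    by (rule nn_integral_cong_AE, use ae in eventually_elim) (rule lim_imp_Liminf[symmetric, OF _ lim], simp)
  also have "\<dots> \<le> liminf (\<lambda>n. \<integral>\<^sup>+X. ennreal (B n X) \<partial>M)"
    by (rule nn_integral_liminf) (rule cong, rule measurable_compose[OF mB measurable_ennreal])
  also have "\<dots> \<le> liminf (\<lambda>n. ?I)"
  proof (rule Liminf_mono)
    show "\<forall>\<^sub>F n in sequentially. (\<integral>\<^sup>+X. ennreal (B n X) \<partial>M) \<le> ?I"
      using eventually_gt_at_top[of "max L 0"]
    proof eventually_elim
      case (elim n)
      then have n: "n > 0" "L \<le> n" by auto
      have "(\<integral>\<^sup>+X. ennreal (B n X) \<partial>M) \<le> (\<integral>\<^sup>+X. ennreal (\<Psi> n X) \<partial>M)"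
        by (intro nn_integral_mono ennreal_leI BP n)
      then show ?case by (simp only: I\<Psi>[OF n(1)])
    qed
  qed
  also have "\<dots> = ?I" by (simp add: Liminf_const)
  finally show ?thesis .
qed

end

section \<open>Linear structure of the Hardy space and square summability of coefficients\<close>

lemma hs_madd: "hs N (madd A B) \<le> 2 * hs N A + 2 * hs N B"
proof -
  have c: "(cmod (a + b))\<^sup>2 \<le> 2 * (cmod a)\<^sup>2 + 2 * (cmod b)\<^sup>2" for a b
  proof -
    have "(cmod (a + b))\<^sup>2 \<le> (cmod a + cmod b)\<^sup>2" by (intro power_mono norm_triangle_ineq) simp
    also have "\<dots> \<le> 2 * (cmod a)\<^sup>2 + 2 * (cmod b)\<^sup>2"
      using sum_squares_bound[of "cmod a" "cmod b"] by (simp add: power2_sum)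
    finally show ?thesis .
  qed
  show ?thesis unfolding hs_def madd_def sum_distrib_left sum.distrib[symmetric] by (intro sum_mono c)
qed

lemma hs_mscale: "hs N (mscale c A) = (cmod c)\<^sup>2 * hs N A"
  by (simp add: hs_def mscale_def sum_distrib_left norm_mult power_mult_distrib)

lemma sum4_swap: "(\<Sum>i\<in>A. \<Sum>l\<in>B. \<Sum>v\<in>C. \<Sum>w\<in>D. g i l v w) = (\<Sum>v\<in>C. \<Sum>w\<in>D. \<Sum>i\<in>A. \<Sum>l\<in>B. g i l v w)"
  for g :: "'i \<Rightarrow> 'l \<Rightarrow> 'v \<Rightarrow> 'w \<Rightarrow> complex"
proof -
  have "(\<Sum>i\<in>A. \<Sum>l\<in>B. \<Sum>v\<in>C. \<Sum>w\<in>D. g i l v w) = (\<Sum>i\<in>A. \<Sum>v\<in>C. \<Sum>l\<in>B. \<Sum>w\<in>D. g i l v w)"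
    by (rule sum.cong[OF refl], rule sum.swap)
  also have "\<dots> = (\<Sum>v\<in>C. \<Sum>i\<in>A. \<Sum>l\<in>B. \<Sum>w\<in>D. g i l v w)" by (rule sum.swap)
  also have "\<dots> = (\<Sum>v\<in>C. \<Sum>i\<in>A. \<Sum>w\<in>D. \<Sum>l\<in>B. g i l v w)"
    by (rule sum.cong[OF refl], rule sum.cong[OF refl], rule sum.swap)
  also have "\<dots> = (\<Sum>v\<in>C. \<Sum>w\<in>D. \<Sum>i\<in>A. \<Sum>l\<in>B. g i l v w)"
    by (rule sum.cong[OF refl], rule sum.swap)
  finally show ?thesis .
qed

lemma W_pos: "W N X (map (\<lambda>j. (j, False)) w) = wpow N X w"
  by (induction w) (simp_all add: wpow_Nil wpow_Cons lt_def)

context nc_meas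
begin

lemma ntr_gramw:
  assumes X: "is_tup m N X" shows "ntr N (W N X (gramw w v)) = ntr N (mmul N (madj (wpow N X v)) (wpow N X w))"
proof -
  have a: "rev (map (\<lambda>j. (j, True)) v) = adjw (map (\<lambda>j. (j, False)) v)"
    by (simp add: adjw_def comp_def)
  have "W N X (gramw w v) = mmul N (wpow N X w) (madj (wpow N X v))"
    unfolding gramw_def a by (simp only: W_append[OF X] W_adjw[OF X] W_pos)
  then show ?thesis by (simp only: ntr_commute)
qed

lemma hs_hpart:
  assumes X: "is_tup m N X"
  shows "complex_of_real (hs N (hpart c l N X) / real N)
    = (\<Sum>v\<in>words m l. \<Sum>w\<in>words m l. cnj (c v) * c w * ntr N (W N X (gramw w v)))"
proof -
  define G where "G i k v w = cnj (wpow N X v k i) * wpow N X w k i" for i k v w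
  have t: "ntr N (W N X (gramw w v)) = (\<Sum>i<N. \<Sum>k<N. G i k v w) / of_nat N" for v w
    unfolding ntr_gramw[OF X] by (simp add: ntr_def mtrace_def mmul_def madj_def G_def)
  have "complex_of_real (hs N (hpart c l N X) / real N) = (\<Sum>i<N. \<Sum>k<N. cnj (hpart c l N X k i) * hpart c l N X k i) / of_nat N"
    unfolding ntr_hs[symmetric] by (simp add: ntr_def mtrace_def mmul_def madj_def)
  also have "(\<Sum>i<N. \<Sum>k<N. cnj (hpart c l N X k i) * hpart c l N X k i)
      = (\<Sum>i<N. \<Sum>k<N. \<Sum>v\<in>words m l. \<Sum>w\<in>words m l. cnj (c v) * c w * G i k v w)"
    unfolding hpart_def cnj_sum sum_product G_def by (intro sum.cong refl) simp
  also have "\<dots> = (\<Sum>v\<in>words m l. \<Sum>w\<in>words m l. \<Sum>i<N. \<Sum>k<N. cnj (c v) * c w * G i k v w)"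
    by (rule sum4_swap)
  finally show ?thesis unfolding t by (simp add: sum_divide_distrib sum_distrib_left)
qed

definition nint :: "ncfun \<Rightarrow> nat \<Rightarrow> real \<Rightarrow> ennreal" where
  "nint f N r = (\<integral>\<^sup>+ X. ennreal (Re (ntr N (mmul N (madj (f N (tscale (of_real r) X)))
                                            (f N (tscale (of_real r) X))))) \<partial>(\<omega> N))"

lemma sets_\<omega>: "N > 0 \<Longrightarrow> sets (\<omega> N) = sets borel"
  using inv[of N] by (simp add: inv_meas_def)

lemma ae_\<omega>: "N > 0 \<Longrightarrow> AE X in \<omega> N. X \<in> bdry N"
  using inv[of N] by (simp add: inv_meas_def)

lemma meas_\<omega>: "N > 0 \<Longrightarrow> g \<in> borel_measurable borel \<Longrightarrow> g \<in> borel_measurable (\<omega> N)"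
  using sets_\<omega>[of N] by (simp cong: measurable_cong_sets)

lemma H2_iff:
  "f \<in> H2 m Dom \<omega> \<longleftrightarrow> f \<in> A_class m Dom \<and> (\<exists>C\<ge>0. \<forall>N>0. \<forall>r. 0 < r \<and> r < 1 \<longrightarrow> nint f N r \<le> ennreal C)"
proof
  assume "f \<in> H2 m Dom \<omega>"
  then have f: "f \<in> A_class m Dom" and S: "(SUP N\<in>{0<..}. SUP r\<in>{0<..<(1::real)}. nint f N r) < \<infinity>" (is "?S < _")
    by (simp_all add: H2_def nint_def)
  have "nint f N r \<le> ennreal (enn2real ?S)" if "N > 0" "0 < r" "r < 1" for N r
  proof -
    have "nint f N r \<le> (SUP r\<in>{0<..<(1::real)}. nint f N r)" using that by (intro SUP_upper) simp
    also have "\<dots> \<le> ?S" using that by (intro SUP_upper) simp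
    finally show ?thesis using S by simp
  qed
  then show "f \<in> A_class m Dom \<and> (\<exists>C\<ge>0. \<forall>N>0. \<forall>r. 0 < r \<and> r < 1 \<longrightarrow> nint f N r \<le> ennreal C)"
    using f by (intro conjI exI[of _ "enn2real ?S"]) auto
next
  assume "f \<in> A_class m Dom \<and> (\<exists>C\<ge>0. \<forall>N>0. \<forall>r. 0 < r \<and> r < 1 \<longrightarrow> nint f N r \<le> ennreal C)"
  then obtain C where f: "f \<in> A_class m Dom" and C: "\<And>N r. N > 0 \<Longrightarrow> 0 < r \<Longrightarrow> r < 1 \<Longrightarrow> nint f N r \<le> ennreal C" by auto
  have "(SUP N\<in>{0<..}. SUP r\<in>{0<..<(1::real)}. nint f N r) \<le> ennreal C"
    by (intro SUP_least C) auto
  then have "(SUP N\<in>{0<..}. SUP r\<in>{0<..<(1::real)}. nint f N r) < \<infinity>"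
    by (rule le_less_trans) simp
  then show "f \<in> H2 m Dom \<omega>" using f by (simp add: H2_def nint_def)
qed

lemma H2_A: "f \<in> H2 m Dom \<omega> \<Longrightarrow> f \<in> A_class m Dom"
  by (simp add: H2_def)

lemma nint_eq:
  assumes f: "f \<in> A_class m Dom" and N: "N > 0" and r: "0 < r" "r < 1"
  shows "nint f N r = (\<integral>\<^sup>+X. ennreal (hs N (fm f N r X) / real N) \<partial>\<omega> N)"
  unfolding nint_def
proof (rule nn_integral_cong_AE, use ae_\<omega>[OF N] in eventually_elim)
  case (elim X)
  show ?case unfolding fm_eq[OF f N elim r] ntr_hs by simp
qed

lemma measurable_hs_fm: "N > 0 \<Longrightarrow> (\<lambda>X. ennreal (hs N (fm f N r X) / real N)) \<in> borel_measurable (\<omega> N)"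
  by (rule meas_\<omega>) (auto intro!: measurable_compose[OF _ measurable_ennreal] borel_measurable_divide measurable_hs measurable_fm)

lemma H2_add:
  assumes f: "f \<in> H2 m Dom \<omega>" and g: "g \<in> H2 m Dom \<omega>" shows "fadd f g \<in> H2 m Dom \<omega>"
proof -
  obtain C where C: "C \<ge> 0" "\<And>N r. N > 0 \<Longrightarrow> 0 < r \<Longrightarrow> r < 1 \<Longrightarrow> nint f N r \<le> ennreal C" using f unfolding H2_iff by auto
  obtain D where D: "D \<ge> 0" "\<And>N r. N > 0 \<Longrightarrow> 0 < r \<Longrightarrow> r < 1 \<Longrightarrow> nint g N r \<le> ennreal D" using g unfolding H2_iff by auto
  have "nint (fadd f g) N r \<le> ennreal (2 * C + 2 * D)" if N: "N > 0" and r: "0 < r" "r < 1" for N r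
  proof -
    let ?F = "\<lambda>X. ennreal (hs N (fm f N r X) / real N)" and ?G = "\<lambda>X. ennreal (hs N (fm g N r X) / real N)"
    have "nint (fadd f g) N r \<le> (\<integral>\<^sup>+X. 2 * ?F X + 2 * ?G X \<partial>\<omega> N)"
      unfolding nint_def
    proof (rule nn_integral_mono_AE, use ae_\<omega>[OF N] in eventually_elim)
      case (elim X)
      have e: "fadd f g N (tscale (of_real r) X) = madd (fm f N r X) (fm g N r X)"
        by (simp add: fadd_def fm_eq[OF H2_A[OF f] N elim r] fm_eq[OF H2_A[OF g] N elim r])
      have "hs N (madd (fm f N r X) (fm g N r X)) / real N \<le> 2 * (hs N (fm f N r X) / real N) + 2 * (hs N (fm g N r X) / real N)"
        using divide_right_mono[OF hs_madd, of "real N" N "fm f N r X" "fm g N r X"] by (simp add: add_divide_distrib)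
      then have "ennreal (hs N (madd (fm f N r X) (fm g N r X)) / real N) \<le> ennreal (2 * (hs N (fm f N r X) / real N) + 2 * (hs N (fm g N r X) / real N))"
        by (rule ennreal_leI)
      also have "\<dots> = 2 * ?F X + 2 * ?G X"
      proof -
        have "ennreal (2 * x) = 2 * ennreal x" if "x \<ge> 0" for x using that by (simp add: ennreal_mult)
        then show ?thesis by (subst ennreal_plus) (simp_all add: hs_nonneg del: times_divide_eq_right)
      qed
      finally show ?case unfolding e ntr_hs Re_complex_of_real .
    qed
    also have "\<dots> = 2 * nint f N r + 2 * nint g N r"
      unfolding nint_eq[OF H2_A[OF f] N r] nint_eq[OF H2_A[OF g] N r]
      by (subst nn_integral_add) (simp_all add: nn_integral_cmult measurable_hs_fm[OF N] borel_measurable_times_ennreal)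
    also have "\<dots> \<le> 2 * ennreal C + 2 * ennreal D"
      by (intro add_mono mult_left_mono C(2) D(2) N r) simp_all
    also have "\<dots> = ennreal (2 * C + 2 * D)" using C(1) D(1) by (simp add: ennreal_plus ennreal_mult)
    finally show ?thesis .
  qed
  then show ?thesis unfolding H2_iff using A_add[OF H2_A[OF f] H2_A[OF g]] C(1) D(1)
    by (intro conjI exI[of _ "2 * C + 2 * D"]) auto
qed

lemma H2_scale:
  assumes f: "f \<in> H2 m Dom \<omega>" shows "fscale c f \<in> H2 m Dom \<omega>"
proof -
  obtain C where C: "C \<ge> 0" "\<And>N r. N > 0 \<Longrightarrow> 0 < r \<Longrightarrow> r < 1 \<Longrightarrow> nint f N r \<le> ennreal C" using f unfolding H2_iff by auto
  have "nint (fscale c f) N r \<le> ennreal ((cmod c)\<^sup>2 * C)" if N: "N > 0" and r: "0 < r" "r < 1" for N r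
  proof -
    have "nint (fscale c f) N r = (\<integral>\<^sup>+X. ennreal ((cmod c)\<^sup>2) * ennreal (hs N (fm f N r X) / real N) \<partial>\<omega> N)"
      unfolding nint_def
    proof (rule nn_integral_cong_AE, use ae_\<omega>[OF N] in eventually_elim)
      case (elim X)
      show ?case unfolding fscale_def fm_eq[OF H2_A[OF f] N elim r] ntr_hs hs_mscale Re_complex_of_real
        by (simp add: ennreal_mult[symmetric] hs_nonneg)
    qed
    also have "\<dots> = ennreal ((cmod c)\<^sup>2) * nint f N r"
      unfolding nint_eq[OF H2_A[OF f] N r] by (rule nn_integral_cmult[OF measurable_hs_fm[OF N]])
    also have "\<dots> \<le> ennreal ((cmod c)\<^sup>2) * ennreal C"
      by (intro mult_left_mono C(2) N r) simp
    also have "\<dots> = ennreal ((cmod c)\<^sup>2 * C)" using C(1) by (simp add: ennreal_mult)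
    finally show ?thesis .
  qed
  then show ?thesis unfolding H2_iff using A_scale[OF H2_A[OF f]] C(1)
    by (intro conjI exI[of _ "(cmod c)\<^sup>2 * C"]) auto
qed

text \<open>Words in a boundary point are contractions. Each column has norm at most 1, so the
  normalised Hilbert-Schmidt norm is at most 1 and scaling by r does not increase it.\<close>

lemma H2_mono:
  assumes w: "w \<in> all_words m" shows "monf w \<in> H2 m Dom \<omega>"
proof -
  have "nint (monf w) N r \<le> ennreal 1" if N: "N > 0" and r: "0 < r" "r < 1" for N r
  proof -
    interpret prob_space "\<omega> N" using inv[OF N] by (simp add: inv_meas_def)
    have "nint (monf w) N r \<le> (\<integral>\<^sup>+X. 1 \<partial>\<omega> N)"
      unfolding nint_def
    proof (rule nn_integral_mono_AE, use ae_\<omega>[OF N] in eventually_elim)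
      case (elim X)
      have e: "monf w N (tscale (of_real r) X) = mscale (of_real r ^ length w) (wpow N X w)"
        by (simp add: monf_def wpow_tscale mscale_def fun_eq_iff)
      have c: "contr N (wpow N X w)"
        using contr_W[OF bdry_contr[OF elim], of "map (\<lambda>j. (j, False)) w"] unfolding W_pos .
      have "hs N (wpow N X w) \<le> (\<Sum>i<N. 1)" unfolding hs_def by (intro sum_mono contr_col[OF c]) simp
      then have h1: "hs N (wpow N X w) \<le> real N" by simp
      have h2: "(cmod (of_real r ^ length w))\<^sup>2 \<le> 1"
        using r by (simp add: norm_power power_le_one)
      have "hs N (mscale (of_real r ^ length w) (wpow N X w)) \<le> 1 * real N"
        unfolding hs_mscale by (intro mult_mono h1 h2) (simp_all add: hs_nonneg)
      then have "hs N (mscale (of_real r ^ length w) (wpow N X w)) / real N \<le> 1" using N by simp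
      then show ?case unfolding e ntr_hs Re_complex_of_real by (simp add: ennreal_le_1)
    qed
    also have "\<dots> = ennreal 1" by (simp add: emeasure_space_1)
    finally show ?thesis .
  qed
  then show ?thesis unfolding H2_iff using A_mono[OF w] by (intro conjI exI[of _ 1]) auto
qed

lemma H2_zero: "fzero \<in> H2 m Dom \<omega>"
proof -
  have "fzero = fscale 0 (monf [])" by (simp add: fzero_def mzero_def fscale_def mscale_def)
  then show ?thesis using H2_scale[OF H2_mono[of "[]"], of 0] by (simp add: all_words_def)
qed

lemma level_integral:
  assumes N: "N > 0"
  shows "integrable (\<omega> N) (\<lambda>X. hs N (hpart c l N X) / real N)" (is ?A)
    and "complex_of_real (\<integral>X. hs N (hpart c l N X) / real N \<partial>\<omega> N)
      = (\<Sum>v\<in>words m l. \<Sum>w\<in>words m l. cnj (c v) * c w * (\<integral>X. ntr N (W N X (gramw w v)) \<partial>\<omega> N))" (is ?B)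
proof -
  let ?q = "\<lambda>X. \<Sum>v\<in>words m l. \<Sum>w\<in>words m l. cnj (c v) * c w * ntr N (W N X (gramw w v))"
  let ?h = "\<lambda>X. complex_of_real (hs N (hpart c l N X) / real N)"
  have it: "integrable (\<omega> N) (\<lambda>X. ntr N (W N X u))" for u
    by (rule bounded_integrable(1)[OF inv[OF N] measurable_ntr[OF measurable_W] contr_ntr[OF contr_W[OF bdry_contr]]])
  have iq: "integrable (\<omega> N) ?q"
    by (intro Bochner_Integration.integrable_sum integrable_mult_right it)
  have mh: "?h \<in> borel_measurable (\<omega> N)"
    by (rule meas_\<omega>[OF N]) (rule measurable_compose[OF _ borel_measurable_of_real], intro borel_measurable_divide measurable_hs measurable_hpart borel_measurable_const)
  have ae: "AE X in \<omega> N. ?q X = ?h X"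
    using ae_\<omega>[OF N] by eventually_elim (rule hs_hpart[OF bdry_tup, symmetric])
  have "integrable (\<omega> N) ?h" by (rule integrable_cong_AE_imp[OF iq mh ae])
  then show ?A by (simp only: complex_of_real_integrable_eq)
  have "complex_of_real (\<integral>X. hs N (hpart c l N X) / real N \<partial>\<omega> N) = (\<integral>X. ?h X \<partial>\<omega> N)"
    by (rule integral_complex_of_real[symmetric])
  also have "\<dots> = (\<integral>X. ?q X \<partial>\<omega> N)"
    by (rule integral_cong_AE[symmetric, OF borel_measurable_integrable[OF iq] mh ae])
  also have "\<dots> = (\<Sum>v\<in>words m l. \<integral>X. (\<Sum>w\<in>words m l. cnj (c v) * c w * ntr N (W N X (gramw w v))) \<partial>\<omega> N)"
    by (rule Bochner_Integration.integral_sum) (intro Bochner_Integration.integrable_sum integrable_mult_right it)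
  also have "\<dots> = (\<Sum>v\<in>words m l. \<Sum>w\<in>words m l. \<integral>X. cnj (c v) * c w * ntr N (W N X (gramw w v)) \<partial>\<omega> N)"
    by (rule sum.cong[OF refl], rule Bochner_Integration.integral_sum) (intro integrable_mult_right it)
  also have "\<dots> = (\<Sum>v\<in>words m l. \<Sum>w\<in>words m l. cnj (c v) * c w * (\<integral>X. ntr N (W N X (gramw w v)) \<partial>\<omega> N))"
    by (simp only: integral_mult_right_zero)
  finally show ?B .
qed

definition wt :: "(nat list \<Rightarrow> complex) \<Rightarrow> nat list \<Rightarrow> real" where
  "wt c w = 1 / real d ^ length w * (cmod (c w))\<^sup>2"

lemma level_limit:
  "((\<lambda>N. \<integral>X. hs N (hpart c l N X) / real N \<partial>\<omega> N) \<longlongrightarrow> (\<Sum>w\<in>words m l. wt c w)) sequentially"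
proof -
  have "((\<lambda>N. \<Sum>v\<in>words m l. \<Sum>w\<in>words m l. cnj (c v) * c w * (\<integral>X. ntr N (W N X (gramw w v)) \<partial>\<omega> N))
     \<longlongrightarrow> (\<Sum>v\<in>words m l. \<Sum>w\<in>words m l. cnj (c v) * c w * (if w = v then 1 / of_nat d ^ length w else 0))) sequentially"
    by (intro tendsto_sum tendsto_mult tendsto_const gram_limit) (auto simp: words_def)
  moreover have "(\<Sum>v\<in>words m l. \<Sum>w\<in>words m l. cnj (c v) * c w * (if w = v then 1 / of_nat d ^ length w else 0))
     = complex_of_real (\<Sum>w\<in>words m l. wt c w)"
  proof -
    have "(\<Sum>w\<in>words m l. cnj (c v) * c w * (if w = v then 1 / of_nat d ^ length w else 0)) = complex_of_real (wt c v)" if v: "v \<in> words m l" for v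
    proof -
      have "(\<Sum>w\<in>words m l. cnj (c v) * c w * (if w = v then 1 / of_nat d ^ length w else 0))
        = (\<Sum>w\<in>words m l. if w = v then 1 / of_nat d ^ length v * (c v * cnj (c v)) else 0)"
        by (intro sum.cong refl) simp
      also have "\<dots> = 1 / of_nat d ^ length v * (c v * cnj (c v))" using v by simp
      also have "\<dots> = complex_of_real (wt c v)"
        unfolding complex_norm_square[symmetric] wt_def by simp
      finally show ?thesis .
    qed
    then show ?thesis by simp
  qed
  ultimately have "((\<lambda>N. \<Sum>v\<in>words m l. \<Sum>w\<in>words m l. cnj (c v) * c w * (\<integral>X. ntr N (W N X (gramw w v)) \<partial>\<omega> N))
     \<longlongrightarrow> complex_of_real (\<Sum>w\<in>words m l. wt c w)) sequentially" by (simp only:)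
  moreover have "\<forall>\<^sub>F N in sequentially. (\<Sum>v\<in>words m l. \<Sum>w\<in>words m l. cnj (c v) * c w * (\<integral>X. ntr N (W N X (gramw w v)) \<partial>\<omega> N))
      = complex_of_real (\<integral>X. hs N (hpart c l N X) / real N \<partial>\<omega> N)"
    using eventually_gt_at_top[of 0] by eventually_elim (rule level_integral(2)[symmetric])
  ultimately have "((\<lambda>N. complex_of_real (\<integral>X. hs N (hpart c l N X) / real N \<partial>\<omega> N)) \<longlongrightarrow> complex_of_real (\<Sum>w\<in>words m l. wt c w)) sequentially"
    by (rule Lim_transform_eventually)
  then show ?thesis by (simp only: tendsto_of_real_iff)
qed

lemma level_bound:
  assumes f: "f \<in> A_class m Dom" and N: "N > 0" and r: "0 < r" "r < 1" and C: "C \<ge> 0" "nint f N r \<le> ennreal C"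
  shows "(\<Sum>l<L. r ^ (2*l) * (\<integral>X. hs N (hpart (coef f) l N X) / real N \<partial>\<omega> N)) \<le> C"
proof -
  let ?h = "\<lambda>l X. hs N (hpart (coef f) l N X) / real N"
  have ih: "integrable (\<omega> N) (\<lambda>X. \<Sum>l<L. r ^ (2*l) * ?h l X)"
    by (intro Bochner_Integration.integrable_sum integrable_mult_right level_integral(1) N)
  have I: "(\<integral>X. (\<Sum>l<L. r ^ (2*l) * ?h l X) \<partial>\<omega> N) = (\<Sum>l<L. r ^ (2*l) * (\<integral>X. ?h l X \<partial>\<omega> N))" (is "_ = ?s")
    by (subst Bochner_Integration.integral_sum) (intro integrable_mult_right level_integral(1) N, simp only: integral_mult_right_zero)
  have nn: "0 \<le> (\<Sum>l<L. r ^ (2*l) * ?h l X)" for X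
    using r by (intro sum_nonneg mult_nonneg_nonneg divide_nonneg_nonneg hs_nonneg) simp_all
  have "ennreal ?s = (\<integral>\<^sup>+X. ennreal (\<Sum>l<L. r ^ (2*l) * ?h l X) \<partial>\<omega> N)"
    by (subst nn_integral_eq_integral[OF ih]) (simp_all only: nn I AE_I2)
  then have "ennreal (real N) * ennreal ?s = (\<integral>\<^sup>+X. ennreal (real N) * ennreal (\<Sum>l<L. r ^ (2*l) * ?h l X) \<partial>\<omega> N)"
    using borel_measurable_integrable[OF ih] by (simp only:) (rule nn_integral_cmult[symmetric], rule measurable_compose[OF _ measurable_ennreal])
  also have "\<dots> = (\<integral>\<^sup>+X. ennreal (\<Sum>l<L. r ^ (2*l) * hs N (hpart (coef f) l N X)) \<partial>\<omega> N)"
  proof (rule nn_integral_cong)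
    fix X
    have "real N * (\<Sum>l<L. r ^ (2*l) * ?h l X) = (\<Sum>l<L. r ^ (2*l) * hs N (hpart (coef f) l N X))"
      unfolding sum_distrib_left using N by (intro sum.cong refl) simp
    then show "ennreal (real N) * ennreal (\<Sum>l<L. r ^ (2*l) * ?h l X) = ennreal (\<Sum>l<L. r ^ (2*l) * hs N (hpart (coef f) l N X))"
      using nn[of X] by (simp only: ennreal_mult[symmetric] of_nat_0_le_iff)
  qed
  also have "\<dots> \<le> (\<integral>\<^sup>+X. ennreal (hs N (fm f N r X)) \<partial>\<omega> N)" by (rule hardy_lower_bound[OF inv[OF N] f N r])
  also have "\<dots> = (\<integral>\<^sup>+X. ennreal (real N) * ennreal (hs N (fm f N r X) / real N) \<partial>\<omega> N)"
    using N by (intro nn_integral_cong) (simp add: ennreal_mult[symmetric] hs_nonneg)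
  also have "\<dots> = ennreal (real N) * nint f N r"
    unfolding nint_eq[OF f N r] by (rule nn_integral_cmult[OF measurable_hs_fm[OF N]])
  also have "\<dots> \<le> ennreal (real N) * ennreal C" by (rule mult_left_mono[OF C(2)]) simp
  finally have "ennreal (real N) * ennreal ?s \<le> ennreal (real N) * ennreal C" .
  then have "ennreal (real N * ?s) \<le> ennreal (real N * C)"
    by (simp only: ennreal_mult'[symmetric] of_nat_0_le_iff)
  then have "real N * ?s \<le> real N * C" using C(1) by (subst (asm) ennreal_le_iff) simp_all
  then show ?thesis using N by simp
qed

text \<open>With L fixed both limits act on a finite sum: r -> 1 at fixed N by continuity, then N ->
  infinity by \<open>level_limit\<close>. The constant depends on none of L, N and r.\<close>

lemma coef_bessel:
  assumes f: "f \<in> H2 m Dom \<omega>"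
  shows "\<exists>C. \<forall>L. (\<Sum>l<L. \<Sum>w\<in>words m l. wt (coef f) w) \<le> C"
proof -
  obtain C where C: "C \<ge> 0" "\<And>N r. N > 0 \<Longrightarrow> 0 < r \<Longrightarrow> r < 1 \<Longrightarrow> nint f N r \<le> ennreal C" using f unfolding H2_iff by auto
  let ?p = "\<lambda>l N. \<integral>X. hs N (hpart (coef f) l N X) / real N \<partial>\<omega> N"
  have p: "(\<Sum>l<L. ?p l N) \<le> C" if N: "N > 0" for N L
  proof (rule tendsto_upperbound)
    show "((\<lambda>r. \<Sum>l<L. r ^ (2*l) * ?p l N) \<longlongrightarrow> (\<Sum>l<L. ?p l N)) (at_left (1::real))"
    proof -
      have "((\<lambda>r. \<Sum>l<L. r ^ (2*l) * ?p l N) \<longlongrightarrow> (\<Sum>l<L. 1 ^ (2*l) * ?p l N)) (at_left (1::real))"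
        by (intro tendsto_sum tendsto_mult tendsto_power tendsto_const tendsto_ident_at)
      then show ?thesis by simp
    qed
    have "\<forall>\<^sub>F r in at_left (1::real). r \<in> {0<..<1}" by (rule eventually_at_left_real) simp
    then show "\<forall>\<^sub>F r in at_left (1::real). (\<Sum>l<L. r ^ (2*l) * ?p l N) \<le> C"
    proof eventually_elim
      case (elim r)
      then have r: "0 < r" "r < 1" by auto
      show ?case by (rule level_bound[OF H2_A[OF f] N r C(1) C(2)[OF N r]])
    qed
  qed simp
  have "(\<Sum>l<L. \<Sum>w\<in>words m l. wt (coef f) w) \<le> C" for L
  proof (rule tendsto_upperbound)
    show "((\<lambda>N. \<Sum>l<L. ?p l N) \<longlongrightarrow> (\<Sum>l<L. \<Sum>w\<in>words m l. wt (coef f) w)) sequentially"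
      by (intro tendsto_sum level_limit)
    show "\<forall>\<^sub>F N in sequentially. (\<Sum>l<L. ?p l N) \<le> C"
      using eventually_gt_at_top[of 0] by eventually_elim (rule p)
  qed simp
  then show ?thesis by blast
qed

end

section \<open>The inner product as a weighted square summable pairing\<close>

context nc_meas
begin

lemma d_pos: "d > 0"
proof -
  have "(0::nat) < m" using m_pos by simp
  then have "cls 0 \<noteq> {}" using self_cls[of 0] by blast
  then show ?thesis using card_cls[OF \<open>0 < m\<close>] finite_cls[of 0] by (metis card_gt_0_iff)
qed

lemma wt_nonneg: "wt c w \<ge> 0"
  by (simp add: wt_def)

definition wle :: "nat \<Rightarrow> nat list set" where
  "wle L = (\<Union>l<L. words m l)"

lemma wle_iff: "w \<in> wle L \<longleftrightarrow> w \<in> all_words m \<and> length w < L"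
  by (auto simp: wle_def words_all)

lemma finite_wle: "finite (wle L)"
  by (simp add: wle_def)

lemma sum_wle: "sum g (wle L) = (\<Sum>l<L. \<Sum>w\<in>words m l. g w)"
  unfolding wle_def by (rule sum.UNION_disjoint) (auto dest: words_length)

lemma finite_subset_wle:
  assumes "finite F" "F \<subseteq> all_words m" shows "\<exists>L. F \<subseteq> wle L"
proof (intro exI subsetI)
  fix w assume w: "w \<in> F"
  then have "length w \<le> Max (length ` F)" using assms(1) by simp
  then show "w \<in> wle (Suc (Max (length ` F)))" using w assms(2) by (auto simp: wle_iff)
qed

lemma filterlim_wle: "filterlim wle (finite_subsets_at_top (all_words m)) sequentially"
  unfolding filterlim_finite_subsets_at_top
proof (intro allI impI)
  fix F assume F: "finite F \<and> F \<subseteq> all_words m"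
  then obtain L where L: "F \<subseteq> wle L" using finite_subset_wle by blast
  show "\<forall>\<^sub>F n in sequentially. finite (wle n) \<and> F \<subseteq> wle n \<and> wle n \<subseteq> all_words m"
    using eventually_ge_at_top[of L]
  proof eventually_elim
    case (elim n)
    then have "wle L \<subseteq> wle n" by (auto simp: wle_iff)
    then show ?case using L finite_wle by (auto simp: wle_iff)
  qed
qed

lemma wt_summable:
  assumes f: "f \<in> H2 m Dom \<omega>" shows "wt (coef f) summable_on all_words m"
proof (rule nonneg_bdd_above_summable_on)
  obtain C where C: "\<And>L. (\<Sum>l<L. \<Sum>w\<in>words m l. wt (coef f) w) \<le> C" using coef_bessel[OF f] by blast
  show "bdd_above (sum (wt (coef f)) ` {F. F \<subseteq> all_words m \<and> finite F})"
  proof (rule bdd_aboveI2)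
    fix F assume F: "F \<in> {F. F \<subseteq> all_words m \<and> finite F}"
    then obtain L where L: "F \<subseteq> wle L" using finite_subset_wle by blast
    have "sum (wt (coef f)) F \<le> sum (wt (coef f)) (wle L)"
      by (rule sum_mono2[OF finite_wle L]) (rule wt_nonneg)
    also have "\<dots> \<le> C" unfolding sum_wle by (rule C)
    finally show "sum (wt (coef f)) F \<le> C" .
  qed
qed (rule wt_nonneg)

definition prd :: "ncfun \<Rightarrow> ncfun \<Rightarrow> nat list \<Rightarrow> complex" where
  "prd f g w = complex_of_real (1 / real d ^ length w) * cnj (coef g w) * coef f w"

lemma prd_abs_summable:
  assumes f: "f \<in> H2 m Dom \<omega>" and g: "g \<in> H2 m Dom \<omega>"
  shows "(\<lambda>w. norm (prd f g w)) summable_on all_words m"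
proof (rule Infinite_Sum.abs_summable_on_comparison_test')
  show "(\<lambda>w. wt (coef f) w + wt (coef g) w) summable_on all_words m"
    by (intro summable_on_add wt_summable f g)
  fix w
  have "2 * (cmod (coef g w) * cmod (coef f w)) \<le> (cmod (coef g w))\<^sup>2 + (cmod (coef f w))\<^sup>2"
    using sum_squares_bound[of "cmod (coef g w)" "cmod (coef f w)"] by (simp only: mult.assoc)
  moreover have "0 \<le> cmod (coef g w) * cmod (coef f w)" by simp
  ultimately have "cmod (coef g w) * cmod (coef f w) \<le> (cmod (coef f w))\<^sup>2 + (cmod (coef g w))\<^sup>2" by linarith
  then have "1 / real d ^ length w * (cmod (coef g w) * cmod (coef f w)) \<le> 1 / real d ^ length w * ((cmod (coef f w))\<^sup>2 + (cmod (coef g w))\<^sup>2)"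
    by (rule mult_left_mono) simp
  moreover have "norm (prd f g w) = 1 / real d ^ length w * (cmod (coef g w) * cmod (coef f w))"
    unfolding prd_def norm_mult norm_of_real complex_mod_cnj by simp
  ultimately show "norm (prd f g w) \<le> wt (coef f) w + wt (coef g) w"
    by (simp only: wt_def distrib_left)
qed

lemma prd_has_sum:
  assumes "f \<in> H2 m Dom \<omega>" "g \<in> H2 m Dom \<omega>"
  shows "(prd f g has_sum infsum (prd f g) (all_words m)) (all_words m)"
  by (rule has_sum_infsum, rule abs_summable_summable, rule prd_abs_summable[OF assms])

definition phi :: "ncfun \<Rightarrow> ncfun \<Rightarrow> real \<Rightarrow> complex" where
  "phi f g r = (\<Sum>l. complex_of_real (r ^ (2*l) / real d ^ l) *
      (\<Sum>w\<in>words m l. cnj (coef g w) * coef f w))"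

definition ip :: "ncfun \<Rightarrow> ncfun \<Rightarrow> complex" where
  "ip f g = Lim (at_left 1) (phi f g)"

lemma phi_eq: "phi f g r = (\<Sum>l. complex_of_real (r ^ (2*l)) * (\<Sum>w\<in>words m l. prd f g w))"
proof -
  have "complex_of_real (r ^ (2*l) / real d ^ l) * (\<Sum>w\<in>words m l. cnj (coef g w) * coef f w)
      = complex_of_real (r ^ (2*l)) * (\<Sum>w\<in>words m l. prd f g w)" for l
    unfolding sum_distrib_left prd_def by (intro sum.cong refl) (simp add: words_length)
  then show ?thesis by (simp only: phi_def)
qed

text \<open>Grouping the absolutely summable family \<open>prd\<close> by word length gives a series
  dominated, for all r in (0, 1), by the sums of norms. Tannery's theorem then lets r -> 1 pass
  through the sum.\<close>

lemma phi_tendsto_sum: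
  assumes f: "f \<in> H2 m Dom \<omega>" and g: "g \<in> H2 m Dom \<omega>"
  shows "(phi f g \<longlongrightarrow> infsum (prd f g) (all_words m)) (at_left 1)"
proof -
  define b where "b l = (\<Sum>w\<in>words m l. prd f g w)" for l
  define M where "M l = (\<Sum>w\<in>words m l. norm (prd f g w))" for l
  have Mb: "norm (b l) \<le> M l" for l unfolding b_def M_def by (rule norm_sum)
  have sM: "summable M"
  proof (rule summableI_nonneg_bounded)
    show "0 \<le> M l" for l unfolding M_def by (intro sum_nonneg) simp
    fix n
    have "(\<Sum>l<n. M l) = sum (\<lambda>w. norm (prd f g w)) (wle n)" by (simp only: M_def sum_wle)
    also have "\<dots> \<le> infsum (\<lambda>w. norm (prd f g w)) (all_words m)"
      by (rule finite_sum_le_infsum[OF prd_abs_summable[OF f g] finite_wle]) (auto simp: wle_iff)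
    finally show "(\<Sum>l<n. M l) \<le> infsum (\<lambda>w. norm (prd f g w)) (all_words m)" .
  qed
  have "((\<lambda>L. sum (prd f g) (wle L)) \<longlongrightarrow> infsum (prd f g) (all_words m)) sequentially"
    using filterlim_compose[OF _ filterlim_wle] prd_has_sum[OF f g] unfolding has_sum_def by fast
  then have "b sums infsum (prd f g) (all_words m)"
    unfolding sums_def b_def sum_wle .
  then have bS: "suminf b = infsum (prd f g) (all_words m)" by (simp add: sums_iff)
  have lim: "((\<lambda>r. complex_of_real (r ^ (2*l)) * b l) \<longlongrightarrow> b l) (at_left 1)" for l
  proof -
    have "((\<lambda>r. complex_of_real (r ^ (2*l)) * b l) \<longlongrightarrow> complex_of_real (1 ^ (2*l)) * b l) (at_left 1)"
      by (intro tendsto_mult tendsto_of_real tendsto_power tendsto_const tendsto_ident_at)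
    then show ?thesis by simp
  qed
  have ev: "\<forall>\<^sub>F r in at_left (1::real). r \<in> {0<..<1}" by (rule eventually_at_left_real) simp
  have "\<forall>\<^sub>F (l, r) in at_top \<times>\<^sub>F at_left 1. norm (complex_of_real (r ^ (2*l)) * b l) \<le> M l"
  proof -
    have le: "norm (complex_of_real (r ^ (2*l)) * b l) \<le> M l" if "r \<in> {0<..<1}" for r l
    proof -
      have "norm (complex_of_real (r ^ (2*l)) * b l) = r ^ (2*l) * norm (b l)" using that by (simp add: norm_mult norm_power)
      also have "\<dots> \<le> 1 * norm (b l)" using that by (intro mult_right_mono power_le_one) auto
      also have "\<dots> \<le> M l" using Mb[of l] by simp
      finally show ?thesis .
    qed
    show ?thesis unfolding eventually_prod_filter
      by (rule exI[of _ "\<lambda>_. True"], rule exI[of _ "\<lambda>r. r \<in> {0<..<1}"]) (use ev le in auto)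
  qed
  from tannerys_theorem[OF lim this sM] have "((\<lambda>r. \<Sum>l. complex_of_real (r ^ (2*l)) * b l) \<longlongrightarrow> suminf b) (at_left 1)"
    by simp
  then show ?thesis unfolding bS b_def phi_eq[symmetric] by simp
qed

lemma ip_eq: "f \<in> H2 m Dom \<omega> \<Longrightarrow> g \<in> H2 m Dom \<omega> \<Longrightarrow> ip f g = infsum (prd f g) (all_words m)"
  unfolding ip_def by (intro tendsto_Lim phi_tendsto_sum) simp

lemma phi_tendsto: "f \<in> H2 m Dom \<omega> \<Longrightarrow> g \<in> H2 m Dom \<omega> \<Longrightarrow> (phi f g \<longlongrightarrow> ip f g) (at_left 1)"
  by (simp only: ip_eq phi_tendsto_sum)

lemma ip_has_sum: "f \<in> H2 m Dom \<omega> \<Longrightarrow> g \<in> H2 m Dom \<omega> \<Longrightarrow> (prd f g has_sum ip f g) (all_words m)"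
  by (simp only: ip_eq prd_has_sum)

lemma ip_add:
  assumes "f \<in> H2 m Dom \<omega>" "f' \<in> H2 m Dom \<omega>" "g \<in> H2 m Dom \<omega>" shows "ip (fadd f f') g = ip f g + ip f' g"
proof (rule has_sum_unique)
  show "(prd (fadd f f') g has_sum ip (fadd f f') g) (all_words m)" by (intro ip_has_sum H2_add assms)
  have "prd (fadd f f') g = (\<lambda>w. prd f g w + prd f' g w)"
    by (simp add: prd_def coef_add[OF H2_A[OF assms(1)] H2_A[OF assms(2)]] distrib_left fun_eq_iff)
  then show "(prd (fadd f f') g has_sum ip f g + ip f' g) (all_words m)"
    using has_sum_add[OF ip_has_sum[OF assms(1,3)] ip_has_sum[OF assms(2,3)]] by simp
qed

lemma ip_scale:
  assumes "f \<in> H2 m Dom \<omega>" "g \<in> H2 m Dom \<omega>" shows "ip (fscale c f) g = c * ip f g"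
proof (rule has_sum_unique)
  show "(prd (fscale c f) g has_sum ip (fscale c f) g) (all_words m)" by (intro ip_has_sum H2_scale assms)
  have "prd (fscale c f) g = (\<lambda>w. c * prd f g w)"
    by (simp only: prd_def coef_scale[OF H2_A[OF assms(1)]] mult.left_commute fun_eq_iff simp_thms)
  then show "(prd (fscale c f) g has_sum c * ip f g) (all_words m)"
    using has_sum_cmult_right[OF ip_has_sum[OF assms], of c] by simp
qed

lemma ip_sym:
  assumes "f \<in> H2 m Dom \<omega>" "g \<in> H2 m Dom \<omega>" shows "ip g f = cnj (ip f g)"
proof (rule has_sum_unique)
  show "(prd g f has_sum ip g f) (all_words m)" by (intro ip_has_sum assms)
  have e: "prd g f = (\<lambda>w. cnj (prd f g w))" by (simp add: prd_def fun_eq_iff mult_ac)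
  show "(prd g f has_sum cnj (ip f g)) (all_words m)"
    unfolding e has_sum_cnj_iff by (rule ip_has_sum[OF assms])
qed

lemma ip_scale_right:
  assumes f: "f \<in> H2 m Dom \<omega>" and g: "g \<in> H2 m Dom \<omega>" shows "ip f (fscale c g) = cnj c * ip f g"
  using ip_sym[OF H2_scale[OF g] f, of c] ip_scale[OF g f, of c] ip_sym[OF g f] by simp

lemma ip_self:
  assumes f: "f \<in> H2 m Dom \<omega>" shows "ip f f = complex_of_real (infsum (wt (coef f)) (all_words m))"
proof (rule has_sum_unique)
  show "(prd f f has_sum ip f f) (all_words m)" by (intro ip_has_sum f)
  have "complex_of_real (wt (coef f) w) = prd f f w" for w
  proof -
    have "complex_of_real (wt (coef f) w) = complex_of_real (1 / real d ^ length w) * (coef f w * cnj (coef f w))"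
      by (simp only: wt_def of_real_mult complex_norm_square)
    then show ?thesis by (simp only: prd_def mult_ac)
  qed
  then show "(prd f f has_sum complex_of_real (infsum (wt (coef f)) (all_words m))) (all_words m)"
    using has_sum_of_real[OF has_sum_infsum[OF wt_summable[OF f]], where 'a = complex] by (simp only:)
qed

lemma ip_definite:
  assumes f: "f \<in> H2 m Dom \<omega>" and z: "ip f f = 0" shows "eq_on Dom f fzero"
proof (rule coef_zero_imp_zero[OF H2_A[OF f]])
  fix w assume w: "w \<in> all_words m"
  have "sum (wt (coef f)) {w} \<le> infsum (wt (coef f)) (all_words m)"
    by (rule finite_sum_le_infsum[OF wt_summable[OF f]]) (use w wt_nonneg in auto)
  then have "wt (coef f) w \<le> 0" using z unfolding ip_self[OF f] by simp
  moreover have "real d ^ length w > 0" using d_pos by simp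
  ultimately show "coef f w = 0" by (simp add: wt_def divide_le_0_iff)
qed

lemma ip_mono:
  assumes f: "f \<in> H2 m Dom \<omega>" and w: "w \<in> all_words m" shows "ip f (monf w) = coef f w / of_nat d ^ length w"
proof (rule has_sum_unique)
  show "(prd f (monf w) has_sum ip f (monf w)) (all_words m)" by (intro ip_has_sum f H2_mono w)
  show "(prd f (monf w) has_sum coef f w / of_nat d ^ length w) (all_words m)"
    by (rule has_sum_finite_neutralI[of "{w}"]) (use w in \<open>auto simp: prd_def coef_mono[OF w]\<close>)
qed

lemma mscale_wpow: "(\<lambda>N X. mscale c (wpow N X w)) = fscale c (monf w)"
  by (simp add: fscale_def monf_def)

theorem H2_inner_product_space: "inner_product_space Dom (H2 m Dom \<omega>) ip"
  unfolding inner_product_space_def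
  by (intro conjI allI ballI impI H2_zero H2_add H2_scale ip_add ip_scale ip_sym ip_definite)
     (simp_all add: ip_self infsum_nonneg wt_nonneg)

theorem H2_complete_orthonormal_system:
  "complete_orthonormal_system Dom (H2 m Dom \<omega>) ip (all_words m)
     (\<lambda>w N X. mscale (complex_of_real (sqrt (real d) ^ length w)) (wpow N X w))"
  unfolding complete_orthonormal_system_def mscale_wpow
proof (intro conjI ballI impI)
  have s: "complex_of_real (sqrt (real d) ^ n) * complex_of_real (sqrt (real d) ^ n) = of_nat d ^ n" for n
  proof -
    have "sqrt (real d) ^ n * sqrt (real d) ^ n = real d ^ n" by (simp add: power_mult_distrib[symmetric])
    then show ?thesis by (metis of_real_mult of_real_of_nat_eq of_real_power)
  qed
  show "fscale (complex_of_real (sqrt (real d) ^ length w)) (monf w) \<in> H2 m Dom \<omega>" if "w \<in> all_words m" for w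
    by (intro H2_scale H2_mono that)
  show "ip (fscale (complex_of_real (sqrt (real d) ^ length v)) (monf v)) (fscale (complex_of_real (sqrt (real d) ^ length w)) (monf w))
      = (if v = w then 1 else 0)" if v: "v \<in> all_words m" and w: "w \<in> all_words m" for v w
  proof -
    have "ip (fscale (complex_of_real (sqrt (real d) ^ length v)) (monf v)) (fscale (complex_of_real (sqrt (real d) ^ length w)) (monf w))
        = complex_of_real (sqrt (real d) ^ length w) * (complex_of_real (sqrt (real d) ^ length v) * ip (monf v) (monf w))"
      by (simp only: ip_scale_right ip_scale H2_scale H2_mono v w complex_cnj_complex_of_real)
    also have "ip (monf v) (monf w) = (if v = w then 1 else 0) / of_nat d ^ length w"
      unfolding ip_mono[OF H2_mono[OF v] w] coef_mono[OF v] by auto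
    finally show ?thesis
      using d_pos s[of "length w"] by (auto simp del: of_real_power simp: mult.assoc[symmetric])
  qed
  show "eq_on Dom f fzero" if f: "f \<in> H2 m Dom \<omega>"
    and z: "\<forall>w\<in>all_words m. ip f (fscale (complex_of_real (sqrt (real d) ^ length w)) (monf w)) = 0" for f
  proof (rule coef_zero_imp_zero[OF H2_A[OF f]])
    fix w assume w: "w \<in> all_words m"
    have "cnj (complex_of_real (sqrt (real d) ^ length w)) * (coef f w / of_nat d ^ length w) = 0"
      using z[rule_format, OF w] unfolding ip_scale_right[OF f H2_mono[OF w]] ip_mono[OF f w] .
    then show "coef f w = 0" using d_pos by simp
  qed
qed

theorem coef_eq_ip:
  assumes f: "f \<in> H2 m Dom \<omega>" and w: "w \<in> all_words m"
  shows "coef f w = ip f (\<lambda>N X. mscale (complex_of_real (real d ^ length w)) (wpow N X w))"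
  unfolding mscale_wpow ip_scale_right[OF f H2_mono[OF w]] ip_mono[OF f w] using d_pos by simp

lemma wsum_H2:
  assumes "finite S" "S \<subseteq> all_words m"
  shows "wsum S c monf \<in> H2 m Dom \<omega> \<and> coef (wsum S c monf) = (\<lambda>w. if w \<in> S then c w else 0)"
  using assms
proof (induction S rule: finite_induct)
  case empty
  have "wsum {} c monf = fzero" by (simp add: wsum_def fzero_def mzero_def)
  then show ?case using H2_zero coef_zero by simp
next
  case (insert w S)
  then have w: "w \<in> all_words m" and IH: "wsum S c monf \<in> H2 m Dom \<omega>" "coef (wsum S c monf) = (\<lambda>w. if w \<in> S then c w else 0)" by auto
  have e: "wsum (insert w S) c monf = fadd (fscale (c w) (monf w)) (wsum S c monf)"
    using insert(1,2) by (simp add: wsum_def fadd_def madd_def fscale_def mscale_def)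
  have "coef (wsum (insert w S) c monf) = (\<lambda>v. if v \<in> insert w S then c v else 0)"
    unfolding e coef_add[OF A_scale[OF A_mono[OF w]] H2_A[OF IH(1)]] coef_scale[OF A_mono[OF w]] coef_mono[OF w] IH(2)
    using insert(2) by (auto simp: fun_eq_iff)
  then show ?case unfolding e using H2_add[OF H2_scale[OF H2_mono[OF w]] IH(1)] by simp
qed

text \<open>Subtracting the partial sum over S deletes exactly the coefficients in S. The squared
  norm of the error is therefore the tail of a convergent nonnegative family.\<close>

theorem H2_expansion:
  assumes f: "f \<in> H2 m Dom \<omega>"
  shows "ortho_expansion ip (all_words m) (coef f) (\<lambda>w N X. wpow N X w) f"
  unfolding ortho_expansion_def monf_def[symmetric]
proof (intro allI impI)
  fix e :: real assume e: "0 < e"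
  let ?t = "infsum (wt (coef f)) (all_words m)"
  have "(sum (wt (coef f)) \<longlongrightarrow> ?t) (finite_subsets_at_top (all_words m))"
    using has_sum_infsum[OF wt_summable[OF f]] by (simp only: has_sum_def)
  then have "\<forall>\<^sub>F S in finite_subsets_at_top (all_words m). dist (sum (wt (coef f)) S) ?t < e\<^sup>2"
    by (rule tendstoD) (use e in simp)
  then obtain G0 where G0: "finite G0" "G0 \<subseteq> all_words m"
    "\<And>S. finite S \<and> G0 \<subseteq> S \<and> S \<subseteq> all_words m \<Longrightarrow> dist (sum (wt (coef f)) S) ?t < e\<^sup>2"
    unfolding eventually_finite_subsets_at_top by blast
  have "ipnorm ip (fsub f (wsum S (coef f) monf)) < e" if S: "finite S \<and> G0 \<subseteq> S \<and> S \<subseteq> all_words m" for S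
  proof -
    have fS: "finite S" "S \<subseteq> all_words m" using S by auto
    let ?p = "wsum S (coef f) monf"
    have p: "?p \<in> H2 m Dom \<omega>" "coef ?p = (\<lambda>w. if w \<in> S then coef f w else 0)" using wsum_H2[OF fS, of "coef f"] by auto
    have h: "fsub f ?p = fadd f (fscale (-1) ?p)" by (simp add: fsub_def fadd_def fscale_def msub_def madd_def mscale_def)
    have hH: "fsub f ?p \<in> H2 m Dom \<omega>" unfolding h by (intro H2_add H2_scale f p(1))
    have c: "coef (fsub f ?p) = (\<lambda>w. if w \<in> S then 0 else coef f w)"
      unfolding h coef_add[OF H2_A[OF f] A_scale[OF H2_A[OF p(1)]]] coef_scale[OF H2_A[OF p(1)]] p(2) by auto
    have "infsum (wt (coef (fsub f ?p))) (all_words m) = infsum (wt (coef f)) (all_words m - S)"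
      unfolding c by (rule infsum_cong_neutral) (auto simp: wt_def)
    also have "\<dots> = ?t - infsum (wt (coef f)) S"
      by (rule infsum_Diff[OF wt_summable[OF f] summable_on_finite[OF fS(1)] fS(2)])
    also have "\<dots> = ?t - sum (wt (coef f)) S" using fS(1) by simp
    also have "\<dots> < e\<^sup>2" using G0(3)[OF S] by (simp add: dist_real_def)
    finally have lt: "infsum (wt (coef (fsub f ?p))) (all_words m) < e\<^sup>2" .
    have "ipnorm ip (fsub f ?p) < sqrt (e\<^sup>2)"
      unfolding ipnorm_def ip_self[OF hH] Re_complex_of_real by (rule real_sqrt_less_mono[OF lt])
    then show ?thesis using e by simp
  qed
  then show "\<exists>G0. finite G0 \<and> G0 \<subseteq> all_words m \<and>
      (\<forall>S. finite S \<and> G0 \<subseteq> S \<and> S \<subseteq> all_words m \<longrightarrow> ipnorm ip (fsub f (wsum S (coef f) monf)) < e)"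
    using G0(1,2) by blast
qed

end

section \<open>Polydisc and ball\<close>

definition sqn :: "nat \<Rightarrow> (nat \<Rightarrow> complex) \<Rightarrow> real" where
  "sqn N v = (\<Sum>k<N. (cmod (v k))\<^sup>2)"

definition rowform :: "nat set \<Rightarrow> nat \<Rightarrow> ctup \<Rightarrow> (nat \<Rightarrow> complex) \<Rightarrow> real" where
  "rowform J N X v = (\<Sum>j\<in>J. \<Sum>i<N. (cmod (\<Sum>k<N. X j i k * v k))\<^sup>2)"

lemma sqn_nonneg: "sqn N v \<ge> 0"
  by (simp add: sqn_def sum_nonneg)

lemma rowform_nonneg: "rowform J N X v \<ge> 0"
  by (simp add: rowform_def sum_nonneg)

lemma sqn_scale: "sqn N (\<lambda>k. of_real c * v k) = c\<^sup>2 * sqn N v"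
  by (simp add: sqn_def sum_distrib_left norm_mult power_mult_distrib)

lemma rowform_scale: "rowform J N X (\<lambda>k. of_real c * v k) = c\<^sup>2 * rowform J N X v"
proof -
  have e: "(\<Sum>k<N. X j i k * (of_real c * v k)) = of_real c * (\<Sum>k<N. X j i k * v k)" for j i
    by (simp add: sum_distrib_left mult.left_commute)
  show ?thesis unfolding rowform_def e norm_mult power_mult_distrib sum_distrib_left[symmetric] by simp
qed

lemma sqn_zero: "sqn N v = 0 \<longleftrightarrow> (\<forall>k<N. v k = 0)"
  by (auto simp: sqn_def sum_nonneg_eq_0_iff)

lemma rowform_bound:
  assumes q: "\<And>v. sqn N v = 1 \<Longrightarrow> rowform J N X v \<le> q"
  shows "rowform J N X v \<le> q * sqn N v"
proof (cases "sqn N v = 0")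
  case True
  then have "v k = 0" if "k < N" for k using that sqn_zero by blast
  then have "rowform J N X v = 0" unfolding rowform_def by (simp add: sum.neutral)
  then show ?thesis using True by simp
next
  case False
  then have p: "sqn N v > 0" using sqn_nonneg[of N v] by simp
  define c where "c = 1 / sqrt (sqn N v)"
  have c2: "c\<^sup>2 = 1 / sqn N v" using p by (simp add: c_def power_divide)
  have "sqn N (\<lambda>k. of_real c * v k) = 1" unfolding sqn_scale c2 using p by simp
  from q[OF this] have "rowform J N X v / sqn N v \<le> q" unfolding rowform_scale c2 by simp
  then show ?thesis using p by (simp add: pos_divide_le_eq)
qed

text \<open>A real supremum carries information only for a bounded set, so boundedness comes first;
  afterwards the square of the norm serves as q. Conversely a gap q bounds the norm by sqrt(max q
  0), the maximum covering a negative q.\<close>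

lemma mnorm_less_one_iff: "mnorm N (X j) < 1 \<longleftrightarrow> (\<exists>q<1. \<forall>v. rowform {j} N X v \<le> q * sqn N v)"
proof
  have mn: "mnorm N (X j) = Sup {sqrt (rowform {j} N X v) | v. sqn N v \<le> 1}"
    by (simp add: mnorm_def rowform_def sqn_def)
  let ?S = "{sqrt (rowform {j} N X v) | v. sqn N v \<le> 1}"
  have z: "sqrt (rowform {j} N X (\<lambda>_. 0)) \<in> ?S" by (auto simp: sqn_def)
  have z0: "sqrt (rowform {j} N X (\<lambda>_. 0)) = 0" by (simp add: rowform_def)
  {
    assume a: "mnorm N (X j) < 1"
    have bdd: "bdd_above ?S"
    proof (rule bdd_aboveI)
      fix x assume "x \<in> ?S"
      then obtain v where x: "x = sqrt (rowform {j} N X v)" and v: "sqn N v \<le> 1" by blast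
      have v1: "cmod (v k) \<le> 1" if "k < N" for k
      proof -
        have "(cmod (v k))\<^sup>2 \<le> sqn N v" unfolding sqn_def by (rule member_le_sum) (use that in auto)
        then have "(cmod (v k))\<^sup>2 \<le> 1" using v by simp
        then show ?thesis by (simp add: power_le_one_iff abs_square_le_1)
      qed
      have "rowform {j} N X v \<le> (\<Sum>i<N. (\<Sum>k<N. cmod (X j i k))\<^sup>2)"
      proof -
        have "(\<Sum>i<N. (cmod (\<Sum>k<N. X j i k * v k))\<^sup>2) \<le> (\<Sum>i<N. (\<Sum>k<N. cmod (X j i k))\<^sup>2)"
        proof (intro sum_mono power_mono norm_ge_zero)
          fix i
          show "cmod (\<Sum>k<N. X j i k * v k) \<le> (\<Sum>k<N. cmod (X j i k))"
            by (rule order_trans[OF norm_sum], rule sum_mono) (use v1 in \<open>simp add: norm_mult mult_left_le\<close>)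
        qed
        then show ?thesis by (simp add: rowform_def)
      qed
      then show "x \<le> sqrt (\<Sum>i<N. (\<Sum>k<N. cmod (X j i k))\<^sup>2)" unfolding x by (rule real_sqrt_le_mono)
    qed
    have m0: "0 \<le> mnorm N (X j)" unfolding mn using cSup_upper[OF z bdd] z0 by simp
    have "rowform {j} N X v \<le> (mnorm N (X j))\<^sup>2" if "sqn N v = 1" for v
    proof -
      have "sqrt (rowform {j} N X v) \<le> mnorm N (X j)" unfolding mn by (rule cSup_upper[OF _ bdd]) (use that in auto)
      then have "(sqrt (rowform {j} N X v))\<^sup>2 \<le> (mnorm N (X j))\<^sup>2" by (rule power_mono) (simp add: rowform_nonneg)
      then show ?thesis by (simp add: rowform_nonneg)
    qed
    then have "\<forall>v. rowform {j} N X v \<le> (mnorm N (X j))\<^sup>2 * sqn N v" using rowform_bound by blast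
    moreover have "(mnorm N (X j))\<^sup>2 < 1" using a m0 by (simp add: power_less_one_iff)
    ultimately show "\<exists>q<1. \<forall>v. rowform {j} N X v \<le> q * sqn N v" by blast
  }
  {
    assume "\<exists>q<1. \<forall>v. rowform {j} N X v \<le> q * sqn N v"
    then obtain q where q: "q < 1" "\<And>v. rowform {j} N X v \<le> q * sqn N v" by blast
    have "mnorm N (X j) \<le> sqrt (max q 0)"
      unfolding mn
    proof (rule cSup_least)
      show "?S \<noteq> {}" using z by blast
      fix x assume "x \<in> ?S"
      then obtain v where x: "x = sqrt (rowform {j} N X v)" and v: "sqn N v \<le> 1" by blast
      have "rowform {j} N X v \<le> max q 0 * sqn N v"
        by (rule order_trans[OF q(2)]) (intro mult_right_mono sqn_nonneg, simp)
      also have "\<dots> \<le> max q 0 * 1" by (rule mult_left_mono[OF v]) simp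
      finally show "x \<le> sqrt (max q 0)" unfolding x by simp
    qed
    also have "\<dots> < 1" using q(1) by simp
    finally show "mnorm N (X j) < 1" .
  }
qed

lemma rowform_posdef:
  "Re (\<Sum>i<N. \<Sum>k<N. cnj (v i) * msub (mid N) (\<lambda>i k. \<Sum>j<m. mmul N (madj (X j)) (X j) i k) i k * v k)
    = sqn N v - rowform {..<m} N X v"
proof -
  have 1: "(\<Sum>i<N. \<Sum>k<N. cnj (v i) * mid N i k * v k) = complex_of_real (sqn N v)"
  proof -
    have "(\<Sum>k<N. cnj (v i) * mid N i k * v k) = v i * cnj (v i)" if "i < N" for i
    proof -
      have "(\<Sum>k<N. cnj (v i) * mid N i k * v k) = (\<Sum>k<N. if k = i then v i * cnj (v i) else 0)"
        using that by (intro sum.cong refl) (auto simp: mid_def)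
      then show ?thesis using that by simp
    qed
    then show ?thesis by (simp only: sqn_def of_real_sum complex_norm_square) (rule sum.cong, auto)
  qed
  have 2: "(\<Sum>i<N. \<Sum>k<N. cnj (v i) * (\<Sum>j<m. mmul N (madj (X j)) (X j) i k) * v k) = complex_of_real (rowform {..<m} N X v)"
  proof -
    have "complex_of_real (rowform {..<m} N X v) = (\<Sum>j<m. \<Sum>l<N. (\<Sum>k<N. X j l k * v k) * cnj (\<Sum>i<N. X j l i * v i))"
      by (simp only: rowform_def of_real_sum complex_norm_square)
    also have "\<dots> = (\<Sum>j<m. \<Sum>l<N. \<Sum>i<N. \<Sum>k<N. cnj (v i) * (cnj (X j l i) * X j l k) * v k)"
    proof (intro sum.cong refl)
      fix j l
      have "(\<Sum>k<N. X j l k * v k) * cnj (\<Sum>i<N. X j l i * v i) = (\<Sum>i<N. cnj (X j l i * v i)) * (\<Sum>k<N. X j l k * v k)"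
        by (simp only: cnj_sum mult.commute)
      also have "\<dots> = (\<Sum>i<N. \<Sum>k<N. cnj (v i) * (cnj (X j l i) * X j l k) * v k)"
        unfolding sum_product by (intro sum.cong refl) (simp add: mult_ac)
      finally show "(\<Sum>k<N. X j l k * v k) * cnj (\<Sum>i<N. X j l i * v i) = (\<Sum>i<N. \<Sum>k<N. cnj (v i) * (cnj (X j l i) * X j l k) * v k)" .
    qed
    also have "\<dots> = (\<Sum>i<N. \<Sum>k<N. \<Sum>j<m. \<Sum>l<N. cnj (v i) * (cnj (X j l i) * X j l k) * v k)"
      by (rule sum4_swap)
    also have "\<dots> = (\<Sum>i<N. \<Sum>k<N. cnj (v i) * (\<Sum>j<m. mmul N (madj (X j)) (X j) i k) * v k)"
      unfolding mmul_def madj_def sum_distrib_left sum_distrib_right by (rule refl)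
    finally show ?thesis by simp
  qed
  have "(\<Sum>i<N. \<Sum>k<N. cnj (v i) * msub (mid N) (\<lambda>i k. \<Sum>j<m. mmul N (madj (X j)) (X j) i k) i k * v k)
     = (\<Sum>i<N. \<Sum>k<N. cnj (v i) * mid N i k * v k) - (\<Sum>i<N. \<Sum>k<N. cnj (v i) * (\<Sum>j<m. mmul N (madj (X j)) (X j) i k) * v k)"
    by (simp only: msub_def right_diff_distrib left_diff_distrib sum_subtractf)
  then show ?thesis unfolding 1 2 by simp
qed

text \<open>Vectors are functions on all of nat. Fixing the coordinates from N on to 0 makes the
  sphere a closed subset of a product of compact sets.\<close>

lemma compact_unit_sphere: "compact {v. (\<forall>k\<ge>N. v k = 0) \<and> sqn N v = 1}"
proof -
  let ?S = "\<lambda>k. if k < N then cball 0 1 else {0::complex}"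
  have c: "compact (PiE UNIV ?S)"
    unfolding compactin_euclidean_iff[symmetric] euclidean_product_topology[symmetric] compactin_PiE
    by (auto simp: compactin_euclidean_iff)
  have "continuous_on UNIV (sqn N)"
    unfolding sqn_def
    by (intro continuous_on_sum continuous_on_power continuous_on_norm continuous_on_product_coordinates)
  then have "closed {v. sqn N v = 1}" by (intro closed_Collect_eq continuous_on_const)
  then have "compact (PiE UNIV ?S \<inter> {v. sqn N v = 1})" by (rule compact_Int_closed[OF c])
  moreover have "PiE UNIV ?S \<inter> {v. sqn N v = 1} = {v. (\<forall>k\<ge>N. v k = 0) \<and> sqn N v = 1}" (is "?L = ?R")
  proof (intro equalityI subsetI)
    fix v assume v: "v \<in> ?L"
    have "v k = 0" if "k \<ge> N" for k
    proof -
      have "v k \<in> ?S k" using v by (auto simp: PiE_iff)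
      then show ?thesis using that by simp
    qed
    then show "v \<in> ?R" using v by auto
  next
    fix v assume v: "v \<in> ?R"
    have "v k \<in> ?S k" for k
    proof (cases "k < N")
      case True
      have "(cmod (v k))\<^sup>2 \<le> sqn N v" unfolding sqn_def by (rule member_le_sum) (use True in auto)
      then have "(cmod (v k))\<^sup>2 \<le> 1" using v by simp
      then show ?thesis using True by (simp add: power_le_one_iff abs_square_le_1)
    qed (use v in auto)
    then show "v \<in> ?L" using v by (auto simp: PiE_iff)
  qed
  ultimately show ?thesis by simp
qed

text \<open>Positive definiteness gives a strict inequality vector by vector, while
  \<open>sdom\<close> asks for one q. Compactness of the unit sphere supplies it as the maximum of
  the form.\<close>

lemma rowform_uniform:
  assumes lt: "\<And>v. sqn N v > 0 \<Longrightarrow> rowform J N X v < sqn N v"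
  shows "\<exists>q<1. \<forall>v. rowform J N X v \<le> q * sqn N v"
proof (cases "N = 0")
  case True
  then show ?thesis by (intro exI[of _ 0]) (simp add: rowform_def sqn_def)
next
  case False
  let ?K = "{v. (\<forall>k\<ge>N. v k = 0) \<and> sqn N v = 1}"
  have "sqn N (\<lambda>k. if k = 0 then 1 else 0) = 1"
  proof -
    have "sqn N (\<lambda>k. if k = 0 then 1 else 0) = (\<Sum>k<N. if k = 0 then 1 else 0)"
      unfolding sqn_def by (intro sum.cong refl) auto
    then show ?thesis using False by simp
  qed
  then have ne: "?K \<noteq> {}" using False by (auto intro!: exI[of _ "\<lambda>k. if k = 0 then 1 else 0"])
  have co: "continuous_on ?K (rowform J N X)"
  proof (rule continuous_on_subset[OF _ subset_UNIV])
    show "continuous_on UNIV (rowform J N X)"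
      unfolding rowform_def
      by (intro continuous_on_sum continuous_on_power continuous_on_norm continuous_on_mult continuous_on_const continuous_on_product_coordinates)
  qed
  obtain u where u: "u \<in> ?K" "\<And>v. v \<in> ?K \<Longrightarrow> rowform J N X v \<le> rowform J N X u"
    using continuous_attains_sup[OF compact_unit_sphere ne co] by blast
  have "rowform J N X v \<le> rowform J N X u" if "sqn N v = 1" for v
  proof -
    let ?v = "\<lambda>k. if k < N then v k else 0"
    have "sqn N ?v = sqn N v" "rowform J N X ?v = rowform J N X v"
      by (auto simp: sqn_def rowform_def intro!: sum.cong)
    then show ?thesis using u(2)[of ?v] that by simp
  qed
  then have "\<forall>v. rowform J N X v \<le> rowform J N X u * sqn N v" using rowform_bound by blast
  moreover have "rowform J N X u < 1" using lt[of u] u(1) by simp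
  ultimately show ?thesis by blast
qed

lemma polydisc_Dom:
  assumes m: "1 \<le> m" shows "polydisc m = nc_dom.Dom m id"
proof
  fix N
  interpret nc_dom m id by unfold_locales (rule m)
  have c: "cls j = {j}" if "j < m" for j using that by (auto simp: cls_def)
  have "(\<forall>j<m. mnorm N (X j) < 1) \<longleftrightarrow> sdom {..<N} X" for X
  proof
    assume "\<forall>j<m. mnorm N (X j) < 1"
    then have "\<forall>j. \<exists>q. j < m \<longrightarrow> q < 1 \<and> (\<forall>v. rowform {j} N X v \<le> q * sqn N v)"
      unfolding mnorm_less_one_iff by blast
    from choice[OF this] obtain q where q: "\<And>j. j < m \<Longrightarrow> q j < 1" "\<And>j v. j < m \<Longrightarrow> rowform {j} N X v \<le> q j * sqn N v"
      by blast
    \<comment> \<open>\<open>sdom\<close> wants one gap for all variables; the largest q j serves,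
      and m >= 1 makes that maximum meaningful.\<close>
    have ne: "q ` {..<m} \<noteq> {}" using m by (auto simp: lessThan_empty_iff)
    have "Max (q ` {..<m}) < 1" using ne q(1) by (subst Max_less_iff) auto
    moreover have "rowform (cls j) N X v \<le> Max (q ` {..<m}) * sqn N v" if "j < m" for j v
      unfolding c[OF that] by (rule order_trans[OF q(2)[OF that]]) (intro mult_right_mono sqn_nonneg Max_ge, use that in auto)
    ultimately show "sdom {..<N} X" unfolding sdom_def rowform_def sqn_def by blast
  next
    assume "sdom {..<N} X"
    then obtain p where p: "p < 1" "\<And>j v. j < m \<Longrightarrow> rowform (cls j) N X v \<le> p * sqn N v"
      unfolding sdom_def rowform_def sqn_def by blast
    show "\<forall>j<m. mnorm N (X j) < 1"
    proof (intro allI impI)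
      fix j assume j: "j < m"
      show "mnorm N (X j) < 1" unfolding mnorm_less_one_iff using p(1) p(2)[OF j] unfolding c[OF j] by blast
    qed
  qed
  then show "polydisc m N = Dom N" by (simp add: polydisc_def Dom_def)
qed

lemma ncball_Dom:
  assumes m: "1 \<le> m" shows "ncball m = nc_dom.Dom m (\<lambda>_. 0)"
proof
  fix N
  interpret nc_dom m "\<lambda>_. 0" by unfold_locales (rule m)
  have c: "cls j = {..<m}" for j by (auto simp: cls_def)
  let ?A = "\<lambda>X. msub (mid N) (\<lambda>i k. \<Sum>j<m. mmul N (madj (X j)) (X j) i k)"
  have adj: "madj (?A X) = ?A X" for X
  proof (intro ext)
    fix i k
    have mj: "madj B i k = cnj (B k i)" for B by (simp add: madj_def)
    have t: "cnj (\<Sum>j<m. mmul N (madj (X j)) (X j) k i) = (\<Sum>j<m. mmul N (madj (X j)) (X j) i k)"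
      by (simp add: mmul_def madj_def mult.commute)
    show "madj (?A X) i k = ?A X i k"
      by (simp only: mj msub_def complex_cnj_diff t) (simp add: mid_def)
  qed
  have nz: "(\<exists>k<N. v k \<noteq> 0) \<longleftrightarrow> sqn N v > 0" for v
  proof -
    have "sqn N v > 0 \<longleftrightarrow> sqn N v \<noteq> 0" using sqn_nonneg[of N v] by linarith
    then show ?thesis unfolding sqn_zero by blast
  qed
  have "posdef N (?A X) \<longleftrightarrow> sdom {..<N} X" for X
  proof
    assume "posdef N (?A X)"
    then have "rowform {..<m} N X v < sqn N v" if "sqn N v > 0" for v
      using that unfolding posdef_def rowform_posdef nz by simp
    from rowform_uniform[OF this] show "sdom {..<N} X" unfolding sdom_def c rowform_def sqn_def by blast
  next
    assume "sdom {..<N} X"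
    then obtain q where q1: "q < 1" and qj: "\<forall>j<m. \<forall>v. rowform {..<m} N X v \<le> q * sqn N v"
      unfolding sdom_def c rowform_def sqn_def by blast
    have "0 < m" using m by simp
    note q = q1 qj[rule_format, OF this]
    have "rowform {..<m} N X v < sqn N v" if "sqn N v > 0" for v
      using q(2)[of v] mult_strict_right_mono[OF q(1) that] by simp
    then show "posdef N (?A X)" unfolding posdef_def rowform_posdef nz adj by simp
  qed
  then show "ncball m N = Dom N" by (simp add: ncball_def Dom_def)
qed

section \<open>Identification of the two boundary measures\<close>

definition blockdiag :: "nat \<Rightarrow> nat \<Rightarrow> ctup \<Rightarrow> cmat" where
  "blockdiag m N U = (\<lambda>a b. if a < m * N \<and> b < m * N \<and> a div N = b div N then U (a div N) (a mod N) (b mod N) else 0)"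

lemma blockdiag_flat:
  assumes "j < m" "i < N" "j' < m" "i' < N"
  shows "blockdiag m N U (j * N + i) (j' * N + i') = (if j = j' then U j i i' else 0)"
  using flat_less[OF assms(1,2)] flat_less[OF assms(3,4)] assms(2,4) by (simp add: blockdiag_def div_mod_flat)

lemma flat_cases:
  assumes "a < m * (N::nat)"
  obtains j i where "j < m" "i < N" "a = j * N + i"
proof (rule that[of "a div N" "a mod N"])
  have "N > 0" using assms by (cases "N = 0") auto
  then show "a div N < m" "a mod N < N" "a = a div N * N + a mod N"
    using assms by (simp_all add: less_mult_imp_div_less)
qed

lemma sum_flat': "(\<Sum>l<m*N. g l) = (\<Sum>j<m. \<Sum>i<N. g (j * N + i))" for g :: "nat \<Rightarrow> 'a::comm_monoid_add"
  using sum_flat[of "\<lambda>j i. g (j * N + i)" N m] by simp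

lemma blockdiag_gram:
  assumes "j < m" "i < N" "j' < m" "i' < N"
  shows "(\<Sum>a<m*N. cnj (blockdiag m N U a (j * N + i)) * blockdiag m N U a (j' * N + i'))
     = (if j = j' then \<Sum>l<N. cnj (U j l i) * U j l i' else 0)"
proof -
  have "(\<Sum>a<m*N. cnj (blockdiag m N U a (j * N + i)) * blockdiag m N U a (j' * N + i'))
     = (\<Sum>p<m. \<Sum>l<N. (if p = j then (if j = j' then cnj (U j l i) * U j l i' else 0) else 0))"
    unfolding sum_flat' by (intro sum.cong refl) (use assms in \<open>auto simp: blockdiag_flat\<close>)
  also have "\<dots> = (\<Sum>p<m. if p = j then (\<Sum>l<N. if j = j' then cnj (U j l i) * U j l i' else 0) else 0)"
    by (intro sum.cong refl) simp
  also have "\<dots> = (if j = j' then \<Sum>l<N. cnj (U j l i) * U j l i' else 0)" using assms(1) by simp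
  finally show ?thesis .
qed

lemma unitary_blockdiag:
  assumes "\<And>j. j < m \<Longrightarrow> is_mat N (U j)"
  shows "unitary (m * N) (blockdiag m N U) \<longleftrightarrow> (\<forall>j<m. unitary N (U j))"
proof
  assume "unitary (m * N) (blockdiag m N U)"
  then have o: "orth (m * N) (m * N) (blockdiag m N U)" by (simp add: unitary_orth)
  show "\<forall>j<m. unitary N (U j)"
    unfolding unitary_orth orth_def
  proof (intro allI impI conjI assms)
    fix j i k assume j: "j < m" and i: "i < N" and k: "k < N"
    have "(\<Sum>a<m*N. cnj (blockdiag m N U a (j * N + i)) * blockdiag m N U a (j * N + k)) = (if j * N + i = j * N + k then 1 else 0)"
      using o flat_less[OF j i] flat_less[OF j k] unfolding orth_def by blast
    then show "(\<Sum>l<N. cnj (U j l i) * U j l k) = (if i = k then 1 else 0)"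
      unfolding blockdiag_gram[OF j i j k] by simp
  qed
next
  assume u: "\<forall>j<m. unitary N (U j)"
  show "unitary (m * N) (blockdiag m N U)"
    unfolding unitary_orth orth_def
  proof (intro allI impI conjI)
    show "is_mat (m * N) (blockdiag m N U)" by (auto simp: is_mat_def blockdiag_def)
    fix a b assume a: "a < m * N" and b: "b < m * N"
    obtain j i where ji: "j < m" "i < N" "a = j * N + i" using flat_cases[OF a] .
    obtain j' i' where ji': "j' < m" "i' < N" "b = j' * N + i'" using flat_cases[OF b] .
    have ab: "a = b \<longleftrightarrow> j = j' \<and> i = i'"
      unfolding ji(3) ji'(3) by (metis div_mod_flat ji(2) ji'(2))
    have "(\<Sum>l<N. cnj (U j l i) * U j l i') = (if i = i' then 1 else 0)"
      using u ji(1,2) ji'(2) unfolding unitary_orth orth_def by blast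
    then show "(\<Sum>c<m*N. cnj (blockdiag m N U c a) * blockdiag m N U c b) = (if a = b then 1 else 0)"
      unfolding ab unfolding ji(3) ji'(3) blockdiag_gram[OF ji(1,2) ji'(1,2)] by (cases "j = j'") auto
  qed
qed

lemma act_torus_col:
  assumes X: "is_tup m N X" and U: "\<And>j. j < m \<Longrightarrow> is_mat N (U j)"
  shows "act_torus m N U X = act_col m N (blockdiag m N U) X"
proof (intro ext)
  fix j i k
  show "act_torus m N U X j i k = act_col m N (blockdiag m N U) X j i k"
  proof (cases "j < m \<and> i < N \<and> k < N")
    case True
    have "act_col m N (blockdiag m N U) X j i k = (\<Sum>p<m. \<Sum>l<N. blockdiag m N U (j * N + i) (p * N + l) * X p l k)"
      unfolding act_col_def sum_flat' using True by simp
    also have "\<dots> = (\<Sum>p<m. if p = j then (\<Sum>l<N. U j i l * X j l k) else 0)"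
      by (intro sum.cong refl) (use True in \<open>auto simp: blockdiag_flat\<close>)
    also have "\<dots> = act_torus m N U X j i k" using True by (simp add: act_torus_def mmul_def)
    finally show ?thesis by simp
  next
    case False
    then consider "\<not> j < m" | "j < m" "\<not> i < N" | "j < m" "\<not> k < N" by blast
    then show ?thesis
    proof cases
      case 2
      then have "U j i l = 0" for l using U[of j] by (simp add: is_mat_def)
      then show ?thesis using 2 by (simp add: act_torus_def act_col_def mmul_def)
    next
      case 3
      then have "X j l k = 0" for l using X by (simp add: is_tup_def is_mat_def)
      then show ?thesis using 3 by (simp add: act_torus_def act_col_def mmul_def)
    qed (simp add: act_torus_def act_col_def mzero_def)
  qed
qed

lemma measurable_act_torus: "act_torus m N U \<in> measurable borel borel"
proof -
  have "(\<lambda>X. act_torus m N U X j i k) \<in> borel_measurable borel" for j i k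
    by (cases "j < m") (auto simp: act_torus_def mmul_def mzero_def
        intro!: borel_measurable_sum borel_measurable_times measurable_entry)
  then show ?thesis by (intro measurable_coordinatewise_then_product)
qed

lemma unitary_mid: "unitary N (mid N)"
proof -
  have "madj (mid N) = mid N" by (auto simp: madj_def mid_def fun_eq_iff)
  then show ?thesis by (simp add: unitary_def is_mat_mid mmul_mid_left)
qed

text \<open>With singleton classes the group consists of the block diagonal matrices of m unitaries,
  so \<open>inv_meas\<close> is the description in \<open>haar_torus\<close>. The torus acts simply
  transitively on itself, which gives existence and uniqueness.\<close>

lemma haar_torus_inv:
  assumes m: "1 \<le> m" and N: "N > 0"
  shows "nc_dom.inv_meas m id N (haar_torus m N)"
proof -
  interpret nc_dom m id by unfold_locales (rule m)
  have c: "cls j = {j}" if "j < m" for j using that by (auto simp: cls_def)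
  have b: "bdry N = torus m N"
  proof (rule set_eqI)
    fix X
    show "X \<in> bdry N \<longleftrightarrow> X \<in> torus m N"
      unfolding bdry_def torus_def mem_Collect_eq unitary_def by (auto simp: c is_tup_def)
  qed
  have bU: "blockdiag m N U \<in> grp N \<longleftrightarrow> (\<forall>j<m. unitary N (U j))" if "\<And>j. j < m \<Longrightarrow> is_mat N (U j)" for U
  proof -
    have "blockdiag m N U a b = 0" if "id (a div N) \<noteq> id (b div N)" for a b using that by (simp add: blockdiag_def)
    moreover have "unitary (m * N) (blockdiag m N U) \<longleftrightarrow> (\<forall>j<m. unitary N (U j))"
      by (rule unitary_blockdiag) (rule that)
    ultimately show ?thesis unfolding grp_def mem_Collect_eq by blast
  qed
  have gr: "\<exists>U. V = blockdiag m N U \<and> (\<forall>j<m. unitary N (U j))" if V: "V \<in> grp N" for V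
  proof -
    define U where "U j i k = (if i < N \<and> k < N then V (j * N + i) (j * N + k) else 0)" for j i k
    have im: "is_mat N (U j)" for j by (auto simp: is_mat_def U_def)
    have "V = blockdiag m N U"
    proof (intro ext)
      fix a b
      show "V a b = blockdiag m N U a b"
      proof (cases "a < m * N \<and> b < m * N")
        case True
        then obtain j i j' i' where ji: "j < m" "i < N" "a = j * N + i" and ji': "j' < m" "i' < N" "b = j' * N + i'"
          by (metis flat_cases)
        have "V a b = 0" if "j \<noteq> j'"
        proof -
          have "id (a div N) \<noteq> id (b div N)" using that ji ji' by (simp add: div_mod_flat)
          then show ?thesis using V True unfolding grp_def by blast
        qed
        then show ?thesis unfolding ji(3) ji'(3) blockdiag_flat[OF ji(1,2) ji'(1,2)] using ji(2) ji'(2) by (auto simp: U_def)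
      next
        case False
        then show ?thesis using V by (auto simp: grp_def unitary_def is_mat_def blockdiag_def)
      qed
    qed
    then show ?thesis using bU[of U, OF im] V by blast
  qed
  have "(sets M = sets borel \<and> prob_space M \<and> (AE X in M. X \<in> torus m N) \<and>
      (\<forall>U. (\<forall>j<m. unitary N (U j)) \<longrightarrow> distr M borel (act_torus m N U) = M)) \<longleftrightarrow> inv_meas N M" for M
  proof -
    \<comment> \<open>The two actions agree on genuine tuples only, that is almost everywhere, which
      is enough for image measures.\<close>
    have eq: "distr M borel (act_torus m N U) = distr M borel (act_col m N (blockdiag m N U))"
      if s: "sets M = sets borel" and ae: "AE X in M. X \<in> torus m N" and U: "\<forall>j<m. unitary N (U j)" for U
    proof (rule distr_cong_AE[OF refl refl])
      show "AE X in M. act_torus m N U X = act_col m N (blockdiag m N U) X"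
        using ae by eventually_elim (rule act_torus_col, use U in \<open>auto simp: torus_def unitary_def\<close>)
      show "act_torus m N U \<in> measurable M borel" "act_col m N (blockdiag m N U) \<in> measurable M borel"
        using s measurable_act_torus measurable_act_col by (simp_all cong: measurable_cong_sets)
    qed
    show ?thesis
    proof
      assume L: "sets M = sets borel \<and> prob_space M \<and> (AE X in M. X \<in> torus m N) \<and>
        (\<forall>U. (\<forall>j<m. unitary N (U j)) \<longrightarrow> distr M borel (act_torus m N U) = M)"
      then have s: "sets M = sets borel" and ae: "AE X in M. X \<in> torus m N" by blast+
      have "distr M borel (act_col m N V) = M" if vg: "V \<in> grp N" for V
      proof -
        obtain U where U: "V = blockdiag m N U" "\<forall>j<m. unitary N (U j)" using gr[OF vg] by blast
        show ?thesis unfolding U(1) eq[OF s ae U(2), symmetric] using L U(2) by blast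
      qed
      then show "inv_meas N M" unfolding inv_meas_def b using L by blast
    next
      assume R: "inv_meas N M"
      then have s: "sets M = sets borel" and ae: "AE X in M. X \<in> torus m N" by (simp_all add: inv_meas_def b)
      have "distr M borel (act_torus m N U) = M" if U: "\<forall>j<m. unitary N (U j)" for U
      proof -
        have "blockdiag m N U \<in> grp N" using bU[of U] U by (simp add: unitary_def)
        then show ?thesis unfolding eq[OF s ae U] using R unfolding inv_meas_def by blast
      qed
      then show "sets M = sets borel \<and> prob_space M \<and> (AE X in M. X \<in> torus m N) \<and>
        (\<forall>U. (\<forall>j<m. unitary N (U j)) \<longrightarrow> distr M borel (act_torus m N U) = M)"
        using R unfolding inv_meas_def b by blast
    qed
  qed
  then have h: "haar_torus m N = (THE M. inv_meas N M)" unfolding haar_torus_def by presburger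
  \<comment> \<open>At the tuple of identities the block diagonal matrix built from x moves the base
    point to x.\<close>
  let ?x0 = "\<lambda>j. if j < m then mid N else mzero"
  have x0: "?x0 \<in> bdry N" unfolding b by (auto simp: torus_def is_tup_def is_mat_mid unitary_mid mzero_def)
  have ex: "\<exists>!M. inv_meas N M"
  proof (rule inv_meas_ex1[OF x0])
    fix x assume x: "x \<in> bdry N"
    then have u: "\<forall>j<m. unitary N (x j)" unfolding b by (simp add: torus_def)
    then have im: "j < m \<Longrightarrow> is_mat N (x j)" for j by (simp add: unitary_def)
    have "act_col m N (blockdiag m N x) ?x0 = act_torus m N x ?x0"
      by (rule act_torus_col[symmetric]) (use im bdry_tup[OF x0] in auto)
    also have "\<dots> = x"
    proof
      fix j
      show "act_torus m N x ?x0 j = x j"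
        using bdry_tup[OF x] im[of j] by (cases "j < m") (simp_all add: act_torus_def mmul_mid_right is_tup_def mzero_def)
    qed
    finally show "\<exists>v\<in>grp N. x = act_col m N v ?x0"
      using bU[of x, OF im] u by (intro bexI[of _ "blockdiag m N x"]) auto
  qed
  show ?thesis unfolding h by (rule theI'[OF ex])
qed

text \<open>The column of a boundary point is an isometry from C^N to C^(mN). Completing its columns
  to an orthonormal basis gives a unitary with these as its first N columns, and this unitary
  carries the base point (1, 0, ..., 0) to the given one. That is the transitivity required by
  \<open>inv_meas_ex1\<close>.\<close>

lemma haar_sphere_inv:
  assumes m: "1 \<le> m" and N: "N > 0"
  shows "nc_dom.inv_meas m (\<lambda>_. 0) N (haar_sphere m N)"
proof -
  interpret nc_dom m "\<lambda>_. 0" by unfold_locales (rule m)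
  have c: "cls j = {..<m}" for j by (auto simp: cls_def)
  have m0: "0 < m" using m by simp
  have b: "bdry N = sphere_nc m N"
    unfolding bdry_def sphere_nc_def c using m0 by auto
  have g: "grp N = {U. unitary (m * N) U}" by (simp add: grp_def)
  have h: "haar_sphere m N = (THE M. inv_meas N M)"
    unfolding haar_sphere_def inv_meas_def b g by simp
  let ?x0 = "\<lambda>j. if j = 0 then mid N else mzero"
  have t0: "is_tup m N ?x0" using m0 by (auto simp: is_tup_def is_mat_mid mzero_def) (simp add: is_mat_def)
  have x0: "?x0 \<in> bdry N"
  proof (rule bdryI[OF t0])
    fix j0 i k assume ik: "i < N" "k < N"
    have "(\<Sum>j\<in>cls j0. \<Sum>l<N. cnj (?x0 j l i) * ?x0 j l k) = (\<Sum>j<m. if j = 0 then (\<Sum>l<N. cnj (mid N l i) * mid N l k) else 0)"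
      unfolding c by (intro sum.cong refl) (simp add: mzero_def)
    also have "\<dots> = (\<Sum>l<N. cnj (mid N l i) * mid N l k)" using m0 by simp
    also have "\<dots> = (\<Sum>l<N. if l = i then (if i = k then 1 else 0) else 0)"
      by (intro sum.cong refl) (auto simp: mid_def)
    also have "\<dots> = (if i = k then 1 else 0)" using ik by simp
    finally show "(\<Sum>j\<in>cls j0. \<Sum>l<N. cnj (?x0 j l i) * ?x0 j l k) = (if i = k then 1 else 0)" .
  qed
  have ex: "\<exists>!M. inv_meas N M"
  proof (rule inv_meas_ex1[OF x0])
    fix x assume x: "x \<in> bdry N"
    define Q where "Q a k = x (a div N) (a mod N) k" for a k
    have Qf: "Q (j * N + l) k = x j l k" if "l < N" for j l k using that by (simp add: Q_def div_mod_flat)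
    have "orth (m * N) N Q"
      unfolding orth_def
    proof (intro allI impI)
      fix i k assume ik: "i < N" "k < N"
      have "(\<Sum>a<m*N. cnj (Q a i) * Q a k) = (\<Sum>j<m. \<Sum>l<N. cnj (x j l i) * x j l k)"
        unfolding sum_flat' by (intro sum.cong refl) (simp add: Qf)
      then show "(\<Sum>a<m*N. cnj (Q a i) * Q a k) = (if i = k then 1 else 0)"
        using bdry_gram[OF x m0 ik] by (simp add: c)
    qed
    moreover have "N \<le> m * N" using m0 by simp
    ultimately obtain R where R: "orth (m * N) (m * N) R" "\<And>a i. i < N \<Longrightarrow> R a i = Q a i"
      using orth_complete by blast
    \<comment> \<open>\<open>orth_complete\<close> says nothing about entries outside the index
      range; cutting them off makes v a matrix in the sense of \<open>is_mat\<close>.\<close>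
    define v where "v = (\<lambda>a b. if a < m * N \<and> b < m * N then R a b else 0)"
    have "orth (m * N) (m * N) v"
      unfolding orth_def
    proof (intro allI impI)
      fix i k assume ik: "i < m * N" "k < m * N"
      have "(\<Sum>a<m*N. cnj (v a i) * v a k) = (\<Sum>a<m*N. cnj (R a i) * R a k)"
        by (intro sum.cong refl) (use ik in \<open>simp add: v_def\<close>)
      then show "(\<Sum>a<m*N. cnj (v a i) * v a k) = (if i = k then 1 else 0)"
        using R(1) ik unfolding orth_def by simp
    qed
    then have vg: "v \<in> grp N" unfolding g by (simp add: unitary_orth) (auto simp: is_mat_def v_def)
    have "act_col m N v ?x0 j i k = x j i k" for j i k
    proof (cases "j < m \<and> i < N \<and> k < N")
      case True
      have "act_col m N v ?x0 j i k = (\<Sum>p<m. \<Sum>l<N. v (j * N + i) (p * N + l) * ?x0 p l k)"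
        unfolding act_col_def sum_flat' using True by simp
      also have "\<dots> = (\<Sum>p<m. if p = 0 then (\<Sum>l<N. v (j * N + i) l * mid N l k) else 0)"
        by (intro sum.cong refl) (auto simp: mzero_def)
      also have "\<dots> = (\<Sum>l<N. v (j * N + i) l * mid N l k)" using m0 by simp
      also have "\<dots> = (\<Sum>l<N. if l = k then v (j * N + i) k else 0)"
        by (intro sum.cong refl) (auto simp: mid_def)
      also have "\<dots> = v (j * N + i) k" using True by simp
      also have "\<dots> = R (j * N + i) k"
      proof -
        have "j * N + i < m * N" "k < m * N" using flat_less[of j m i N] flat_less[of 0 m k N] True m0 by auto
        then show ?thesis by (simp add: v_def)
      qed
      also have "\<dots> = x j i k" using True by (simp add: R(2) Qf)
      finally show ?thesis .
    next
      case False
      then show ?thesis using bdry_tup[OF x] by (cases "j < m") (auto simp: act_col_def is_tup_def is_mat_def not_less)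
    qed
    then show "\<exists>v\<in>grp N. x = act_col m N v ?x0" using vg by (intro bexI[of _ v]) (simp_all add: fun_eq_iff)
  qed
  show ?thesis unfolding h by (rule theI'[OF ex])
qed

theorem theorem3p5:
  fixes m :: nat
  assumes "1 \<le> m"
  shows
   \<comment> \<open>(i) polydisc\<close>
   "inner_product_space (polydisc m) (H2_polydisc m) (ip_polydisc m) \<and>
    (\<forall>f\<in>H2_polydisc m. \<forall>g\<in>H2_polydisc m.
       (phi_polydisc m f g \<longlongrightarrow> ip_polydisc m f g) (at_left 1) \<and>
       ((\<lambda>w. cnj (tt_coeff m (polydisc m) g w) * tt_coeff m (polydisc m) f w)
          has_sum ip_polydisc m f g) (all_words m)) \<and>
   \<comment> \<open>(i) ball\<close>
    inner_product_space (ncball m) (H2_ball m) (ip_ball m) \<and>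
    (\<forall>f\<in>H2_ball m. \<forall>g\<in>H2_ball m.
       (phi_ball m f g \<longlongrightarrow> ip_ball m f g) (at_left 1) \<and>
       ((\<lambda>w. complex_of_real (1 / real m ^ length w) *
              cnj (tt_coeff m (ncball m) g w) * tt_coeff m (ncball m) f w)
          has_sum ip_ball m f g) (all_words m)) \<and>
   \<comment> \<open>(ii)\<close>
    complete_orthonormal_system (polydisc m) (H2_polydisc m) (ip_polydisc m)
       (all_words m) (\<lambda>w N X. wpow N X w) \<and>
    (\<forall>f\<in>H2_polydisc m.
       (\<forall>w\<in>all_words m. tt_coeff m (polydisc m) f w = ip_polydisc m f (\<lambda>N X. wpow N X w)) \<and>
       ortho_expansion (ip_polydisc m) (all_words m) (tt_coeff m (polydisc m) f)
          (\<lambda>w N X. wpow N X w) f) \<and>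
   \<comment> \<open>(iii)\<close>
    complete_orthonormal_system (ncball m) (H2_ball m) (ip_ball m)
       (all_words m) (\<lambda>w N X. mscale (complex_of_real (sqrt (real m) ^ length w)) (wpow N X w)) \<and>
    (\<forall>f\<in>H2_ball m.
       (\<forall>w\<in>all_words m. tt_coeff m (ncball m) f w =
           ip_ball m f (\<lambda>N X. mscale (complex_of_real (real m ^ length w)) (wpow N X w))) \<and>
       ortho_expansion (ip_ball m) (all_words m) (tt_coeff m (ncball m) f)
          (\<lambda>w N X. wpow N X w) f)"
proof -
  interpret P0: nc_dom m id by unfold_locales (rule assms)
  interpret P: nc_meas m id "haar_torus m" 1
  proof unfold_locales
    fix j assume "j < m"
    then have "P0.cls j = {j}" by (auto simp: P0.cls_def)
    then show "card (P0.cls j) = 1" by simp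
  qed (rule haar_torus_inv[OF assms])
  interpret B0: nc_dom m "\<lambda>_. 0" by unfold_locales (rule assms)
  interpret B: nc_meas m "\<lambda>_. 0" "haar_sphere m" m
  proof unfold_locales
    fix j
    have "B0.cls j = {..<m}" by (auto simp: B0.cls_def)
    then show "card (B0.cls j) = m" by simp
  qed (rule haar_sphere_inv[OF assms])
  have PD: "P0.Dom = polydisc m" by (rule polydisc_Dom[OF assms, symmetric])
  have BD: "B0.Dom = ncball m" by (rule ncball_Dom[OF assms, symmetric])
  \<comment> \<open>For d = 1 the normalising factors of the general statements reduce to 1, which
    gives the unweighted form for the polydisc.\<close>
  have s1: "mscale (complex_of_real (sqrt (real 1) ^ n)) A = A" "mscale (complex_of_real (real 1 ^ n)) A = A" for n A
    by (simp_all add: mscale_def)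
  have "P.phi f g = phi_polydisc m f g" for f g
    by (rule ext, unfold P.phi_def phi_polydisc_def PD) simp
  then have Pphi: "P.phi = phi_polydisc m" by (intro ext) (simp only:)
  have Pip: "P.ip = ip_polydisc m" by (intro ext) (simp only: P.ip_def ip_polydisc_def Pphi)
  have PH: "H2 m (polydisc m) (haar_torus m) = H2_polydisc m" by (simp add: H2_polydisc_def)
  have Pprd: "P.prd f g = (\<lambda>w. cnj (tt_coeff m (polydisc m) g w) * tt_coeff m (polydisc m) f w)" for f g
    by (rule ext, unfold P.prd_def PD) simp
  have "B.phi f g = phi_ball m f g" for f g
    by (rule ext, unfold B.phi_def phi_ball_def BD) (rule refl)
  then have Bphi: "B.phi = phi_ball m" by (intro ext) (simp only:)
  have Bip: "B.ip = ip_ball m" by (intro ext) (simp only: B.ip_def ip_ball_def Bphi)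
  have BH: "H2 m (ncball m) (haar_sphere m) = H2_ball m" by (simp add: H2_ball_def)
  have Bprd: "B.prd f g = (\<lambda>w. complex_of_real (1 / real m ^ length w) * cnj (tt_coeff m (ncball m) g w) * tt_coeff m (ncball m) f w)" for f g
    by (rule ext, unfold B.prd_def BD) (rule refl)
  note P = P.H2_inner_product_space P.phi_tendsto P.ip_has_sum P.H2_complete_orthonormal_system P.coef_eq_ip P.H2_expansion
  note P' = P[unfolded PD PH Pphi Pip Pprd s1]
  note B = B.H2_inner_product_space B.phi_tendsto B.ip_has_sum B.H2_complete_orthonormal_system B.coef_eq_ip B.H2_expansion
  note B' = B[unfolded BD BH Bphi Bip Bprd]
  show ?thesis by (intro conjI ballI P' B')
qed

end
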